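(* Let $k$ be an algebraically closed field, $\Lambda$ a basic finite-dimensional $k$-algebra and $d\geq 1$. Let $\mu,\nu\in T_d(\Lambda)$ be triangular representations, and let $M_1\xrightarrow{i_1}M_2\xrightarrow{i_2}\cdots\xrightarrow{i_{d-1}}M_d$ and $N_1\xrightarrow{j_1}N_2\xrightarrow{j_2}\cdots\xrightarrow{j_{d-1}}N_d$ be the composition series corresponding to $\mu$ and $\nu$ respectively. Then $\nu$ lies in the Zariski closure $\overline{U_d(k)*\mu}$ of the $U_d(k)$-orbit of $\mu$ if and only if there exist $\Lambda$-modules $X_1,\ldots,X_d$, $\Lambda$-homomorphisms $h_l:X_l\to X_{l+1}$ ($1\leq l\leq d-1$), and for each $1\leq l\leq d$ a short exact sequence $0\to X_l\xrightarrow{a_l} X_l\oplus M_l\xrightarrow{b_l} N_l\to 0$, such that for all $1\leq l\leq d-1$ we have $\begin{pmatrix}h_l&0\\0&i_l\end{pmatrix}a_l=a_{l+1}h_l$ and $j_l b_l=b_{l+1}\begin{pmatrix}h_l&0\\0&i_l\end{pmatrix}$ (i.e. the diagram formed by the rows $X_\bullet$, $X_\bullet\oplus M_\bullet$, $N_\bullet$ and these exact columns commutes).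
   Context: A $d$-dimensional representation of $\Lambda$ is a $k$-algebra homomorphism $\rho:\Lambda\to M_d(k)$; it corresponds to the $\Lambda$-module structure on $k^d$ given by $\lambda\cdot v=\rho(\lambda)v$. The set $\mathrm{mod}_d\Lambda$ of such representations is an affine variety. A representation $\rho$ is triangular if $\rho(\Lambda)$ is contained in the algebra of upper triangular $d\times d$ matrices; $T_d(\Lambda)$ denotes the (closed) subvariety of triangular representations. The group $U_d(k)$ of invertible upper triangular $d\times d$ matrices acts on $T_d(\Lambda)$ by conjugation, $(g*\rho)(\lambda)=g\rho(\lambda)g^{-1}$. The composition series corresponding to a triangular $\mu$: let $M_d$ be $k^d$ with the module structure from $\mu$, and for each $i$ let $M_i\subseteq M_d$ be the submodule spanned by the first $i$ unit vectors $u_1,\ldots,u_i$ (a submodule since $\mu$ is triangular), with $i_l:M_l\hookrightarrow M_{l+1}$ the inclusions.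
   Formalization: The modules X_1,…,X_d are required to be finite-dimensional; with arbitrary Λ-modules the "if" direction fails (e.g. Λ=k×k, d=1, X_1 an infinite direct sum of both simple modules). *)

theory Defs
  imports "Jordan_Normal_Form.Matrix" "HOL-Computational_Algebra.Polynomial"
begin

definition k_algebra :: "('k::field \<Rightarrow> 'a::ring_1 \<Rightarrow> 'a) \<Rightarrow> bool" where
  "k_algebra scal \<longleftrightarrow> vector_space scal \<and>
     (\<forall>c x y. scal c (x * y) = scal c x * y \<and> scal c (x * y) = x * scal c y)"

definition fin_dim_algebra :: "('k::field \<Rightarrow> 'a::ring_1 \<Rightarrow> 'a) \<Rightarrow> bool" where
  "fin_dim_algebra scal \<longleftrightarrow> k_algebra scal \<and>
     (\<exists>B. finite B \<and> module.span scal B = UNIV)"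

definition idempotent_el :: "'a::ring_1 \<Rightarrow> bool" where
  "idempotent_el e \<longleftrightarrow> e * e = e"

definition primitive_idempotent :: "'a::ring_1 \<Rightarrow> bool" where
  "primitive_idempotent e \<longleftrightarrow> idempotent_el e \<and> e \<noteq> 0 \<and>
     \<not> (\<exists>f g. idempotent_el f \<and> idempotent_el g \<and> f \<noteq> 0 \<and> g \<noteq> 0 \<and>
              f * g = 0 \<and> g * f = 0 \<and> e = f + g)"

definition right_ideals_iso :: "'a::ring_1 \<Rightarrow> 'a \<Rightarrow> bool" where
  "right_ideals_iso e f \<longleftrightarrow> (\<exists>\<phi>. bij_betw \<phi> {e * x | x. True} {f * x | x. True} \<and>
      (\<forall>x\<in>{e * x | x. True}. \<forall>y\<in>{e * x | x. True}. \<phi> (x + y) = \<phi> x + \<phi> y) \<and>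
      (\<forall>x\<in>{e * x | x. True}. \<forall>l. \<phi> (x * l) = \<phi> x * l))"

definition basic_algebra :: "('k::field \<Rightarrow> 'a::ring_1 \<Rightarrow> 'a) \<Rightarrow> bool" where
  "basic_algebra scal \<longleftrightarrow> fin_dim_algebra scal \<and>
     (\<exists>(n::nat) (e::nat \<Rightarrow> 'a). (\<forall>i<n. primitive_idempotent (e i)) \<and>
            (\<forall>i<n. \<forall>j<n. i \<noteq> j \<longrightarrow> e i * e j = 0) \<and>
            (\<Sum>i<n. e i) = 1 \<and>
            (\<forall>i<n. \<forall>j<n. i \<noteq> j \<longrightarrow> \<not> right_ideals_iso (e i) (e j)))"

definition is_rep :: "('k::field \<Rightarrow> 'a::ring_1 \<Rightarrow> 'a) \<Rightarrow> nat \<Rightarrow> ('a \<Rightarrow> 'k mat) \<Rightarrow> bool" where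
  "is_rep scal n \<rho> \<longleftrightarrow> (\<forall>x. \<rho> x \<in> carrier_mat n n) \<and> \<rho> 1 = 1\<^sub>m n \<and>
     (\<forall>x y. \<rho> (x + y) = \<rho> x + \<rho> y) \<and> (\<forall>x y. \<rho> (x * y) = \<rho> x * \<rho> y) \<and>
     (\<forall>c x. \<rho> (scal c x) = c \<cdot>\<^sub>m \<rho> x)"

definition upper_tri :: "nat \<Rightarrow> 'k::zero mat \<Rightarrow> bool" where
  "upper_tri d A \<longleftrightarrow> (\<forall>i<d. \<forall>j<d. j < i \<longrightarrow> A $$ (i, j) = 0)"

definition tri_reps :: "('k::field \<Rightarrow> 'a::ring_1 \<Rightarrow> 'a) \<Rightarrow> nat \<Rightarrow> ('a \<Rightarrow> 'k mat) set" where
  "tri_reps scal d = {\<rho>. is_rep scal d \<rho> \<and> (\<forall>x. upper_tri d (\<rho> x))}"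

definition U_orbit :: "nat \<Rightarrow> ('a \<Rightarrow> 'k::field mat) \<Rightarrow> ('a \<Rightarrow> 'k mat) set" where
  "U_orbit d \<mu> = {(\<lambda>x. g * \<mu> x * h) | g h.
      g \<in> carrier_mat d d \<and> h \<in> carrier_mat d d \<and> upper_tri d g \<and>
      g * h = 1\<^sub>m d \<and> h * g = 1\<^sub>m d}"

inductive_set poly_fun :: "nat \<Rightarrow> (('a \<Rightarrow> 'k::field mat) \<Rightarrow> 'k) set" for d where
  const: "(\<lambda>\<rho>. c) \<in> poly_fun d"
| coord: "i < d \<Longrightarrow> j < d \<Longrightarrow> (\<lambda>\<rho>. \<rho> x $$ (i, j)) \<in> poly_fun d"
| add: "p \<in> poly_fun d \<Longrightarrow> q \<in> poly_fun d \<Longrightarrow> (\<lambda>\<rho>. p \<rho> + q \<rho>) \<in> poly_fun d"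
| mult: "p \<in> poly_fun d \<Longrightarrow> q \<in> poly_fun d \<Longrightarrow> (\<lambda>\<rho>. p \<rho> * q \<rho>) \<in> poly_fun d"

definition zariski_closure :: "nat \<Rightarrow> ('a \<Rightarrow> 'k::field mat) set \<Rightarrow> ('a \<Rightarrow> 'k mat) set" where
  "zariski_closure d S = {\<nu>. \<forall>p\<in>poly_fun d. (\<forall>\<rho>\<in>S. p \<rho> = 0) \<longrightarrow> p \<nu> = 0}"

definition is_hom :: "nat \<Rightarrow> ('a \<Rightarrow> 'k::field mat) \<Rightarrow> nat \<Rightarrow> ('a \<Rightarrow> 'k mat) \<Rightarrow> 'k mat \<Rightarrow> bool" where
  "is_hom m rX n rY H \<longleftrightarrow> H \<in> carrier_mat n m \<and> (\<forall>x. H * rX x = rY x * H)"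

definition dsum_rep :: "nat \<Rightarrow> ('a \<Rightarrow> 'k::field mat) \<Rightarrow> nat \<Rightarrow> ('a \<Rightarrow> 'k mat) \<Rightarrow> ('a \<Rightarrow> 'k mat)" where
  "dsum_rep m rX n rY = (\<lambda>x. four_block_mat (rX x) (0\<^sub>m m n) (0\<^sub>m n m) (rY x))"

definition diag_block :: "nat \<Rightarrow> nat \<Rightarrow> 'k::field mat \<Rightarrow> nat \<Rightarrow> nat \<Rightarrow> 'k mat \<Rightarrow> 'k mat" where
  "diag_block r1 c1 A r2 c2 B = four_block_mat A (0\<^sub>m r1 c2) (0\<^sub>m r2 c1) B"

definition short_exact :: "nat \<Rightarrow> nat \<Rightarrow> nat \<Rightarrow> 'k::field mat \<Rightarrow> 'k mat \<Rightarrow> bool" where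
  "short_exact m n p A B \<longleftrightarrow> A \<in> carrier_mat n m \<and> B \<in> carrier_mat p n \<and>
     (\<forall>u\<in>carrier_vec m. A *\<^sub>v u = 0\<^sub>v n \<longrightarrow> u = 0\<^sub>v m) \<and>
     (\<forall>w\<in>carrier_vec p. \<exists>v\<in>carrier_vec n. B *\<^sub>v v = w) \<and>
     (\<forall>v\<in>carrier_vec n. B *\<^sub>v v = 0\<^sub>v p \<longleftrightarrow> (\<exists>u\<in>carrier_vec m. v = A *\<^sub>v u))"

text \<open>M_l: the submodule spanned by u_1..u_l, realised on k^l (top-left l x l block)\<close>
definition sub_rep :: "nat \<Rightarrow> ('a \<Rightarrow> 'k::field mat) \<Rightarrow> ('a \<Rightarrow> 'k mat)" where
  "sub_rep l \<mu> = (\<lambda>x. mat l l (\<lambda>(i, j). \<mu> x $$ (i, j)))"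

definition incl_mat :: "nat \<Rightarrow> 'k::field mat" where
  "incl_mat l = mat (l + 1) l (\<lambda>(i, j). if i = j then 1 else 0)"

end

theory Submission
  imports Defs "HOL-Library.FuncSet" "HOL-Library.Function_Algebras"
    "HOL-Computational_Algebra.Formal_Power_Series" "HOL-Computational_Algebra.Fraction_Field"
    "Jordan_Normal_Form.Char_Poly"
begin

text \<open>
  If \<open>\<nu>\<close> lies in the closure of the orbit of \<open>\<mu>\<close>, consider the function field \<open>F\<close> of the group of upper
  triangular matrices. Evaluation at \<open>\<nu>\<close> is a homomorphism to \<open>k\<close> from the algebra generated by the
  coefficients of the generic conjugate of \<open>\<mu>\<close>. It extends to a one-dimensional local domain in \<open>F\<close>
  (Artin--Rees, places) and, after passing to a discrete valuation ring, to power series: there is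
  \<open>G\<close> in the triangular group over \<open>k((X))\<close> such that \<open>G^-1 \<mu> G\<close> is defined over \<open>k[[X]]\<close> with value \<open>\<nu>\<close>
  at \<open>X = 0\<close>. Following Zwara, the lattices \<open>G k[[X]]^l\<close> are submodules of \<open>k((X))^l\<close>; modulo
  \<open>X^n k[[X]]^l\<close> they give \<open>X_l\<close>, modulo \<open>X^(n + 1) k[[X]]^l\<close> they give \<open>X_l \<oplus> M_l\<close>, and multiplication by
  \<open>X\<close> embeds the former in the latter with cokernel \<open>N_l\<close>.

  Conversely, let \<open>V\<close> be a section of \<open>b_d\<close> adapted to the flags. For almost all \<open>t\<close> the cokernel of
  \<open>a_l + t (1, 0)\<close> is isomorphic to \<open>M_l\<close>, compatibly in \<open>l\<close>. In the basis given by \<open>V\<close> these cokernels form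
  a rational curve of representations which passes through \<open>\<nu>\<close> at \<open>t = 0\<close> and otherwise stays in the
  triangular orbit of \<open>\<mu>\<close>.
\<close>

section \<open>Finitely generated algebras and the basis theorem\<close>

text \<open>The obstacle in the forward direction is that the conjugating matrices need not have a
  limit: over \<nu> the entries of the generic matrix or of its inverse may have poles, and the
  local ring at \<nu> may have any dimension. A first place of \<open>F\<close> decides for each
  entry whether it or its inverse is finite; this yields an element \<open>s\<close> of the maximal
  ideal that clears all poles. The local ring is then cut down by elements that complete
  \<open>s\<close> to a system of parameters: modulo them \<open>s\<close> is not nilpotent, but the
  maximal ideal is the radical of \<open>s\<close>, so the curve is forced off the polar locus.
  Their existence is shown by counting monomials, with Artin--Rees to cancel \<open>s\<close>, in
  place of dimension theory. A second place, of the residue field \<open>D / Q\<close> this time,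
  has a discrete valuation ring by a count of Krull--Akizuki type. The flags cause no extra work in
  this direction, as triangular matrices preserve the first l coordinates and one curve serves all
  l. In the converse they do: the section must consist of lifts chosen level by level, or the base
  change need not be triangular.\<close>

definition is_subring :: "'a::comm_ring_1 set \<Rightarrow> bool" where
  "is_subring W \<longleftrightarrow> 0 \<in> W \<and> 1 \<in> W \<and> (\<forall>x\<in>W. \<forall>y\<in>W. x + y \<in> W \<and> x - y \<in> W \<and> x * y \<in> W)"

lemma is_subringD:
  assumes "is_subring W"
  shows "0 \<in> W" "1 \<in> W" "x \<in> W \<Longrightarrow> y \<in> W \<Longrightarrow> x + y \<in> W" "x \<in> W \<Longrightarrow> y \<in> W \<Longrightarrow> x - y \<in> W"
    "x \<in> W \<Longrightarrow> y \<in> W \<Longrightarrow> x * y \<in> W" "x \<in> W \<Longrightarrow> - x \<in> W" "x \<in> W \<Longrightarrow> x ^ n \<in> W"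
proof -
  show "0 \<in> W" and one: "1 \<in> W" and "x \<in> W \<Longrightarrow> y \<in> W \<Longrightarrow> x + y \<in> W" "x \<in> W \<Longrightarrow> y \<in> W \<Longrightarrow> x - y \<in> W"
    and mult: "\<And>x y. x \<in> W \<Longrightarrow> y \<in> W \<Longrightarrow> x * y \<in> W"
    using assms by (auto simp: is_subring_def)
  show "x \<in> W \<Longrightarrow> - x \<in> W"
    using assms unfolding is_subring_def by (metis diff_0)
  show "x \<in> W \<Longrightarrow> x ^ n \<in> W"
    by (induction n) (auto intro: one mult)
qed

lemma is_subring_sum:
  assumes "is_subring W" "\<And>i. i \<in> I \<Longrightarrow> f i \<in> W"
  shows "sum f I \<in> W"
  using assms(2) by (induction I rule: infinite_finite_induct) (auto intro: is_subringD[OF assms(1)])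

inductive_set gen :: "'a::comm_ring_1 set \<Rightarrow> 'a set \<Rightarrow> 'a set" for K Y where
  base: "x \<in> K \<Longrightarrow> x \<in> gen K Y"
| gen: "y \<in> Y \<Longrightarrow> y \<in> gen K Y"
| add: "x \<in> gen K Y \<Longrightarrow> y \<in> gen K Y \<Longrightarrow> x + y \<in> gen K Y"
| mult: "x \<in> gen K Y \<Longrightarrow> y \<in> gen K Y \<Longrightarrow> x * y \<in> gen K Y"

lemma is_subring_gen:
  assumes "is_subring K" shows "is_subring (gen K Y)"
proof -
  have "x - y \<in> gen K Y" if "x \<in> gen K Y" "y \<in> gen K Y" for x y
  proof -
    have "- 1 * y \<in> gen K Y"
      by (intro gen.mult gen.base that is_subringD(6)[OF assms] is_subringD(2)[OF assms])
    from gen.add[OF that(1) this] show ?thesis by simp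
  qed
  then show ?thesis
    using is_subringD[OF assms] by (auto simp: is_subring_def intro: gen.intros)
qed

lemma gen_least:
  assumes "is_subring W" "K \<subseteq> W" "Y \<subseteq> W" shows "gen K Y \<subseteq> W"
proof
  fix x assume "x \<in> gen K Y"
  then show "x \<in> W" by induction (use assms is_subringD[OF assms(1)] in auto)
qed

lemma gen_insert:
  assumes "is_subring K" shows "gen K (insert x Y) = gen (gen K Y) {x}"
proof
  show "gen K (insert x Y) \<subseteq> gen (gen K Y) {x}"
    by (rule gen_least) (auto intro!: is_subring_gen assms intro: gen.intros)
  have "gen K Y \<subseteq> gen K (insert x Y)"
    by (rule gen_least) (auto intro!: is_subring_gen assms intro: gen.intros)
  then show "gen (gen K Y) {x} \<subseteq> gen K (insert x Y)"
    by (intro gen_least) (auto intro!: is_subring_gen assms intro: gen.intros)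
qed

lemma gen_empty:
  assumes "is_subring K" shows "gen K {} = K"
  using gen_least[OF assms, of K "{}"] by (auto intro: gen.base)

text \<open>\<open>G\<close> need not lie in \<open>W\<close>, so this is the
  \<open>W\<close>-submodule spanned by \<open>G\<close>. Over the embedded field,
  \<open>idl K E\<close> is the linear span of \<open>E\<close>; finite dimension of a quotient is
  expressed through it.\<close>

inductive_set idl :: "'a::comm_ring_1 set \<Rightarrow> 'a set \<Rightarrow> 'a set" for W G where
  zero: "0 \<in> idl W G"
| step: "x \<in> idl W G \<Longrightarrow> w \<in> W \<Longrightarrow> g \<in> G \<Longrightarrow> x + w * g \<in> idl W G"

definition is_ideal :: "'a::comm_ring_1 set \<Rightarrow> 'a set \<Rightarrow> bool" where
  "is_ideal W I \<longleftrightarrow> I \<subseteq> W \<and> 0 \<in> I \<and> (\<forall>x\<in>I. \<forall>y\<in>I. x + y \<in> I) \<and> (\<forall>w\<in>W. \<forall>x\<in>I. w * x \<in> I)"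

lemma is_idealD:
  assumes "is_ideal W I"
  shows "I \<subseteq> W" "0 \<in> I" "x \<in> I \<Longrightarrow> y \<in> I \<Longrightarrow> x + y \<in> I" "w \<in> W \<Longrightarrow> x \<in> I \<Longrightarrow> w * x \<in> I"
    "w \<in> W \<Longrightarrow> x \<in> I \<Longrightarrow> x * w \<in> I"
  using assms by (auto simp: is_ideal_def mult.commute)

lemma is_ideal_uminus:
  assumes "is_subring W" "is_ideal W I" "x \<in> I" shows "- x \<in> I"
  using is_idealD(4)[OF assms(2) is_subringD(6)[OF assms(1) is_subringD(2)[OF assms(1)]] assms(3)] by simp

lemma is_ideal_diff:
  assumes "is_subring W" "is_ideal W I" "x \<in> I" "y \<in> I" shows "x - y \<in> I"
  using is_idealD(3)[OF assms(2,3) is_ideal_uminus[OF assms(1,2,4)]] by simp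

lemma is_ideal_sum:
  assumes "is_ideal W I" "\<And>i. i \<in> A \<Longrightarrow> f i \<in> I"
  shows "sum f A \<in> I"
  using assms(2) by (induction A rule: infinite_finite_induct) (auto intro: is_idealD[OF assms(1)])

lemma idl_add: "x \<in> idl W G \<Longrightarrow> y \<in> idl W G \<Longrightarrow> x + y \<in> idl W G"
  by (rotate_tac, induction rule: idl.induct) (auto simp: add.assoc[symmetric] intro: idl.step)

lemma idl_mult:
  assumes "is_subring W" "w \<in> W" "x \<in> idl W G" shows "w * x \<in> idl W G"
  using assms(3)
  by induction (auto simp: distrib_left mult.assoc[symmetric] intro!: idl.intros is_subringD[OF assms(1)] assms)

lemma idl_gen: "is_subring W \<Longrightarrow> g \<in> G \<Longrightarrow> g \<in> idl W G"
  using idl.step[OF idl.zero, of 1 W g G] by (auto dest: is_subringD)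

lemma idl_least:
  assumes "is_ideal W I" "G \<subseteq> I" shows "idl W G \<subseteq> I"
proof
  fix x assume "x \<in> idl W G"
  then show "x \<in> I" by induction (use assms is_idealD[OF assms(1)] in auto)
qed

lemma is_ideal_idl:
  assumes "is_subring W" "G \<subseteq> W" shows "is_ideal W (idl W G)"
proof -
  have "is_ideal W W" using is_subringD[OF assms(1)] by (auto simp: is_ideal_def)
  from idl_least[OF this assms(2)] show ?thesis
    by (auto simp: is_ideal_def intro: idl.zero idl_add idl_mult[OF assms(1)])
qed

lemma idl_mono: "W \<subseteq> W' \<Longrightarrow> G \<subseteq> G' \<Longrightarrow> idl W G \<subseteq> idl W' G'"
proof
  fix x assume *: "W \<subseteq> W'" "G \<subseteq> G'" "x \<in> idl W G"
  from *(3) show "x \<in> idl W' G'" by induction (use * in \<open>auto intro: idl.intros\<close>)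
qed

lemma idl_trans:
  assumes "is_subring W" "G \<subseteq> idl W H" "x \<in> idl W G" shows "x \<in> idl W H"
  using assms(3) by induction (auto intro!: idl.zero idl_add idl_mult[OF assms(1)] simp: assms(2)[THEN subsetD])

lemma idl_finite_subset:
  assumes "x \<in> idl W S" shows "\<exists>S'\<subseteq>S. finite S' \<and> x \<in> idl W S'"
  using assms
proof induction
  case zero
  then show ?case by (intro exI[of _ "{}"]) (auto intro: idl.zero)
next
  case (step x w g)
  then obtain S' where "S' \<subseteq> S" "finite S'" "x \<in> idl W S'" by auto
  with step(2,3) show ?case
    by (intro exI[of _ "insert g S'"]) (auto intro!: idl.step[of x] elim: subsetD[OF idl_mono, rotated 2])
qed

lemma idl_finite_subset_set:
  assumes "finite T" "T \<subseteq> idl W S" shows "\<exists>S'\<subseteq>S. finite S' \<and> T \<subseteq> idl W S'"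
  using assms
proof (induction T)
  case empty
  then show ?case by auto
next
  case (insert x T)
  then obtain S1 S2 where "S1 \<subseteq> S" "finite S1" "T \<subseteq> idl W S1" "S2 \<subseteq> S" "finite S2" "x \<in> idl W S2"
    using idl_finite_subset[of x W S] by auto
  then show ?case
    using idl_mono[of W W S1 "S1 \<union> S2"] idl_mono[of W W S2 "S1 \<union> S2"]
    by (intro exI[of _ "S1 \<union> S2"]) auto
qed

text \<open>The finite generating set is a subset of \<open>S\<close> itself. In the Artin--Rees
  lemma this is what makes the generators monomials of a known shape.\<close>

definition noetherian :: "'a::comm_ring_1 set \<Rightarrow> bool" where
  "noetherian W \<longleftrightarrow> (\<forall>S\<subseteq>W. \<exists>S'\<subseteq>S. finite S' \<and> S \<subseteq> idl W S')"

section \<open>Adjoining one element to a noetherian ring\<close>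

lemma gen_single:
  assumes "is_subring W"
  shows "gen W {x} = {poly p x |p. \<forall>i. coeff p i \<in> W}"
proof
  note W = is_subringD[OF assms]
  let ?P = "{poly p x |p. \<forall>i. coeff p i \<in> W}"
  have "is_subring ?P"
    unfolding is_subring_def
  proof (intro conjI ballI)
    show "0 \<in> ?P" by (rule CollectI, rule exI[of _ 0]) (use W in auto)
    show "1 \<in> ?P" by (rule CollectI, rule exI[of _ 1]) (use W in auto)
    fix a b assume "a \<in> ?P" "b \<in> ?P"
    then obtain p q where pq: "a = poly p x" "b = poly q x" "\<forall>i. coeff p i \<in> W" "\<forall>i. coeff q i \<in> W" by auto
    show "a + b \<in> ?P" by (rule CollectI, rule exI[of _ "p + q"]) (use W pq in auto)
    show "a - b \<in> ?P" by (rule CollectI, rule exI[of _ "p - q"]) (use W pq in auto)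
    show "a * b \<in> ?P" by (rule CollectI, rule exI[of _ "p * q"])
      (use W pq in \<open>auto simp: coeff_mult intro!: is_subring_sum[OF assms]\<close>)
  qed
  moreover have "W \<subseteq> ?P"
  proof
    fix w assume "w \<in> W"
    then show "w \<in> ?P"
      by (intro CollectI exI[of _ "[:w:]"]) (use W in \<open>auto simp: coeff_pCons split: nat.splits\<close>)
  qed
  moreover have "x \<in> ?P"
    by (intro CollectI exI[of _ "[:0,1:]"]) (use W in \<open>auto simp: coeff_pCons split: nat.splits\<close>)
  ultimately show "gen W {x} \<subseteq> ?P" by (intro gen_least) auto
  show "?P \<subseteq> gen W {x}"
  proof
    fix y assume "y \<in> ?P"
    then obtain p where p: "y = poly p x" "\<forall>i. coeff p i \<in> W" by auto
    have R: "is_subring (gen W {x})" by (rule is_subring_gen[OF assms])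
    show "y \<in> gen W {x}" unfolding p(1) poly_altdef
      using p(2) by (intro is_subring_sum[OF R] gen.mult is_subringD(7)[OF R]) (auto intro: gen.intros)
  qed
qed

text \<open>Hilbert's leading coefficient argument, run on the set \<open>P\<close> of polynomials
  whose value at \<open>x\<close> lies in the given ideal. Working upstairs in \<open>P\<close>
  allows \<open>x\<close> to be algebraic over \<open>W\<close>: polynomials that vanish at
  \<open>x\<close> simply belong to \<open>P\<close>.\<close>

theorem hilbert_basis:
  fixes x :: "'a::comm_ring_1"
  assumes W: "is_subring W" and N: "noetherian W"
  shows "noetherian (gen W {x})"
  unfolding noetherian_def
proof (intro allI impI)
  note Wr = is_subringD[OF W]
  let ?R = "gen W {x}"
  have R: "is_subring ?R" by (rule is_subring_gen[OF W])
  fix S assume S: "S \<subseteq> ?R"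
  have I: "is_ideal ?R (idl ?R S)" by (rule is_ideal_idl[OF R S])
  define P where "P = {p. (\<forall>i. coeff p i \<in> W) \<and> poly p x \<in> idl ?R S}"
  define L where "L n = {coeff p n |p. p \<in> P \<and> degree p \<le> n}" for n
  have P_mult: "monom w k * p \<in> P" if "w \<in> W" "p \<in> P" for w k p
  proof -
    have "\<forall>i. coeff (monom w k * p) i \<in> W"
      using that Wr by (auto simp: P_def coeff_monom_mult)
    moreover have "poly (monom w k * p) x = (w * x ^ k) * poly p x" by (simp add: poly_monom)
    moreover have "w * x ^ k \<in> ?R"
      using that by (intro gen.mult is_subringD(7)[OF R]) (auto intro: gen.intros)
    ultimately show ?thesis using that is_idealD(4)[OF I] by (auto simp: P_def)
  qed
  have P_add: "p + q \<in> P" if "p \<in> P" "q \<in> P" for p q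
    using that Wr is_idealD[OF I] by (auto simp: P_def)
  have P0: "0 \<in> P" using Wr by (auto simp: P_def intro: idl.zero)
  have LW: "L n \<subseteq> W" for n by (auto simp: L_def P_def)
  have L_mono: "L m \<subseteq> L n" if "m \<le> n" for m n
  proof
    fix a assume "a \<in> L m"
    then obtain p where p: "a = coeff p m" "p \<in> P" "degree p \<le> m" by (auto simp: L_def)
    have "degree (monom 1 (n - m) * p) \<le> n"
      using degree_mult_le[of "monom (1::'a) (n - m)" p] degree_monom_le[of "1::'a" "n - m"] p that by linarith
    moreover have "coeff (monom 1 (n - m) * p) n = a"
      using that p by (simp add: coeff_monom_mult)
    moreover have "monom 1 (n - m) * p \<in> P" using P_mult p Wr by auto
    ultimately show "a \<in> L n" unfolding L_def by blast
  qed
  obtain S0 where S0: "S0 \<subseteq> (\<Union>n. L n)" "finite S0" "(\<Union>n. L n) \<subseteq> idl W S0"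
    using N[unfolded noetherian_def, rule_format, of "\<Union>n. L n"] LW by blast
  have "\<exists>n0. S0 \<subseteq> L n0"
    using S0(2,1)
  proof (induction S0)
    case (insert a T)
    then obtain n1 n2 where "T \<subseteq> L n1" "a \<in> L n2" by auto
    then show ?case using L_mono[of n1 "max n1 n2"] L_mono[of n2 "max n1 n2"]
      by (intro exI[of _ "max n1 n2"]) auto
  qed auto
  then obtain n0 where n0: "S0 \<subseteq> L n0" ..
  have "\<forall>m. \<exists>T. T \<subseteq> L m \<and> finite T \<and> L m \<subseteq> idl W T"
    using N LW unfolding noetherian_def by blast
  then obtain T where T: "\<And>m. T m \<subseteq> L m" "\<And>m. finite (T m)" "\<And>m. L m \<subseteq> idl W (T m)" by metis
  have "\<forall>m b. \<exists>p. b \<in> T m \<longrightarrow> p \<in> P \<and> degree p \<le> m \<and> coeff p m = b"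
    using T(1) by (fastforce simp: L_def)
  then obtain pp where pp: "\<And>m b. b \<in> T m \<Longrightarrow> pp m b \<in> P \<and> degree (pp m b) \<le> m \<and> coeff (pp m b) m = b"
    by metis
  define G where "G = (\<Union>m\<le>n0. (\<lambda>b. poly (pp m b) x) ` T m)"
  have G: "finite G" "G \<subseteq> idl ?R S" using T pp by (auto simp: G_def P_def)
  have lift: "\<exists>q. q \<in> P \<and> degree q \<le> n \<and> coeff q n = a \<and> poly q x \<in> idl ?R G" if "a \<in> L n" for a n
  proof -
    \<comment> \<open>Generators are chosen only in degrees up to \<open>n0\<close>. For larger
      \<open>n\<close> the coefficients in \<open>L n\<close> are already generated by those in
      degree \<open>n0\<close>, and the missing factor \<open>x ^ (n - m)\<close> is supplied by a
      monomial.\<close>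
    define m where "m = min n n0"
    have "a \<in> idl W (T m)"
    proof (cases "n \<le> n0")
      case True
      then show ?thesis using that T(3) by (auto simp: m_def)
    next
      case False
      then have m: "m = n0" by (simp add: m_def)
      have "a \<in> idl W S0" using that S0(3) by auto
      then show ?thesis using n0 T(3)[of n0] m by (auto intro: idl_trans[OF W])
    qed
    then show ?thesis
    proof induction
      case zero
      then show ?case using P0 by (intro exI[of _ 0]) (auto intro: idl.zero)
    next
      case (step a w b)
      then obtain q where q: "q \<in> P" "degree q \<le> n" "coeff q n = a" "poly q x \<in> idl ?R G" by auto
      let ?r = "monom w (n - m) * pp m b"
      have mn: "m \<le> n" "m \<le> n0" by (auto simp: m_def)
      have "degree ?r \<le> n"
        using degree_mult_le[of "monom w (n - m)" "pp m b"] degree_monom_le[of w "n - m"] pp[OF step(3)] mn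
        by linarith
      moreover have "coeff ?r n = w * b"
        using mn pp[OF step(3)] by (simp add: coeff_monom_mult)
      moreover have "?r \<in> P" using P_mult pp[OF step(3)] step(2) by auto
      moreover have "poly ?r x \<in> idl ?R G"
      proof -
        have "w * x ^ (n - m) \<in> ?R"
          using step(2) by (intro gen.mult is_subringD(7)[OF R]) (auto intro: gen.intros)
        moreover have "poly (pp m b) x \<in> idl ?R G"
          using mn step(3) by (intro idl_gen[OF R]) (auto simp: G_def)
        ultimately show ?thesis using idl_mult[OF R] by (simp add: poly_monom)
      qed
      ultimately show ?case using q P_add
        by (intro exI[of _ "q + ?r"]) (auto intro: idl_add degree_add_le)
    qed
  qed
  have main: "poly p x \<in> idl ?R G" if "p \<in> P" "degree p \<le> n" for p n
    using that
  proof (induction n arbitrary: p)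
    case 0
    then obtain q where q: "q \<in> P" "degree q \<le> 0" "coeff q 0 = coeff p 0" "poly q x \<in> idl ?R G"
      using lift[of "coeff p 0" 0] by (auto simp: L_def)
    then have "p = q" using 0 by (metis degree_0_id le_zero_eq)
    then show ?case using q by simp
  next
    case (Suc n)
    then obtain q where q: "q \<in> P" "degree q \<le> Suc n" "coeff q (Suc n) = coeff p (Suc n)" "poly q x \<in> idl ?R G"
      using lift[of "coeff p (Suc n)" "Suc n"] by (auto simp: L_def)
    have "degree (p - q) \<le> n"
    proof (intro degree_le allI impI)
      fix i assume "n < i"
      then consider "i = Suc n" | "Suc n < i" by linarith
      then show "coeff (p - q) i = 0"
        by cases (use Suc.prems q in \<open>auto simp: coeff_eq_0\<close>)
    qed
    moreover have "p - q \<in> P"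
    proof -
      have "- 1 \<in> W" using Wr(6)[OF Wr(2)] .
      from P_add[OF Suc.prems(1) P_mult[OF this q(1), of 0]] show ?thesis by (simp add: monom_0)
    qed
    ultimately have "poly (p - q) x \<in> idl ?R G" using Suc.IH by blast
    from idl_add[OF this q(4)] show ?case by simp
  qed
  have "S \<subseteq> idl ?R G"
  proof
    fix y assume y: "y \<in> S"
    with S obtain p where p: "y = poly p x" "\<forall>i. coeff p i \<in> W" unfolding gen_single[OF W] by auto
    then have "p \<in> P" using y idl_gen[OF R y] by (auto simp: P_def)
    from main[OF this order.refl] p show "y \<in> idl ?R G" by simp
  qed
  \<comment> \<open>So far the generators only lie in the ideal of \<open>S\<close>; expressing
    these finitely many through \<open>S\<close> selects the required finite subset.\<close>
  moreover obtain S' where S': "S' \<subseteq> S" "finite S'" "G \<subseteq> idl ?R S'"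
    using idl_finite_subset_set[OF G] by auto
  ultimately have "S \<subseteq> idl ?R S'"
    using idl_trans[OF R S'(3)] by (meson subset_iff)
  with S' show "\<exists>S'\<subseteq>S. finite S' \<and> S \<subseteq> idl ?R S'" by auto
qed

corollary noetherian_gen:
  assumes "is_subring W" "noetherian W" "finite Y"
  shows "noetherian (gen W Y)"
  using assms(3)
proof (induction Y)
  case empty
  then show ?case using assms by (simp add: gen_empty)
next
  case (insert x Y)
  then show ?case using hilbert_basis[OF is_subring_gen[OF assms(1)]] by (simp add: gen_insert[OF assms(1)])
qed

section \<open>The Artin--Rees lemma\<close>

text \<open>The power \<open>J ^ n\<close> of the ideal \<open>J = (z 0, ..., z (r - 1))\<close> of \<open>C\<close>.\<close>
primrec jpow :: "'a::comm_ring_1 set \<Rightarrow> (nat \<Rightarrow> 'a) \<Rightarrow> nat \<Rightarrow> nat \<Rightarrow> 'a set" where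
  "jpow C z r 0 = C"
| "jpow C z r (Suc n) = {\<Sum>i<r. z i * x i |x. \<forall>i<r. x i \<in> jpow C z r n}"

lemma is_ideal_jpow:
  assumes C: "is_subring C" and z: "\<And>i. i < r \<Longrightarrow> z i \<in> C"
  shows "is_ideal C (jpow C z r n)"
proof (induction n)
  case 0
  then show ?case using is_subringD[OF C] by (auto simp: is_ideal_def)
next
  case (Suc n)
  note I = is_idealD[OF Suc]
  show ?case unfolding is_ideal_def
  proof (intro conjI ballI subsetI)
    fix y assume "y \<in> jpow C z r (Suc n)"
    then show "y \<in> C" using I(1) by (auto intro!: is_subring_sum[OF C] is_subringD(5)[OF C] z)
  next
    show "0 \<in> jpow C z r (Suc n)" using I(2) by (auto intro!: exI[of _ "\<lambda>_. 0"])
  next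
    fix a b assume "a \<in> jpow C z r (Suc n)" "b \<in> jpow C z r (Suc n)"
    then obtain x y where "a = (\<Sum>i<r. z i * x i)" "\<forall>i<r. x i \<in> jpow C z r n"
      "b = (\<Sum>i<r. z i * y i)" "\<forall>i<r. y i \<in> jpow C z r n" by auto
    then show "a + b \<in> jpow C z r (Suc n)" using I(3)
      by (auto simp: distrib_left sum.distrib intro!: exI[of _ "\<lambda>i. x i + y i"])
  next
    fix w a assume w: "w \<in> C" "a \<in> jpow C z r (Suc n)"
    then obtain x where "a = (\<Sum>i<r. z i * x i)" "\<forall>i<r. x i \<in> jpow C z r n" by auto
    then show "w * a \<in> jpow C z r (Suc n)" using I(4) w
      by (auto simp: sum_distrib_left mult_ac intro!: exI[of _ "\<lambda>i. w * x i"])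
  qed
qed

lemma jpow_mono1:
  assumes C: "is_subring C" and z: "\<And>i. i < r \<Longrightarrow> z i \<in> C"
  shows "jpow C z r (Suc n) \<subseteq> jpow C z r n"
proof
  fix y assume "y \<in> jpow C z r (Suc n)"
  then obtain x where x: "y = (\<Sum>i<r. z i * x i)" "\<forall>i<r. x i \<in> jpow C z r n" by auto
  show "y \<in> jpow C z r n" unfolding x(1)
    using x(2) z by (intro is_ideal_sum[OF is_ideal_jpow[OF C]] is_idealD(4)[OF is_ideal_jpow[OF C]]) auto
qed

lemma jpow_mono:
  assumes C: "is_subring C" and z: "\<And>i. i < r \<Longrightarrow> z i \<in> C" and "m \<le> n"
  shows "jpow C z r n \<subseteq> jpow C z r m"
  using assms(3) by (induction rule: dec_induct) (use jpow_mono1[of C r z] C z in blast)+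

lemma jpow_mult:
  assumes C: "is_subring C" and z: "\<And>i. i < r \<Longrightarrow> z i \<in> C"
    and "x \<in> jpow C z r m" "y \<in> jpow C z r n"
  shows "x * y \<in> jpow C z r (m + n)"
  using assms(3)
proof (induction m arbitrary: x)
  case 0
  then show ?case using is_idealD(4)[OF is_ideal_jpow[of C r z, OF C z]] assms(4) by auto
next
  case (Suc m)
  then obtain u where u: "x = (\<Sum>i<r. z i * u i)" "\<forall>i<r. u i \<in> jpow C z r m" by auto
  then have "x * y = (\<Sum>i<r. z i * (u i * y))" by (simp add: sum_distrib_right mult.assoc)
  then show ?case using u Suc.IH by auto
qed

lemma jpow_elem:
  assumes "is_subring C" "i < r" shows "z i \<in> jpow C z r (Suc 0)"
proof -
  have "z i = (\<Sum>j<r. z j * (if j = i then 1 else 0))"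
    using assms by (simp add: sum.delta if_distrib cong: if_cong)
  then show ?thesis using is_subringD[OF assms(1)]
    by (auto intro!: exI[of _ "\<lambda>j. if j = i then 1 else 0"])
qed

lemma noetherianD:
  "noetherian W \<Longrightarrow> S \<subseteq> W \<Longrightarrow> \<exists>S'. S' \<subseteq> S \<and> finite S' \<and> S \<subseteq> idl W S'"
  unfolding noetherian_def by blast

section \<open>Rees algebras and cancellation modulo powers of an ideal\<close>

lemma noetherian_image:
  assumes "noetherian A" and add: "\<And>x y. f (x + y) = f x + f y" and mult: "\<And>x y. f (x * y) = f x * f y"
    and zero: "f 0 = 0"
  shows "noetherian (f ` A)"
  unfolding noetherian_def
proof (intro allI impI)
  fix S assume "S \<subseteq> f ` A"
  then obtain T where T: "T \<subseteq> A" "S = f ` T" by (auto simp: subset_image_iff)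
  from noetherianD[OF assms(1) T(1)] obtain T' where T': "T' \<subseteq> T" "finite T'" "T \<subseteq> idl A T'"
    by (elim exE conjE)
  have "f x \<in> idl (f ` A) (f ` T')" if "x \<in> idl A T'" for x
    using that by induction (auto simp: zero add mult intro: idl.intros)
  then show "\<exists>S'\<subseteq>S. finite S' \<and> S \<subseteq> idl (f ` A) S'"
    using T T' by (intro exI[of _ "f ` T'"]) auto
qed

text \<open>This is the sum of all \<open>J ^ n T ^ n\<close> inside \<open>A[T]\<close>, where
  \<open>J\<close> is generated by \<open>z 0, ..., z (r - 1)\<close>; \<open>coeff_rees\<close> and
  \<open>monom_rees\<close> are the two inclusions. It is finitely generated over \<open>A\<close>,
  hence noetherian, which turns a statement about all powers of \<open>J\<close> into a single
  finite generation statement.\<close>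

definition rees :: "'a::comm_ring_1 set \<Rightarrow> (nat \<Rightarrow> 'a) \<Rightarrow> nat \<Rightarrow> 'a poly set" where
  "rees A z r = gen ((\<lambda>a. [:a:]) ` A) ((\<lambda>i. monom (z i) 1) ` {..<r})"

lemma is_subring_const:
  assumes "is_subring A" shows "is_subring ((\<lambda>a. [:a:]) ` A)"
  using is_subringD[OF assms] by (auto simp: is_subring_def image_iff one_pCons)

lemma is_subring_rees: "is_subring A \<Longrightarrow> is_subring (rees A z r)"
  unfolding rees_def by (intro is_subring_gen is_subring_const)

lemma noetherian_rees: "is_subring A \<Longrightarrow> noetherian A \<Longrightarrow> noetherian (rees A z r)"
  unfolding rees_def by (intro noetherian_gen is_subring_const noetherian_image) auto

lemma coeff_rees:
  assumes A: "is_subring A" and z: "\<And>i. i < r \<Longrightarrow> z i \<in> A" and "p \<in> rees A z r"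
  shows "coeff p n \<in> jpow A z r n"
  using assms(3) unfolding rees_def
proof (induction arbitrary: n)
  case (base x)
  then show ?case using is_idealD(2)[OF is_ideal_jpow[of A r z, OF A z]]
    by (cases n) (auto simp del: jpow.simps(2))
next
  case (gen y)
  then obtain i where i: "i < r" "y = monom (z i) 1" by auto
  then show ?case using is_idealD(2)[OF is_ideal_jpow[of A r z, OF A z]] jpow_elem[OF A i(1)]
    by (auto simp: coeff_monom simp del: jpow.simps(2))
next
  case (add x y)
  then show ?case using is_idealD(3)[OF is_ideal_jpow[of A r z, OF A z]] by auto
next
  case (mult x y)
  have "coeff x i * coeff y (n - i) \<in> jpow A z r n" if "i \<le> n" for i
    using jpow_mult[of A r z, OF A z mult.IH(1)[of i] mult.IH(2)[of "n - i"]] that by simp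
  then show ?case unfolding coeff_mult by (intro is_ideal_sum[OF is_ideal_jpow[of A r z, OF A z]]) auto
qed

lemma monom_sum: "monom (sum f I) n = (\<Sum>i\<in>I. monom (f i) n)"
  by (induction I rule: infinite_finite_induct) (auto simp: add_monom[symmetric])

lemma monom_rees:
  assumes A: "is_subring A" and "x \<in> jpow A z r n"
  shows "monom x n \<in> rees A z r"
  using assms(2)
proof (induction n arbitrary: x)
  case 0
  then show ?case by (auto simp: rees_def monom_0 intro: gen.base)
next
  case (Suc n)
  then obtain u where u: "x = (\<Sum>i<r. z i * u i)" "\<forall>i<r. u i \<in> jpow A z r n" by auto
  then have "monom x (Suc n) = (\<Sum>i<r. monom (z i) 1 * monom (u i) n)"
    by (simp add: mult_monom monom_sum)
  also have "\<dots> \<in> rees A z r"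
  proof (intro is_subring_sum[OF is_subring_rees[OF A]] is_subringD(5)[OF is_subring_rees[OF A]])
    fix i assume "i \<in> {..<r}"
    then show "monom (z i) 1 \<in> rees A z r" "monom (u i) n \<in> rees A z r"
      using u Suc.IH by (auto simp: rees_def intro: gen.gen)
  qed
  finally show ?case .
qed

text \<open>The elements \<open>s x T ^ n\<close> with \<open>s x\<close> in \<open>J ^ n\<close>
  generate an ideal of the Rees algebra that is already generated by finitely many of them;
  \<open>c\<close> bounds the degrees of these. In an expansion of \<open>s x T ^ (n + c)\<close>
  every cofactor then contributes in degree at least \<open>n\<close>, with a coefficient in
  \<open>J ^ n\<close>, and \<open>s\<close> cancels in a domain.\<close>

theorem artin_rees:
  fixes s :: "'a::idom"
  assumes A: "is_subring A" and N: "noetherian A" and z: "\<And>i. i < r \<Longrightarrow> z i \<in> A"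
    and s: "s \<in> A" "s \<noteq> 0"
  shows "\<exists>c. \<forall>n x. x \<in> A \<longrightarrow> s * x \<in> jpow A z r (n + c) \<longrightarrow> x \<in> jpow A z r n"
proof -
  note J = is_ideal_jpow[of A r z, OF A z]
  let ?R = "rees A z r"
  define S where "S = {monom (s * x) n |x n. x \<in> A \<and> s * x \<in> jpow A z r n}"
  have "S \<subseteq> ?R" using monom_rees[OF A] by (auto simp: S_def simp del: jpow.simps)
  from noetherianD[OF noetherian_rees[OF A N] this]
  obtain S' where S': "S' \<subseteq> S" "finite S'" "S \<subseteq> idl ?R S'"
    by (elim exE conjE)
  have "\<exists>c. \<forall>p\<in>S'. \<exists>x m. m \<le> c \<and> p = monom (s * x) m \<and> x \<in> A"
    using S'(2,1)
  proof (induction S')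
    case (insert p T)
    then obtain c where c: "\<forall>p\<in>T. \<exists>x m. m \<le> c \<and> p = monom (s * x) m \<and> x \<in> A" by auto
    have "p \<in> S" using insert.prems by auto
    then obtain x m where p: "p = monom (s * x) m" "x \<in> A" unfolding S_def by (elim CollectE exE conjE)
    show ?case
    proof (intro exI[of _ "max c m"] ballI)
      fix q assume "q \<in> insert p T"
      then show "\<exists>x k. k \<le> max c m \<and> q = monom (s * x) k \<and> x \<in> A"
        using c p by (force simp: le_max_iff_disj)
    qed
  qed auto
  then obtain c where c: "\<And>p. p \<in> S' \<Longrightarrow> \<exists>x m. m \<le> c \<and> p = monom (s * x) m \<and> x \<in> A" by blast
  have key: "\<exists>y\<in>jpow A z r n. coeff q (n + c) = s * y" if "q \<in> idl ?R S'" for q n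
    using that
  proof induction
    case zero
    then show ?case using is_idealD(2)[OF J] by (intro bexI[of _ 0]) auto
  next
    case (step q w p)
    then obtain y where y: "y \<in> jpow A z r n" "coeff q (n + c) = s * y" by auto
    obtain x m where p: "m \<le> c" "p = monom (s * x) m" "x \<in> A" using c step(3) by blast
    have "n \<le> n + c - m" using p(1) by linarith
    from subsetD[OF jpow_mono[OF A z this] coeff_rees[OF A z step(2)]]
    have "x * coeff w (n + c - m) \<in> jpow A z r n" by (intro is_idealD(4)[OF J p(3)])
    from is_idealD(3)[OF J y(1) this] have "y + x * coeff w (n + c - m) \<in> jpow A z r n" .
    moreover have "coeff (q + w * p) (n + c) = s * (y + x * coeff w (n + c - m))"
      using y(2) p(1) by (simp add: p(2) coeff_monom_mult mult.commute[of w] distrib_left mult.assoc)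
    ultimately show ?case by blast
  qed
  show ?thesis
  proof (intro exI allI impI)
    fix n x assume x: "x \<in> A" "s * x \<in> jpow A z r (n + c)"
    then have "monom (s * x) (n + c) \<in> idl ?R S'" using S' by (auto simp: S_def)
    from key[OF this, of n] show "x \<in> jpow A z r n" using s by auto
  qed
qed

section \<open>Growth of algebras in a field\<close>

text \<open>In a finite field the product of all \<open>X - a\<close>, increased by 1, has no
  root.\<close>

lemma infinite_alg_closed_field: "infinite (UNIV :: 'k::alg_closed_field set)"
proof
  assume fin: "finite (UNIV :: 'k set)"
  let ?q = "\<Prod>a\<in>(UNIV::'k set). [:- a, 1:]"
  have "degree ?q = card (UNIV :: 'k set)"
    by (subst degree_prod_eq_sum_degree) (auto)
  moreover have "card (UNIV :: 'k set) > 0" using fin by (simp add: card_gt_0_iff)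
  ultimately have "degree (?q + 1) > 0" by (simp add: degree_add_eq_left)
  then obtain x where "poly (?q + 1) x = 0" using alg_closed_imp_poly_has_root by blast
  moreover have "poly ?q x = 0" using fin by (auto simp: poly_prod)
  ultimately show False by simp
qed

text \<open>Exponential beats polynomial growth, in the form in which the counting argument below
  reaches its contradiction: an inequality between dimensions, iterated \<open>j\<close> times,
  against the bound \<open>n ^ r\<close> for the number of monomials.\<close>

lemma geometric_not_le_polynomial:
  fixes e D r :: nat
  assumes "\<And>j. (e + 1) ^ j \<le> e ^ j * (1 + D * j) ^ r"
  shows False
proof (cases "e = 0")
  case True
  then show ?thesis using assms[of 1] by simp
next
  case False
  define q where "q = real e / (e + 1)"
  have q: "0 < q" "q < 1" using False by (auto simp: q_def)
  \<comment> \<open>With \<open>q\<close> written as \<open>u ^ Suc r\<close>, each of the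
    \<open>r\<close> linear factors gets its own null sequence \<open>u ^ j\<close>, and one such
    factor is left over.\<close>
  define u where "u = root (Suc r) q"
  have u: "0 < u" "u < 1" "q = u ^ Suc r" using q by (auto simp: u_def simp del: power_Suc)
  have "(\<lambda>j. real j * u ^ j) \<longlonglongrightarrow> 0" using powser_times_n_limit_0[of u] u by simp
  moreover have "(\<lambda>j. u ^ j) \<longlonglongrightarrow> 0" using LIMSEQ_power_zero[of u] u by simp
  ultimately have "(\<lambda>j. (u ^ j + real D * (real j * u ^ j)) ^ r * u ^ j) \<longlonglongrightarrow> (0 + real D * 0) ^ r * 0"
    by (intro tendsto_mult tendsto_power tendsto_add tendsto_const)
  moreover have "(u ^ j + real D * (real j * u ^ j)) ^ r * u ^ j = (1 + D * real j) ^ r * q ^ j" for j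
  proof -
    have "u ^ j + D * (real j * u ^ j) = (1 + D * real j) * u ^ j" by (simp add: algebra_simps)
    moreover have "q ^ j = (u ^ j) ^ r * u ^ j"
      by (simp only: u(3) power_mult[symmetric] mult.commute[of "Suc r"] power_add[symmetric]) (simp add: algebra_simps)
    ultimately show ?thesis by (simp only: power_mult_distrib mult.assoc)
  qed
  ultimately have "((\<lambda>j::nat. (1 + D * real j) ^ r * q ^ j) \<longlongrightarrow> 0) sequentially" by simp
  then have "eventually (\<lambda>j::nat. (1 + D * real j) ^ r * q ^ j < 1) sequentially"
    by (rule order_tendstoD) simp
  then obtain j :: nat where j: "(1 + D * real j) ^ r * q ^ j < 1"
    by (auto simp: eventually_sequentially)
  have "real ((e + 1) ^ j) \<le> real (e ^ j * (1 + D * j) ^ r)" using assms[of j] by (simp only: of_nat_le_iff)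
  then have "1 \<le> (1 + D * real j) ^ r * q ^ j"
    using False by (simp add: q_def power_divide field_simps)
  with j show False by simp
qed

text \<open>The bound is strict because monomials of degree at least \<open>n\<close> lie in
  \<open>J ^ n\<close>, so that those in \<open>Mon r n\<close> suffice modulo this power. Exponents
  from \<open>r\<close> on are set to 0 to keep the set finite.\<close>

definition Mon :: "nat \<Rightarrow> nat \<Rightarrow> (nat \<Rightarrow> nat) set" where
  "Mon r n = {\<alpha>. (\<forall>i\<ge>r. \<alpha> i = 0) \<and> (\<Sum>i<r. \<alpha> i) < n}"

definition zpow :: "(nat \<Rightarrow> 'a::comm_ring_1) \<Rightarrow> nat \<Rightarrow> (nat \<Rightarrow> nat) \<Rightarrow> 'a" where
  "zpow z r \<alpha> = (\<Prod>i<r. z i ^ \<alpha> i)"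

lemma Mon_card: "finite (Mon r n) \<and> card (Mon r n) \<le> n ^ r"
proof -
  have "inj_on (\<lambda>\<alpha>. restrict \<alpha> {..<r}) (Mon r n)"
  proof (rule inj_onI)
    fix \<alpha> \<beta> assume *: "\<alpha> \<in> Mon r n" "\<beta> \<in> Mon r n" "restrict \<alpha> {..<r} = restrict \<beta> {..<r}"
    show "\<alpha> = \<beta>"
    proof
      fix i show "\<alpha> i = \<beta> i"
        using *(1,2) fun_cong[OF *(3), of i] by (cases "i < r") (auto simp: Mon_def)
    qed
  qed
  moreover have "(\<lambda>\<alpha>. restrict \<alpha> {..<r}) ` Mon r n \<subseteq> {..<r} \<rightarrow>\<^sub>E {..<n}"
  proof (intro image_subsetI)
    fix \<alpha> assume \<alpha>: "\<alpha> \<in> Mon r n"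
    have "\<alpha> i < n" if "i < r" for i
      using \<alpha> that member_le_sum[of i "{..<r}" \<alpha>] by (auto simp: Mon_def)
    then show "restrict \<alpha> {..<r} \<in> {..<r} \<rightarrow>\<^sub>E {..<n}" by (intro restrict_PiE_iff[THEN iffD2] ballI) auto
  qed
  moreover have "finite ({..<r} \<rightarrow>\<^sub>E {..<n})" by (intro finite_PiE) auto
  moreover have "card ({..<r} \<rightarrow>\<^sub>E {..<n}) = n ^ r" by (simp add: card_PiE)
  ultimately show ?thesis
    by (metis card_image card_mono finite_imageD finite_subset)
qed

lemma Mon_mono: "m \<le> n \<Longrightarrow> Mon r m \<subseteq> Mon r n"
  by (auto simp: Mon_def)

lemma Mon_1: "card (Mon r 1) = 1"
proof -
  have "Mon r 1 = {\<lambda>_. 0}"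
  proof (auto simp: Mon_def)
    fix \<alpha> :: "nat \<Rightarrow> nat" assume "\<forall>i\<ge>r. \<alpha> i = 0" "\<forall>i\<in>{..<r}. \<alpha> i = 0"
    then show "\<alpha> = (\<lambda>_. 0)" by (intro ext) (metis lessThan_iff not_le)
  qed
  then show ?thesis by simp
qed

lemma Mon_Suc:
  assumes "\<alpha> \<in> Mon r n" "i < r"
  shows "\<alpha>(i := Suc (\<alpha> i)) \<in> Mon r (Suc n)" "zpow z r (\<alpha>(i := Suc (\<alpha> i))) = z i * zpow z r \<alpha>"
proof -
  have "(\<Sum>j<r. (\<alpha>(i := Suc (\<alpha> i))) j) = Suc (\<alpha> i) + (\<Sum>j\<in>{..<r}-{i}. \<alpha> j)"
    using assms(2) by (subst sum.remove[of _ i]) auto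
  also have "\<dots> = Suc (\<Sum>j<r. \<alpha> j)" using assms(2) by (subst (2) sum.remove[of _ i]) auto
  finally show "\<alpha>(i := Suc (\<alpha> i)) \<in> Mon r (Suc n)" using assms by (auto simp: Mon_def)
  have "(\<Prod>j<r. z j ^ (\<alpha>(i := Suc (\<alpha> i))) j) = z i ^ Suc (\<alpha> i) * (\<Prod>j\<in>{..<r}-{i}. z j ^ \<alpha> j)"
    using assms(2) by (subst prod.remove[of _ i]) auto
  also have "\<dots> = z i * (\<Prod>j<r. z j ^ \<alpha> j)" using assms(2) by (subst (2) prod.remove[of _ i]) auto
  finally show "zpow z r (\<alpha>(i := Suc (\<alpha> i))) = z i * zpow z r \<alpha>" by (simp add: zpow_def)
qed

text \<open>Base \<open>K\<close> expansions are read off modulo \<open>K\<close>, one digit at a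
  time; their uniqueness makes the Kronecker substitution injective on exponents.\<close>

lemma digits_inj:
  fixes \<alpha> \<beta> :: "nat \<Rightarrow> nat"
  assumes "\<forall>i<r. \<alpha> i < K" "\<forall>i<r. \<beta> i < K" "(\<Sum>i<r. \<alpha> i * K ^ i) = (\<Sum>i<r. \<beta> i * K ^ i)"
  shows "\<forall>i<r. \<alpha> i = \<beta> i"
  using assms
proof (induction r arbitrary: \<alpha> \<beta>)
  case (Suc r)
  have split: "(\<Sum>i<Suc r. \<gamma> i * K ^ i) = \<gamma> 0 + K * (\<Sum>i<r. \<gamma> (Suc i) * K ^ i)" for \<gamma> :: "nat \<Rightarrow> nat"
    by (subst sum.lessThan_Suc_shift) (simp add: sum_distrib_left mult_ac)
  from Suc.prems(3) have eq: "\<alpha> 0 + K * (\<Sum>i<r. \<alpha> (Suc i) * K ^ i) = \<beta> 0 + K * (\<Sum>i<r. \<beta> (Suc i) * K ^ i)"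
    by (simp only: split)
  have lt: "\<alpha> 0 < K" "\<beta> 0 < K" using Suc.prems by auto
  have 0: "\<alpha> 0 = \<beta> 0" using arg_cong[OF eq, of "\<lambda>x. x mod K"] lt by simp
  with eq lt have "(\<Sum>i<r. \<alpha> (Suc i) * K ^ i) = (\<Sum>i<r. \<beta> (Suc i) * K ^ i)" by auto
  from Suc.IH[OF _ _ this] Suc.prems have "\<forall>i<r. \<alpha> (Suc i) = \<beta> (Suc i)" by auto
  with 0 show ?case using less_Suc_eq_0_disj by auto
qed auto

text \<open>Kronecker substitution: put the powers \<open>t ^ (n ^ i)\<close> of a single element for the variables.\<close>
lemma poly_nonvanishing:
  fixes p :: "(nat \<Rightarrow> nat) \<Rightarrow> 'k::alg_closed_field"
  assumes "S \<subseteq> Mon r n" "\<alpha>0 \<in> S" "p \<alpha>0 \<noteq> 0"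
  shows "\<exists>\<xi>. (\<forall>i. \<xi> i \<noteq> 0) \<and> (\<Sum>\<alpha>\<in>S. p \<alpha> * zpow \<xi> r \<alpha>) \<noteq> 0"
proof -
  have fin: "finite S" using assms(1) Mon_card finite_subset by blast
  define w where "w \<alpha> = (\<Sum>i<r. \<alpha> i * n ^ i)" for \<alpha> :: "nat \<Rightarrow> nat"
  have inj: "\<alpha> = \<beta>" if "\<alpha> \<in> S" "\<beta> \<in> S" "w \<alpha> = w \<beta>" for \<alpha> \<beta>
  proof -
    have lt: "\<forall>i<r. \<gamma> i < n" if "\<gamma> \<in> S" for \<gamma>
    proof (intro allI impI)
      fix i assume "i < r"
      then have "\<gamma> i \<le> (\<Sum>i<r. \<gamma> i)" by (intro member_le_sum) auto
      then show "\<gamma> i < n" using that assms(1) by (auto simp: Mon_def)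
    qed
    have "\<forall>i<r. \<alpha> i = \<beta> i" using digits_inj[OF lt lt] that by (simp add: w_def)
    moreover have "\<alpha> \<in> Mon r n" "\<beta> \<in> Mon r n" using that assms(1) by auto
    then have "\<forall>i\<ge>r. \<alpha> i = \<beta> i" by (auto simp: Mon_def)
    ultimately show ?thesis using not_le by blast
  qed
  define P where "P = (\<Sum>\<alpha>\<in>S. monom (p \<alpha>) (w \<alpha>))"
  have "coeff P (w \<alpha>0) = (\<Sum>\<alpha>\<in>S. if \<alpha> = \<alpha>0 then p \<alpha> else 0)"
    unfolding P_def coeff_sum using inj assms(2) by (intro sum.cong) auto
  then have "P \<noteq> 0" using assms fin by (auto simp: sum.delta)
  then have "finite ({x. poly P x = 0} \<union> {0})" using poly_roots_finite by auto
  from ex_new_if_finite[OF infinite_alg_closed_field this] obtain t where t: "poly P t \<noteq> 0" "t \<noteq> 0"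
    by auto
  have "poly P t = (\<Sum>\<alpha>\<in>S. p \<alpha> * zpow (\<lambda>i. t ^ (n ^ i)) r \<alpha>)"
    by (simp add: P_def poly_sum poly_monom zpow_def w_def power_sum power_mult[symmetric] mult.commute)
  then show ?thesis using t by (intro exI[of _ "\<lambda>i. t ^ (n ^ i)"]) auto
qed

section \<open>Linear algebra over an embedded algebraically closed field\<close>

locale field_embedding =
  fixes \<iota> :: "'k::alg_closed_field \<Rightarrow> 'f::field"
  assumes \<iota>_add: "\<iota> (a + b) = \<iota> a + \<iota> b" and \<iota>_mult: "\<iota> (a * b) = \<iota> a * \<iota> b" and \<iota>_1: "\<iota> 1 = 1"
begin

lemma \<iota>_0: "\<iota> 0 = 0" by (metis \<iota>_add add.right_neutral add_left_cancel)
lemma \<iota>_uminus: "\<iota> (- a) = - \<iota> a" using \<iota>_add[of a "-a"] by (simp add: \<iota>_0 eq_neg_iff_add_eq_0 add.commute)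
lemma \<iota>_diff: "\<iota> (a - b) = \<iota> a - \<iota> b" using \<iota>_add[of a "-b"] by (simp add: \<iota>_uminus)
lemma \<iota>_sum: "\<iota> (sum f I) = (\<Sum>i\<in>I. \<iota> (f i))"
  by (induction I rule: infinite_finite_induct) (auto simp: \<iota>_0 \<iota>_add)
lemma \<iota>_power: "\<iota> (a ^ n) = \<iota> a ^ n" by (induction n) (auto simp: \<iota>_1 \<iota>_mult)
lemma \<iota>_prod: "\<iota> (prod f I) = (\<Prod>i\<in>I. \<iota> (f i))"
  by (induction I rule: infinite_finite_induct) (auto simp: \<iota>_1 \<iota>_mult)
lemma \<iota>_inverse: "\<iota> (inverse a) = inverse (\<iota> a)"
proof (cases "a = 0")
  case False
  then have "\<iota> a * \<iota> (inverse a) = 1" by (simp add: \<iota>_mult[symmetric] \<iota>_1)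
  then show ?thesis by (metis inverse_unique)
qed (simp add: \<iota>_0)

abbreviation "K \<equiv> range \<iota>"

lemma is_subring_K: "is_subring K"
  unfolding is_subring_def
  by (auto simp: image_iff \<iota>_add[symmetric] \<iota>_diff[symmetric] \<iota>_mult[symmetric]
      intro: exI[of _ 0] exI[of _ 1] simp: \<iota>_0 \<iota>_1)

lemma noetherian_K: "noetherian K"
  unfolding noetherian_def
proof (intro allI impI)
  fix S assume S: "S \<subseteq> K"
  show "\<exists>S'\<subseteq>S. finite S' \<and> S \<subseteq> idl K S'"
  proof (cases "S \<subseteq> {0}")
    case True
    then show ?thesis by (intro exI[of _ "{}"]) (auto intro: idl.zero)
  next
    case False
    then obtain a where a: "\<iota> a \<in> S" "\<iota> a \<noteq> 0" using S by auto
    have "y \<in> idl K {\<iota> a}" if y: "y \<in> S" for y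
    proof -
      obtain b where b: "y = \<iota> b" using y S by auto
      have "y = 0 + \<iota> (b * inverse a) * \<iota> a"
        using a(2) by (simp add: b \<iota>_mult \<iota>_inverse)
      then show ?thesis using idl.step[OF idl.zero, of "\<iota> (b * inverse a)" K "\<iota> a" "{\<iota> a}"] by auto
    qed
    then show ?thesis using a by (intro exI[of _ "{\<iota> a}"]) auto
  qed
qed

definition ksub :: "'f set \<Rightarrow> bool" where
  "ksub J \<longleftrightarrow> 0 \<in> J \<and> (\<forall>x\<in>J. \<forall>y\<in>J. x + y \<in> J) \<and> (\<forall>c. \<forall>x\<in>J. \<iota> c * x \<in> J)"

lemma ksubD:
  assumes "ksub J"
  shows "0 \<in> J" "x \<in> J \<Longrightarrow> y \<in> J \<Longrightarrow> x + y \<in> J" "x \<in> J \<Longrightarrow> \<iota> c * x \<in> J"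
    "x \<in> J \<Longrightarrow> - x \<in> J" "x \<in> J \<Longrightarrow> y \<in> J \<Longrightarrow> x - y \<in> J"
proof -
  show *: "0 \<in> J" "\<And>x y. x \<in> J \<Longrightarrow> y \<in> J \<Longrightarrow> x + y \<in> J" "\<And>c x. x \<in> J \<Longrightarrow> \<iota> c * x \<in> J"
    using assms by (auto simp: ksub_def)
  show **: "- x \<in> J" if "x \<in> J" for x using *(3)[OF that, of "-1"] by (simp add: \<iota>_uminus \<iota>_1)
  show "x - y \<in> J" if "x \<in> J" "y \<in> J" for x y using *(2)[OF that(1) **[OF that(2)]] by simp
qed

lemma ksub_sum: "ksub J \<Longrightarrow> (\<And>i. i \<in> I \<Longrightarrow> f i \<in> J) \<Longrightarrow> sum f I \<in> J"
  by (induction I rule: infinite_finite_induct) (auto intro: ksubD)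

lemma idl_K_insert:
  assumes "x \<in> idl K (insert g G)" shows "\<exists>c. x - \<iota> c * g \<in> idl K G"
  using assms
proof induction
  case zero
  then show ?case by (intro exI[of _ 0]) (auto simp: \<iota>_0 intro: idl.zero)
next
  case (step x w h)
  then obtain c d where c: "x - \<iota> c * g \<in> idl K G" "w = \<iota> d" by auto
  show ?case
  proof (cases "h = g")
    case True
    then show ?thesis using c by (intro exI[of _ "c + d"]) (simp add: \<iota>_add algebra_simps)
  next
    case False
    then have "(x - \<iota> c * g) + w * h \<in> idl K G" using step c by (intro idl.step) auto
    then show ?thesis by (intro exI[of _ c]) (simp add: algebra_simps)
  qed
qed

text \<open>Gaussian elimination without a quotient space: one generator \<open>g\<close> at a time
  is removed by subtracting multiples of a vector \<open>x i0\<close> in which it occurs. Both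
  growth arguments below count with this lemma.\<close>

lemma dependent_modulo:
  assumes "finite G" "finite I" "card G < card I" "ksub J"
    and "\<And>i. i \<in> I \<Longrightarrow> \<exists>a\<in>idl K G. x i - a \<in> J"
  shows "\<exists>\<kappa>. (\<exists>i\<in>I. \<kappa> i \<noteq> 0) \<and> (\<Sum>i\<in>I. \<iota> (\<kappa> i) * x i) \<in> J"
  using assms(1,2,3,5)
proof (induction G arbitrary: I x)
  case empty
  have idl0: "idl K {} = {0}" by (auto elim: idl.cases intro: idl.zero)
  then have x: "x i \<in> J" if "i \<in> I" for i using empty.prems(3)[OF that] by auto
  obtain i where "i \<in> I" using empty.prems by fastforce
  then show ?case using x by (intro exI[of _ "\<lambda>_. 1"]) (auto simp: \<iota>_1 intro: ksub_sum[OF assms(4)])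
next
  case (insert g G)
  obtain a where a: "\<And>i. i \<in> I \<Longrightarrow> a i \<in> idl K (insert g G)" "\<And>i. i \<in> I \<Longrightarrow> x i - a i \<in> J"
    using insert.prems(3) by metis
  then have "\<forall>i\<in>I. \<exists>c. a i - \<iota> c * g \<in> idl K G" using idl_K_insert by blast
  then obtain w where w: "\<And>i. i \<in> I \<Longrightarrow> a i - \<iota> (w i) * g \<in> idl K G" by metis
  show ?case
  proof (cases "\<forall>i\<in>I. w i = 0")
    case True
    then have "\<And>i. i \<in> I \<Longrightarrow> \<exists>a\<in>idl K G. x i - a \<in> J" using w a(2) by (force simp: \<iota>_0)
    then show ?thesis using insert by (intro insert.IH) auto
  next
    case False
    then obtain i0 where i0: "i0 \<in> I" "w i0 \<noteq> 0" by auto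
    define u where "u i = w i / w i0" for i
    define x' where "x' i = x i - \<iota> (u i) * x i0" for i
    have "\<exists>a\<in>idl K G. x' i - a \<in> J" if i: "i \<in> I - {i0}" for i
    proof -
      let ?a = "(a i - \<iota> (w i) * g) - \<iota> (u i) * (a i0 - \<iota> (w i0) * g)"
      have *: "a i - \<iota> (w i) * g \<in> idl K G" "a i0 - \<iota> (w i0) * g \<in> idl K G" using w i i0 by auto
      have "?a = (a i - \<iota> (w i) * g) + \<iota> (- u i) * (a i0 - \<iota> (w i0) * g)" by (simp add: \<iota>_uminus)
      also have "\<dots> \<in> idl K G" by (intro idl_add * idl_mult[OF is_subring_K]) auto
      finally have "?a \<in> idl K G" .
      moreover have "\<iota> (u i) * \<iota> (w i0) = \<iota> (w i)" using i0 by (simp add: \<iota>_mult[symmetric] u_def)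
      then have eq: "x' i - ?a = (x i - a i) - \<iota> (u i) * (x i0 - a i0)"
        by (simp add: x'_def algebra_simps)
      have "x' i - ?a \<in> J" unfolding eq
        using i i0 by (intro ksubD(3)[OF assms(4)] ksubD(5)[OF assms(4)] a(2)) auto
      ultimately show ?thesis by auto
    qed
    moreover have "card G < card (I - {i0})" using insert i0 by auto
    moreover have "finite (I - {i0})" using insert by auto
    ultimately obtain \<kappa> where \<kappa>: "\<exists>i\<in>I - {i0}. \<kappa> i \<noteq> 0" "(\<Sum>i\<in>I - {i0}. \<iota> (\<kappa> i) * x' i) \<in> J"
      using insert.IH[of "I - {i0}" x'] by auto
    \<comment> \<open>The coefficient at \<open>i0\<close> collects the multiples of
      \<open>x i0\<close> that were subtracted in forming \<open>x'\<close>.\<close>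
    define \<kappa>' where "\<kappa>' = \<kappa>(i0 := - (\<Sum>i\<in>I - {i0}. \<kappa> i * u i))"
    have "(\<Sum>i\<in>I. \<iota> (\<kappa>' i) * x i) = \<iota> (\<kappa>' i0) * x i0 + (\<Sum>i\<in>I - {i0}. \<iota> (\<kappa> i) * x i)"
      using insert i0 by (subst sum.remove[of _ i0]) (auto simp: \<kappa>'_def)
    also have "\<dots> = (\<Sum>i\<in>I - {i0}. \<iota> (\<kappa> i) * x' i)"
      by (simp add: \<kappa>'_def x'_def \<iota>_uminus \<iota>_sum \<iota>_mult algebra_simps sum_subtractf sum_distrib_left)
    finally show ?thesis using \<kappa> by (intro exI[of _ \<kappa>']) (auto simp: \<kappa>'_def)
  qed
qed

end

lemma idl_insert:
  assumes W: "is_subring W" and "x \<in> idl W (insert g G)" shows "\<exists>c\<in>W. x - c * g \<in> idl W G"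
  using assms(2)
proof induction
  case zero
  then show ?case by (intro bexI[of _ 0]) (auto intro: idl.zero is_subringD[OF W])
next
  case (step x w h)
  then obtain c where c: "x - c * g \<in> idl W G" "c \<in> W" by auto
  show ?case
  proof (cases "h = g")
    case True
    then show ?thesis using c step is_subringD(3)[OF W]
      by (intro bexI[of _ "c + w"]) (auto simp add: algebra_simps)
  next
    case False
    then have "(x - c * g) + w * h \<in> idl W G" using step c by (intro idl.step) auto
    then show ?thesis using c by (intro bexI[of _ c]) (simp_all add: algebra_simps)
  qed
qed

lemma idl_image_mult: "b \<in> idl W E \<Longrightarrow> y * b \<in> idl W ((\<lambda>e. y * e) ` E)"
proof (induction rule: idl.induct)
  case (step x w g)
  have "y * x + w * (y * g) \<in> idl W ((\<lambda>e. y * e) ` E)" using step by (intro idl.step) auto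
  then show ?case by (simp add: algebra_simps)
qed (auto intro: idl.zero)

lemma idl_sum: "(\<And>i. i \<in> I \<Longrightarrow> f i \<in> idl W E) \<Longrightarrow> sum f I \<in> idl W E"
  by (induction I rule: infinite_finite_induct) (auto intro: idl.zero idl_add)

lemma is_ideal_plus1:
  assumes C: "is_subring C" and I: "is_ideal C I" and y: "y \<in> C"
  shows "is_ideal C {i + y * c |i c. i \<in> I \<and> c \<in> C}"
  unfolding is_ideal_def
proof (intro conjI ballI subsetI)
  fix x assume "x \<in> {i + y * c |i c. i \<in> I \<and> c \<in> C}"
  then show "x \<in> C" using is_subringD[OF C] is_idealD(1)[OF I] y by auto
next
  show "0 \<in> {i + y * c |i c. i \<in> I \<and> c \<in> C}"
    using is_subringD(1)[OF C] is_idealD(2)[OF I] by (auto intro!: exI[of _ 0])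
next
  fix a b assume "a \<in> {i + y * c |i c. i \<in> I \<and> c \<in> C}" "b \<in> {i + y * c |i c. i \<in> I \<and> c \<in> C}"
  then obtain i c j d where *: "a = i + y * c" "b = j + y * d" "i \<in> I" "j \<in> I" "c \<in> C" "d \<in> C" by auto
  have "a + b = (i + j) + y * (c + d)" using * by (simp add: algebra_simps)
  then show "a + b \<in> {i + y * c |i c. i \<in> I \<and> c \<in> C}"
    using is_subringD(3)[OF C *(5,6)] is_idealD(3)[OF I *(3,4)] by blast
next
  fix w a assume w: "w \<in> C" "a \<in> {i + y * c |i c. i \<in> I \<and> c \<in> C}"
  then obtain i c where *: "a = i + y * c" "i \<in> I" "c \<in> C" by auto
  have "w * a = w * i + y * (w * c)" using * by (simp add: algebra_simps)
  then show "w * a \<in> {i + y * c |i c. i \<in> I \<and> c \<in> C}"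
    using is_subringD(5)[OF C w(1) *(3)] is_idealD(4)[OF I w(1) *(2)] by blast
qed

section \<open>Ideals of finite codimension\<close>

context field_embedding
begin

lemma ksub_ideal:
  assumes I: "is_ideal C I" and "K \<subseteq> C" shows "ksub I"
proof -
  have "\<iota> c * x \<in> I" if "x \<in> I" for c x using assms(2) that by (intro is_idealD(4)[OF I]) auto
  then show ?thesis using is_idealD(2,3)[OF I] by (auto simp: ksub_def)
qed

definition finite_codim :: "'f set \<Rightarrow> 'f set \<Rightarrow> bool" where
  "finite_codim C I \<longleftrightarrow> (\<exists>E. finite E \<and> E \<subseteq> C \<and> (\<forall>x\<in>C. \<exists>a\<in>idl K E. x - a \<in> I))"

lemma finite_codim_mono: "finite_codim C I \<Longrightarrow> I \<subseteq> I' \<Longrightarrow> finite_codim C I'"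
  unfolding finite_codim_def by (meson subsetD)

text \<open>The rule \<open>C = span E + I + y C\<close> is substituted into its own last term
  \<open>M\<close> times. It serves for \<open>y\<close> nilpotent modulo \<open>I\<close>, where
  the remainder disappears, and later for an element \<open>s\<close>, where \<open>C\<close> is
  described modulo a power of \<open>s\<close>.\<close>

lemma finite_codim_iterate:
  assumes C: "is_subring C" and I: "is_ideal C I" and y: "y \<in> C"
    and E: "\<And>x. x \<in> C \<Longrightarrow> \<exists>a\<in>idl K E. x - a \<in> {i + y * c |i c. i \<in> I \<and> c \<in> C}"
    and x: "x \<in> C"
  shows "\<exists>a\<in>idl K (\<Union>j<M. (\<lambda>e. y ^ j * e) ` E). \<exists>c\<in>C. x - a - y ^ M * c \<in> I"
proof (induction M)
  case 0
  then show ?case using x is_idealD(2)[OF I]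
    by (intro bexI[of _ 0] bexI[of _ x]) (auto intro: idl.zero)
next
  case (Suc M)
  let ?F = "\<lambda>M. \<Union>j<M. (\<lambda>e. y ^ j * e) ` E"
  obtain a c where ac: "a \<in> idl K (?F M)" "c \<in> C" "x - a - y ^ M * c \<in> I" using Suc by auto
  from E[OF ac(2)] obtain b i c' where b: "b \<in> idl K E" "c - b = i + y * c'" "i \<in> I" "c' \<in> C" by auto
  have "idl K (?F M) \<subseteq> idl K (?F (Suc M))" "idl K ((\<lambda>e. y ^ M * e) ` E) \<subseteq> idl K (?F (Suc M))"
    by (intro idl_mono; force)+
  then have "a + y ^ M * b \<in> idl K (?F (Suc M))"
    using ac(1) idl_image_mult[OF b(1), of "y ^ M"] idl_add by blast
  moreover have c: "c = b + i + y * c'" using b(2) by (simp add: algebra_simps)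
  have eq: "x - (a + y ^ M * b) - y ^ Suc M * c' = (x - a - y ^ M * c) + y ^ M * i"
    unfolding c by (simp add: algebra_simps)
  have "x - (a + y ^ M * b) - y ^ Suc M * c' \<in> I" unfolding eq
    by (intro is_idealD(3)[OF I ac(3)] is_idealD(4)[OF I _ b(3)] is_subringD(7)[OF C y])
  ultimately show ?case using b(4) by blast
qed

lemma finite_codim_step:
  assumes C: "is_subring C" "K \<subseteq> C" and I: "is_ideal C I" and y: "y \<in> C" "y ^ N \<in> I"
    and fin: "finite_codim C {i + y * c |i c. i \<in> I \<and> c \<in> C}"
  shows "finite_codim C I"
proof -
  obtain E where E: "finite E" "E \<subseteq> C"
    "\<And>x. x \<in> C \<Longrightarrow> \<exists>a\<in>idl K E. x - a \<in> {i + y * c |i c. i \<in> I \<and> c \<in> C}"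
    using fin unfolding finite_codim_def by auto
  let ?F = "\<Union>j<N. (\<lambda>e. y ^ j * e) ` E"
  show ?thesis unfolding finite_codim_def
  proof (intro exI conjI ballI)
    show "finite ?F" using E by auto
    show "?F \<subseteq> C" using E is_subringD(5,7)[OF C(1)] y by auto
    fix x assume "x \<in> C"
    from finite_codim_iterate[OF C(1) I y(1) E(3) this, of N]
    obtain a c where ac: "a \<in> idl K ?F" "c \<in> C" "x - a - y ^ N * c \<in> I" by blast
    have eq: "x - a = (x - a - y ^ N * c) + c * y ^ N" by (simp add: algebra_simps)
    have "x - a \<in> I" using is_idealD(3)[OF I ac(3) is_idealD(4)[OF I ac(2) y(2)]]
      by (simp only: eq[symmetric])
    with ac show "\<exists>a\<in>idl K ?F. x - a \<in> I" by auto
  qed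
qed

text \<open>The elements of \<open>Y\<close> are adjoined to \<open>I\<close> one at a time; passing
  back over one of them only multiplies a spanning set by finitely many powers of an element that is
  nilpotent modulo the smaller ideal.\<close>

lemma finite_codim_rad:
  assumes C: "is_subring C" "K \<subseteq> C" and "finite Y" "Y \<subseteq> C" and I: "is_ideal C I"
    and "\<And>y. y \<in> Y \<Longrightarrow> \<exists>N. y ^ N \<in> I"
    and "finite_codim C {i + j |i j. i \<in> I \<and> j \<in> idl C Y}"
  shows "finite_codim C I"
  using assms(3-7)
proof (induction Y arbitrary: I)
  case empty
  have "{i + j |i j. i \<in> I \<and> j \<in> idl C {}} \<subseteq> I" by (auto elim: idl.cases)
  then show ?case using empty finite_codim_mono by blast
next
  case (insert y Y)
  let ?I = "{i + y * c |i c. i \<in> I \<and> c \<in> C}"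
  have y: "y \<in> C" using insert by auto
  obtain N where N: "y ^ N \<in> I" using insert.prems(3)[of y] by auto
  have sub: "I \<subseteq> ?I"
  proof
    fix i assume "i \<in> I"
    then show "i \<in> ?I" using is_subringD(1)[OF C(1)] by (intro CollectI exI[of _ i] exI[of _ 0]) auto
  qed
  have "{i + j |i j. i \<in> I \<and> j \<in> idl C (insert y Y)} \<subseteq> {i + j |i j. i \<in> ?I \<and> j \<in> idl C Y}"
  proof (intro subsetI, elim CollectE exE conjE)
    fix x i j assume x: "x = i + j" "i \<in> I" "j \<in> idl C (insert y Y)"
    then obtain c where c: "c \<in> C" "j - c * y \<in> idl C Y" using idl_insert[OF C(1)] by blast
    have "x = (i + y * c) + (j - c * y)" using x by (simp add: mult.commute)
    then show "x \<in> {i + j |i j. i \<in> ?I \<and> j \<in> idl C Y}" using x(2) c by blast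
  qed
  then have *: "finite_codim C {i + j |i j. i \<in> ?I \<and> j \<in> idl C Y}"
    using finite_codim_mono[OF insert.prems(4)] by auto
  have "finite_codim C ?I"
  proof (rule insert.IH)
    show "\<exists>N. u ^ N \<in> ?I" if "u \<in> Y" for u
      using insert.prems(3)[of u] that sub by (meson insertCI subsetD)
  qed (use insert.prems y * is_ideal_plus1[OF C(1)] in auto)
  then show ?case using finite_codim_step[OF C insert.prems(2) y N] by auto
qed

text \<open>By induction on \<open>n\<close>: what remains of \<open>x\<close> after subtracting a
  combination of \<open>E\<close> lies in \<open>J\<close>, and its cofactors are expanded modulo
  \<open>J ^ n\<close>. The number of monomials times \<open>card E\<close> is the upper bound in
  the count that follows.\<close>

lemma jpow_span:
  assumes C: "is_subring C" "K \<subseteq> C" and z: "\<And>i. i < r \<Longrightarrow> z i \<in> C"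
    and E: "\<And>x. x \<in> C \<Longrightarrow> \<exists>a\<in>idl K E. x - a \<in> jpow C z r 1"
    and "x \<in> C"
  shows "\<exists>a\<in>idl K ((\<lambda>(\<alpha>, e). zpow z r \<alpha> * e) ` (Mon r n \<times> E)). x - a \<in> jpow C z r n"
  using assms(5)
proof (induction n arbitrary: x)
  case 0
  then show ?case by (intro bexI[of _ 0]) (auto intro: idl.zero)
next
  case (Suc n)
  let ?Z = "\<lambda>n. (\<lambda>(\<alpha>, e). zpow z r \<alpha> * e) ` (Mon r n \<times> E)"
  obtain a0 u where a0: "a0 \<in> idl K E" "x - a0 = (\<Sum>i<r. z i * u i)" "\<forall>i<r. u i \<in> C"
    using E[OF Suc.prems] by auto
  have "\<exists>b. i < r \<longrightarrow> b \<in> idl K (?Z n) \<and> u i - b \<in> jpow C z r n" for i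
    using Suc.IH[of "u i"] a0(3) by auto
  then have "\<forall>i. \<exists>b. i < r \<longrightarrow> b \<in> idl K (?Z n) \<and> u i - b \<in> jpow C z r n" ..
  from choice[OF this] obtain a where a: "\<And>i. i < r \<Longrightarrow> a i \<in> idl K (?Z n)"
    "\<And>i. i < r \<Longrightarrow> u i - a i \<in> jpow C z r n" by auto
  have "E \<subseteq> ?Z (Suc n)"
  proof
    fix e assume "e \<in> E"
    then show "e \<in> ?Z (Suc n)"
      by (intro image_eqI[of _ _ "(\<lambda>_. 0, e)"]) (auto simp: zpow_def Mon_def)
  qed
  then have a0': "a0 \<in> idl K (?Z (Suc n))" using a0(1) idl_mono[of K K E] by auto
  have "z i * a i \<in> idl K (?Z (Suc n))" if i: "i < r" for i
  proof -
    have "(\<lambda>e. z i * e) ` ?Z n \<subseteq> ?Z (Suc n)"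
    proof (intro image_subsetI, elim imageE, clarify)
      fix \<alpha> e assume "\<alpha> \<in> Mon r n" "e \<in> E"
      then show "z i * (zpow z r \<alpha> * e) \<in> ?Z (Suc n)"
        using Mon_Suc(1)[of \<alpha> r n i] Mon_Suc(2)[of \<alpha> r n i z] i
        by (intro image_eqI[of _ _ "(\<alpha>(i := Suc (\<alpha> i)), e)"]) (auto simp: mult.assoc)
    qed
    then show ?thesis using idl_image_mult[OF a(1)[OF i], of "z i"] idl_mono[of K K] by blast
  qed
  then have "a0 + (\<Sum>i<r. z i * a i) \<in> idl K (?Z (Suc n))" by (intro idl_add a0' idl_sum) auto
  moreover have "x - (a0 + (\<Sum>i<r. z i * a i)) = (\<Sum>i<r. z i * (u i - a i))"
    using a0(2) by (simp add: algebra_simps sum_subtractf)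
  then have "x - (a0 + (\<Sum>i<r. z i * a i)) \<in> jpow C z r (Suc n)" using a(2) by auto
  ultimately show ?case by blast
qed

text \<open>Otherwise the elements \<open>s ^ i * z ^ \<alpha>\<close> with \<open>i \<le> e\<close> would be independent modulo the
  powers of \<open>J\<close>, and there are more of them than \<open>e * dim (k[z] / (z) ^ n)\<close>.\<close>
lemma growth_relation:
  assumes C: "is_subring C" "K \<subseteq> C" and z: "\<And>i. i < r \<Longrightarrow> z i \<in> C" and s: "s \<in> C"
    and AR: "\<And>n x. x \<in> C \<Longrightarrow> s * x \<in> jpow C z r (n + c) \<Longrightarrow> x \<in> jpow C z r n"
    and fin: "finite_codim C (jpow C z r 1)"
  shows "\<exists>n p. (\<exists>\<alpha>\<in>Mon r n. p \<alpha> \<noteq> 0) \<and>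
    (\<exists>x\<in>C. (\<Sum>\<alpha>\<in>Mon r n. \<iota> (p \<alpha>) * zpow z r \<alpha>) - s * x \<in> jpow C z r n)"
proof (rule ccontr)
  assume neg: "\<not> ?thesis"
  note Cr = is_subringD[OF C(1)]
  have J: "is_ideal C (jpow C z r n)" for n by (rule is_ideal_jpow[OF C(1) z])
  have neg': "p \<alpha> = 0" if "x \<in> C" "(\<Sum>\<alpha>\<in>Mon r n. \<iota> (p \<alpha>) * zpow z r \<alpha>) - s * x \<in> jpow C z r n" "\<alpha> \<in> Mon r n"
    for n p x \<alpha> using neg that by blast
  obtain E where E: "finite E" "E \<subseteq> C" "\<And>x. x \<in> C \<Longrightarrow> \<exists>a\<in>idl K E. x - a \<in> jpow C z r 1"
    using fin unfolding finite_codim_def by auto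
  have zC: "zpow z r \<alpha> \<in> C" for \<alpha>
  proof -
    have "(\<Prod>i\<in>S. z i ^ \<alpha> i) \<in> C" if "finite S" "S \<subseteq> {..<r}" for S
      using that by (induction S) (auto intro!: Cr(5) Cr(7) Cr(2) z)
    then show ?thesis by (auto simp: zpow_def)
  qed
  \<comment> \<open>The lowest power of \<open>s\<close> is peeled off. The sum is
    \<open>P + s * R\<close>, so \<open>P\<close> has zero coefficients by the negated claim, and
    cancelling \<open>s\<close> from \<open>s * R\<close> costs \<open>c\<close> powers of
    \<open>J\<close> by Artin--Rees. This is why the degree bound drops by \<open>c\<close> with
    each power of \<open>s\<close>.\<close>
  have indep: "\<forall>i<M. \<forall>\<alpha>\<in>Mon r (n + c * (M - i)). q i \<alpha> = 0"
    if "(\<Sum>i<M. s ^ i * (\<Sum>\<alpha>\<in>Mon r (n + c * (M - i)). \<iota> (q i \<alpha>) * zpow z r \<alpha>)) \<in> jpow C z r (n + c * M)"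
    for M n q
    using that
  proof (induction M arbitrary: q)
    case (Suc M)
    define R where "R = (\<Sum>i<M. s ^ i * (\<Sum>\<alpha>\<in>Mon r (n + c * (M - i)). \<iota> (q (Suc i) \<alpha>) * zpow z r \<alpha>))"
    define P where "P = (\<Sum>\<alpha>\<in>Mon r (n + c * Suc M). \<iota> (q 0 \<alpha>) * zpow z r \<alpha>)"
    have R: "R \<in> C" unfolding R_def using C(2)
      by (intro is_subring_sum[OF C(1)] Cr(5) Cr(7) zC s) auto
    have "(\<Sum>i<Suc M. s ^ i * (\<Sum>\<alpha>\<in>Mon r (n + c * (Suc M - i)). \<iota> (q i \<alpha>) * zpow z r \<alpha>)) = P + s * R"
      by (subst sum.lessThan_Suc_shift) (simp add: P_def R_def sum_distrib_left mult.assoc)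
    with Suc.prems have PR: "P + s * R \<in> jpow C z r (n + c * Suc M)" by simp
    then have q0: "q 0 \<alpha> = 0" if "\<alpha> \<in> Mon r (n + c * Suc M)" for \<alpha>
      using neg'[where x = "- R" and n = "n + c * Suc M" and p = "q 0" and \<alpha> = \<alpha>] that Cr(6)[OF R] by (simp add: P_def)
    then have "P = 0" by (simp add: P_def \<iota>_0)
    with PR have "s * R \<in> jpow C z r ((n + c * M) + c)" by (simp add: algebra_simps)
    from AR[OF R this] have "R \<in> jpow C z r (n + c * M)" .
    from Suc.IH[OF this[unfolded R_def]] have IH: "\<forall>i<M. \<forall>\<alpha>\<in>Mon r (n + c * (M - i)). q (Suc i) \<alpha> = 0" .
    show ?case
    proof (intro allI impI)
      fix i assume "i < Suc M"
      then show "\<forall>\<alpha>\<in>Mon r (n + c * (Suc M - i)). q i \<alpha> = 0"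
        using IH q0 by (cases i) auto
    qed
  qed auto
  define e where "e = card E"
  \<comment> \<open>One power of \<open>s\<close> more than there are elements of \<open>E\<close>.
    The comparison below then gives \<open>(e + 1) * f n \<le> e * f (n + c * M)\<close>, which
    iterates to geometric growth of \<open>f\<close> along an arithmetic progression.\<close>
  define M where "M = e + 1"
  define f where "f n = card (Mon r n)" for n
  have step: "M * f n \<le> e * f (n + c * M)" for n
  proof -
    define I where "I = Sigma {..<M} (\<lambda>i. Mon r (n + c * (M - i)))"
    define G where "G = (\<lambda>(\<alpha>, e). zpow z r \<alpha> * e) ` (Mon r (n + c * M) \<times> E)"
    have G: "finite G" "card G \<le> f (n + c * M) * e"
      using E(1) Mon_card unfolding G_def e_def f_def
      by (auto intro!: order.trans[OF card_image_le] simp: card_cartesian_product)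
    have "M * f n = (\<Sum>i<M. f n)" by simp
    also have "\<dots> \<le> (\<Sum>i<M. f (n + c * (M - i)))"
      unfolding f_def using Mon_card by (intro sum_mono card_mono Mon_mono) auto
    also have "\<dots> = card I" unfolding I_def f_def using Mon_card by (subst card_SigmaI) auto
    finally have I: "M * f n \<le> card I" .
    have finI: "finite I" unfolding I_def using Mon_card by auto
    have "\<not> card G < card I"
    proof
      assume less: "card G < card I"
      have "\<exists>\<kappa>. (\<exists>i\<in>I. \<kappa> i \<noteq> 0) \<and> (\<Sum>i\<in>I. \<iota> (\<kappa> i) * (s ^ fst i * zpow z r (snd i))) \<in> jpow C z r (n + c * M)"
      proof (rule dependent_modulo[OF G(1) finI less])
        show "ksub (jpow C z r (n + c * M))" by (rule ksub_ideal[OF J C(2)])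
        fix i assume "i \<in> I"
        have "s ^ fst i * zpow z r (snd i) \<in> C" by (intro Cr(5) Cr(7) zC s)
        from jpow_span[OF C z E(3) this]
        show "\<exists>a\<in>idl K G. s ^ fst i * zpow z r (snd i) - a \<in> jpow C z r (n + c * M)"
          by (simp add: G_def)
      qed
      then obtain \<kappa> where \<kappa>: "\<exists>i\<in>I. \<kappa> i \<noteq> 0"
        "(\<Sum>i\<in>I. \<iota> (\<kappa> i) * (s ^ fst i * zpow z r (snd i))) \<in> jpow C z r (n + c * M)" by blast
      have "(\<Sum>i\<in>I. \<iota> (\<kappa> i) * (s ^ fst i * zpow z r (snd i))) =
        (\<Sum>i<M. s ^ i * (\<Sum>\<alpha>\<in>Mon r (n + c * (M - i)). \<iota> (\<kappa> (i, \<alpha>)) * zpow z r \<alpha>))"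
      proof -
        have "(\<Sum>i\<in>I. \<iota> (\<kappa> i) * (s ^ fst i * zpow z r (snd i))) =
          (\<Sum>(i, \<alpha>)\<in>I. s ^ i * (\<iota> (\<kappa> (i, \<alpha>)) * zpow z r \<alpha>))"
          by (intro sum.cong) (auto simp: mult_ac)
        also have "\<dots> = (\<Sum>i<M. \<Sum>\<alpha>\<in>Mon r (n + c * (M - i)). s ^ i * (\<iota> (\<kappa> (i, \<alpha>)) * zpow z r \<alpha>))"
          unfolding I_def by (rule sum.Sigma[symmetric]) (use Mon_card in auto)
        finally show ?thesis by (simp only: sum_distrib_left)
      qed
      with \<kappa>(2) indep[where q = "\<lambda>i \<alpha>. \<kappa> (i, \<alpha>)"]
      have "\<forall>i<M. \<forall>\<alpha>\<in>Mon r (n + c * (M - i)). \<kappa> (i, \<alpha>) = 0" by auto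
      with \<kappa>(1) show False by (auto simp: I_def)
    qed
    with I G(2) show ?thesis by (simp add: mult.commute)
  qed
  have "(e + 1) ^ j \<le> e ^ j * f (1 + (c * M) * j)" for j
  proof (induction j)
    case 0
    then show ?case by (simp add: f_def Mon_1[unfolded One_nat_def])
  next
    case (Suc j)
    have "(e + 1) ^ Suc j = M * (e + 1) ^ j" by (simp add: M_def)
    also have "\<dots> \<le> M * (e ^ j * f (1 + (c * M) * j))" by (intro mult_le_mono2 Suc)
    also have "\<dots> = e ^ j * (M * f (1 + (c * M) * j))" by (simp add: mult_ac)
    also have "\<dots> \<le> e ^ j * (e * f ((1 + (c * M) * j) + c * M))" by (intro mult_le_mono2 step)
    also have "\<dots> = e ^ Suc j * f (1 + (c * M) * Suc j)" by (simp add: algebra_simps)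
    finally show ?case .
  qed
  then have "(e + 1) ^ j \<le> e ^ j * (1 + (c * M) * j) ^ r" for j
    using Mon_card[of r "1 + (c * M) * j"] unfolding f_def by (meson mult_le_mono2 order.trans)
  from geometric_not_le_polynomial[OF this] show False .
qed

section \<open>Homomorphisms to k and localisation at their kernels\<close>

definition khom :: "'f set \<Rightarrow> ('f \<Rightarrow> 'k) \<Rightarrow> bool" where
  "khom A \<phi> \<longleftrightarrow> is_subring A \<and> K \<subseteq> A \<and> (\<forall>c. \<phi> (\<iota> c) = c) \<and>
     (\<forall>x\<in>A. \<forall>y\<in>A. \<phi> (x + y) = \<phi> x + \<phi> y \<and> \<phi> (x * y) = \<phi> x * \<phi> y)"

lemma khomD:
  assumes "khom A \<phi>"
  shows "is_subring A" "K \<subseteq> A" "\<iota> c \<in> A" "\<phi> (\<iota> c) = c" "x \<in> A \<Longrightarrow> y \<in> A \<Longrightarrow> \<phi> (x + y) = \<phi> x + \<phi> y"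
    "x \<in> A \<Longrightarrow> y \<in> A \<Longrightarrow> \<phi> (x * y) = \<phi> x * \<phi> y" "\<phi> 0 = 0" "\<phi> 1 = 1"
    "x \<in> A \<Longrightarrow> \<phi> (- x) = - \<phi> x" "x \<in> A \<Longrightarrow> y \<in> A \<Longrightarrow> \<phi> (x - y) = \<phi> x - \<phi> y"
    "x \<in> A \<Longrightarrow> \<phi> (x ^ n) = \<phi> x ^ n"
proof -
  show A: "is_subring A" "K \<subseteq> A" "\<iota> c \<in> A" "\<And>c. \<phi> (\<iota> c) = c"
    "\<And>x y. x \<in> A \<Longrightarrow> y \<in> A \<Longrightarrow> \<phi> (x + y) = \<phi> x + \<phi> y"
    "\<And>x y. x \<in> A \<Longrightarrow> y \<in> A \<Longrightarrow> \<phi> (x * y) = \<phi> x * \<phi> y"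
    using assms by (auto simp: khom_def)
  note Ar = is_subringD[OF A(1)]
  show "\<phi> 0 = 0" using A(4)[of 0] by (simp add: \<iota>_0)
  then have 0: "\<phi> 0 = 0" .
  show 1: "\<phi> 1 = 1" using A(4)[of 1] by (simp add: \<iota>_1)
  show m: "\<phi> (- x) = - \<phi> x" if "x \<in> A" for x
    using A(5)[OF that Ar(6)[OF that]] 0 by (simp add: eq_neg_iff_add_eq_0 add.commute)
  show "\<phi> (x - y) = \<phi> x - \<phi> y" if "x \<in> A" "y \<in> A" for x y
    using A(5)[OF that(1) Ar(6)[OF that(2)]] m[OF that(2)] by simp
  show "\<phi> (x ^ n) = \<phi> x ^ n" if "x \<in> A"
    using that by (induction n) (auto simp: 1 A(6) Ar(7))
qed

lemma khom_sum:
  assumes "khom A \<phi>" "\<And>i. i \<in> I \<Longrightarrow> f i \<in> A"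
  shows "\<phi> (sum f I) = (\<Sum>i\<in>I. \<phi> (f i))"
  using assms(2)
  by (induction I rule: infinite_finite_induct)
    (auto simp: khomD[OF assms(1)] is_subring_sum[OF khomD(1)[OF assms(1)]])

definition loc :: "'f set \<Rightarrow> ('f \<Rightarrow> 'k) \<Rightarrow> 'f set" where
  "loc A \<phi> = {a / u |a u. a \<in> A \<and> u \<in> A \<and> \<phi> u \<noteq> 0}"

text \<open>The value is read off from some representation as a fraction; \<open>loc_hom_eq\<close>
  shows that the choice is immaterial. The localisation itself stays inside the field, so no
  equivalence classes are formed.\<close>

definition loc_hom :: "'f set \<Rightarrow> ('f \<Rightarrow> 'k) \<Rightarrow> 'f \<Rightarrow> 'k" where
  "loc_hom A \<phi> x = (SOME c. \<exists>a u. a \<in> A \<and> u \<in> A \<and> \<phi> u \<noteq> 0 \<and> x = a / u \<and> c = \<phi> a / \<phi> u)"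

lemma locE:
  assumes "x \<in> loc A \<phi>" obtains a u where "x = a / u" "a \<in> A" "u \<in> A" "\<phi> u \<noteq> 0"
  using assms by (auto simp: loc_def)

lemma loc_hom_eq:
  assumes A: "khom A \<phi>" and "a \<in> A" "u \<in> A" "\<phi> u \<noteq> 0"
  shows "loc_hom A \<phi> (a / u) = \<phi> a / \<phi> u"
  unfolding loc_hom_def
proof (rule some_equality)
  show "\<exists>a' u'. a' \<in> A \<and> u' \<in> A \<and> \<phi> u' \<noteq> 0 \<and> a / u = a' / u' \<and> \<phi> a / \<phi> u = \<phi> a' / \<phi> u'"
    using assms by blast
next
  fix c assume "\<exists>a' u'. a' \<in> A \<and> u' \<in> A \<and> \<phi> u' \<noteq> 0 \<and> a / u = a' / u' \<and> c = \<phi> a' / \<phi> u'"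
  then obtain a' u' where a': "a' \<in> A" "u' \<in> A" "\<phi> u' \<noteq> 0" "a / u = a' / u'" "c = \<phi> a' / \<phi> u'" by auto
  have "u \<noteq> 0" "u' \<noteq> 0" using assms a' khomD(7)[OF A] by auto
  then have "a * u' = a' * u" using a'(4) by (simp add: field_simps)
  then have "\<phi> a * \<phi> u' = \<phi> a' * \<phi> u" using assms a' khomD(6)[OF A] by metis
  then show "c = \<phi> a / \<phi> u" using assms(4) a'(3) by (simp add: frac_eq_eq a'(5))
qed

lemma loc_base:
  assumes A: "khom A \<phi>" and "a \<in> A" shows "a \<in> loc A \<phi>" "loc_hom A \<phi> a = \<phi> a"
proof -
  have 1: "1 \<in> A" "\<phi> 1 = 1" using khomD(8)[OF A] is_subringD(2)[OF khomD(1)[OF A]] by auto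
  show "loc_hom A \<phi> a = \<phi> a" using loc_hom_eq[OF A assms(2) 1(1)] 1(2) by simp
  show "a \<in> loc A \<phi>" unfolding loc_def
    by (intro CollectI exI[of _ a] exI[of _ 1]) (use 1 assms in auto)
qed

lemma khom_loc:
  assumes A: "khom A \<phi>" shows "khom (loc A \<phi>) (loc_hom A \<phi>)"
proof -
  note Ar = is_subringD[OF khomD(1)[OF A]]
  have *: "x + y \<in> loc A \<phi> \<and> loc_hom A \<phi> (x + y) = loc_hom A \<phi> x + loc_hom A \<phi> y \<and>
      x - y \<in> loc A \<phi> \<and> x * y \<in> loc A \<phi> \<and> loc_hom A \<phi> (x * y) = loc_hom A \<phi> x * loc_hom A \<phi> y"
    if "x \<in> loc A \<phi>" "y \<in> loc A \<phi>" for x y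
  proof -
    obtain a u b v where x: "x = a / u" "a \<in> A" "u \<in> A" "\<phi> u \<noteq> 0" and y: "y = b / v" "b \<in> A" "v \<in> A" "\<phi> v \<noteq> 0"
      using \<open>x \<in> loc A \<phi>\<close> \<open>y \<in> loc A \<phi>\<close> by (elim locE) auto
    have nz: "u \<noteq> 0" "v \<noteq> 0" using x y khomD(7)[OF A] by auto
    have uv: "u * v \<in> A" "\<phi> (u * v) = \<phi> u * \<phi> v" "\<phi> (u * v) \<noteq> 0"
      using x y Ar khomD(6)[OF A] by auto
    have p: "x + y = (a * v + b * u) / (u * v)" and m: "x - y = (a * v - b * u) / (u * v)"
      and t: "x * y = (a * b) / (u * v)" using nz by (auto simp: x y field_simps)
    have num: "a * v + b * u \<in> A" "a * v - b * u \<in> A" "a * b \<in> A" using x y Ar by auto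
    have "loc_hom A \<phi> (x + y) = \<phi> (a * v + b * u) / \<phi> (u * v)" unfolding p by (rule loc_hom_eq[OF A num(1) uv(1,3)])
    moreover have "\<phi> (a * v + b * u) = \<phi> a * \<phi> v + \<phi> b * \<phi> u" using x y Ar khomD(5,6)[OF A] by auto
    moreover have "loc_hom A \<phi> (x * y) = \<phi> (a * b) / \<phi> (u * v)" unfolding t by (rule loc_hom_eq[OF A num(3) uv(1,3)])
    moreover have "\<phi> (a * b) = \<phi> a * \<phi> b" using x y khomD(6)[OF A] by auto
    moreover have "loc_hom A \<phi> x = \<phi> a / \<phi> u" "loc_hom A \<phi> y = \<phi> b / \<phi> v"
      unfolding x(1) y(1) by (intro loc_hom_eq[OF A] x(2-) y(2-))+
    ultimately have "loc_hom A \<phi> (x + y) = loc_hom A \<phi> x + loc_hom A \<phi> y" "loc_hom A \<phi> (x * y) = loc_hom A \<phi> x * loc_hom A \<phi> y"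
      by (simp_all only: uv(2) add_frac_eq[OF x(4) y(4)] times_divide_times_eq)
    moreover have "x + y \<in> loc A \<phi>" "x - y \<in> loc A \<phi>" "x * y \<in> loc A \<phi>"
      using p m t num uv unfolding loc_def by blast+
    ultimately show ?thesis by blast
  qed
  have "is_subring (loc A \<phi>)" unfolding is_subring_def
    using * loc_base(1)[OF A] Ar by auto
  then show ?thesis unfolding khom_def
    using * loc_base[OF A] khomD(2,3,4)[OF A] by (auto simp: subset_iff)
qed

lemma loc_inverse:
  assumes A: "khom A \<phi>" and "x \<in> loc A \<phi>" "loc_hom A \<phi> x \<noteq> 0"
  shows "inverse x \<in> loc A \<phi>"
proof -
  obtain a u where x: "x = a / u" "a \<in> A" "u \<in> A" "\<phi> u \<noteq> 0" using assms by (auto elim: locE)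
  then have "\<phi> a \<noteq> 0" using assms loc_hom_eq[OF A x(2,3,4)] by auto
  then show ?thesis using x by (auto simp: loc_def)
qed

end

section \<open>Systems of parameters\<close>

lemma ideal_cong_mult:
  assumes C: "is_subring C" and I: "is_ideal C I" and "a \<in> C" "d \<in> C" "a - b \<in> I" "c - d \<in> I"
  shows "a * c - b * d \<in> I"
proof -
  have eq: "a * c - b * d = a * (c - d) + d * (a - b)" by (simp add: algebra_simps)
  show ?thesis unfolding eq using assms by (intro is_idealD(3,4)[OF I])
qed

lemma ideal_cong_power:
  assumes C: "is_subring C" and I: "is_ideal C I" and "a \<in> C" "b \<in> C" "a - b \<in> I"
  shows "a ^ n - b ^ n \<in> I"
proof (induction n)
  case (Suc n)
  then show ?case using assms
    by (auto intro!: ideal_cong_mult[OF C I] is_subringD(7)[OF C])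
qed (simp add: is_idealD[OF I])

lemma ideal_cong_prod:
  assumes C: "is_subring C" and I: "is_ideal C I"
    and "\<And>i. i \<in> S \<Longrightarrow> a i \<in> C" "\<And>i. i \<in> S \<Longrightarrow> b i \<in> C" "\<And>i. i \<in> S \<Longrightarrow> a i - b i \<in> I"
  shows "prod a S - prod b S \<in> I"
proof -
  have "prod a T - prod b T \<in> I \<and> prod a T \<in> C \<and> prod b T \<in> C" if "finite T" "T \<subseteq> S" for T
    using that
  proof (induction T)
    case empty
    then show ?case using is_idealD(2)[OF I] is_subringD[OF C] by auto
  next
    case (insert i T)
    then have "prod a T - prod b T \<in> I" "prod a T \<in> C" "prod b T \<in> C" "i \<in> S" by auto
    then show ?case using insert(1,2) assms(3-5)[of i]
      by (auto intro!: ideal_cong_mult[OF C I] is_subringD(5)[OF C])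
  qed
  then show ?thesis using is_idealD(2)[OF I] by (cases "finite S") auto
qed

context field_embedding
begin

text \<open>All generators have value 0, so a polynomial expression in them differs from its
  constant term by an element of the ideal of \<open>Y\<close>. This is the source of the fact that
  \<open>Y\<close> generates the maximal ideal of the localisation.\<close>

lemma gen_minus_const:
  assumes A: "khom (gen K Y) \<phi>" and Y: "\<And>y. y \<in> Y \<Longrightarrow> \<phi> y = 0" and "a \<in> gen K Y"
  shows "a - \<iota> (\<phi> a) \<in> idl (gen K Y) Y"
  using assms(3)
proof induction
  case (base x)
  then show ?case using khomD(4)[OF A] by (auto intro: idl.zero)
next
  case (gen y)
  then show ?case using Y by (auto simp: \<iota>_0 intro: idl_gen[OF khomD(1)[OF A]])
next
  case (add x y)
  have "(x - \<iota> (\<phi> x)) + (y - \<iota> (\<phi> y)) \<in> idl (gen K Y) Y" by (intro idl_add add.IH)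
  then show ?case using add.hyps by (simp add: khomD(5)[OF A] \<iota>_add algebra_simps)
next
  case (mult x y)
  have "y * (x - \<iota> (\<phi> x)) + \<iota> (\<phi> x) * (y - \<iota> (\<phi> y)) \<in> idl (gen K Y) Y"
    using khomD(1,3)[OF A] mult by (intro idl_add idl_mult) auto
  then show ?case using mult.hyps by (simp add: khomD(6)[OF A] \<iota>_mult algebra_simps)
qed

lemma loc_maximal_ideal:
  assumes A: "khom (gen K Y) \<phi>" and Y: "\<And>y. y \<in> Y \<Longrightarrow> \<phi> y = 0"
    and x: "x \<in> loc (gen K Y) \<phi>" "loc_hom (gen K Y) \<phi> x = 0"
  shows "x \<in> idl (loc (gen K Y) \<phi>) Y"
proof -
  obtain a u where a: "x = a / u" "a \<in> gen K Y" "u \<in> gen K Y" "\<phi> u \<noteq> 0" using x(1) by (rule locE)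
  then have "\<phi> a = 0" using x(2) loc_hom_eq[OF A] by auto
  then have "a \<in> idl (gen K Y) Y" using gen_minus_const[OF A Y a(2)] by (simp add: \<iota>_0)
  then have *: "a \<in> idl (loc (gen K Y) \<phi>) Y"
    using idl_mono[of "gen K Y" "loc (gen K Y) \<phi>" Y Y] loc_base(1)[OF A] by blast
  have "inverse u \<in> loc (gen K Y) \<phi>" unfolding loc_def
    by (intro CollectI exI[of _ 1] exI[of _ u]) (use a is_subringD(2)[OF khomD(1)[OF A]] in \<open>auto simp: field_simps\<close>)
  from idl_mult[OF khomD(1)[OF khom_loc[OF A]] this *] show ?thesis
    by (simp add: a(1) field_simps)
qed

text \<open>The residue field is \<open>k\<close>, so 1 spans modulo the maximal ideal, and this
  ideal is generated by finitely many elements that are nilpotent modulo \<open>I\<close>.\<close>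

lemma finite_codim_local:
  assumes A: "khom (gen K Y) \<phi>" and fin: "finite Y" and Y: "\<And>y. y \<in> Y \<Longrightarrow> \<phi> y = 0"
    and I: "is_ideal (loc (gen K Y) \<phi>) I"
    and rad: "\<And>x. x \<in> loc (gen K Y) \<phi> \<Longrightarrow> loc_hom (gen K Y) \<phi> x = 0 \<Longrightarrow> \<exists>N. x ^ N \<in> I"
  shows "finite_codim (loc (gen K Y) \<phi>) I"
proof -
  let ?C = "loc (gen K Y) \<phi>" and ?l = "loc_hom (gen K Y) \<phi>"
  note C = khom_loc[OF A]
  have YC: "y \<in> ?C" "?l y = 0" if "y \<in> Y" for y using loc_base[OF A, of y] Y that by (auto intro: gen.gen)
  have "finite_codim ?C {i + j |i j. i \<in> I \<and> j \<in> idl ?C Y}"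
    unfolding finite_codim_def
  proof (intro exI[of _ "{1}"] conjI ballI)
    show "{1} \<subseteq> ?C" using is_subringD(2)[OF khomD(1)[OF C]] by auto
    fix x assume x: "x \<in> ?C"
    have "x - \<iota> (?l x) \<in> ?C" using is_subringD(4)[OF khomD(1)[OF C]] khomD(3)[OF C] x by auto
    moreover have "?l (x - \<iota> (?l x)) = 0" using x khomD(3,4,10)[OF C] by auto
    ultimately have "x - \<iota> (?l x) \<in> idl ?C Y" using loc_maximal_ideal[OF A Y] by blast
    moreover have "\<iota> (?l x) \<in> idl K {1}"
      using idl.step[OF idl.zero, of "\<iota> (?l x)" K 1 "{1}"] by auto
    moreover have "x - \<iota> (?l x) = 0 + (x - \<iota> (?l x))" by simp
    ultimately show "\<exists>a\<in>idl K {1}. x - a \<in> {i + j |i j. i \<in> I \<and> j \<in> idl ?C Y}"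
      using is_idealD(2)[OF I] by blast
  qed auto
  then show ?thesis using YC rad
    by (intro finite_codim_rad[OF khomD(1,2)[OF C] fin _ I]) auto
qed

lemma khom_prod_nz:
  assumes A: "khom A \<phi>" and "finite S" "\<And>i. i \<in> S \<Longrightarrow> u i \<in> A \<and> \<phi> (u i) \<noteq> 0"
  shows "prod u S \<in> A \<and> \<phi> (prod u S) \<noteq> 0"
  using assms(2,3)
proof (induction S)
  case empty
  then show ?case using khomD(8)[OF A] is_subringD(2)[OF khomD(1)[OF A]] by auto
next
  case (insert i S)
  then show ?case using khomD(6)[OF A] is_subringD(5)[OF khomD(1)[OF A]] by auto
qed

text \<open>Membership in a power of the ideal involves finitely many fractions; their denominators
  are cleared together by a product, which again has nonzero value.\<close>

lemma jpow_loc: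
  assumes A: "khom A \<phi>" and z: "\<And>i. i < r \<Longrightarrow> z i \<in> A" and "y \<in> jpow (loc A \<phi>) z r n"
  shows "\<exists>u\<in>A. \<phi> u \<noteq> 0 \<and> u * y \<in> jpow A z r n"
  using assms(3)
proof (induction n arbitrary: y)
  case 0
  then obtain a u where a: "y = a / u" "a \<in> A" "u \<in> A" "\<phi> u \<noteq> 0" by (auto elim: locE)
  then have "u \<noteq> 0" using khomD(7)[OF A] by auto
  then show ?case using a by (intro bexI[of _ u]) auto
next
  case (Suc n)
  then obtain x where x: "y = (\<Sum>i<r. z i * x i)" "\<forall>i<r. x i \<in> jpow (loc A \<phi>) z r n" by auto
  then have "\<forall>i. \<exists>u. i < r \<longrightarrow> u \<in> A \<and> \<phi> u \<noteq> 0 \<and> u * x i \<in> jpow A z r n" using Suc.IH by blast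
  from choice[OF this] obtain u where u: "\<And>i. i < r \<Longrightarrow> u i \<in> A \<and> \<phi> (u i) \<noteq> 0"
    "\<And>i. i < r \<Longrightarrow> u i * x i \<in> jpow A z r n" by auto
  have U: "prod u {..<r} \<in> A \<and> \<phi> (prod u {..<r}) \<noteq> 0" using u by (intro khom_prod_nz[OF A]) auto
  have "prod u {..<r} * x i \<in> jpow A z r n" if i: "i < r" for i
  proof -
    have "prod u ({..<r} - {i}) \<in> A" using khom_prod_nz[OF A, of "{..<r} - {i}" u] u by auto
    from is_idealD(4)[OF is_ideal_jpow[OF khomD(1)[OF A] z] this u(2)[OF i]]
    have "prod u ({..<r} - {i}) * (u i * x i) \<in> jpow A z r n" .
    moreover have "prod u {..<r} = u i * prod u ({..<r} - {i})" using i by (intro prod.remove) auto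
    ultimately show ?thesis by (simp add: mult_ac)
  qed
  moreover have "prod u {..<r} * y = (\<Sum>i<r. z i * (prod u {..<r} * x i))"
    by (simp add: x sum_distrib_left mult_ac)
  ultimately have "prod u {..<r} * y \<in> jpow A z r (Suc n)" by auto
  then show ?case using U by blast
qed

lemma jpow_mono_ring:
  assumes "A \<subseteq> C" shows "jpow A z r n \<subseteq> jpow C z r n"
proof (induction n)
  case (Suc n)
  show ?case
  proof
    fix y assume "y \<in> jpow A z r (Suc n)"
    then obtain x where "y = (\<Sum>i<r. z i * x i)" "\<forall>i<r. x i \<in> jpow A z r n" by auto
    then show "y \<in> jpow C z r (Suc n)" using Suc by auto
  qed
qed (use assms in auto)

lemma artin_rees_loc:
  assumes A: "khom A \<phi>" and N: "noetherian A" and z: "\<And>i. i < r \<Longrightarrow> z i \<in> A" and s: "s \<in> A" "s \<noteq> 0"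
  shows "\<exists>c. \<forall>n x. x \<in> loc A \<phi> \<longrightarrow> s * x \<in> jpow (loc A \<phi>) z r (n + c) \<longrightarrow> x \<in> jpow (loc A \<phi>) z r n"
proof -
  let ?C = "loc A \<phi>"
  note C = khom_loc[OF A]
  have AC: "A \<subseteq> ?C" using loc_base(1)[OF A] by auto
  obtain c where c: "\<And>n x. x \<in> A \<Longrightarrow> s * x \<in> jpow A z r (n + c) \<Longrightarrow> x \<in> jpow A z r n"
    using artin_rees[where A = A and r = r and z = z and s = s, OF khomD(1)[OF A] N z s] by blast
  show ?thesis
  proof (intro exI allI impI)
    fix n x assume x: "x \<in> ?C" "s * x \<in> jpow ?C z r (n + c)"
    obtain u where u: "u \<in> A" "\<phi> u \<noteq> 0" "u * (s * x) \<in> jpow A z r (n + c)"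
      using jpow_loc[OF A z x(2)] by auto
    obtain a v where a: "x = a / v" "a \<in> A" "v \<in> A" "\<phi> v \<noteq> 0" using x(1) by (rule locE)
    have v: "v \<noteq> 0" "u \<noteq> 0" using a u khomD(7)[OF A] by auto
    have "u * a \<in> A" using u a is_subringD(5)[OF khomD(1)[OF A]] by auto
    moreover have eq: "s * (u * a) = v * (u * (s * x))" using v by (simp add: a field_simps)
    have "s * (u * a) \<in> jpow A z r (n + c)"
      unfolding eq by (rule is_idealD(4)[OF is_ideal_jpow[OF khomD(1)[OF A] z] a(3) u(3)])
    ultimately have "u * a \<in> jpow ?C z r n" using c jpow_mono_ring[OF AC] by blast
    moreover have "1 / (u * v) \<in> ?C" unfolding loc_def
      by (intro CollectI exI[of _ 1] exI[of _ "u * v"])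
        (use u a is_subringD(2,5)[OF khomD(1)[OF A]] khomD(6)[OF A] in auto)
    moreover have "is_ideal ?C (jpow ?C z r n)" using z AC by (intro is_ideal_jpow[OF khomD(1)[OF C]]) auto
    ultimately have "1 / (u * v) * (u * a) \<in> jpow ?C z r n" using is_idealD(4) by blast
    then show "x \<in> jpow ?C z r n" using v by (simp add: a)
  qed
qed

text \<open>Modulo \<open>I\<close> every \<open>z i\<close> is a multiple of \<open>z 0\<close>, so
  the relation among the \<open>z i\<close> becomes one for \<open>z 0\<close> alone. Its lowest
  coefficient is the value at \<mu> of the lowest form of \<open>p\<close>. As this is nonzero,
  \<open>z 0 ^ a\<close> times a unit of the local ring \<open>C\<close> is a multiple of
  \<open>s\<close> modulo \<open>I\<close>.\<close>

lemma one_variable_left: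
  assumes C: "khom C l" and inv: "\<And>x. x \<in> C \<Longrightarrow> l x \<noteq> 0 \<Longrightarrow> inverse x \<in> C"
    and s: "s \<in> C" "l s = 0" and I: "is_ideal C I" and z: "\<And>i. i < r \<Longrightarrow> z i \<in> C \<and> l (z i) = 0"
    and "0 < r" and \<mu>: "\<And>i. i < r \<Longrightarrow> z i - \<iota> (\<mu> i) * z 0 \<in> I"
    and rel: "x \<in> C" "(\<Sum>\<alpha>\<in>Mon r n. \<iota> (p \<alpha>) * zpow z r \<alpha>) - s * x \<in> jpow C z r n"
    and low: "\<And>\<alpha>. \<alpha> \<in> Mon r n \<Longrightarrow> (\<Sum>i<r. \<alpha> i) < a \<Longrightarrow> p \<alpha> = 0" "a < n"
    and nz: "(\<Sum>\<alpha>\<in>{\<alpha>\<in>Mon r n. (\<Sum>i<r. \<alpha> i) = a}. p \<alpha> * zpow \<mu> r \<alpha>) \<noteq> 0"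
  shows "\<exists>y\<in>C. z 0 ^ a - s * y \<in> I"
    and "u \<in> jpow C z r m \<Longrightarrow> \<exists>c\<in>C. u - z 0 ^ m * c \<in> I"
proof -
  note Cr = is_subringD[OF khomD(1)[OF C]]
  note IC = is_idealD[OF I]
  have z0: "z 0 \<in> C" "l (z 0) = 0" using z \<open>0 < r\<close> by auto
  have \<iota>C: "\<iota> c \<in> C" for c using khomD(3)[OF C] .
  show *: "\<exists>c\<in>C. u - z 0 ^ m * c \<in> I" if "u \<in> jpow C z r m" for u m
    using that
  proof (induction m arbitrary: u)
    case 0
    then show ?case using IC by (intro bexI[of _ u]) auto
  next
    case (Suc m)
    then obtain v where v: "u = (\<Sum>i<r. z i * v i)" "\<forall>i<r. v i \<in> jpow C z r m" by auto
    then have "\<forall>i. \<exists>c. i < r \<longrightarrow> c \<in> C \<and> v i - z 0 ^ m * c \<in> I" using Suc.IH by blast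
    from choice[OF this] obtain c where c: "\<And>i. i < r \<Longrightarrow> c i \<in> C" "\<And>i. i < r \<Longrightarrow> v i - z 0 ^ m * c i \<in> I" by auto
    have vC: "v i \<in> C" if "i < r" for i
    proof -
      have "is_ideal C (jpow C z r m)" using z by (intro is_ideal_jpow khomD(1)[OF C]) auto
      then show ?thesis using v(2) that is_idealD(1) by blast
    qed
    have "(\<Sum>i<r. z i * v i - (\<iota> (\<mu> i) * z 0) * (z 0 ^ m * c i)) \<in> I"
      using c \<mu> z vC z0 Cr \<iota>C
      by (intro is_ideal_sum[OF I] ideal_cong_mult[OF khomD(1)[OF C] I]) auto
    moreover have "(\<Sum>i<r. z i * v i - (\<iota> (\<mu> i) * z 0) * (z 0 ^ m * c i)) =
      u - z 0 ^ Suc m * (\<Sum>i<r. \<iota> (\<mu> i) * c i)"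
      by (simp add: v sum_subtractf sum_distrib_left mult_ac)
    ultimately have "u - z 0 ^ Suc m * (\<Sum>i<r. \<iota> (\<mu> i) * c i) \<in> I" by simp
    moreover have "(\<Sum>i<r. \<iota> (\<mu> i) * c i) \<in> C" using c \<iota>C Cr by (intro is_subring_sum[OF khomD(1)[OF C]]) auto
    ultimately show ?case by blast
  qed
  define deg where "deg \<alpha> = (\<Sum>i<r. \<alpha> i)" for \<alpha> :: "nat \<Rightarrow> nat"
  have mon: "zpow z r \<alpha> - \<iota> (zpow \<mu> r \<alpha>) * z 0 ^ deg \<alpha> \<in> I" for \<alpha>
  proof -
    have "zpow z r \<alpha> - (\<Prod>i<r. (\<iota> (\<mu> i) * z 0) ^ \<alpha> i) \<in> I" unfolding zpow_def
      using z \<mu> Cr \<iota>C z0 by (intro ideal_cong_prod[OF khomD(1)[OF C] I] ideal_cong_power[OF khomD(1)[OF C] I]) auto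
    moreover have "(\<Prod>i<r. (\<iota> (\<mu> i) * z 0) ^ \<alpha> i) = \<iota> (zpow \<mu> r \<alpha>) * z 0 ^ deg \<alpha>"
      by (simp add: zpow_def \<iota>_prod \<iota>_power power_mult_distrib prod.distrib power_sum deg_def)
    ultimately show ?thesis by simp
  qed
  define \<kappa> where "\<kappa> = (\<Sum>\<alpha>\<in>{\<alpha>\<in>Mon r n. deg \<alpha> = a}. p \<alpha> * zpow \<mu> r \<alpha>)"
  define w where "w = (\<Sum>\<alpha>\<in>{\<alpha>\<in>Mon r n. deg \<alpha> \<noteq> a}. \<iota> (p \<alpha> * zpow \<mu> r \<alpha>) * z 0 ^ (deg \<alpha> - Suc a))"
  obtain c where c: "c \<in> C" "(\<Sum>\<alpha>\<in>Mon r n. \<iota> (p \<alpha>) * zpow z r \<alpha>) - s * x - z 0 ^ n * c \<in> I"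
    using *[OF rel(2)] by blast
  have wC: "w \<in> C" unfolding w_def using Cr \<iota>C z0 by (intro is_subring_sum[OF khomD(1)[OF C]]) auto
  have fin: "finite (Mon r n)" using Mon_card by auto
  have Q: "(\<Sum>\<alpha>\<in>Mon r n. \<iota> (p \<alpha>) * (\<iota> (zpow \<mu> r \<alpha>) * z 0 ^ deg \<alpha>)) = z 0 ^ a * (\<iota> \<kappa> + z 0 * w)"
  proof -
    have "(\<Sum>\<alpha>\<in>Mon r n. \<iota> (p \<alpha>) * (\<iota> (zpow \<mu> r \<alpha>) * z 0 ^ deg \<alpha>)) =
       (\<Sum>\<alpha>\<in>{\<alpha>\<in>Mon r n. deg \<alpha> = a}. \<iota> (p \<alpha>) * (\<iota> (zpow \<mu> r \<alpha>) * z 0 ^ deg \<alpha>)) +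
       (\<Sum>\<alpha>\<in>{\<alpha>\<in>Mon r n. deg \<alpha> \<noteq> a}. \<iota> (p \<alpha>) * (\<iota> (zpow \<mu> r \<alpha>) * z 0 ^ deg \<alpha>))"
      using fin by (subst sum.union_disjoint[symmetric]) (auto intro!: sum.cong)
    also have "(\<Sum>\<alpha>\<in>{\<alpha>\<in>Mon r n. deg \<alpha> = a}. \<iota> (p \<alpha>) * (\<iota> (zpow \<mu> r \<alpha>) * z 0 ^ deg \<alpha>)) = z 0 ^ a * \<iota> \<kappa>"
      unfolding \<kappa>_def \<iota>_sum sum_distrib_left by (intro sum.cong) (auto simp: \<iota>_mult mult_ac)
    also have "(\<Sum>\<alpha>\<in>{\<alpha>\<in>Mon r n. deg \<alpha> \<noteq> a}. \<iota> (p \<alpha>) * (\<iota> (zpow \<mu> r \<alpha>) * z 0 ^ deg \<alpha>)) = z 0 ^ a * (z 0 * w)"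
      unfolding w_def sum_distrib_left
    proof (intro sum.cong refl)
      fix \<alpha> assume \<alpha>: "\<alpha> \<in> {\<alpha>\<in>Mon r n. deg \<alpha> \<noteq> a}"
      show "\<iota> (p \<alpha>) * (\<iota> (zpow \<mu> r \<alpha>) * z 0 ^ deg \<alpha>) =
        z 0 ^ a * (z 0 * (\<iota> (p \<alpha> * zpow \<mu> r \<alpha>) * z 0 ^ (deg \<alpha> - Suc a)))"
      proof (cases "deg \<alpha> < a")
        case True
        then have "p \<alpha> = 0" using low(1) \<alpha> by (auto simp: deg_def)
        then show ?thesis by (simp add: \<iota>_0)
      next
        case False
        then have "deg \<alpha> = a + Suc (deg \<alpha> - Suc a)" using \<alpha> by auto
        then have "z 0 ^ deg \<alpha> = z 0 ^ a * (z 0 * z 0 ^ (deg \<alpha> - Suc a))"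
          by (metis power_Suc power_add)
        then show ?thesis by (simp add: \<iota>_mult mult_ac)
      qed
    qed
    finally show ?thesis by (simp add: distrib_left)
  qed
  \<comment> \<open>Modulo \<open>I\<close> the remainder from \<open>J ^ n\<close> is
    \<open>z 0 ^ n * c\<close>. As \<open>a < n\<close>, it is absorbed into the cofactor of
    \<open>z 0 ^ a\<close> without changing the value \<kappa> of the latter.\<close>
  define v where "v = \<iota> \<kappa> + z 0 * (w - z 0 ^ (n - Suc a) * c)"
  have wC': "w - z 0 ^ (n - Suc a) * c \<in> C" by (intro Cr(4) Cr(5) Cr(7) wC c z0)
  have "l v = \<kappa>" unfolding v_def
    using khomD(3,4,5,6)[OF C] z0 wC' Cr by auto
  moreover have vC: "v \<in> C" unfolding v_def by (intro Cr(3) Cr(5) \<iota>C z0 wC')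
  ultimately have v: "v \<in> C" "inverse v \<in> C" "v \<noteq> 0"
    using nz inv[OF vC] khomD(7)[OF C] by (auto simp: \<kappa>_def deg_def)
  have "(\<Sum>\<alpha>\<in>Mon r n. \<iota> (p \<alpha>) * (zpow z r \<alpha> - \<iota> (zpow \<mu> r \<alpha>) * z 0 ^ deg \<alpha>)) \<in> I"
    by (intro is_ideal_sum[OF I] IC(4) mon \<iota>C)
  then have d1: "(\<Sum>\<alpha>\<in>Mon r n. \<iota> (p \<alpha>) * zpow z r \<alpha>) - z 0 ^ a * (\<iota> \<kappa> + z 0 * w) \<in> I"
    by (simp only: right_diff_distrib sum_subtractf Q)
  have "z 0 ^ n = z 0 ^ a * (z 0 * z 0 ^ (n - Suc a))"
    using low(2) by (metis Suc_leI le_add_diff_inverse mult.assoc power_Suc2 power_add)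
  then have eq: "z 0 ^ a * v - s * x = ((\<Sum>\<alpha>\<in>Mon r n. \<iota> (p \<alpha>) * zpow z r \<alpha>) - s * x - z 0 ^ n * c)
     - ((\<Sum>\<alpha>\<in>Mon r n. \<iota> (p \<alpha>) * zpow z r \<alpha>) - z 0 ^ a * (\<iota> \<kappa> + z 0 * w))"
    unfolding v_def by (simp add: algebra_simps)
  have "z 0 ^ a * v - s * x \<in> I" unfolding eq by (rule is_ideal_diff[OF khomD(1)[OF C] I c(2) d1])
  then have "inverse v * (z 0 ^ a * v - s * x) \<in> I" by (rule IC(4)[OF v(2)])
  moreover have "inverse v * (z 0 ^ a * v - s * x) = z 0 ^ a - s * (inverse v * x)"
    using v(3) by (simp add: field_simps)
  ultimately show "\<exists>y\<in>C. z 0 ^ a - s * y \<in> I" using Cr(5)[OF v(2) rel(1)] by auto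
qed

text \<open>The counterpart of the theorem that a nonzero element of the maximal ideal of a local
  domain belongs to a system of parameters. Let \<open>r\<close> be least such that \<open>r\<close>
  elements generate the maximal ideal up to radical. The growth relation lets \<open>s\<close> take
  the place of one of them: \<open>r - 1\<close> linear combinations together with \<open>s\<close>
  still suffice. Were \<open>s\<close> nilpotent modulo these combinations, they would suffice
  alone, against the choice of \<open>r\<close>.\<close>

theorem parameter_system:
  assumes A: "khom A \<phi>" and AY: "A = gen K Y" and finY: "finite Y" and Y: "\<And>y. y \<in> Y \<Longrightarrow> \<phi> y = 0"
    and s: "s \<in> A" "s \<noteq> 0" "\<phi> s = 0"
  defines "C \<equiv> loc A \<phi>" and "l \<equiv> loc_hom A \<phi>"
  shows "\<exists>r z. (\<forall>i<r. z i \<in> A \<and> \<phi> (z i) = 0) \<and>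
    (\<forall>x\<in>C. l x = 0 \<longrightarrow> (\<exists>N. \<exists>y\<in>C. x ^ N - s * y \<in> jpow C z r 1)) \<and> (\<forall>N. s ^ N \<notin> jpow C z r 1)"
proof -
  have C: "khom C l" unfolding C_def l_def by (rule khom_loc[OF A])
  note Cr = is_subringD[OF khomD(1)[OF C]]
  have AC: "a \<in> C \<and> l a = \<phi> a" if "a \<in> A" for a using loc_base[OF A that] by (auto simp: C_def l_def)
  define P where "P r \<longleftrightarrow> (\<exists>z. (\<forall>i<r. z i \<in> A \<and> \<phi> (z i) = 0) \<and>
     (\<forall>x\<in>C. l x = 0 \<longrightarrow> (\<exists>N. x ^ N \<in> jpow C z r 1)))" for r
  have "\<exists>r. P r"
  proof -
    obtain ys where ys: "set ys = Y" using finite_list[OF finY] by auto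
    have zi: "ys ! i \<in> A \<and> \<phi> (ys ! i) = 0" if "i < length ys" for i
      using that ys Y nth_mem[OF that] by (auto simp: AY intro: gen.gen)
    have J: "is_ideal C (jpow C ((!) ys) (length ys) 1)"
      using zi AC by (intro is_ideal_jpow khomD(1)[OF C]) auto
    have "Y \<subseteq> jpow C ((!) ys) (length ys) 1"
    proof
      fix y assume "y \<in> Y"
      then obtain i where "i < length ys" "y = ys ! i" using ys by (metis in_set_conv_nth)
      then show "y \<in> jpow C ((!) ys) (length ys) 1"
        using jpow_elem[OF khomD(1)[OF C], of i "length ys" "(!) ys"] by simp
    qed
    then have "idl C Y \<subseteq> jpow C ((!) ys) (length ys) 1" by (rule idl_least[OF J])
    then have "x ^ 1 \<in> jpow C ((!) ys) (length ys) 1" if "x \<in> C" "l x = 0" for x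
      using loc_maximal_ideal[OF A[unfolded AY] Y] that by (auto simp: C_def l_def AY)
    then have "P (length ys)" unfolding P_def using zi by blast
    then show ?thesis ..
  qed
  define r where "r = (LEAST r. P r)"
  have "P r" unfolding r_def using \<open>\<exists>r. P r\<close> by (rule LeastI_ex)
  have least: "\<not> P r'" if "r' < r" for r' using that not_less_Least unfolding r_def by blast
  obtain z where z: "\<And>i. i < r \<Longrightarrow> z i \<in> A \<and> \<phi> (z i) = 0"
    "\<And>x. x \<in> C \<Longrightarrow> l x = 0 \<Longrightarrow> \<exists>N. x ^ N \<in> jpow C z r 1" using \<open>P r\<close> unfolding P_def by blast
  have sC: "s \<in> C" "l s = 0" using AC s by auto
  have r: "0 < r"
  proof (rule ccontr)
    assume "\<not> 0 < r"
    then obtain N where "s ^ N \<in> jpow C z 0 1" using z(2)[OF sC] by auto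
    then show False using s by auto
  qed
  have zC: "z i \<in> C" if "i < r" for i using z(1)[OF that] AC by auto
  have J: "is_ideal C (jpow C z r n)" for n using zC by (intro is_ideal_jpow khomD(1)[OF C])
  obtain c where c: "\<And>n x. x \<in> C \<Longrightarrow> s * x \<in> jpow C z r (n + c) \<Longrightarrow> x \<in> jpow C z r n"
    using artin_rees_loc[OF A noetherian_gen[OF is_subring_K noetherian_K finY, folded AY], of r z s] z(1) s
    unfolding C_def by blast
  have fin: "finite_codim C (jpow C z r 1)"
    unfolding C_def AY
    by (rule finite_codim_local[OF A[unfolded AY] finY Y J[of 1, unfolded C_def AY] z(2)[unfolded C_def l_def AY]])
  obtain n p x where p: "\<exists>\<alpha>\<in>Mon r n. p \<alpha> \<noteq> 0" "x \<in> C"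
    "(\<Sum>\<alpha>\<in>Mon r n. \<iota> (p \<alpha>) * zpow z r \<alpha>) - s * x \<in> jpow C z r n"
    using growth_relation[OF khomD(1,2)[OF C] zC sC(1) c fin] by blast
  define deg where "deg \<alpha> = (\<Sum>i<r. \<alpha> i)" for \<alpha> :: "nat \<Rightarrow> nat"
  define a where "a = (LEAST a. \<exists>\<alpha>\<in>Mon r n. p \<alpha> \<noteq> 0 \<and> deg \<alpha> = a)"
  have "\<exists>a. \<exists>\<alpha>\<in>Mon r n. p \<alpha> \<noteq> 0 \<and> deg \<alpha> = a" using p(1) by auto
  from LeastI_ex[OF this] obtain \<alpha>0 where \<alpha>0: "\<alpha>0 \<in> Mon r n" "p \<alpha>0 \<noteq> 0" "deg \<alpha>0 = a" unfolding a_def by blast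
  have low: "p \<alpha> = 0" if "\<alpha> \<in> Mon r n" "(\<Sum>i<r. \<alpha> i) < a" for \<alpha>
    using not_less_Least[of "deg \<alpha>" "\<lambda>a. \<exists>\<alpha>\<in>Mon r n. p \<alpha> \<noteq> 0 \<and> deg \<alpha> = a"] that
    unfolding a_def[symmetric] by (auto simp: deg_def)
  have an: "a < n" using \<alpha>0 by (auto simp: Mon_def deg_def)
  define S where "S = {\<alpha>\<in>Mon r n. (\<Sum>i<r. \<alpha> i) = a}"
  obtain \<xi> where \<xi>: "\<And>i. \<xi> i \<noteq> 0" "(\<Sum>\<alpha>\<in>S. p \<alpha> * zpow \<xi> r \<alpha>) \<noteq> 0"
    using poly_nonvanishing[of S r n \<alpha>0 p] \<alpha>0 by (auto simp: S_def deg_def)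
  \<comment> \<open>The form of lowest degree is homogeneous, so the point may be normalised at its
    nonzero coordinate \<open>\<xi> 0\<close>; the value changes only by the factor
    \<open>\<xi> 0 ^ a\<close>.\<close>
  define \<mu> where "\<mu> i = \<xi> i / \<xi> 0" for i
  have zp: "zpow \<xi> r \<alpha> = \<xi> 0 ^ a * zpow \<mu> r \<alpha>" if "\<alpha> \<in> S" for \<alpha>
  proof -
    have "zpow \<xi> r \<alpha> = (\<Prod>i<r. (\<xi> 0 * \<mu> i) ^ \<alpha> i)" using \<xi>(1)[of 0] by (simp add: zpow_def \<mu>_def)
    also have "\<dots> = \<xi> 0 ^ (\<Sum>i<r. \<alpha> i) * zpow \<mu> r \<alpha>"
      by (simp add: power_mult_distrib prod.distrib power_sum zpow_def)
    finally show ?thesis using that by (simp add: S_def)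
  qed
  have "(\<Sum>\<alpha>\<in>S. p \<alpha> * zpow \<xi> r \<alpha>) = \<xi> 0 ^ a * (\<Sum>\<alpha>\<in>S. p \<alpha> * zpow \<mu> r \<alpha>)"
    unfolding sum_distrib_left by (intro sum.cong) (auto simp: zp)
  then have nz: "(\<Sum>\<alpha>\<in>S. p \<alpha> * zpow \<mu> r \<alpha>) \<noteq> 0" using \<xi>(2) by auto
  obtain r' where r': "r = Suc r'" using r by (cases r) auto
  define z' where "z' i = z (Suc i) - \<iota> (\<mu> (Suc i)) * z 0" for i
  have z'A: "z' i \<in> A \<and> \<phi> (z' i) = 0" if "i < r'" for i
    using z(1)[of "Suc i"] z(1)[of 0] that r' khomD(3,4,6,10)[OF A] is_subringD(4,5)[OF khomD(1)[OF A]]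
    by (auto simp: z'_def)
  define I where "I = jpow C z' r' 1"
  have I: "is_ideal C I" unfolding I_def using z'A AC by (intro is_ideal_jpow khomD(1)[OF C]) auto
  have \<mu>I: "z i - \<iota> (\<mu> i) * z 0 \<in> I" if "i < r" for i
  proof (cases i)
    case 0
    then show ?thesis using is_idealD(2)[OF I] \<xi>(1)[of 0] by (simp add: \<mu>_def \<iota>_1)
  next
    case (Suc j)
    then show ?thesis using jpow_elem[OF khomD(1)[OF C], of j r' z'] that r' by (simp add: I_def z'_def)
  qed
  have inv: "inverse x \<in> C" if "x \<in> C" "l x \<noteq> 0" for x
    using loc_inverse[OF A] that by (auto simp: C_def l_def)
  have zl: "z i \<in> C \<and> l (z i) = 0" if "i < r" for i using z(1)[OF that] AC by auto
  note ovl = one_variable_left[where C = C and l = l and r = r and z = z and \<mu> = \<mu> and I = I and s = s and x = x and n = n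
    and p = p and a = a, OF C inv sC I zl r \<mu>I p(2,3) low an nz[unfolded S_def]]
  have ovl2: "\<exists>c\<in>C. u - z 0 ^ m * c \<in> I" if "u \<in> jpow C z r m" for u m
    by (rule ovl(2)[OF _ _ _ _ _ _ that])
  from ovl(1) obtain y0 where y0: "y0 \<in> C" "z 0 ^ a - s * y0 \<in> I" by auto
  have z0: "z 0 \<in> C" using zC r by auto
  \<comment> \<open>Modulo \<open>I\<close> some power of \<open>x\<close> is a multiple of
    \<open>z 0\<close>; its \<open>a\<close>-th power then contains \<open>z 0 ^ a\<close>, which is
    a multiple of \<open>s\<close> modulo \<open>I\<close>.\<close>
  have main: "\<exists>N. \<exists>y\<in>C. x ^ N - s * y \<in> I" if x: "x \<in> C" "l x = 0" for x
  proof -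
    obtain N where "x ^ N \<in> jpow C z r 1" using z(2)[OF x] by auto
    from ovl2[OF this] obtain c where c: "c \<in> C" "x ^ N - z 0 * c \<in> I" by auto
    have xN: "x ^ N \<in> C" using Cr(7)[OF x(1)] .
    have "(x ^ N) ^ a - (z 0 * c) ^ a \<in> I"
      by (intro ideal_cong_power[OF khomD(1)[OF C] I xN _ c(2)] Cr(5) z0 c)
    moreover have "c ^ a * (z 0 ^ a - s * y0) \<in> I" by (intro is_idealD(4)[OF I _ y0(2)] Cr(7) c)
    ultimately have "((x ^ N) ^ a - (z 0 * c) ^ a) + c ^ a * (z 0 ^ a - s * y0) \<in> I" by (rule is_idealD(3)[OF I])
    moreover have "((x ^ N) ^ a - (z 0 * c) ^ a) + c ^ a * (z 0 ^ a - s * y0) = x ^ (N * a) - s * (c ^ a * y0)"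
      by (simp add: power_mult algebra_simps power_mult_distrib)
    moreover have "c ^ a * y0 \<in> C" by (intro Cr(5) Cr(7) c y0)
    ultimately show ?thesis by (intro exI[of _ "N * a"] bexI[of _ "c ^ a * y0"]) auto
  qed
  have "s ^ N \<notin> I" for N
  proof
    assume sN: "s ^ N \<in> I"
    have "P r'" unfolding P_def
    proof (intro exI[of _ z'] conjI allI impI ballI)
      fix x assume x: "x \<in> C" "l x = 0"
      from main[OF x] obtain M y where y: "y \<in> C" "x ^ M - s * y \<in> I" by auto
      have xM: "x ^ M \<in> C" using Cr(7)[OF x(1)] .
      have "(x ^ M) ^ N - (s * y) ^ N \<in> I"
        by (intro ideal_cong_power[OF khomD(1)[OF C] I xM _ y(2)] Cr(5) sC y)
      moreover have "(s * y) ^ N \<in> I"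
        using is_idealD(4)[OF I Cr(7)[OF y(1)] sN, of N] by (simp add: power_mult_distrib mult.commute)
      ultimately have "((x ^ M) ^ N - (s * y) ^ N) + (s * y) ^ N \<in> I" by (rule is_idealD(3)[OF I])
      then have "x ^ (M * N) \<in> I" by (simp add: power_mult)
      then show "\<exists>N. x ^ N \<in> jpow C z' r' 1" unfolding I_def by blast
    qed (use z'A in auto)
    then show False using least r' by auto
  qed
  with main z'A show ?thesis unfolding I_def by (intro exI[of _ r'] exI[of _ z']) auto
qed

end

section \<open>Extension of places\<close>

lemma poly_sum_le:
  fixes p :: "'a::comm_ring_1 poly"
  shows "degree p \<le> n \<Longrightarrow> poly p x = (\<Sum>i\<le>n. coeff p i * x ^ i)"
  unfolding poly_altdef by (intro sum.mono_neutral_left) (auto simp: coeff_eq_0)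

context field_embedding
begin

text \<open>Graphs of \<open>k\<close>-algebra homomorphisms to \<open>k\<close> on subrings of \<open>D\<close> that vanish on \<open>Q\<close>;
  as sets of pairs they can be united along chains.\<close>
definition kgraph :: "'f set \<Rightarrow> 'f set \<Rightarrow> ('f \<times> 'k) set \<Rightarrow> bool" where
  "kgraph D Q G \<longleftrightarrow> (\<forall>c. (\<iota> c, c) \<in> G) \<and> (\<forall>x a y b. (x, a) \<in> G \<longrightarrow> (y, b) \<in> G \<longrightarrow>
     (x + y, a + b) \<in> G \<and> (x * y, a * b) \<in> G) \<and> (\<forall>c. (0, c) \<in> G \<longrightarrow> c = 0) \<and> fst ` G \<subseteq> D \<and> (\<forall>q\<in>Q. (q, 0) \<in> G)"

lemma kgraphD:
  assumes "kgraph D Q G"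
  shows "(\<iota> c, c) \<in> G" "(x, a) \<in> G \<Longrightarrow> (y, b) \<in> G \<Longrightarrow> (x + y, a + b) \<in> G"
    "(x, a) \<in> G \<Longrightarrow> (y, b) \<in> G \<Longrightarrow> (x * y, a * b) \<in> G" "(0, c) \<in> G \<Longrightarrow> c = 0"
    "(x, a) \<in> G \<Longrightarrow> x \<in> D" "q \<in> Q \<Longrightarrow> (q, 0) \<in> G"
    "(x, a) \<in> G \<Longrightarrow> (y, b) \<in> G \<Longrightarrow> (x - y, a - b) \<in> G" "(x, a) \<in> G \<Longrightarrow> (x, b) \<in> G \<Longrightarrow> a = b"
proof -
  show 1: "(\<iota> c, c) \<in> G" for c using assms by (simp add: kgraph_def)
  have 23: "(x + y, a + b) \<in> G \<and> (x * y, a * b) \<in> G" if "(x, a) \<in> G" "(y, b) \<in> G" for x y a b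
    using assms that unfolding kgraph_def by (elim conjE) metis
  then show 2: "(x + y, a + b) \<in> G" and 3: "(x * y, a * b) \<in> G" if "(x, a) \<in> G" "(y, b) \<in> G" for x y a b
    using that by blast+
  show 4: "c = 0" if "(0, c) \<in> G" for c using assms that by (simp add: kgraph_def)
  show "q \<in> Q \<Longrightarrow> (q, 0) \<in> G" using assms by (simp add: kgraph_def)
  show "(x, a) \<in> G \<Longrightarrow> x \<in> D" using assms by (force simp: kgraph_def)
  have 5: "(x - y, a - b) \<in> G" if "(x, a) \<in> G" "(y, b) \<in> G" for x y a b
  proof -
    have "(\<iota> (-1) * y, (-1) * b) \<in> G" by (rule 3[OF _ that(2)]) (use assms in \<open>simp add: kgraph_def\<close>)
    from 2[OF that(1) this] show ?thesis by (simp add: \<iota>_uminus \<iota>_1)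
  qed
  then show "(x, a) \<in> G \<Longrightarrow> (y, b) \<in> G \<Longrightarrow> (x - y, a - b) \<in> G" .
  show "a = b" if "(x, a) \<in> G" "(x, b) \<in> G" using 4[of "a - b"] 5[OF that] by simp
qed

lemma maximal_kgraph:
  assumes "kgraph D Q G0"
  shows "\<exists>G. kgraph D Q G \<and> G0 \<subseteq> G \<and> (\<forall>G'. kgraph D Q G' \<longrightarrow> G \<subseteq> G' \<longrightarrow> G' = G)"
proof -
  have "\<exists>M\<in>{G. kgraph D Q G \<and> G0 \<subseteq> G}. \<forall>X\<in>{G. kgraph D Q G \<and> G0 \<subseteq> G}. M \<subseteq> X \<longrightarrow> X = M"
  proof (rule subset_Zorn_nonempty)
    show "{G. kgraph D Q G \<and> G0 \<subseteq> G} \<noteq> {}" using assms by auto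
    fix \<C> assume ne: "\<C> \<noteq> {}" and ch: "subset.chain {G. kgraph D Q G \<and> G0 \<subseteq> G} \<C>"
    have sub: "kgraph D Q G" "G0 \<subseteq> G" if "G \<in> \<C>" for G
      using ch that unfolding subset_chain_def by auto
    have two: "\<exists>G\<in>\<C>. u \<in> G \<and> v \<in> G" if "u \<in> \<Union>\<C>" "v \<in> \<Union>\<C>" for u v
    proof -
      obtain G H where GH: "G \<in> \<C>" "u \<in> G" "H \<in> \<C>" "v \<in> H" using \<open>u \<in> \<Union>\<C>\<close> \<open>v \<in> \<Union>\<C>\<close> by auto
      then have "G \<subseteq> H \<or> H \<subseteq> G" using ch unfolding subset_chain_def by blast
      with GH show ?thesis by auto
    qed
    have "kgraph D Q (\<Union>\<C>)" unfolding kgraph_def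
    proof (intro conjI allI impI ballI)
      obtain G where G: "G \<in> \<C>" using ne by auto
      show "(\<iota> c, c) \<in> \<Union>\<C>" for c using kgraphD(1)[OF sub(1)[OF G]] G by auto
      show "(q, 0) \<in> \<Union>\<C>" if "q \<in> Q" for q using kgraphD(6)[OF sub(1)[OF G] that] G by auto
    next
      fix x a y b assume "(x, a) \<in> \<Union>\<C>" "(y, b) \<in> \<Union>\<C>"
      from two[OF this] obtain G where G: "G \<in> \<C>" "(x, a) \<in> G" "(y, b) \<in> G" by auto
      then show "(x + y, a + b) \<in> \<Union>\<C>" "(x * y, a * b) \<in> \<Union>\<C>"
        using kgraphD(2,3)[OF sub(1)[OF G(1)] G(2,3)] by auto
    next
      fix c assume "(0, c) \<in> \<Union>\<C>"
      then show "c = 0" using kgraphD(4)[OF sub(1)] by blast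
    next
      show "fst ` (\<Union>\<C>) \<subseteq> D" using kgraphD(5)[OF sub(1)] by fastforce
    qed
    then show "\<Union>\<C> \<in> {G. kgraph D Q G \<and> G0 \<subseteq> G}" using sub(2) ne by blast
  qed
  then obtain G where "kgraph D Q G" "G0 \<subseteq> G" "\<forall>X. kgraph D Q X \<and> G0 \<subseteq> X \<longrightarrow> G \<subseteq> X \<longrightarrow> X = G" by auto
  then show ?thesis by (intro exI[of _ G]) auto
qed

lemma map_poly_khom:
  assumes W: "khom W \<psi>" and p: "\<And>i. coeff p i \<in> W" and q: "\<And>i. coeff q i \<in> W"
  shows "map_poly \<psi> (p + q) = map_poly \<psi> p + map_poly \<psi> q" "map_poly \<psi> (p * q) = map_poly \<psi> p * map_poly \<psi> q"
    "\<And>i. coeff (p + q) i \<in> W" "\<And>i. coeff (p * q) i \<in> W"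
proof -
  note Wr = is_subringD[OF khomD(1)[OF W]]
  show "map_poly \<psi> (p + q) = map_poly \<psi> p + map_poly \<psi> q"
    by (intro poly_eqI) (simp add: coeff_map_poly khomD(5,7)[OF W] p q)
  show "map_poly \<psi> (p * q) = map_poly \<psi> p * map_poly \<psi> q"
    by (intro poly_eqI)
      (simp add: coeff_map_poly coeff_mult khomD(6,7)[OF W] p q khom_sum[OF W] Wr(5))
  show "coeff (p + q) i \<in> W" for i using Wr(3) p q by auto
  show "coeff (p * q) i \<in> W" for i unfolding coeff_mult
    by (intro is_subring_sum[OF khomD(1)[OF W]] Wr(5) p q)
qed

text \<open>Zorn's lemma, starting from the homomorphism on \<open>A + Q\<close> that kills
  \<open>Q\<close>. The last clause is the yield of maximality: if \<open>c\<close> is a root of the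
  images of all relations of \<open>x\<close> modulo \<open>Q\<close>, then sending \<open>x\<close>
  to \<open>c\<close> extends \<psi> to \<open>W[x]\<close>, so \<open>x\<close> was in
  \<open>W\<close> already.\<close>

lemma maximal_khom:
  assumes D: "is_subring D" and Q: "is_ideal D Q"
    and A: "khom A \<phi>" "A \<subseteq> D" "\<And>x. x \<in> A \<Longrightarrow> x \<in> Q \<Longrightarrow> \<phi> x = 0"
  shows "\<exists>W \<psi>. khom W \<psi> \<and> A \<subseteq> W \<and> W \<subseteq> D \<and> Q \<subseteq> W \<and> (\<forall>x\<in>A. \<psi> x = \<phi> x) \<and> (\<forall>x\<in>Q. \<psi> x = 0) \<and>
     (\<forall>x\<in>D. \<forall>c. (\<forall>p. (\<forall>i. coeff p i \<in> W) \<longrightarrow> poly p x \<in> Q \<longrightarrow> poly (map_poly \<psi> p) c = 0) \<longrightarrow> x \<in> W)"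
proof -
  note Dr = is_subringD[OF D] and Qr = is_idealD[OF Q] and Ar = is_subringD[OF khomD(1)[OF A(1)]]
  define G0 where "G0 = {(x + q, \<phi> x) |x q. x \<in> A \<and> q \<in> Q}"
  have "kgraph D Q G0" unfolding kgraph_def
  proof (intro conjI allI impI ballI)
    show "(\<iota> c, c) \<in> G0" for c unfolding G0_def
      using khomD(3,4)[OF A(1)] Qr(2) by (intro CollectI exI[of _ "\<iota> c"] exI[of _ 0]) auto
    show "(q, 0) \<in> G0" if "q \<in> Q" for q unfolding G0_def
      using khomD(7)[OF A(1)] Ar(1) that by (intro CollectI exI[of _ 0] exI[of _ q]) auto
    show "fst ` G0 \<subseteq> D" using A(2) Qr(1) by (auto simp: G0_def intro!: Dr(3))
  next
    fix c assume "(0, c) \<in> G0"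
    then obtain x q where x: "x + q = 0" "c = \<phi> x" "x \<in> A" "q \<in> Q" by (auto simp: G0_def)
    then have "x = - q" by (simp add: eq_neg_iff_add_eq_0)
    then have "x \<in> Q" using is_ideal_uminus[OF D Q x(4)] by simp
    then show "c = 0" using A(3) x by auto
  next
    fix x a y b assume "(x, a) \<in> G0" "(y, b) \<in> G0"
    then obtain u q v q' where u: "x = u + q" "a = \<phi> u" "u \<in> A" "q \<in> Q"
      and v: "y = v + q'" "b = \<phi> v" "v \<in> A" "q' \<in> Q" by (auto simp: G0_def)
    show "(x + y, a + b) \<in> G0" unfolding G0_def
      using u v Ar(3) Qr(3) khomD(5)[OF A(1)]
      by (intro CollectI exI[of _ "u + v"] exI[of _ "q + q'"]) auto
    have "u \<in> D" "v \<in> D" "q' \<in> D" using u v A(2) Qr(1) by auto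
    then have "u * q' + v * q + q' * q \<in> Q" using u v by (intro Qr(3) Qr(4)) auto
    then show "(x * y, a * b) \<in> G0" unfolding G0_def
      using u v Ar(5) khomD(6)[OF A(1)]
      by (intro CollectI exI[of _ "u * v"] exI[of _ "u * q' + v * q + q' * q"]) (auto simp: algebra_simps)
  qed
  from maximal_kgraph[OF this] obtain G where G: "kgraph D Q G" "G0 \<subseteq> G"
    and max: "\<And>G'. kgraph D Q G' \<Longrightarrow> G \<subseteq> G' \<Longrightarrow> G' = G" by blast
  note Gr = kgraphD[OF G(1)]
  define W where "W = fst ` G"
  define \<psi> where "\<psi> x = (THE a. (x, a) \<in> G)" for x
  have \<psi>: "\<psi> x = a" if "(x, a) \<in> G" for x a
    unfolding \<psi>_def using that Gr(8) by (intro the_equality) auto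
  have W: "(x, \<psi> x) \<in> G" if "x \<in> W" for x using that \<psi> by (auto simp: W_def)
  have WI: "x \<in> W" if "(x, a) \<in> G" for x a using that by (force simp: W_def)
  have kW: "khom W \<psi>" unfolding khom_def
  proof (intro conjI allI ballI)
    show "is_subring W" unfolding is_subring_def
    proof (intro conjI ballI)
      show "0 \<in> W" "1 \<in> W" using WI[OF Gr(1)[of 0]] WI[OF Gr(1)[of 1]] by (auto simp: \<iota>_0 \<iota>_1)
      fix x y assume "x \<in> W" "y \<in> W"
      then show "x + y \<in> W" "x - y \<in> W" "x * y \<in> W"
        using WI[OF Gr(2)[OF W W]] WI[OF Gr(7)[OF W W]] WI[OF Gr(3)[OF W W]] by auto
    qed
    show "K \<subseteq> W" using WI[OF Gr(1)] by auto
    show "\<psi> (\<iota> c) = c" for c using \<psi>[OF Gr(1)] .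
    fix x y assume "x \<in> W" "y \<in> W"
    then show "\<psi> (x + y) = \<psi> x + \<psi> y" "\<psi> (x * y) = \<psi> x * \<psi> y"
      using \<psi>[OF Gr(2)[OF W W]] \<psi>[OF Gr(3)[OF W W]] by auto
  qed
  note Wr = is_subringD[OF khomD(1)[OF kW]]
  have WD: "W \<subseteq> D" using Gr(5) by (auto simp: W_def)
  have A0: "(x, \<phi> x) \<in> G" if "x \<in> A" for x
  proof -
    have "(x, \<phi> x) \<in> G0" unfolding G0_def using that Qr(2)
      by (intro CollectI exI[of _ x] exI[of _ 0]) auto
    then show ?thesis using G(2) by auto
  qed
  have ext: "x \<in> W" if x: "x \<in> D" and c: "\<And>p. (\<forall>i. coeff p i \<in> W) \<Longrightarrow> poly p x \<in> Q \<Longrightarrow> poly (map_poly \<psi> p) c = 0"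
    for x c
  proof -
    define G' where "G' = {(poly p x, poly (map_poly \<psi> p) c) |p. \<forall>i. coeff p i \<in> W}"
    have const: "(w, \<psi> w) \<in> G'" if "w \<in> W" for w unfolding G'_def
      using that Wr(1) khomD(7)[OF kW]
      by (intro CollectI exI[of _ "[:w:]"]) (auto simp: coeff_pCons Polynomial.map_poly_pCons split: nat.splits)
    have "kgraph D Q G'" unfolding kgraph_def
    proof (intro conjI allI impI ballI)
      show "(\<iota> a, a) \<in> G'" for a using const[of "\<iota> a"] khomD(3,4)[OF kW] by auto
      show "(q, 0) \<in> G'" if "q \<in> Q" for q using const[of q] Gr(6)[OF that] \<psi> WI by auto
      show "fst ` G' \<subseteq> D"
      proof -
        have "poly p x \<in> D" if "\<forall>i. coeff p i \<in> W" for p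
          unfolding poly_altdef using that WD x by (intro is_subring_sum[OF D] Dr(5) Dr(7)) auto
        then show ?thesis by (auto simp: G'_def)
      qed
    next
      fix a assume "(0, a) \<in> G'"
      then obtain p where "0 = poly p x" "a = poly (map_poly \<psi> p) c" "\<forall>i. coeff p i \<in> W" by (auto simp: G'_def)
      then show "a = 0" using c[of p] Qr(2) by auto
    next
      fix u a v b assume "(u, a) \<in> G'" "(v, b) \<in> G'"
      then obtain p q where p: "u = poly p x" "a = poly (map_poly \<psi> p) c" "\<And>i. coeff p i \<in> W"
        and q: "v = poly q x" "b = poly (map_poly \<psi> q) c" "\<And>i. coeff q i \<in> W" by (auto simp: G'_def)
      show "(u + v, a + b) \<in> G'" "(u * v, a * b) \<in> G'" unfolding G'_def
        using map_poly_khom[OF kW p(3) q(3)] p(1,2) q(1,2)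
        by (intro CollectI exI[of _ "p + q"] exI[of _ "p * q"]; auto)+
    qed
    moreover have "G \<subseteq> G'"
    proof clarify
      fix w a assume "(w, a) \<in> G"
      then show "(w, a) \<in> G'" using const WI \<psi> by metis
    qed
    ultimately have "G' = G" by (rule max)
    moreover have "(x, c) \<in> G'" unfolding G'_def
      using Wr(1,2) khomD(7,8)[OF kW]
      by (intro CollectI exI[of _ "[:0, 1:]"]) (auto simp: coeff_pCons Polynomial.map_poly_pCons split: nat.splits)
    ultimately show ?thesis using WI by blast
  qed
  show ?thesis
  proof (intro exI[of _ W] exI[of _ \<psi>] conjI)
    show "khom W \<psi>" "W \<subseteq> D" by fact+
    show "A \<subseteq> W" "\<forall>x\<in>A. \<psi> x = \<phi> x" using A0 WI \<psi> by blast+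
    show "Q \<subseteq> W" "\<forall>x\<in>Q. \<psi> x = 0" using Gr(6) WI \<psi> by blast+
    show "\<forall>x\<in>D. \<forall>c. (\<forall>p. (\<forall>i. coeff p i \<in> W) \<longrightarrow> poly p x \<in> Q \<longrightarrow> poly (map_poly \<psi> p) c = 0) \<longrightarrow> x \<in> W"
      using ext by blast
  qed
qed

text \<open>The images of the relations of \<open>x\<close> form an ideal of \<open>k[X]\<close>,
  which is principal. A nonconstant generator would have a root in the algebraically closed field,
  common to all of them, so the generator is a unit.\<close>

lemma no_common_root:
  assumes W: "khom W \<psi>" and D: "is_subring D" and Q: "is_ideal D Q" and "W \<subseteq> D" "x \<in> D"
    and no: "\<And>c. \<exists>p. (\<forall>i. coeff p i \<in> W) \<and> poly p x \<in> Q \<and> poly (map_poly \<psi> p) c \<noteq> 0"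
  shows "\<exists>p. (\<forall>i. coeff p i \<in> W) \<and> poly p x \<in> Q \<and> map_poly \<psi> p = 1"
proof -
  note Dr = is_subringD[OF D] and Qr = is_idealD[OF Q] and Wr = is_subringD[OF khomD(1)[OF W]]
  define I where "I = {map_poly \<psi> p |p. (\<forall>i. coeff p i \<in> W) \<and> poly p x \<in> Q}"
  have add: "f + g \<in> I" if fg: "f \<in> I" "g \<in> I" for f g
  proof -
    obtain p q where p: "f = map_poly \<psi> p" "\<And>i. coeff p i \<in> W" "poly p x \<in> Q"
      and q: "g = map_poly \<psi> q" "\<And>i. coeff q i \<in> W" "poly q x \<in> Q"
      using fg by (auto simp: I_def)
    show ?thesis unfolding I_def using map_poly_khom[OF W p(2) q(2)] p q Qr(3)
      by (intro CollectI exI[of _ "p + q"]) auto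
  qed
  have mult: "h * f \<in> I" if f: "f \<in> I" for f h
  proof -
    obtain p where p: "f = map_poly \<psi> p" "\<And>i. coeff p i \<in> W" "poly p x \<in> Q" using f by (auto simp: I_def)
    \<comment> \<open>Closure of \<open>I\<close> under multiplication by \<open>h\<close> requires
      a lift of \<open>h\<close> to coefficients in \<open>W\<close>; constants lift along
      \<iota>.\<close>
    define q where "q = map_poly \<iota> h"
    have q: "\<And>i. coeff q i \<in> W" using khomD(3)[OF W] by (simp add: q_def coeff_map_poly \<iota>_0)
    have "map_poly \<psi> q = h" unfolding q_def
      by (intro poly_eqI) (simp add: coeff_map_poly \<iota>_0 khomD(4,7)[OF W])
    moreover have "poly q x \<in> D" unfolding poly_altdef
      using q assms(4,5) by (intro is_subring_sum[OF D] Dr(5) Dr(7)) auto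
    ultimately show ?thesis unfolding I_def
      using map_poly_khom[OF W q p(2)] p Qr(4) by (intro CollectI exI[of _ "q * p"]) auto
  qed
  have "1 \<in> I"
  proof -
    obtain f0 where f0: "f0 \<in> I" "f0 \<noteq> 0" using no[of 0] by (force simp: I_def)
    define n where "n = (LEAST n. \<exists>f\<in>I. f \<noteq> 0 \<and> degree f = n)"
    have "\<exists>n. \<exists>f\<in>I. f \<noteq> 0 \<and> degree f = n" using f0 by auto
    from LeastI_ex[OF this] obtain f where f: "f \<in> I" "f \<noteq> 0" "degree f = n" unfolding n_def by blast
    have min: "g = 0" if "g \<in> I" "degree g < n" for g
      using that not_less_Least[of "degree g" "\<lambda>n. \<exists>f\<in>I. f \<noteq> 0 \<and> degree f = n"] unfolding n_def by blast
    have dvd: "f dvd g" if "g \<in> I" for g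
    proof -
      have "g mod f = g + (- (g div f)) * f" by (simp add: minus_mult_div_eq_mod[symmetric] mult.commute)
      then have "g mod f \<in> I" using add[OF that mult[OF f(1), of "- (g div f)"]] by simp
      moreover have "g mod f = 0 \<or> degree (g mod f) < n" using degree_mod_less[OF f(2), of g] f(3) by simp
      ultimately have "g mod f = 0" using min by blast
      then show ?thesis by (simp add: dvd_eq_mod_eq_0)
    qed
    have "degree f = 0"
    proof (rule ccontr)
      assume "degree f \<noteq> 0"
      then obtain c where c: "poly f c = 0" using alg_closed_imp_poly_has_root by blast
      obtain p where p: "\<forall>i. coeff p i \<in> W" "poly p x \<in> Q" "poly (map_poly \<psi> p) c \<noteq> 0" using no by blast
      then have "f dvd map_poly \<psi> p" using dvd by (auto simp: I_def)
      then show False using p(3) c by (auto elim!: dvdE)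
    qed
    then obtain a where a: "f = [:a:]" by (metis degree_eq_zeroE)
    then have "a \<noteq> 0" using f(2) by auto
    then have "1 = [:inverse a:] * f" by (simp add: a one_pCons)
    then show ?thesis using mult[OF f(1), of "[:inverse a:]"] by simp
  qed
  then show ?thesis by (auto simp: I_def)
qed

text \<open>Chevalley's extension theorem for the field \<open>D / Q\<close>. If \<open>x\<close>
  and its inverse \<open>y\<close> were both outside \<open>W\<close>, each would satisfy a
  polynomial relation whose constant term has value 1 and whose other coefficients have value 0. The
  relation of lower degree shortens the other one, until degree 0 is reached, which is
  absurd.\<close>

theorem place_extension:
  assumes D: "is_subring D" and Q: "is_ideal D Q"
    and inv: "\<And>x. x \<in> D \<Longrightarrow> x \<notin> Q \<Longrightarrow> \<exists>y\<in>D. x * y - 1 \<in> Q"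
    and A: "khom A \<phi>" "A \<subseteq> D" "\<And>x. x \<in> A \<Longrightarrow> x \<in> Q \<Longrightarrow> \<phi> x = 0"
  shows "\<exists>W \<psi>. khom W \<psi> \<and> A \<subseteq> W \<and> W \<subseteq> D \<and> Q \<subseteq> W \<and> (\<forall>x\<in>A. \<psi> x = \<phi> x) \<and> (\<forall>x\<in>Q. \<psi> x = 0) \<and>
     (\<forall>x\<in>D. x \<notin> W \<longrightarrow> (\<exists>y\<in>W. \<psi> y = 0 \<and> x * y - 1 \<in> Q))"
proof -
  obtain W \<psi> where kW: "khom W \<psi>" and AW: "A \<subseteq> W" and WD: "W \<subseteq> D" and QW: "Q \<subseteq> W"
    and \<psi>A: "\<forall>x\<in>A. \<psi> x = \<phi> x" and \<psi>Q: "\<And>x. x \<in> Q \<Longrightarrow> \<psi> x = 0"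
    and ext: "\<And>x c. x \<in> D \<Longrightarrow> (\<And>p. (\<forall>i. coeff p i \<in> W) \<Longrightarrow> poly p x \<in> Q \<Longrightarrow> poly (map_poly \<psi> p) c = 0) \<Longrightarrow> x \<in> W"
    using maximal_khom[OF D Q A] by blast
  note Dr = is_subringD[OF D] and Qr = is_idealD[OF Q] and Wr = is_subringD[OF khomD(1)[OF kW]]
  have Qdiff: "a - b \<in> Q" if "a \<in> Q" "b \<in> Q" for a b using is_ideal_diff[OF D Q that] .
  \<comment> \<open>\<open>W\<close> is local modulo \<open>Q\<close>: the inverse \<open>y\<close>
    of \<open>w\<close> meets the extension criterion with the value
    \<open>inverse (\<psi> w)\<close>, as one sees on multiplying a relation of \<open>y\<close> by
    a power of \<open>w\<close>.\<close>
  have unit: "\<exists>v\<in>W. w * v - 1 \<in> Q" if w: "w \<in> W" "\<psi> w \<noteq> 0" for w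
  proof -
    have "w \<notin> Q" using \<psi>Q w by auto
    then obtain y where y: "y \<in> D" "w * y - 1 \<in> Q" using inv w WD by blast
    have "y \<in> W"
    proof (rule ext[OF y(1), of "inverse (\<psi> w)"])
      fix p assume p: "\<forall>i. coeff p i \<in> W" "poly p y \<in> Q"
      define n where "n = degree p"
      have wD: "w \<in> D" using w WD by auto
      have pD: "coeff p i \<in> D" for i using p WD by auto
      have "(\<Sum>i\<le>n. coeff p i * w ^ (n - i) * ((w * y) ^ i - 1 ^ i)) \<in> Q"
        using wD pD y Dr
        by (intro is_ideal_sum[OF Q] Qr(4) ideal_cong_power[OF D Q]) auto
      moreover have "w ^ n * poly p y \<in> Q" using p(2) wD Dr by (intro Qr(4)) auto
      moreover have "w ^ n * poly p y = (\<Sum>i\<le>n. coeff p i * w ^ (n - i) * (w * y) ^ i)"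
        unfolding poly_altdef n_def[symmetric] sum_distrib_left
      proof (intro sum.cong refl)
        fix i assume "i \<in> {..n}"
        then have "w ^ n = w ^ (n - i) * w ^ i" by (simp flip: power_add)
        then show "w ^ n * (coeff p i * y ^ i) = coeff p i * w ^ (n - i) * (w * y) ^ i"
          by (simp add: power_mult_distrib mult_ac)
      qed
      ultimately have "(\<Sum>i\<le>n. coeff p i * w ^ (n - i)) \<in> Q"
        using Qdiff[of "w ^ n * poly p y" "\<Sum>i\<le>n. coeff p i * w ^ (n - i) * ((w * y) ^ i - 1 ^ i)"]
        by (simp add: right_diff_distrib sum_subtractf)
      then have "\<psi> (\<Sum>i\<le>n. coeff p i * w ^ (n - i)) = 0" by (rule \<psi>Q)
      moreover have "\<psi> (\<Sum>i\<le>n. coeff p i * w ^ (n - i)) = (\<Sum>i\<le>n. \<psi> (coeff p i) * \<psi> w ^ (n - i))"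
        using p w Wr khomD(6,11)[OF kW] by (subst khom_sum[OF kW]) auto
      moreover have "(\<Sum>i\<le>n. \<psi> (coeff p i) * inverse (\<psi> w) ^ i) =
         inverse (\<psi> w) ^ n * (\<Sum>i\<le>n. \<psi> (coeff p i) * \<psi> w ^ (n - i))"
        unfolding sum_distrib_left
      proof (intro sum.cong refl)
        fix i assume "i \<in> {..n}"
        then have "inverse (\<psi> w) ^ n = inverse (\<psi> w) ^ i * inverse (\<psi> w) ^ (n - i)" by (simp flip: power_add)
        then show "\<psi> (coeff p i) * inverse (\<psi> w) ^ i = inverse (\<psi> w) ^ n * (\<psi> (coeff p i) * \<psi> w ^ (n - i))"
          using w(2) by (simp add: field_simps)
      qed
      moreover have "poly (map_poly \<psi> p) (inverse (\<psi> w)) = (\<Sum>i\<le>n. \<psi> (coeff p i) * inverse (\<psi> w) ^ i)"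
      proof -
        have "degree (map_poly \<psi> p) \<le> n" unfolding n_def
          by (intro degree_le allI impI) (simp add: coeff_map_poly khomD(7)[OF kW] coeff_eq_0)
        from poly_sum_le[OF this] show ?thesis by (simp add: coeff_map_poly khomD(7)[OF kW])
      qed
      ultimately show "poly (map_poly \<psi> p) (inverse (\<psi> w)) = 0" by simp
    qed
    then show ?thesis using y(2) by auto
  qed
  define rel where "rel x n \<longleftrightarrow> (\<exists>p. (\<forall>i. coeff p i \<in> W) \<and> poly p x \<in> Q \<and> map_poly \<psi> p = 1 \<and> degree p \<le> n)" for x n
  have ex_rel: "\<exists>n. rel x n" if "x \<in> D" "x \<notin> W" for x
  proof -
    have "\<exists>p. (\<forall>i. coeff p i \<in> W) \<and> poly p x \<in> Q \<and> poly (map_poly \<psi> p) c \<noteq> 0" for c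
      using ext[OF that(1), of c] that(2) by blast
    from no_common_root[OF kW D Q WD that(1) this] show ?thesis unfolding rel_def by blast
  qed
  have rel0: "\<not> rel x 0" for x
  proof
    assume "rel x 0"
    then obtain p where p: "\<forall>i. coeff p i \<in> W" "poly p x \<in> Q" "map_poly \<psi> p = 1" "degree p = 0" by (auto simp: rel_def)
    then obtain a where a: "p = [:a:]" by (metis degree_eq_zeroE)
    then have "\<psi> a = 0" using p(2) \<psi>Q by auto
    moreover have "coeff (map_poly \<psi> p) 0 = 1" by (simp add: p(3))
    ultimately show False by (simp add: coeff_map_poly khomD(7)[OF kW] a)
  qed
  have descent: "rel x n" if x: "rel x (Suc n)" and y: "rel y m" and m: "m \<le> Suc n" and xy: "x \<in> D" "y \<in> D" "x * y - 1 \<in> Q"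
    for x y n m
  proof -
    obtain p where p: "\<And>i. coeff p i \<in> W" "poly p x \<in> Q" "map_poly \<psi> p = 1" "degree p \<le> Suc n"
      using x by (auto simp: rel_def)
    obtain q where q: "\<And>i. coeff q i \<in> W" "poly q y \<in> Q" "map_poly \<psi> q = 1" "degree q \<le> m"
      using y by (auto simp: rel_def)
    have \<psi>p: "\<psi> (coeff p i) = (if i = 0 then 1 else 0)" for i
      using arg_cong[OF p(3), of "\<lambda>f. coeff f i"] by (simp add: coeff_map_poly khomD(7)[OF kW])
    have \<psi>q: "\<psi> (coeff q i) = (if i = 0 then 1 else 0)" for i
      using arg_cong[OF q(3), of "\<lambda>f. coeff f i"] by (simp add: coeff_map_poly khomD(7)[OF kW])
    obtain v where v: "v \<in> W" "coeff q 0 * v - 1 \<in> Q" using unit[OF q(1)[of 0]] \<psi>q[of 0] by auto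
    define a where "a = coeff p (Suc n)"
    have a: "a \<in> W" "\<psi> a = 0" using p(1) \<psi>p by (auto simp: a_def)
    have qsum: "poly q y = (\<Sum>j\<le>m. coeff q j * y ^ j)" by (rule poly_sum_le[OF q(4)])
    have D': "x \<in> D" "y \<in> D" "v \<in> D" "a \<in> D" "\<And>i. coeff q i \<in> D" using xy v a q WD by auto
    \<comment> \<open>The relation of \<open>y\<close>, multiplied by
      \<open>a * v * x ^ Suc n\<close> and rewritten in powers of \<open>x\<close>, since
      \<open>x * y\<close> is 1 modulo \<open>Q\<close>. Its leading coefficient is that of
      \<open>p\<close> up to the element \<open>e\<close> of \<open>Q\<close> below, which is
      corrected separately.\<close>
    define r where "r = (\<Sum>j\<le>m. monom (a * v * coeff q j) (Suc n - j))"
    have "poly r x \<in> Q"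
    proof -
      have "(\<Sum>j\<le>m. a * v * coeff q j * x ^ (Suc n - j) * (1 ^ j - (x * y) ^ j)) \<in> Q"
      proof (intro is_ideal_sum[OF Q] Qr(4) ideal_cong_power[OF D Q])
        show "1 - x * y \<in> Q" using is_ideal_uminus[OF D Q xy(3)] by simp
      qed (use D' Dr in auto)
      moreover have "a * v * x ^ Suc n * poly q y \<in> Q" using D' Dr(5,7) by (intro Qr(4) q) auto
      moreover have "a * v * x ^ Suc n * poly q y = (\<Sum>j\<le>m. a * v * coeff q j * x ^ (Suc n - j) * (x * y) ^ j)"
        unfolding qsum sum_distrib_left
      proof (intro sum.cong refl)
        fix j assume "j \<in> {..m}"
        then have "x ^ Suc n = x ^ (Suc n - j) * x ^ j" using m by (simp flip: power_add)
        then show "a * v * x ^ Suc n * (coeff q j * y ^ j) = a * v * coeff q j * x ^ (Suc n - j) * (x * y) ^ j"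
          by (simp add: power_mult_distrib mult_ac)
      qed
      moreover have "poly r x = (\<Sum>j\<le>m. a * v * coeff q j * x ^ (Suc n - j))"
        by (simp add: r_def poly_sum poly_monom)
      moreover have "(\<Sum>j\<le>m. a * v * coeff q j * x ^ (Suc n - j)) =
        (\<Sum>j\<le>m. a * v * coeff q j * x ^ (Suc n - j) * (1 ^ j - (x * y) ^ j)) +
        (\<Sum>j\<le>m. a * v * coeff q j * x ^ (Suc n - j) * (x * y) ^ j)"
        unfolding sum.distrib[symmetric] by (intro sum.cong) (auto simp: algebra_simps)
      ultimately show ?thesis using Qr(3) by simp
    qed
    have rW: "coeff r i \<in> W \<and> \<psi> (coeff r i) = 0" for i
    proof -
      have "coeff r i = a * (\<Sum>j\<le>m. if Suc n - j = i then v * coeff q j else 0)"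
        by (simp add: r_def coeff_sum sum_distrib_left mult.assoc if_distrib cong: if_cong)
      moreover have "(\<Sum>j\<le>m. if Suc n - j = i then v * coeff q j else 0) \<in> W"
        using v q Wr by (intro is_subring_sum[OF khomD(1)[OF kW]]) auto
      ultimately show ?thesis using a Wr(5) khomD(6)[OF kW] by auto
    qed
    define e where "e = a * (coeff q 0 * v - 1)"
    have e: "e \<in> Q" unfolding e_def by (rule Qr(4)[OF D'(4) v(2)])
    then have eW: "e \<in> W" "\<psi> e = 0" using QW \<psi>Q by auto
    have xn: "x ^ Suc n * e \<in> Q" using e Dr(7)[OF D'(1)] Qr(4) by blast
    define p' where "p' = p - r + monom e (Suc n)"
    have c': "coeff p' i = coeff p i - coeff r i + (if i = Suc n then e else 0)" for i by (simp add: p'_def)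
    have "poly p' x \<in> Q" unfolding p'_def
      using Qr(3)[OF Qdiff[OF p(2) \<open>poly r x \<in> Q\<close>] xn] by (simp add: poly_monom mult.commute)
    moreover have "\<forall>i. coeff p' i \<in> W" unfolding c' using p rW eW Wr by auto
    moreover have "\<psi> (coeff p' i) = \<psi> (coeff p i)" for i unfolding c'
      using p rW eW Wr khomD(5,7,10)[OF kW] by auto
    then have "map_poly \<psi> p' = map_poly \<psi> p"
      by (intro poly_eqI) (simp add: coeff_map_poly khomD(7)[OF kW])
    then have "map_poly \<psi> p' = 1" using p(3) by simp
    moreover have "degree p' \<le> n"
    proof (intro degree_le allI impI)
      fix i assume i: "n < i"
      show "coeff p' i = 0"
      proof (cases "i = Suc n")
        case True
        have "coeff r (Suc n) = (\<Sum>j\<le>m. if j = 0 then a * v * coeff q j else 0)"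
          unfolding r_def coeff_sum using m by (intro sum.cong) auto
        also have "\<dots> = a * v * coeff q 0" by simp
        finally show ?thesis unfolding c' True by (simp add: e_def a_def algebra_simps)
      next
        case False
        have "coeff r i = 0" unfolding r_def coeff_sum using i False m by (intro sum.neutral) auto
        then show ?thesis unfolding c' using i False p(4) by (simp add: coeff_eq_0)
      qed
    qed
    ultimately show ?thesis unfolding rel_def by blast
  qed
  have no_rel: False if "rel x n" "rel y m" "x \<in> D" "y \<in> D" "x * y - 1 \<in> Q" for x y n m
    using that
  proof (induction "n + m" arbitrary: n m x y rule: less_induct)
    case less
    obtain n' m' where nm: "n = Suc n'" "m = Suc m'" using rel0 less.prems by (metis not0_implies_Suc)
    show False
    proof (cases "m \<le> n")
      case True
      then have "rel x n'" using descent[of x n' y m] less.prems nm by auto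
      then show False using less.hyps[of n' m x y] less.prems nm by auto
    next
      case False
      have yx: "y * x - 1 \<in> Q" using less.prems(5) by (simp add: mult.commute)
      then have "rel y m'" using False descent[of y m' x n] less.prems nm by auto
      then show False using less.hyps[of n m' x y] less.prems nm by auto
    qed
  qed
  have "\<exists>y\<in>W. \<psi> y = 0 \<and> x * y - 1 \<in> Q" if x: "x \<in> D" "x \<notin> W" for x
  proof -
    obtain y where y: "y \<in> D" "x * y - 1 \<in> Q" using inv x QW by blast
    have "y \<in> W"
    proof (rule ccontr)
      assume "y \<notin> W"
      then show False using no_rel ex_rel[OF x] ex_rel[OF y(1)] x y by blast
    qed
    \<comment> \<open>Otherwise \<open>y\<close> has an inverse \<open>v\<close> in
      \<open>W\<close>, and \<open>x\<close> agrees with \<open>v\<close> modulo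
      \<open>Q\<close>.\<close>
    moreover have "\<psi> y = 0"
    proof (rule ccontr)
      assume "\<psi> y \<noteq> 0"
      from unit[OF \<open>y \<in> W\<close> this] obtain v where v: "v \<in> W" "y * v - 1 \<in> Q" by auto
      have "v * (x * y - 1) \<in> Q" "x * (y * v - 1) \<in> Q" using v WD x y by (auto intro!: Qr(4))
      from Qdiff[OF this] have "v * (x * y - 1) - x * (y * v - 1) \<in> Q" .
      then have "x - v \<in> Q" by (simp add: algebra_simps)
      then have "(x - v) + v \<in> W" using QW v Wr(3) by blast
      then show False using x by simp
    qed
    ultimately show ?thesis using y by auto
  qed
  then show ?thesis using kW AW WD QW \<psi>A \<psi>Q by blast
qed

end

section \<open>One-dimensional local rings and power series\<close>

lemma max_ideal:
  assumes D: "is_subring D" and I0: "is_ideal D I0" "1 \<notin> I0"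
  shows "\<exists>Q. is_ideal D Q \<and> I0 \<subseteq> Q \<and> 1 \<notin> Q \<and> (\<forall>x\<in>D. x \<notin> Q \<longrightarrow> (\<exists>y\<in>D. x * y - 1 \<in> Q))"
proof -
  let ?A = "{I. is_ideal D I \<and> I0 \<subseteq> I \<and> 1 \<notin> I}"
  have "\<exists>M\<in>?A. \<forall>X\<in>?A. M \<subseteq> X \<longrightarrow> X = M"
  proof (rule subset_Zorn_nonempty)
    show "?A \<noteq> {}" using I0 by auto
    fix \<C> assume ne: "\<C> \<noteq> {}" and ch: "subset.chain ?A \<C>"
    have sub: "is_ideal D I" "I0 \<subseteq> I" "1 \<notin> I" if "I \<in> \<C>" for I
      using ch that unfolding subset_chain_def by auto
    have "is_ideal D (\<Union>\<C>)" unfolding is_ideal_def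
    proof (intro conjI ballI)
      show "\<Union>\<C> \<subseteq> D" using is_idealD(1)[OF sub(1)] by blast
      show "0 \<in> \<Union>\<C>" using is_idealD(2)[OF sub(1)] ne by blast
      show "w * x \<in> \<Union>\<C>" if "w \<in> D" "x \<in> \<Union>\<C>" for w x
        using is_idealD(4)[OF sub(1)] that by blast
      fix x y assume "x \<in> \<Union>\<C>" "y \<in> \<Union>\<C>"
      then obtain I J where IJ: "I \<in> \<C>" "x \<in> I" "J \<in> \<C>" "y \<in> J" by auto
      then have "I \<subseteq> J \<or> J \<subseteq> I" using ch unfolding subset_chain_def by blast
      then show "x + y \<in> \<Union>\<C>"
      proof
        assume "I \<subseteq> J"
        then have "x + y \<in> J" using IJ is_idealD(3)[OF sub(1)[OF IJ(3)]] by auto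
        then show ?thesis using IJ by auto
      next
        assume "J \<subseteq> I"
        then have "x + y \<in> I" using IJ is_idealD(3)[OF sub(1)[OF IJ(1)]] by auto
        then show ?thesis using IJ by auto
      qed
    qed
    then show "\<Union>\<C> \<in> ?A" using sub(2,3) ne by blast
  qed
  then obtain Q where Q: "is_ideal D Q" "I0 \<subseteq> Q" "1 \<notin> Q"
    and max: "\<And>X. is_ideal D X \<Longrightarrow> I0 \<subseteq> X \<Longrightarrow> 1 \<notin> X \<Longrightarrow> Q \<subseteq> X \<Longrightarrow> X = Q" by auto
  have "\<exists>y\<in>D. x * y - 1 \<in> Q" if x: "x \<in> D" "x \<notin> Q" for x
  proof -
    let ?X = "{i + x * c |i c. i \<in> Q \<and> c \<in> D}"
    have sub: "Q \<subseteq> ?X"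
    proof
      fix i assume "i \<in> Q"
      then show "i \<in> ?X" using is_subringD(1)[OF D] by (intro CollectI exI[of _ i] exI[of _ 0]) auto
    qed
    have "x \<in> ?X" using is_subringD(2)[OF D] is_idealD(2)[OF Q(1)]
      by (intro CollectI exI[of _ 0] exI[of _ 1]) auto
    then have "?X \<noteq> Q" using x by auto
    then have "1 \<in> ?X" using max[OF is_ideal_plus1[OF D Q(1) x(1)]] sub Q(2) by blast
    then obtain i c where c: "1 = i + x * c" "i \<in> Q" "c \<in> D" by auto
    then have "x * c - 1 + i = 0" by (simp add: algebra_simps)
    then have "x * c - 1 = - i" by (simp add: eq_neg_iff_add_eq_0)
    then have "x * c - 1 \<in> Q" using is_ideal_uminus[OF D Q(1) c(2)] by simp
    then show ?thesis using c(3) by blast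
  qed
  with Q show ?thesis by blast
qed

text \<open>\<open>D / Q\<close> is a field and \<open>W / Q\<close> a valuation ring in it with residue field \<open>k\<close>; everything is
  phrased with representatives in \<open>D\<close> to avoid quotients.\<close>
locale residue_valuation = field_embedding +
  fixes D Q W \<psi>
  assumes D: "is_subring D" and Q: "is_ideal D Q" and Q1: "1 \<notin> Q"
    and inv: "\<And>x. x \<in> D \<Longrightarrow> x \<notin> Q \<Longrightarrow> \<exists>y\<in>D. x * y - 1 \<in> Q"
    and W: "khom W \<psi>" and WD: "W \<subseteq> D" and QW: "Q \<subseteq> W" and \<psi>Q: "\<And>x. x \<in> Q \<Longrightarrow> \<psi> x = 0"
    and val: "\<And>x. x \<in> D \<Longrightarrow> x \<notin> W \<Longrightarrow> \<exists>y\<in>W. \<psi> y = 0 \<and> x * y - 1 \<in> Q"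
begin

lemmas Dr = is_subringD[OF D]
lemmas Wr = is_subringD[OF khomD(1)[OF W]]
lemmas Qr = is_idealD[OF Q]

lemma Qdiff: "a \<in> Q \<Longrightarrow> b \<in> Q \<Longrightarrow> a - b \<in> Q"
  by (rule is_ideal_diff[OF D Q])

lemma Qcomb: "c \<in> D \<Longrightarrow> d \<in> D \<Longrightarrow> a \<in> Q \<Longrightarrow> b \<in> Q \<Longrightarrow> c * a - d * b \<in> Q"
  by (rule Qdiff; rule Qr(4))

lemma prime: assumes "x \<in> D" "y \<in> D" "x * y \<in> Q" "x \<notin> Q" shows "y \<in> Q"
proof -
  obtain u where u: "u \<in> D" "x * u - 1 \<in> Q" using inv assms by blast
  have eq: "y = u * (x * y) - y * (x * u - 1)" by (simp add: algebra_simps)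
  have "u * (x * y) - y * (x * u - 1) \<in> Q" using u assms by (intro Qcomb)
  then show ?thesis by (simp only: eq[symmetric])
qed

lemma power_notin: "x \<in> D \<Longrightarrow> x \<notin> Q \<Longrightarrow> x ^ n \<notin> Q"
  by (induction n) (use Q1 prime Dr(7) in auto)

lemma unit:
  assumes "w \<in> W" "\<psi> w \<noteq> 0" shows "\<exists>v\<in>W. w * v - 1 \<in> Q"
proof -
  obtain y where y: "y \<in> D" "w * y - 1 \<in> Q" using inv assms \<psi>Q WD by blast
  have "y \<in> W"
  proof (rule ccontr)
    assume "y \<notin> W"
    then obtain y' where y': "y' \<in> W" "\<psi> y' = 0" "y * y' - 1 \<in> Q" using val y by blast
    have "w * (y * y' - 1) - y' * (w * y - 1) \<in> Q" using assms y y' WD by (intro Qcomb) auto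
    then have "y' - w \<in> Q" by (simp add: algebra_simps)
    then have "\<psi> (y' - w) = 0" by (rule \<psi>Q)
    then show False using assms y' khomD(10)[OF W] by auto
  qed
  then show ?thesis using y by auto
qed

text \<open>The image of \<open>T x\<close> in the field \<open>D / Q\<close> is the product of \<open>x\<close> with the maximal ideal of the
  valuation ring.\<close>
definition T :: "'b \<Rightarrow> 'b set" where
  "T x = {x * w + q |w q. w \<in> W \<and> \<psi> w = 0 \<and> q \<in> Q}"

lemma T_add: assumes "a \<in> T x" "b \<in> T x" shows "a + b \<in> T x"
proof -
  obtain w q w' q' where a: "a = x * w + q" "w \<in> W" "\<psi> w = 0" "q \<in> Q" "b = x * w' + q'" "w' \<in> W" "\<psi> w' = 0" "q' \<in> Q"
    using assms by (auto simp: T_def)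
  have "a + b = x * (w + w') + (q + q')" by (simp add: a algebra_simps)
  moreover have "w + w' \<in> W" "\<psi> (w + w') = 0" using a Wr(3) khomD(5)[OF W] by auto
  ultimately show ?thesis using Qr(3) a unfolding T_def by blast
qed

lemma T_mult: assumes "a \<in> T x" "c \<in> W" shows "c * a \<in> T x"
proof -
  obtain w q where a: "a = x * w + q" "w \<in> W" "\<psi> w = 0" "q \<in> Q" using assms by (auto simp: T_def)
  have "c * a = x * (c * w) + c * q" by (simp add: a algebra_simps)
  moreover have "c * w \<in> W" "\<psi> (c * w) = 0" using a assms Wr(5) khomD(6)[OF W] by auto
  moreover have "c * q \<in> Q" using a assms WD Qr(4) by auto
  ultimately show ?thesis unfolding T_def by blast
qed

lemma T_Q: "q \<in> Q \<Longrightarrow> q \<in> T x"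
  unfolding T_def using Wr(1) khomD(7)[OF W] by (intro CollectI exI[of _ 0] exI[of _ q]) auto

lemma T_sum: "(\<And>i. i \<in> I \<Longrightarrow> f i \<in> T x) \<Longrightarrow> sum f I \<in> T x"
  by (induction I rule: infinite_finite_induct) (auto intro: T_add T_Q Qr(2))

lemma T_trans: assumes "y \<in> T x" "u \<in> T y" shows "u \<in> T x"
proof -
  obtain w q where u: "u = y * w + q" "w \<in> W" "\<psi> w = 0" "q \<in> Q" using assms by (auto simp: T_def)
  have "w * y + q \<in> T x" by (intro T_add T_mult assms u T_Q)
  then show ?thesis by (simp add: u mult.commute)
qed

text \<open>If \<open>x\<close> times a nonzero constant were \<open>x\<close> times an element of
  value 0, cancelling \<open>x\<close> modulo the prime ideal \<open>Q\<close> would identify two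
  elements of different value.\<close>

lemma T_self: assumes "x \<in> D" "\<iota> c * x \<in> T x" "x \<notin> Q" shows "c = 0"
proof (rule ccontr)
  assume c: "c \<noteq> 0"
  obtain w q where w: "\<iota> c * x = x * w + q" "w \<in> W" "\<psi> w = 0" "q \<in> Q" using assms by (auto simp: T_def)
  have "x * (\<iota> c - w) = q" using w(1) by (simp add: algebra_simps)
  moreover have "\<iota> c - w \<in> D" using Dr(4) WD w khomD(3)[OF W] by blast
  ultimately have "\<iota> c - w \<in> Q" using prime assms w by blast
  then have "\<psi> (\<iota> c - w) = 0" by (rule \<psi>Q)
  then show False using w c khomD(3,4,10)[OF W] by auto
qed

end

text \<open>The count behind the Krull--Akizuki theorem: modulo \<open>Q\<close>, the quotient of
  \<open>W\<close> by \<open>s\<close> has dimension at most \<open>card E\<close>, although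
  \<open>W\<close> need not be finite over \<open>C\<close>. Otherwise the
  \<open>s ^ j * x i\<close> with \<open>j < M\<close> would be independent modulo
  \<open>s ^ M\<close>. Multiplied by one \<open>s ^ N\<close> that brings all \<open>x i\<close>
  into \<open>C\<close>, they meet there only \<open>(M + N) * card E\<close> spanning elements
  modulo \<open>s ^ (M + N)\<close>.\<close>

lemma (in residue_valuation) dependent:
  assumes C: "is_subring C" "K \<subseteq> C" "C \<subseteq> W" and s: "s \<in> C" "s \<notin> Q"
    and clear: "\<And>x. x \<in> D \<Longrightarrow> \<exists>n. s ^ n * x \<in> C"
    and E: "finite E" "\<And>x. x \<in> C \<Longrightarrow> \<exists>a\<in>idl K E. x - a \<in> {b + s * c |b c. b \<in> Q \<inter> C \<and> c \<in> C}"
    and x: "\<And>i. i \<le> card E \<Longrightarrow> x i \<in> W"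
  shows "\<exists>\<kappa>. (\<exists>i\<le>card E. \<kappa> i \<noteq> 0) \<and> (\<exists>w\<in>W. (\<Sum>i\<le>card E. \<iota> (\<kappa> i) * x i) - s * w \<in> Q)"
proof (rule ccontr)
  assume neg: "\<not> ?thesis"
  note Cr = is_subringD[OF C(1)]
  define e where "e = card E"
  have I: "is_ideal C (Q \<inter> C)"
    unfolding is_ideal_def using Qr C(3) WD Cr by auto
  have sD: "s \<in> D" "s \<in> W" using s C(3) WD by auto
  have "\<exists>N. \<forall>i\<in>S. s ^ N * x i \<in> C" if "finite S" "S \<subseteq> {..e}" for S
    using that
  proof (induction S)
    case (insert i S)
    then obtain N where N: "\<forall>i\<in>S. s ^ N * x i \<in> C" by auto
    have "x i \<in> D" using x[of i] insert.prems WD by (auto simp: e_def)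
    then obtain M where M: "s ^ M * x i \<in> C" using clear by blast
    have "s ^ (N + M) * x j \<in> C" if j: "j \<in> insert i S" for j
    proof (cases "j = i")
      case True
      have "s ^ N * (s ^ M * x i) \<in> C" by (rule Cr(5)[OF Cr(7)[OF s(1)] M])
      then show ?thesis using True by (simp add: power_add mult_ac)
    next
      case False
      then have "s ^ N * x j \<in> C" using N j by auto
      then have "s ^ M * (s ^ N * x j) \<in> C" by (rule Cr(5)[OF Cr(7)[OF s(1)]])
      then show ?thesis by (simp add: power_add mult_ac)
    qed
    then show ?case by blast
  qed auto
  from this[of "{..e}"] obtain N where N: "\<And>i. i \<le> e \<Longrightarrow> s ^ N * x i \<in> C" by auto
  have indep: "\<forall>j<M. \<forall>i\<le>e. \<kappa> j i = 0"
    if "w \<in> W" "(\<Sum>j<M. s ^ j * (\<Sum>i\<le>e. \<iota> (\<kappa> j i) * x i)) - s ^ M * w \<in> Q" for M \<kappa> w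
    using that
  proof (induction M arbitrary: \<kappa>)
    case (Suc M)
    define R where "R = (\<Sum>j<M. s ^ j * (\<Sum>i\<le>e. \<iota> (\<kappa> (Suc j) i) * x i))"
    define P where "P = (\<Sum>i\<le>e. \<iota> (\<kappa> 0 i) * x i)"
    have R: "R \<in> W" unfolding R_def using x khomD(3)[OF W]
      by (intro is_subring_sum[OF khomD(1)[OF W]] Wr(5) Wr(7) sD) (auto simp: e_def)
    have "(\<Sum>j<Suc M. s ^ j * (\<Sum>i\<le>e. \<iota> (\<kappa> j i) * x i)) - s ^ Suc M * w = P - s * (s ^ M * w - R)"
      unfolding P_def R_def by (subst sum.lessThan_Suc_shift) (simp add: sum_distrib_left algebra_simps)
    with Suc.prems have PR: "P - s * (s ^ M * w - R) \<in> Q" by simp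
    moreover have wR: "s ^ M * w - R \<in> W" by (intro Wr(4) Wr(5) Wr(7) sD R Suc.prems)
    ultimately have "\<not> (\<exists>i\<le>card E. \<kappa> 0 i \<noteq> 0)" using neg unfolding P_def e_def by blast
    then have \<kappa>0: "\<forall>i\<le>e. \<kappa> 0 i = 0" by (auto simp: e_def)
    then have "P = 0" by (simp add: P_def \<iota>_0)
    with PR have "- (s * (s ^ M * w - R)) \<in> Q" by simp
    then have "s * (s ^ M * w - R) \<in> Q" using is_ideal_uminus[OF D Q] by fastforce
    then have "s ^ M * w - R \<in> Q" using prime[OF sD(1)] wR WD s(2) by blast
    then have "- (s ^ M * w - R) \<in> Q" by (rule is_ideal_uminus[OF D Q])
    then have "R - s ^ M * w \<in> Q" by simp
    from Suc.IH[OF Suc.prems(1) this[unfolded R_def]] \<kappa>0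
    show ?case by (metis Suc_less_eq gr0_conv_Suc not_gr_zero)
  qed auto
  \<comment> \<open>The least value for which \<open>M * (e + 1)\<close> exceeds
    \<open>(M + N) * e\<close>.\<close>
  define M where "M = N * e + 1"
  define I where "I = {..<M} \<times> {..e}"
  define F where "F = (\<Union>j<M + N. (\<lambda>a. s ^ j * a) ` E)"
  define J where "J = {b + s ^ (M + N) * c |b c. b \<in> Q \<inter> C \<and> c \<in> C}"
  have "card F \<le> (\<Sum>j<M + N. card ((\<lambda>a. s ^ j * a) ` E))" unfolding F_def by (rule card_UN_le) auto
  also have "\<dots> \<le> (\<Sum>j<M + N. e)" unfolding e_def by (intro sum_mono card_image_le E)
  finally have "card F \<le> (M + N) * e" by simp
  moreover have "card I = M * (e + 1)" by (simp add: I_def)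
  moreover have "(M + N) * e < M * (e + 1)" by (simp add: M_def algebra_simps)
  ultimately have less: "card F < card I" by linarith
  have J: "is_ideal C J" unfolding J_def
    by (rule is_ideal_plus1[OF C(1) \<open>is_ideal C (Q \<inter> C)\<close> Cr(7)[OF s(1)]])
  have "\<exists>\<kappa>. (\<exists>i\<in>I. \<kappa> i \<noteq> 0) \<and> (\<Sum>i\<in>I. \<iota> (\<kappa> i) * (s ^ fst i * (s ^ N * x (snd i)))) \<in> J"
  proof (rule dependent_modulo[OF _ _ less])
    show "finite F" "finite I" using E by (auto simp: F_def I_def)
    show "ksub J" by (rule ksub_ideal[OF J C(2)])
    fix i assume "i \<in> I"
    then have "s ^ fst i * (s ^ N * x (snd i)) \<in> C" by (intro Cr(5) Cr(7) s N) (auto simp: I_def)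
    from finite_codim_iterate[OF C(1) \<open>is_ideal C (Q \<inter> C)\<close> s(1) E(2) this, of "M + N"]
    obtain a c where a: "a \<in> idl K F" "c \<in> C" "s ^ fst i * (s ^ N * x (snd i)) - a - s ^ (M + N) * c \<in> Q \<inter> C"
      unfolding F_def by blast
    have "s ^ fst i * (s ^ N * x (snd i)) - a =
      (s ^ fst i * (s ^ N * x (snd i)) - a - s ^ (M + N) * c) + s ^ (M + N) * c" by simp
    then show "\<exists>a\<in>idl K F. s ^ fst i * (s ^ N * x (snd i)) - a \<in> J"
      using a unfolding J_def by blast
  qed
  then obtain \<kappa> where \<kappa>: "\<exists>i\<in>I. \<kappa> i \<noteq> 0"
    "(\<Sum>i\<in>I. \<iota> (\<kappa> i) * (s ^ fst i * (s ^ N * x (snd i)))) \<in> J" by blast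
  define S where "S = (\<Sum>j<M. s ^ j * (\<Sum>i\<le>e. \<iota> (\<kappa> (j, i)) * x i))"
  have "(\<Sum>i\<in>I. \<iota> (\<kappa> i) * (s ^ fst i * (s ^ N * x (snd i)))) =
     (\<Sum>(j, i)\<in>I. s ^ N * (s ^ j * (\<iota> (\<kappa> (j, i)) * x i)))"
    by (intro sum.cong) (auto simp: mult_ac)
  also have "\<dots> = s ^ N * S" unfolding I_def S_def sum_distrib_left
    by (rule sum.cartesian_product[symmetric])
  finally obtain b c where b: "s ^ N * S = b + s ^ (M + N) * c" "b \<in> Q" "c \<in> C" using \<kappa>(2) by (auto simp: J_def)
  have "s ^ N * (S - s ^ M * c) = b" using b(1) by (simp add: power_add algebra_simps)
  moreover have "S \<in> W" unfolding S_def using x khomD(3)[OF W]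
    by (intro is_subring_sum[OF khomD(1)[OF W]] Wr(5) Wr(7) sD) (auto simp: e_def)
  then have "S \<in> D" "c \<in> D" using b(3) C(3) WD by auto
  then have "S - s ^ M * c \<in> D" by (intro Dr(4) Dr(5) Dr(7) sD)
  ultimately have "S - s ^ M * c \<in> Q"
    using prime[OF Dr(7)[OF sD(1), of N]] power_notin[OF sD(1) s(2), of N] b(2) by blast
  from indep[where w = c and M = M and \<kappa> = "\<lambda>j i. \<kappa> (j, i)"] this b(3) C(3)
  have "\<forall>j<M. \<forall>i\<le>e. \<kappa> (j, i) = 0" unfolding S_def by blast
  with \<kappa>(1) show False by (auto simp: I_def)
qed

text \<open>In the given combination consider the least index with nonzero coefficient. Its term
  divides all later ones, \<open>x (Suc e) * w\<close> included, with a quotient of value 0; so it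
  is itself its own multiple by an element of value 0, against \<open>T_self\<close>.\<close>

lemma (in residue_valuation) no_long_chain:
  assumes dep: "\<exists>\<kappa>. (\<exists>i\<le>e. \<kappa> i \<noteq> 0) \<and> (\<exists>w\<in>W. (\<Sum>i\<le>e. \<iota> (\<kappa> i) * x i) - x (Suc e) * w \<in> Q)"
    and x: "\<And>i. i \<le> e \<Longrightarrow> x i \<in> W \<and> x i \<notin> Q" "\<And>i. i \<le> e \<Longrightarrow> x (Suc i) \<in> T (x i)"
  shows False
proof -
  obtain \<kappa> w where \<kappa>: "\<exists>i\<le>e. \<kappa> i \<noteq> 0" "w \<in> W" "(\<Sum>i\<le>e. \<iota> (\<kappa> i) * x i) - x (Suc e) * w \<in> Q"
    using dep by blast
  define i0 where "i0 = (LEAST i. i \<le> e \<and> \<kappa> i \<noteq> 0)"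
  have i0: "i0 \<le> e" "\<kappa> i0 \<noteq> 0" using LeastI_ex[OF \<kappa>(1)] by (auto simp: i0_def)
  have low: "\<kappa> i = 0" if "i < i0" for i
    using not_less_Least[of i "\<lambda>i. i \<le> e \<and> \<kappa> i \<noteq> 0"] that i0(1) unfolding i0_def by linarith
  have up: "x (Suc j) \<in> T (x i0)" if "i0 \<le> j" "j \<le> e" for j
    using that
  proof (induction j rule: dec_induct)
    case base
    then show ?case using x(2) by auto
  next
    case (step j)
    then show ?case using T_trans[OF _ x(2)] by auto
  qed
  have "\<iota> (\<kappa> i) * x i \<in> T (x i0)" if i: "i \<in> {..e} - {i0}" for i
  proof (cases "i < i0")
    case True
    then show ?thesis using low T_Q[OF Qr(2)] by (simp add: \<iota>_0)
  next
    case False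
    then obtain j where "i = Suc j" "i0 \<le> j" "j \<le> e" using i by (cases i) auto
    then show ?thesis using up khomD(3)[OF W] by (auto intro: T_mult)
  qed
  then have 1: "(\<Sum>i\<in>{..e} - {i0}. \<iota> (\<kappa> i) * x i) \<in> T (x i0)" by (rule T_sum)
  have 2: "w * x (Suc e) \<in> T (x i0)" using up[of e] i0 \<kappa>(2) by (auto intro: T_mult)
  have "(-1) * (\<Sum>i\<in>{..e} - {i0}. \<iota> (\<kappa> i) * x i) + (w * x (Suc e) +
      ((\<Sum>i\<le>e. \<iota> (\<kappa> i) * x i) - x (Suc e) * w)) \<in> T (x i0)"
    by (rule T_add[OF T_mult[OF 1 Wr(6)[OF Wr(2)]] T_add[OF 2 T_Q[OF \<kappa>(3)]]])
  moreover have "(\<Sum>i\<le>e. \<iota> (\<kappa> i) * x i) = \<iota> (\<kappa> i0) * x i0 + (\<Sum>i\<in>{..e} - {i0}. \<iota> (\<kappa> i) * x i)"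
    using i0 by (intro sum.remove) auto
  ultimately have "\<iota> (\<kappa> i0) * x i0 \<in> T (x i0)" by (simp add: mult.commute)
  then show False using T_self[of "x i0" "\<kappa> i0"] x(1)[OF i0(1)] i0(2) WD by blast
qed

text \<open>Divisor chains that end in \<open>s\<close> have bounded length. If the maximal ideal
  were not principal, a proper divisor of value 0 could be found again and again, beginning with
  \<open>s\<close>. If \<open>s\<close> were not a unit times a power of \<tau>, all powers of
  \<tau> would divide it. Either way some chain is too long. Powers of \<tau> then clear whatever
  powers of \<open>s\<close> clear.\<close>

theorem (in residue_valuation) uniformizer:
  assumes C: "is_subring C" "K \<subseteq> C" "C \<subseteq> W" and s: "s \<in> C" "s \<notin> Q" "\<psi> s = 0"
    and clear: "\<And>x. x \<in> D \<Longrightarrow> \<exists>n. s ^ n * x \<in> C"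
    and fin: "finite_codim C {b + s * c |b c. b \<in> Q \<inter> C \<and> c \<in> C}"
  shows "\<exists>\<tau>\<in>W. \<psi> \<tau> = 0 \<and> \<tau> \<notin> Q \<and> (\<forall>x\<in>W. \<psi> x = 0 \<longrightarrow> (\<exists>y\<in>W. x - \<tau> * y \<in> Q)) \<and> (\<forall>x\<in>D. \<exists>n. \<tau> ^ n * x \<in> W)"
proof -
  obtain E where E: "finite E" "\<And>x. x \<in> C \<Longrightarrow> \<exists>a\<in>idl K E. x - a \<in> {b + s * c |b c. b \<in> Q \<inter> C \<and> c \<in> C}"
    using fin unfolding finite_codim_def by blast
  define e where "e = card E"
  have dep: "\<exists>\<kappa>. (\<exists>i\<le>e. \<kappa> i \<noteq> 0) \<and> (\<exists>w\<in>W. (\<Sum>i\<le>e. \<iota> (\<kappa> i) * x i) - s * w \<in> Q)"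
    if "\<And>i. i \<le> e \<Longrightarrow> x i \<in> W" for x
    unfolding e_def by (rule dependent[OF C s(1,2) clear E]) (use that in \<open>auto simp: e_def\<close>)
  have chain: False if "x (Suc e) = s" "\<And>i. i \<le> e \<Longrightarrow> x i \<in> W \<and> x i \<notin> Q" "\<And>i. i \<le> e \<Longrightarrow> x (Suc i) \<in> T (x i)" for x
  proof (rule no_long_chain[of e x])
    show "\<exists>\<kappa>. (\<exists>i\<le>e. \<kappa> i \<noteq> 0) \<and> (\<exists>w\<in>W. (\<Sum>i\<le>e. \<iota> (\<kappa> i) * x i) - x (Suc e) * w \<in> Q)"
      using dep[of x] that(1,2) by auto
  qed (use that in auto)
  have sW: "s \<in> W" using s C by auto
  have "\<exists>\<tau>\<in>W. \<psi> \<tau> = 0 \<and> \<tau> \<notin> Q \<and> (\<forall>x\<in>W. \<psi> x = 0 \<longrightarrow> (\<exists>y\<in>W. x - \<tau> * y \<in> Q))"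
  proof (rule ccontr)
    assume neg: "\<not> ?thesis"
    \<comment> \<open>Some \<open>y\<close> of value 0 is not a multiple of \<open>x\<close>. The
      quotient of \<open>y\<close> by \<open>x\<close> is then outside the valuation ring, so that
      of \<open>x\<close> by \<open>y\<close> has value 0.\<close>
    have "\<exists>y. y \<in> W \<and> \<psi> y = 0 \<and> y \<notin> Q \<and> x \<in> T y" if x: "x \<in> W" "\<psi> x = 0" "x \<notin> Q" for x
    proof -
      obtain y where y: "y \<in> W" "\<psi> y = 0" "\<And>w. w \<in> W \<Longrightarrow> y - x * w \<notin> Q" using neg x by blast
      have "y \<notin> Q" using y(3)[OF Wr(1)] by simp
      obtain u where u: "u \<in> D" "x * u - 1 \<in> Q" using inv x WD by blast
      have D': "x \<in> D" "y \<in> D" using x y WD by auto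
      have "y * u \<notin> W"
      proof
        assume yu: "y * u \<in> W"
        have "y * (x * u - 1) \<in> Q" using D' u by (intro Qr(4)) auto
        then have "- (y * (x * u - 1)) \<in> Q" by (rule is_ideal_uminus[OF D Q])
        then have "y - x * (y * u) \<in> Q" by (simp add: algebra_simps)
        then show False using y(3)[OF yu] by simp
      qed
      then obtain w where w: "w \<in> W" "\<psi> w = 0" "y * u * w - 1 \<in> Q" using val Dr(5)[OF D'(2) u(1)] by blast
      have "y * w * (x * u - 1) - x * (y * u * w - 1) \<in> Q"
        using D' u w WD Dr(5) by (intro Qcomb) auto
      then have "x - y * w \<in> Q" by (simp add: algebra_simps)
      moreover have "x = y * w + (x - y * w)" by simp
      ultimately have "x \<in> T y" using w unfolding T_def by blast
      then show ?thesis using y \<open>y \<notin> Q\<close> by auto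
    qed
    then have "\<forall>x. \<exists>y. x \<in> W \<and> \<psi> x = 0 \<and> x \<notin> Q \<longrightarrow> y \<in> W \<and> \<psi> y = 0 \<and> y \<notin> Q \<and> x \<in> T y" by blast
    from choice[OF this] obtain f where f: "\<And>x. x \<in> W \<Longrightarrow> \<psi> x = 0 \<Longrightarrow> x \<notin> Q \<Longrightarrow>
        f x \<in> W \<and> \<psi> (f x) = 0 \<and> f x \<notin> Q \<and> x \<in> T (f x)" by auto
    have f': "(f ^^ n) s \<in> W \<and> \<psi> ((f ^^ n) s) = 0 \<and> (f ^^ n) s \<notin> Q" for n
      by (induction n) (use sW s f in auto)
    \<comment> \<open>The index runs backwards, as \<open>f\<close> passes to a divisor while the
      chain has to end in \<open>s\<close>.\<close>
    show False
    proof (rule chain[of "\<lambda>i. (f ^^ (Suc e - i)) s"])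
      fix i assume "i \<le> e"
      then have "Suc e - i = Suc (Suc e - Suc i)" by simp
      then have "(f ^^ (Suc e - i)) s = f ((f ^^ (Suc e - Suc i)) s)" by simp
      then show "(f ^^ (Suc e - Suc i)) s \<in> T ((f ^^ (Suc e - i)) s)" using f f' by simp
    qed (use f' in auto)
  qed
  then obtain \<tau> where \<tau>: "\<tau> \<in> W" "\<psi> \<tau> = 0" "\<tau> \<notin> Q" "\<And>x. x \<in> W \<Longrightarrow> \<psi> x = 0 \<Longrightarrow> \<exists>y\<in>W. x - \<tau> * y \<in> Q" by blast
  have \<tau>D: "\<tau> \<in> D" using \<tau> WD by auto
  have T_eq: "y \<in> T x" if "y - x * w \<in> Q" "w \<in> W" "\<psi> w = 0" for x y w
  proof -
    have "y = x * w + (y - x * w)" by simp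
    then show ?thesis using that unfolding T_def by blast
  qed
  have "\<exists>a w. w \<in> W \<and> \<psi> w \<noteq> 0 \<and> s - \<tau> ^ a * w \<in> Q"
  proof (rule ccontr)
    assume neg: "\<not> ?thesis"
    have all: "\<exists>w\<in>W. s - \<tau> ^ n * w \<in> Q" for n
    proof (induction n)
      case 0
      then show ?case using sW Qr(2) by (intro bexI[of _ s]) auto
    next
      case (Suc n)
      then obtain w where w: "w \<in> W" "s - \<tau> ^ n * w \<in> Q" by auto
      then obtain y where y: "y \<in> W" "w - \<tau> * y \<in> Q" using neg \<tau>(4) by blast
      have "(s - \<tau> ^ n * w) + \<tau> ^ n * (w - \<tau> * y) \<in> Q" using \<tau>D Dr(7) by (intro Qr(3) Qr(4) w y) auto
      then have "s - \<tau> ^ Suc n * y \<in> Q" by (simp add: algebra_simps)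
      then show ?case using y by auto
    qed
    obtain w where w: "w \<in> W" "s - \<tau> ^ Suc e * w \<in> Q" using all by blast
    show False
    proof (rule chain[of "\<lambda>i. if i = Suc e then s else \<tau> ^ i"])
      fix i assume i: "i \<le> e"
      show "(if i = Suc e then s else \<tau> ^ i) \<in> W \<and> (if i = Suc e then s else \<tau> ^ i) \<notin> Q"
        using i power_notin[OF \<tau>D \<tau>(3)] Wr(7)[OF \<tau>(1)] by auto
      have "s \<in> T (\<tau> ^ e)"
        using w Wr(5)[OF \<tau>(1) w(1)] khomD(6)[OF W \<tau>(1) w(1)] \<tau>(2)
        by (intro T_eq[of s "\<tau> ^ e" "\<tau> * w"]) (auto simp: mult_ac)
      moreover have "\<tau> ^ Suc i \<in> T (\<tau> ^ i)"
        using \<tau> Qr(2) by (intro T_eq[of "\<tau> ^ Suc i" "\<tau> ^ i" \<tau>]) (auto simp: mult.commute)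
      ultimately show "(if Suc i = Suc e then s else \<tau> ^ Suc i) \<in> T (if i = Suc e then s else \<tau> ^ i)"
        using i by auto
    qed auto
  qed
  then obtain a w where w: "w \<in> W" "\<psi> w \<noteq> 0" "s - \<tau> ^ a * w \<in> Q" by blast
  obtain v where v: "v \<in> W" "w * v - 1 \<in> Q" using unit[OF w(1,2)] by auto
  have "\<exists>n. \<tau> ^ n * x \<in> W" if x: "x \<in> D" for x
  proof -
    obtain n where n: "s ^ n * x \<in> C" using clear x by blast
    have D': "s \<in> D" "w \<in> D" "v \<in> D" using sW w v WD by auto
    have "v * (s - \<tau> ^ a * w) + \<tau> ^ a * (w * v - 1) \<in> Q"
      using D' \<tau>D Dr(7) by (intro Qr(3) Qr(4) w v) auto
    then have "v * s - \<tau> ^ a \<in> Q" by (simp add: algebra_simps)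
    then have "(v * s) ^ n - (\<tau> ^ a) ^ n \<in> Q"
      using D' \<tau>D Dr(5,7) by (intro ideal_cong_power[OF D Q]) auto
    then have "x * ((v * s) ^ n - (\<tau> ^ a) ^ n) \<in> Q" by (rule Qr(4)[OF x])
    then have "x * ((v * s) ^ n - (\<tau> ^ a) ^ n) \<in> W" using QW by auto
    moreover have "v ^ n * (s ^ n * x) \<in> W" by (rule Wr(5)[OF Wr(7)[OF v(1)] subsetD[OF C(3) n]])
    ultimately have "v ^ n * (s ^ n * x) - x * ((v * s) ^ n - (\<tau> ^ a) ^ n) \<in> W" using Wr(4) by blast
    moreover have "v ^ n * (s ^ n * x) - x * ((v * s) ^ n - (\<tau> ^ a) ^ n) = \<tau> ^ (a * n) * x"
      by (simp add: power_mult_distrib power_mult algebra_simps)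
    ultimately show ?thesis by auto
  qed
  with \<tau> show ?thesis by blast
qed

text \<open>The expansion is computed digit by digit: subtract the value, divide by \<tau>, repeat.
  The quotient \<open>f x\<close> is determined only modulo \<open>Q\<close>, and
  \<open>cong\<close> shows that the coefficients do not depend on its choice.\<close>

theorem (in residue_valuation) power_series_expansion:
  assumes \<tau>: "\<tau> \<in> W" "\<psi> \<tau> = 0" "\<tau> \<notin> Q" "\<And>x. x \<in> W \<Longrightarrow> \<psi> x = 0 \<Longrightarrow> \<exists>y\<in>W. x - \<tau> * y \<in> Q"
  shows "\<exists>\<theta> :: 'b \<Rightarrow> 'a fps. (\<forall>x\<in>W. \<forall>y\<in>W. \<theta> (x + y) = \<theta> x + \<theta> y \<and> \<theta> (x * y) = \<theta> x * \<theta> y) \<and>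
    (\<forall>c. \<theta> (\<iota> c) = fps_const c) \<and> \<theta> \<tau> = fps_X \<and> (\<forall>x\<in>W. fps_nth (\<theta> x) 0 = \<psi> x)"
proof -
  have "\<exists>y. x \<in> W \<longrightarrow> y \<in> W \<and> x - \<iota> (\<psi> x) - \<tau> * y \<in> Q" for x
  proof (cases "x \<in> W")
    case True
    then have "x - \<iota> (\<psi> x) \<in> W" "\<psi> (x - \<iota> (\<psi> x)) = 0" using khomD(3,4,10)[OF W] Wr(4) by auto
    then show ?thesis using \<tau>(4) by blast
  qed auto
  then have "\<forall>x. \<exists>y. x \<in> W \<longrightarrow> y \<in> W \<and> x - \<iota> (\<psi> x) - \<tau> * y \<in> Q" ..
  from choice[OF this] obtain f where f: "\<And>x. x \<in> W \<Longrightarrow> f x \<in> W" "\<And>x. x \<in> W \<Longrightarrow> x - \<iota> (\<psi> x) - \<tau> * f x \<in> Q" by auto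
  define \<theta> where "\<theta> x = Abs_fps (\<lambda>n. \<psi> ((f ^^ n) x))" for x
  have \<theta>0: "fps_nth (\<theta> x) 0 = \<psi> x" and \<theta>S: "fps_nth (\<theta> x) (Suc n) = fps_nth (\<theta> (f x)) n" for x n
    by (simp_all add: \<theta>_def funpow_swap1)
  have \<tau>D: "\<tau> \<in> D" using \<tau> WD by auto
  have \<iota>W: "\<iota> c \<in> W" for c using khomD(3)[OF W] .
  have cancel: "x - y \<in> Q" if "\<tau> * (x - y) \<in> Q" "x \<in> W" "y \<in> W" for x y
    using that(2,3) WD by (intro prime[OF \<tau>D _ that(1) \<tau>(3)] Dr(4)) auto
  have next_eq: "f x - y \<in> Q" if "x \<in> W" "y \<in> W" "x - \<iota> (\<psi> x) - \<tau> * y \<in> Q" for x y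
  proof -
    have "(x - \<iota> (\<psi> x) - \<tau> * y) - (x - \<iota> (\<psi> x) - \<tau> * f x) \<in> Q"
      using f(2)[OF that(1)] that(3) by (rule Qdiff[rotated])
    then have "\<tau> * (f x - y) \<in> Q" by (simp add: algebra_simps)
    then show ?thesis using cancel f(1) that by blast
  qed
  have cong: "fps_nth (\<theta> x) n = fps_nth (\<theta> y) n" if "x \<in> W" "y \<in> W" "x - y \<in> Q" for x y n
    using that
  proof (induction n arbitrary: x y)
    case 0
    then show ?case using \<psi>Q[of "x - y"] khomD(10)[OF W] by (simp add: \<theta>0)
  next
    case (Suc n)
    have \<psi>: "\<psi> x = \<psi> y" using \<psi>Q[of "x - y"] khomD(10)[OF W] Suc by simp
    have "(x - y) + (y - \<iota> (\<psi> y) - \<tau> * f y) \<in> Q" using Suc f by (intro Qr(3)) auto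
    then have "x - \<iota> (\<psi> x) - \<tau> * f y \<in> Q" by (simp add: \<psi> algebra_simps)
    then have "f x - f y \<in> Q" using next_eq Suc.prems f by blast
    then show ?case using Suc f by (simp add: \<theta>S)
  qed
  have congE: "\<theta> x = \<theta> y" if "x \<in> W" "y \<in> W" "x - y \<in> Q" for x y
    using cong[OF that] by (intro fps_ext)
  have add: "\<theta> (x + y) = \<theta> x + \<theta> y" if "x \<in> W" "y \<in> W" for x y
  proof (rule fps_ext)
    fix n show "fps_nth (\<theta> (x + y)) n = fps_nth (\<theta> x + \<theta> y) n" using that
    proof (induction n arbitrary: x y)
      case 0
      then show ?case using khomD(5)[OF W] by (simp add: \<theta>0)
    next
      case (Suc n)
      have "(x - \<iota> (\<psi> x) - \<tau> * f x) + (y - \<iota> (\<psi> y) - \<tau> * f y) \<in> Q" using Suc f by (intro Qr(3)) auto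
      then have "(x + y) - \<iota> (\<psi> (x + y)) - \<tau> * (f x + f y) \<in> Q"
        using khomD(5)[OF W] Suc by (simp add: \<iota>_add algebra_simps)
      then have "f (x + y) - (f x + f y) \<in> Q" using next_eq Suc.prems Wr(3) f(1) by blast
      then have "fps_nth (\<theta> (f (x + y))) n = fps_nth (\<theta> (f x + f y)) n"
        using cong Suc.prems Wr(3) f(1) by blast
      then show ?case using Suc.IH[of "f x" "f y"] Suc.prems f by (simp add: \<theta>S)
    qed
  qed
  have \<theta>Q: "\<theta> x = 0" if "x \<in> Q" for x
  proof -
    have "\<theta> (0 + 0) = \<theta> 0 + \<theta> 0" using add[OF Wr(1) Wr(1)] .
    then have "\<theta> 0 = \<theta> 0 + \<theta> 0" by (simp only: add_0_left)
    then have "\<theta> 0 = 0" by (metis add_cancel_right_right)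
    then show ?thesis using congE[of x 0] that QW Wr(1) by auto
  qed
  have const: "\<theta> (\<iota> c) = fps_const c" for c
  proof (rule fps_ext)
    fix n
    have "\<iota> c - \<iota> (\<psi> (\<iota> c)) - \<tau> * 0 \<in> Q" using khomD(4)[OF W] Qr(2) by simp
    then have "f (\<iota> c) - 0 \<in> Q" using next_eq \<iota>W Wr(1) by blast
    then have "\<theta> (f (\<iota> c)) = 0" using \<theta>Q by simp
    then show "fps_nth (\<theta> (\<iota> c)) n = fps_nth (fps_const c) n"
      using khomD(4)[OF W] by (cases n) (simp_all add: \<theta>0 \<theta>S)
  qed
  have shift: "\<theta> (\<tau> * x) = fps_X * \<theta> x" if x: "x \<in> W" for x
  proof (rule fps_ext)
    fix n
    have \<psi>: "\<psi> (\<tau> * x) = 0" using khomD(6)[OF W] \<tau> x by simp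
    then have "\<tau> * x - \<iota> (\<psi> (\<tau> * x)) - \<tau> * x \<in> Q" using Qr(2) by (simp add: \<iota>_0)
    then have "f (\<tau> * x) - x \<in> Q" using next_eq Wr(5)[OF \<tau>(1) x] x by blast
    then have "\<theta> (f (\<tau> * x)) = \<theta> x" using congE f(1) Wr(5)[OF \<tau>(1) x] x by blast
    then show "fps_nth (\<theta> (\<tau> * x)) n = fps_nth (fps_X * \<theta> x) n" using \<psi> by (cases n) (simp_all add: \<theta>0 \<theta>S)
  qed
  have cmult: "\<theta> (\<iota> c * x) = fps_const c * \<theta> x" if "x \<in> W" for c x
  proof (rule fps_ext)
    fix n show "fps_nth (\<theta> (\<iota> c * x)) n = fps_nth (fps_const c * \<theta> x) n" using that
    proof (induction n arbitrary: x)
      case 0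
      then show ?case using khomD(4,6)[OF W] \<iota>W by (simp add: \<theta>0)
    next
      case (Suc n)
      have \<psi>: "\<psi> (\<iota> c * x) = c * \<psi> x" using khomD(4,6)[OF W] \<iota>W Suc by simp
      have "\<iota> c * (x - \<iota> (\<psi> x) - \<tau> * f x) \<in> Q" using Suc f \<iota>W WD by (intro Qr(4)) auto
      moreover have "\<iota> c * x - \<iota> (\<psi> (\<iota> c * x)) - \<tau> * (\<iota> c * f x) = \<iota> c * (x - \<iota> (\<psi> x) - \<tau> * f x)"
        unfolding \<psi> \<iota>_mult by (simp add: algebra_simps)
      ultimately have "\<iota> c * x - \<iota> (\<psi> (\<iota> c * x)) - \<tau> * (\<iota> c * f x) \<in> Q" by simp
      then have "f (\<iota> c * x) - \<iota> c * f x \<in> Q" using next_eq Suc.prems Wr(5) \<iota>W f(1) by blast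
      then have "fps_nth (\<theta> (f (\<iota> c * x))) n = fps_nth (\<theta> (\<iota> c * f x)) n"
        using cong Suc.prems Wr(5) \<iota>W f(1) by blast
      then show ?case using Suc.IH[of "f x"] Suc.prems f by (simp add: \<theta>S)
    qed
  qed
  \<comment> \<open>Only the first factor is expanded, so that the induction for multiplicativity
    lowers the coefficient index and replaces \<open>x\<close> by \<open>f x\<close> while
    \<open>y\<close> stays fixed.\<close>
  have expand: "\<theta> (x * y) = fps_const (\<psi> x) * \<theta> y + fps_X * \<theta> (f x * y)" if "x \<in> W" "y \<in> W" for x y
  proof -
    have "y * (x - \<iota> (\<psi> x) - \<tau> * f x) \<in> Q" using that f WD by (intro Qr(4)) auto
    then have *: "x * y - (\<iota> (\<psi> x) * y + \<tau> * (f x * y)) \<in> Q" by (simp add: algebra_simps)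
    have "\<theta> (x * y) = \<theta> (\<iota> (\<psi> x) * y + \<tau> * (f x * y))"
      using that f(1) \<iota>W \<tau>(1) Wr by (intro congE[OF _ _ *]) auto
    also have "\<dots> = \<theta> (\<iota> (\<psi> x) * y) + \<theta> (\<tau> * (f x * y))"
      using that f(1) \<iota>W \<tau>(1) Wr by (intro add) auto
    finally show ?thesis using that f(1) Wr(5) by (simp add: cmult shift)
  qed
  have one: "\<theta> 1 = 1" using const[of 1] by (simp add: \<iota>_1)
  have mult: "\<theta> (x * y) = \<theta> x * \<theta> y" if "x \<in> W" "y \<in> W" for x y
  proof (rule fps_ext)
    have exp1: "\<theta> x = fps_const (\<psi> x) + fps_X * \<theta> (f x)" if "x \<in> W" for x
      using expand[OF that Wr(2)] by (simp add: one)
    fix n show "fps_nth (\<theta> (x * y)) n = fps_nth (\<theta> x * \<theta> y) n" using that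
    proof (induction n arbitrary: x)
      case 0
      then show ?case using khomD(6)[OF W] by (simp add: \<theta>0)
    next
      case (Suc n)
      have "\<theta> x * \<theta> y = (fps_const (\<psi> x) + fps_X * \<theta> (f x)) * \<theta> y" using exp1[OF Suc.prems(1)] by simp
      also have "\<dots> = fps_const (\<psi> x) * \<theta> y + fps_X * (\<theta> (f x) * \<theta> y)" by (simp add: algebra_simps)
      finally have "fps_nth (\<theta> x * \<theta> y) (Suc n) = \<psi> x * fps_nth (\<theta> y) (Suc n) + fps_nth (\<theta> (f x) * \<theta> y) n" by simp
      moreover have "fps_nth (\<theta> (x * y)) (Suc n) = \<psi> x * fps_nth (\<theta> y) (Suc n) + fps_nth (\<theta> (f x * y)) n"
        using expand[OF Suc.prems] by simp
      ultimately show ?case using Suc.IH[of "f x"] Suc.prems f by simp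
    qed
  qed
  have "\<theta> \<tau> = fps_X" using shift[OF Wr(2)] by (simp add: one)
  then show ?thesis using add mult const \<theta>0 by blast
qed

section \<open>Curve selection\<close>

text \<open>For each \<open>f\<close> in \<open>B\<close>, either \<open>f\<close> or its inverse is
  finite at the place; the finite one is adjoined to the algebra, normalised to value 0. The product
  of the inverses of the infinite ones clears all poles. The factor \<open>y0\<close>, a nonconstant
  function minus its value, makes \<open>s\<close> vanish at the place even when nothing in
  \<open>B\<close> has a pole.\<close>

lemma (in field_embedding) clear_denominators:
  assumes V: "khom V \<psi>" and val: "\<And>x. x \<notin> V \<Longrightarrow> inverse x \<in> V \<and> \<psi> (inverse x) = 0"
    and fin: "finite Y0" "finite B" "Y0 \<subseteq> V" and x0: "x0 \<in> B" "x0 \<notin> K"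
  shows "\<exists>Y s. finite Y \<and> Y \<subseteq> V \<and> (\<forall>y\<in>Y. \<psi> y = 0) \<and> Y0 \<subseteq> gen K Y \<and> s \<in> gen K Y \<and> s \<noteq> 0 \<and> \<psi> s = 0 \<and>
    (\<forall>f\<in>B. s * f \<in> gen K Y)"
proof -
  note Vr = is_subringD[OF khomD(1)[OF V]]
  define g where "g f = (if f \<in> V then f else inverse f)" for f
  have gV: "g f \<in> V" for f using val by (simp add: g_def)
  define Y where "Y = (\<lambda>y. y - \<iota> (\<psi> y)) ` (Y0 \<union> g ` B)"
  have YV: "Y \<subseteq> V" unfolding Y_def using fin(3) gV khomD(3)[OF V] Vr(4) by blast
  have \<psi>Y: "\<psi> y = 0" if "y \<in> Y" for y
    using that fin(3) gV khomD(3,4,10)[OF V] by (auto simp: Y_def)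
  have R: "is_subring (gen K Y)" by (rule is_subring_gen[OF is_subring_K])
  note Rr = is_subringD[OF R]
  have RV: "gen K Y \<subseteq> V" by (rule gen_least[OF khomD(1,2)[OF V] YV])
  have mem: "y \<in> gen K Y" if "y \<in> Y0 \<union> g ` B" for y
  proof -
    have "(y - \<iota> (\<psi> y)) + \<iota> (\<psi> y) \<in> gen K Y"
      using that by (intro gen.add) (auto simp: Y_def intro: gen.gen gen.base)
    then show ?thesis by simp
  qed
  define y0 where "y0 = g x0 - \<iota> (\<psi> (g x0))"
  have y0: "y0 \<in> Y" using x0 by (auto simp: y0_def Y_def)
  have "y0 \<noteq> 0"
  proof
    assume "y0 = 0"
    then have "g x0 = \<iota> (\<psi> (g x0))" by (simp add: y0_def)
    then have "x0 \<in> K"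
    proof (cases "x0 \<in> V")
      case False
      then have "inverse x0 = \<iota> (\<psi> (g x0))" using \<open>g x0 = \<iota> (\<psi> (g x0))\<close> by (simp add: g_def)
      then have "x0 = \<iota> (inverse (\<psi> (g x0)))" by (metis \<iota>_inverse inverse_inverse_eq)
      then show ?thesis by blast
    qed (auto simp: g_def)
    then show False using x0 by simp
  qed
  define s where "s = y0 * (\<Prod>f\<in>B - V. inverse f)"
  have prodR: "(\<Prod>f\<in>S. inverse f) \<in> gen K Y" if "S \<subseteq> B - V" for S
  proof -
    have "finite S" using that fin(2) finite_subset by blast
    then show ?thesis using that
    proof (induction S)
      case (insert f S)
      then have "inverse f \<in> gen K Y" using mem[of "g f"] by (auto simp: g_def)
      then show ?case using insert Rr(5) by auto
    qed (use Rr in auto)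
  qed
  have y0R: "y0 \<in> gen K Y" using y0 by (rule gen.gen)
  have "s \<in> gen K Y" unfolding s_def by (intro Rr(5) y0R prodR) auto
  moreover have "s \<noteq> 0"
  proof -
    have "f \<noteq> 0" if "f \<in> B - V" for f using that Vr(1) by auto
    then show ?thesis using \<open>y0 \<noteq> 0\<close> fin(2) by (auto simp: s_def)
  qed
  moreover have "\<psi> s = 0"
    unfolding s_def using khomD(6)[OF V, of y0 "\<Prod>f\<in>B - V. inverse f"] y0R prodR[of "B - V"] RV \<psi>Y[OF y0] by auto
  moreover have "s * f \<in> gen K Y" if f: "f \<in> B" for f
  proof (cases "f \<in> V")
    case True
    then show ?thesis using mem[of "g f"] f \<open>s \<in> gen K Y\<close> Rr(5) by (auto simp: g_def)
  next
    case False
    then have "f \<noteq> 0" using Vr(1) by auto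
    have "(\<Prod>f\<in>B - V. inverse f) = inverse f * (\<Prod>f\<in>B - V - {f}. inverse f)"
      using f False fin(2) by (intro prod.remove) auto
    then have "s * f = y0 * (\<Prod>f\<in>B - V - {f}. inverse f)" using \<open>f \<noteq> 0\<close> by (simp add: s_def)
    moreover have "(\<Prod>f\<in>B - V - {f}. inverse f) \<in> gen K Y" by (intro prodR) auto
    ultimately show ?thesis using Rr(5) y0R by auto
  qed
  moreover have "finite Y" using fin by (simp add: Y_def)
  ultimately show ?thesis using YV \<psi>Y mem by (intro exI[of _ Y] exI[of _ s]) auto
qed

text \<open>A curve germ through the point \<open>\<phi>\<close> of the affine variety with coordinate ring \<open>A\<close>
  that is not contained in the polar loci of the functions in \<open>B0\<close>.\<close>
theorem (in field_embedding) curve_selection: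
  assumes A: "khom A \<phi>" "A = gen K Y0" and fin: "finite Y0" "finite B0" and x0: "x0 \<notin> K"
  shows "\<exists>W \<tau> (\<theta> :: 'f \<Rightarrow> 'k fps) n. is_subring W \<and> A \<subseteq> W \<and> \<tau> \<in> W \<and> (\<forall>f\<in>B0. \<tau> ^ n * f \<in> W) \<and>
    (\<forall>x\<in>W. \<forall>y\<in>W. \<theta> (x + y) = \<theta> x + \<theta> y \<and> \<theta> (x * y) = \<theta> x * \<theta> y) \<and>
    (\<forall>c. \<theta> (\<iota> c) = fps_const c) \<and> \<theta> \<tau> = fps_X \<and> (\<forall>x\<in>A. fps_nth (\<theta> x) 0 = \<phi> x)"
proof -
  have "is_subring (UNIV :: 'f set)" "is_ideal (UNIV :: 'f set) {0}" by (auto simp: is_subring_def is_ideal_def)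
  moreover have "\<exists>y\<in>UNIV. x * y - 1 \<in> {0}" if "x \<notin> {0}" for x :: 'f
    using that by (intro bexI[of _ "inverse x"]) auto
  \<comment> \<open>With the zero ideal for \<open>Q\<close>, this is a valuation ring of the whole
    field whose place extends the given evaluation.\<close>
  ultimately obtain V \<psi> where V: "khom V \<psi>" "A \<subseteq> V" "\<forall>x\<in>A. \<psi> x = \<phi> x"
    and val: "\<forall>x\<in>UNIV. x \<notin> V \<longrightarrow> (\<exists>y\<in>V. \<psi> y = 0 \<and> x * y - 1 \<in> {0})"
    using place_extension[of UNIV "{0}" A \<phi>] A(1) khomD(7)[OF A(1)] by auto
  have val': "inverse x \<in> V \<and> \<psi> (inverse x) = 0" if x: "x \<notin> V" for x
  proof -
    obtain y where "y \<in> V" "\<psi> y = 0" "x * y = 1" using val x by auto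
    then show ?thesis using inverse_unique by metis
  qed
  define B where "B = insert x0 B0"
  have "Y0 \<subseteq> V" using V(2) by (auto simp: A(2) intro: gen.gen)
  obtain Y s where Y: "finite Y" "Y \<subseteq> V" "\<And>y. y \<in> Y \<Longrightarrow> \<psi> y = 0" "Y0 \<subseteq> gen K Y"
    and s: "s \<in> gen K Y" "s \<noteq> 0" "\<psi> s = 0" "\<And>f. f \<in> B \<Longrightarrow> s * f \<in> gen K Y"
    using clear_denominators[OF V(1) val' fin(1) _ \<open>Y0 \<subseteq> V\<close> _ x0, of B] fin(2) unfolding B_def by blast
  define A1 where "A1 = gen K Y"
  have A1V: "A1 \<subseteq> V" unfolding A1_def by (rule gen_least[OF khomD(1,2)[OF V(1)] Y(2)])
  have A1: "khom A1 \<psi>"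
    using is_subring_gen[OF is_subring_K, of Y] A1V V(1) gen.base[of _ K Y]
    unfolding khom_def A1_def by blast
  have AA1: "A \<subseteq> A1" unfolding A(2)
    using Y(4) khomD(1,2)[OF A1] by (intro gen_least) (auto simp: A1_def)
  define C where "C = loc A1 \<psi>"
  define l where "l = loc_hom A1 \<psi>"
  have C: "khom C l" unfolding C_def l_def by (rule khom_loc[OF A1])
  note Cr = is_subringD[OF khomD(1)[OF C]]
  have A1C: "a \<in> C \<and> l a = \<psi> a" if "a \<in> A1" for a using loc_base[OF A1 that] by (auto simp: C_def l_def)
  obtain r z where z: "\<And>i. i < r \<Longrightarrow> z i \<in> A1 \<and> \<psi> (z i) = 0"
    and rad: "\<And>x. x \<in> C \<Longrightarrow> l x = 0 \<Longrightarrow> \<exists>N. \<exists>y\<in>C. x ^ N - s * y \<in> jpow C z r 1"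
    and s_notin: "\<And>N. s ^ N \<notin> jpow C z r 1"
    using parameter_system[OF A1 A1_def Y(1,3) s(1)[folded A1_def] s(2,3)] unfolding C_def l_def by blast
  define I where "I = jpow C z r 1"
  have I: "is_ideal C I" unfolding I_def using z A1C by (intro is_ideal_jpow khomD(1)[OF C]) auto
  have sC: "s \<in> C" "l s = 0" using A1C s by (auto simp: A1_def)
  \<comment> \<open>\<open>D\<close> is \<open>C\<close> with \<open>s\<close> inverted, and
    \<open>I0\<close> is the ideal generated there by the \<open>z i\<close>. It is proper because
    no power of \<open>s\<close> lies in \<open>I\<close>. A maximal ideal \<open>Q\<close> above it
    defines a curve germ that is not contained in the zero locus of \<open>s\<close>.\<close>
  define D where "D = {x. \<exists>n. s ^ n * x \<in> C}"
  define I0 where "I0 = {x. \<exists>n. s ^ n * x \<in> I}"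
  have CD: "C \<subseteq> D" unfolding D_def by (auto intro!: exI[of _ 0])
  have up: "s ^ (n + m) * x \<in> J" if J: "is_ideal C J" and "s ^ n * x \<in> J" for J n m x
  proof -
    have "s ^ m * (s ^ n * x) \<in> J" by (rule is_idealD(4)[OF J Cr(7)[OF sC(1)] that(2)])
    then show ?thesis by (simp add: power_add mult_ac)
  qed
  have CC: "is_ideal C C" using Cr by (auto simp: is_ideal_def)
  have addJ: "\<exists>n. s ^ n * (x + y) \<in> J" if J: "is_ideal C J" and "s ^ n * x \<in> J" "s ^ m * y \<in> J" for J n m x y
  proof -
    have "s ^ (n + m) * x + s ^ (m + n) * y \<in> J" by (intro is_idealD(3)[OF J] up[OF J] that)
    then show ?thesis by (intro exI[of _ "n + m"]) (simp add: algebra_simps)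
  qed
  have multJ: "\<exists>n. s ^ n * (w * x) \<in> J" if J: "is_ideal C J" and "s ^ n * w \<in> C" "s ^ m * x \<in> J" for J n m w x
  proof -
    have "(s ^ n * w) * (s ^ m * x) \<in> J" by (rule is_idealD(4)[OF J that(2,3)])
    then show ?thesis by (intro exI[of _ "n + m"]) (simp add: power_add mult_ac)
  qed
  have Dring: "is_subring D" unfolding is_subring_def
  proof (intro conjI ballI)
    show "0 \<in> D" "1 \<in> D" using CD Cr by auto
    fix x y assume xy: "x \<in> D" "y \<in> D"
    then obtain n m where nm: "s ^ n * x \<in> C" "s ^ m * y \<in> C" by (auto simp: D_def)
    show "x + y \<in> D" "x * y \<in> D" using addJ[OF CC nm] multJ[OF CC nm] by (auto simp: D_def)
    have "s ^ m * (- y) \<in> C" using Cr(6)[OF nm(2)] by simp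
    from addJ[OF CC nm(1) this] show "x - y \<in> D" by (auto simp: D_def)
  qed
  have I0: "is_ideal D I0" unfolding is_ideal_def
  proof (intro conjI ballI)
    show "I0 \<subseteq> D" using is_idealD(1)[OF I] by (auto simp: I0_def D_def)
    show "0 \<in> I0" using is_idealD(2)[OF I] by (auto simp: I0_def)
    fix x y assume "x \<in> I0" "y \<in> I0"
    then show "x + y \<in> I0" using addJ[OF I] by (auto simp: I0_def)
  next
    fix w x assume "w \<in> D" "x \<in> I0"
    then show "w * x \<in> I0" using multJ[OF I] by (auto simp: I0_def D_def)
  qed
  have "1 \<notin> I0" using s_notin by (auto simp: I0_def I_def)
  from max_ideal[OF Dring I0 this] obtain Q where Q: "is_ideal D Q" "I0 \<subseteq> Q" "1 \<notin> Q"
    and inv: "\<And>x. x \<in> D \<Longrightarrow> x \<notin> Q \<Longrightarrow> \<exists>y\<in>D. x * y - 1 \<in> Q" by blast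
  have IQ: "I \<subseteq> Q" using Q(2) by (auto simp: I0_def intro!: exI[of _ 0])
  \<comment> \<open>In the local ring \<open>C\<close> an element of nonzero value is a unit, which
    a proper ideal cannot contain. Thus evaluation at the point is still defined on the
    curve.\<close>
  have lQ: "l x = 0" if x: "x \<in> C" "x \<in> Q" for x
  proof (rule ccontr)
    assume "l x \<noteq> 0"
    then have "inverse x \<in> C" using loc_inverse[OF A1] x(1) by (auto simp: C_def l_def)
    then have "inverse x * x \<in> Q" using CD x(2) is_idealD(4)[OF Q(1)] by auto
    moreover have "x \<noteq> 0" using \<open>l x \<noteq> 0\<close> khomD(7)[OF C] by auto
    ultimately show False using Q(3) by simp
  qed
  obtain W \<psi>2 where W: "khom W \<psi>2" "C \<subseteq> W" "W \<subseteq> D" "Q \<subseteq> W" "\<And>x. x \<in> C \<Longrightarrow> \<psi>2 x = l x" "\<And>x. x \<in> Q \<Longrightarrow> \<psi>2 x = 0"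
    and valW: "\<And>x. x \<in> D \<Longrightarrow> x \<notin> W \<Longrightarrow> \<exists>y\<in>W. \<psi>2 y = 0 \<and> x * y - 1 \<in> Q"
    using place_extension[OF Dring Q(1) inv C CD lQ] by blast
  interpret rv: residue_valuation \<iota> D Q W \<psi>2
    by unfold_locales (use Dring Q inv W valW in auto)
  have sQ: "s \<notin> Q"
  proof
    assume "s \<in> Q"
    have "\<exists>n. s ^ n * inverse s \<in> C" using s(2) Cr(2) by (intro exI[of _ 1]) auto
    then have "inverse s \<in> D" by (simp add: D_def)
    from is_idealD(4)[OF Q(1) this \<open>s \<in> Q\<close>] show False using s(2) Q(3) by simp
  qed
  \<comment> \<open>\<open>C\<close> modulo \<open>J\<close> is the ring of the curve modulo
    \<open>s\<close>. It is finite-dimensional, since the \<open>z i\<close> lie in \<open>Q\<close>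
    and together with \<open>s\<close> generate the maximal ideal up to radical; this is the
    one-dimensionality that \<open>uniformizer\<close> asks for.\<close>
  define J where "J = {b + s * c |b c. b \<in> Q \<inter> C \<and> c \<in> C}"
  have QC: "is_ideal C (Q \<inter> C)"
    using is_idealD[OF Q(1)] CD Cr is_idealD[OF CC] unfolding is_ideal_def by auto
  have J: "is_ideal C J" unfolding J_def by (rule is_ideal_plus1[OF khomD(1)[OF C] QC sC(1)])
  have radJ: "\<exists>N. x ^ N \<in> J" if x: "x \<in> C" "l x = 0" for x
  proof -
    obtain N y where N: "y \<in> C" "x ^ N - s * y \<in> I" using rad[OF x] unfolding I_def by blast
    have "x ^ N = (x ^ N - s * y) + s * y" by simp
    moreover have "x ^ N - s * y \<in> Q \<inter> C" using N IQ is_idealD(1)[OF I] by auto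
    ultimately show ?thesis using N(1) unfolding J_def by blast
  qed
  have fc: "finite_codim C J" unfolding C_def A1_def
    by (rule finite_codim_local[OF A1[unfolded A1_def] Y(1,3) J[unfolded C_def A1_def] radJ[unfolded C_def A1_def l_def]])
  have \<psi>s: "\<psi>2 s = 0" using W(5)[OF sC(1)] sC(2) by simp
  have clear: "\<exists>n. s ^ n * x \<in> C" if "x \<in> D" for x using that by (simp add: D_def)
  obtain \<tau> where \<tau>: "\<tau> \<in> W" "\<psi>2 \<tau> = 0" "\<tau> \<notin> Q" "\<And>x. x \<in> W \<Longrightarrow> \<psi>2 x = 0 \<Longrightarrow> \<exists>y\<in>W. x - \<tau> * y \<in> Q"
    and cl: "\<And>x. x \<in> D \<Longrightarrow> \<exists>n. \<tau> ^ n * x \<in> W"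
    using rv.uniformizer[OF khomD(1,2)[OF C] W(2) sC(1) sQ \<psi>s clear fc[unfolded J_def]] by blast
  obtain \<theta> :: "'f \<Rightarrow> 'k fps" where \<theta>: "\<forall>x\<in>W. \<forall>y\<in>W. \<theta> (x + y) = \<theta> x + \<theta> y \<and> \<theta> (x * y) = \<theta> x * \<theta> y"
    "\<forall>c. \<theta> (\<iota> c) = fps_const c" "\<theta> \<tau> = fps_X" "\<forall>x\<in>W. fps_nth (\<theta> x) 0 = \<psi>2 x"
    using rv.power_series_expansion[OF \<tau>] by blast
  note Wr = is_subringD[OF khomD(1)[OF W(1)]]
  have BD: "f \<in> D" if "f \<in> B0" for f
  proof -
    have "s ^ 1 * f \<in> C" using s(4)[of f] that A1C by (auto simp: B_def A1_def)
    then show ?thesis unfolding D_def by blast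
  qed
  have "\<exists>n. \<forall>f\<in>B0. \<tau> ^ n * f \<in> W"
    using fin(2) BD
  proof (induction B0)
    case (insert f B0)
    then obtain n m where n: "\<forall>f\<in>B0. \<tau> ^ n * f \<in> W" and m: "\<tau> ^ m * f \<in> W" using cl[of f] by auto
    have "\<tau> ^ (n + m) * g \<in> W" if "g \<in> insert f B0" for g
    proof (cases "g = f")
      case True
      have "\<tau> ^ n * (\<tau> ^ m * f) \<in> W" by (rule Wr(5)[OF Wr(7)[OF \<tau>(1)] m])
      then show ?thesis using True by (simp add: power_add mult_ac)
    next
      case False
      then have "\<tau> ^ n * g \<in> W" using n that by auto
      from Wr(5)[OF Wr(7)[OF \<tau>(1)] this, of m] show ?thesis by (simp add: power_add mult_ac)
    qed
    then show ?case by blast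
  qed auto
  then obtain n where n: "\<forall>f\<in>B0. \<tau> ^ n * f \<in> W" ..
  have "A \<subseteq> W" using AA1 A1C W(2) by blast
  moreover have "fps_nth (\<theta> x) 0 = \<phi> x" if "x \<in> A" for x
    using that AA1 A1C W(2,5) \<theta>(4) V(3) by (metis subsetD)
  ultimately show ?thesis using khomD(1)[OF W(1)] \<tau>(1) n \<theta>(1-3)
    by (intro exI[of _ W] exI[of _ \<tau>] exI[of _ \<theta>] exI[of _ n]) auto
qed

section \<open>The generic upper triangular matrix\<close>

inductive_set pfun :: "((nat \<times> nat \<Rightarrow> 'k::comm_ring_1) \<Rightarrow> 'k) set" where
  const: "(\<lambda>x. c) \<in> pfun"
| var: "(\<lambda>x. x i) \<in> pfun"
| add: "p \<in> pfun \<Longrightarrow> q \<in> pfun \<Longrightarrow> (\<lambda>x. p x + q x) \<in> pfun"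
| mult: "p \<in> pfun \<Longrightarrow> q \<in> pfun \<Longrightarrow> (\<lambda>x. p x * q x) \<in> pfun"

lemma pfun_uminus: "p \<in> pfun \<Longrightarrow> (\<lambda>x. - p x) \<in> pfun"
  using pfun.mult[OF pfun.const[of "-1"]] by fastforce

lemma pfun_on_line:
  fixes p :: "(nat \<times> nat \<Rightarrow> 'k::comm_ring_1) \<Rightarrow> 'k"
  assumes "p \<in> pfun" shows "\<exists>P. \<forall>t. p (\<lambda>i. a i + t * b i) = poly P t"
  using assms
proof induction
  case (const c)
  then show ?case by (intro exI[of _ "[:c:]"]) auto
next
  case (var i)
  then show ?case by (intro exI[of _ "[:a i, b i:]"]) auto
next
  case (add p q)
  then obtain P R where "\<forall>t. p (\<lambda>i. a i + t * b i) = poly P t" "\<forall>t. q (\<lambda>i. a i + t * b i) = poly R t" by auto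
  then show ?case by (intro exI[of _ "P + R"]) auto
next
  case (mult p q)
  then obtain P R where "\<forall>t. p (\<lambda>i. a i + t * b i) = poly P t" "\<forall>t. q (\<lambda>i. a i + t * b i) = poly R t" by auto
  then show ?case by (intro exI[of _ "P * R"]) auto
qed

text \<open>On the line through \<open>x\<close> and \<open>y\<close> both functions become
  polynomials in one variable, nonzero at \<open>t = 0\<close> and at \<open>t = 1\<close>
  respectively; over an infinite field their product has a nonroot.\<close>

lemma pfun_no_zero_divisors:
  fixes p q :: "(nat \<times> nat \<Rightarrow> 'k::alg_closed_field) \<Rightarrow> 'k"
  assumes "p \<in> pfun" "q \<in> pfun" "p x \<noteq> 0" "q y \<noteq> 0"
  shows "\<exists>z. p z * q z \<noteq> 0"
proof -
  obtain P where P: "\<And>t. p (\<lambda>i. x i + t * (y i - x i)) = poly P t" using pfun_on_line[OF assms(1)] by metis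
  obtain R where R: "\<And>t. q (\<lambda>i. x i + t * (y i - x i)) = poly R t" using pfun_on_line[OF assms(2)] by metis
  have "P \<noteq> 0" using P[of 0] assms(3) by auto
  moreover have "R \<noteq> 0" using R[of 1] assms(4) by auto
  ultimately have "finite {t. poly (P * R) t = 0}" by (intro poly_roots_finite) simp
  then obtain t where "poly (P * R) t \<noteq> 0"
    using infinite_alg_closed_field ex_new_if_finite by (metis (mono_tags, lifting) mem_Collect_eq)
  then show ?thesis using P[of t] R[of t] by (intro exI[of _ "\<lambda>i. x i + t * (y i - x i)"]) auto
qed

text \<open>The polynomial ring in the variables \<open>(i, j)\<close>, realised as polynomial functions; this is
  faithful because an algebraically closed field is infinite.\<close>
typedef (overloaded) ('k::alg_closed_field) mpoly = "pfun :: ((nat \<times> nat \<Rightarrow> 'k) \<Rightarrow> 'k) set"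
  morphisms mval Abs_mpoly by (auto intro: pfun.const)

setup_lifting type_definition_mpoly

instantiation mpoly :: (alg_closed_field) idom
begin

lift_definition zero_mpoly :: "'a mpoly" is "\<lambda>x. 0" by (rule pfun.const)
lift_definition one_mpoly :: "'a mpoly" is "\<lambda>x. 1" by (rule pfun.const)
lift_definition plus_mpoly :: "'a mpoly \<Rightarrow> 'a mpoly \<Rightarrow> 'a mpoly" is "\<lambda>p q x. p x + q x" by (rule pfun.add)
lift_definition times_mpoly :: "'a mpoly \<Rightarrow> 'a mpoly \<Rightarrow> 'a mpoly" is "\<lambda>p q x. p x * q x" by (rule pfun.mult)
lift_definition uminus_mpoly :: "'a mpoly \<Rightarrow> 'a mpoly" is "\<lambda>p x. - p x" by (rule pfun_uminus)
definition minus_mpoly :: "'a mpoly \<Rightarrow> 'a mpoly \<Rightarrow> 'a mpoly" where "minus_mpoly p q = p + - q"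

instance
proof
  fix a b c :: "'a mpoly"
  show "a + b + c = a + (b + c)" "a + b = b + a" "0 + a = a" "a * b * c = a * (b * c)" "a * b = b * a"
    "1 * a = a" "(a + b) * c = a * c + b * c" "a * (b + c) = a * b + a * c" "- a + a = 0" "0 * a = 0" "a * 0 = 0"
    by (transfer; simp add: algebra_simps)+
  show "a - b = a + - b" by (simp add: minus_mpoly_def)
  show "(0::'a mpoly) \<noteq> 1" by (transfer, metis zero_neq_one)
  show "a * b \<noteq> 0" if "a \<noteq> 0" "b \<noteq> 0"
    using that
  proof transfer
    fix a b :: "(nat \<times> nat \<Rightarrow> 'a) \<Rightarrow> 'a"
    assume ab: "a \<in> pfun" "b \<in> pfun" "a \<noteq> (\<lambda>x. 0)" "b \<noteq> (\<lambda>x. 0)"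
    then obtain x y where "a x \<noteq> 0" "b y \<noteq> 0" by (metis ext)
    from pfun_no_zero_divisors[OF ab(1,2) this] show "(\<lambda>x. a x * b x) \<noteq> (\<lambda>x. 0)" by metis
  qed
qed

end

lift_definition mconst :: "'k::alg_closed_field \<Rightarrow> 'k mpoly" is "\<lambda>c x. c" by (rule pfun.const)
lift_definition mvar :: "nat \<times> nat \<Rightarrow> 'k::alg_closed_field mpoly" is "\<lambda>i x. x i" by (rule pfun.var)

lemma mval_simps [simp]:
  "mval 0 x = 0" "mval 1 x = 1" "mval (p + q) x = mval p x + mval q x" "mval (p * q) x = mval p x * mval q x"
  "mval (- p) x = - mval p x" "mval (mconst c) x = c" "mval (mvar i) x = x i"
  by (transfer; simp)+

lemma comm_ring_hom_mval: "comm_ring_hom (\<lambda>p. mval p x)"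
  by unfold_locales auto

definition to_fr :: "'k::alg_closed_field mpoly \<Rightarrow> 'k mpoly fract" where "to_fr p = Fract p 1"

lemma to_fr_simps: "to_fr (p + q) = to_fr p + to_fr q" "to_fr (p * q) = to_fr p * to_fr q" "to_fr 1 = 1" "to_fr 0 = 0"
  by (simp_all add: to_fr_def One_fract_def Zero_fract_def)

lemma to_fr_sum: "to_fr (sum f I) = (\<Sum>i\<in>I. to_fr (f i))"
  by (induction I rule: infinite_finite_induct) (auto simp: to_fr_simps)

lemma to_fr_eq_0: "to_fr p = 0 \<longleftrightarrow> p = 0"
  by (simp add: to_fr_def Zero_fract_def eq_fract)

definition fconst :: "'k::alg_closed_field \<Rightarrow> 'k mpoly fract" where "fconst c = to_fr (mconst c)"

interpretation gen: field_embedding fconst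
proof
  have "mconst (a + b) = mconst a + mconst b" "mconst (a * b) = mconst a * mconst b" "mconst (1::'a) = 1" for a b :: 'a
    by (transfer; simp)+
  then show "fconst (a + b) = fconst a + fconst b" "fconst (a * b) = fconst a * fconst b" "fconst (1::'a) = 1" for a b :: 'a
    by (simp_all add: fconst_def to_fr_simps)
qed

text \<open>Supplies the nonconstant function that \<open>curve_selection\<close> asks for.\<close>

lemma to_fr_mvar_notin: "to_fr (mvar i :: 'k::alg_closed_field mpoly) \<notin> range fconst"
proof
  assume "to_fr (mvar i :: 'k mpoly) \<in> range fconst"
  then obtain c :: 'k where "to_fr (mvar i) = to_fr (mconst c)" by (auto simp: fconst_def)
  then have "mvar i = mconst c" by (simp add: to_fr_def eq_fract)
  then have "x i = c" for x using mval_simps(6,7) by metis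
  from this[of "\<lambda>_. 0"] this[of "\<lambda>_. 1"] show False by simp
qed

text \<open>\<open>f\<close> is defined at \<open>x\<close> with value \<open>c\<close>; a relation, since it depends on the choice of a fraction.\<close>
definition spec :: "(nat \<times> nat \<Rightarrow> 'k::alg_closed_field) \<Rightarrow> 'k mpoly fract \<Rightarrow> 'k \<Rightarrow> bool" where
  "spec x f c \<longleftrightarrow> (\<exists>n m. f = Fract n m \<and> mval m x \<noteq> 0 \<and> c = mval n x / mval m x)"

lemma spec_Fract: "mval m x \<noteq> 0 \<Longrightarrow> spec x (Fract n m) (mval n x / mval m x)"
  by (auto simp: spec_def)

lemma spec_to_fr: "spec x (to_fr p) (mval p x)"
  using spec_Fract[of 1 x p] by (simp add: to_fr_def)

lemma spec_unique:
  assumes "spec x f c" "spec x f c'" shows "c = c'"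
proof -
  obtain n m where 1: "f = Fract n m" "mval m x \<noteq> 0" "c = mval n x / mval m x"
    using assms(1) unfolding spec_def by blast
  obtain n' m' where 2: "f = Fract n' m'" "mval m' x \<noteq> 0" "c' = mval n' x / mval m' x"
    using assms(2) unfolding spec_def by blast
  note * = 1 2
  then have "m \<noteq> 0" "m' \<noteq> 0" by auto
  with * have "n * m' = n' * m" by (simp add: eq_fract)
  then have "mval n x * mval m' x = mval n' x * mval m x" by (metis mval_simps(4))
  with * show ?thesis by (simp add: frac_eq_eq)
qed

lemma spec_add_mult:
  assumes "spec x f c" "spec x f' c'" shows "spec x (f + f') (c + c')" "spec x (f * f') (c * c')"
proof -
  obtain n m where 1: "f = Fract n m" "mval m x \<noteq> 0" "c = mval n x / mval m x"
    using assms(1) unfolding spec_def by blast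
  obtain n' m' where 2: "f' = Fract n' m'" "mval m' x \<noteq> 0" "c' = mval n' x / mval m' x"
    using assms(2) unfolding spec_def by blast
  note * = 1 2
  then have "m \<noteq> 0" "m' \<noteq> 0" by auto
  have "f + f' = Fract (n * m' + n' * m) (m * m')" using * \<open>m \<noteq> 0\<close> \<open>m' \<noteq> 0\<close> by simp
  moreover have "c + c' = mval (n * m' + n' * m) x / mval (m * m') x" using * by (simp add: add_frac_eq)
  ultimately show "spec x (f + f') (c + c')" using spec_Fract[of "m * m'" x "n * m' + n' * m"] * by simp
  show "spec x (f * f') (c * c')" using spec_Fract[of "m * m'" x "n * n'"] * by simp
qed

lemma spec_sum: "(\<And>i. i \<in> I \<Longrightarrow> spec x (f i) (c i)) \<Longrightarrow> spec x (sum f I) (sum c I)"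
  using spec_to_fr[of x 0]
  by (induction I rule: infinite_finite_induct) (auto simp: to_fr_simps intro: spec_add_mult)

text \<open>\<open>f\<close> is the value of the polynomial function \<open>p\<close> at the representation \<open>E\<close> over the function field.\<close>
inductive polrel :: "nat \<Rightarrow> ('a \<Rightarrow> nat \<Rightarrow> nat \<Rightarrow> 'k::alg_closed_field mpoly fract) \<Rightarrow>
    'k mpoly fract \<Rightarrow> (('a \<Rightarrow> 'k mat) \<Rightarrow> 'k) \<Rightarrow> bool" for d E where
  const: "polrel d E (fconst c) (\<lambda>\<rho>. c)"
| coord: "i < d \<Longrightarrow> j < d \<Longrightarrow> polrel d E (E x i j) (\<lambda>\<rho>. \<rho> x $$ (i, j))"
| add: "polrel d E f p \<Longrightarrow> polrel d E g q \<Longrightarrow> polrel d E (f + g) (\<lambda>\<rho>. p \<rho> + q \<rho>)"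
| mult: "polrel d E f p \<Longrightarrow> polrel d E g q \<Longrightarrow> polrel d E (f * g) (\<lambda>\<rho>. p \<rho> * q \<rho>)"

lemma polrel_poly_fun: "polrel d E f p \<Longrightarrow> p \<in> poly_fun d"
  by (induction rule: polrel.induct) (auto intro: poly_fun.intros)

lemma polrel_spec:
  assumes "polrel d E f p" "\<And>x i j. i < d \<Longrightarrow> j < d \<Longrightarrow> spec P (E x i j) (\<rho> x $$ (i, j))"
  shows "spec P f (p \<rho>)"
  using assms(1)
proof induction
  case (const c)
  then show ?case using spec_to_fr[of P "mconst c"] by (simp add: fconst_def)
qed (auto intro: assms spec_add_mult)

text \<open>Evaluation at \<nu> is well defined on generic values because \<nu> lies in the closure:
  a polynomial function with generic value 0 vanishes on \<open>S\<close>, whose points are all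
  specialisations of the generic one, and hence at \<nu>.\<close>

lemma polrel_hom:
  assumes E: "\<And>\<rho>. \<rho> \<in> S \<Longrightarrow> \<exists>P. \<forall>x i j. i < d \<longrightarrow> j < d \<longrightarrow> spec P (E x i j) (\<rho> x $$ (i, j))"
    and \<nu>: "\<nu> \<in> zariski_closure d S"
  shows "\<exists>A \<phi>. gen.khom A \<phi> \<and> A = {f. \<exists>p. polrel d E f p} \<and> (\<forall>x i j. i < d \<longrightarrow> j < d \<longrightarrow> \<phi> (E x i j) = \<nu> x $$ (i, j))"
proof -
  define A where "A = {f. \<exists>p. polrel d E f p}"
  define \<phi> where "\<phi> f = (SOME p. polrel d E f p) \<nu>" for f
  have zero: "p \<nu> = 0" if "polrel d E 0 p" for p
  proof -
    have "p \<rho> = 0" if "\<rho> \<in> S" for \<rho>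
    proof -
      from E[OF that] obtain P where "\<forall>x i j. i < d \<longrightarrow> j < d \<longrightarrow> spec P (E x i j) (\<rho> x $$ (i, j))" ..
      then have "spec P 0 (p \<rho>)" using polrel_spec[OF \<open>polrel d E 0 p\<close>] by blast
      moreover have "spec P 0 0" using spec_to_fr[of P 0] by (simp add: to_fr_simps)
      ultimately show ?thesis by (rule spec_unique)
    qed
    then show ?thesis using \<nu>[unfolded zariski_closure_def] polrel_poly_fun[OF that] by blast
  qed
  have neg: "polrel d E (- f) (\<lambda>\<rho>. - p \<rho>)" if "polrel d E f p" for f p
    using polrel.mult[OF polrel.const[of d E "-1"] that] by (simp add: gen.\<iota>_uminus gen.\<iota>_1)
  have \<phi>: "\<phi> f = p \<nu>" if "polrel d E f p" for f p
  proof -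
    have "polrel d E f (SOME p. polrel d E f p)"
      by (rule someI[of "polrel d E f", OF that])
    from polrel.add[OF this neg[OF that]] have "polrel d E 0 (\<lambda>\<rho>. (SOME p. polrel d E f p) \<rho> + - p \<rho>)" by simp
    from zero[OF this] show ?thesis by (simp add: \<phi>_def)
  qed
  have "gen.khom A \<phi>" unfolding gen.khom_def
  proof (intro conjI allI ballI)
    show "is_subring A" unfolding is_subring_def
    proof (intro conjI ballI)
      show "0 \<in> A" "1 \<in> A" using polrel.const[of d E 0] polrel.const[of d E 1]
        by (auto simp: A_def gen.\<iota>_0 gen.\<iota>_1)
      fix f g assume "f \<in> A" "g \<in> A"
      then obtain p q where pq: "polrel d E f p" "polrel d E g q" by (auto simp: A_def)
      show "f + g \<in> A" "f * g \<in> A" using polrel.add[OF pq] polrel.mult[OF pq] by (auto simp: A_def)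
      show "f - g \<in> A" using polrel.add[OF pq(1) neg[OF pq(2)]] by (auto simp: A_def)
    qed
    show "range fconst \<subseteq> A" using polrel.const by (auto simp: A_def)
    show "\<phi> (fconst c) = c" for c using \<phi>[OF polrel.const] .
    fix f g assume "f \<in> A" "g \<in> A"
    then obtain p q where pq: "polrel d E f p" "polrel d E g q" by (auto simp: A_def)
    show "\<phi> (f + g) = \<phi> f + \<phi> g" "\<phi> (f * g) = \<phi> f * \<phi> g"
      using \<phi>[OF polrel.add[OF pq]] \<phi>[OF polrel.mult[OF pq]] \<phi>[OF pq(1)] \<phi>[OF pq(2)] by auto
  qed
  moreover have "\<phi> (E x i j) = \<nu> x $$ (i, j)" if "i < d" "j < d" for x i j using \<phi>[OF polrel.coord[OF that]] .
  ultimately show ?thesis using A_def by blast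
qed

section \<open>The generic conjugate and its curve germ\<close>

lemma index_triple_mult:
  assumes "A \<in> carrier_mat d d" "B \<in> carrier_mat d d" "C \<in> carrier_mat d d" "i < d" "j < d"
  shows "(A * B * C) $$ (i, j) = (\<Sum>b<d. (\<Sum>a<d. A $$ (i, a) * B $$ (a, b)) * C $$ (b, j))"
  using assms by (simp add: scalar_prod_def atLeast0LessThan del: assoc_mult_mat)

text \<open>In column \<open>j\<close> of the product only \<open>h k j * g j j\<close> survives
  once the earlier columns of \<open>h\<close> are known, and the diagonal equation makes
  \<open>g j j\<close> nonzero. Entries are given as functions since the lemma is applied both over
  the function field and to matrices over \<open>k\<close>.\<close>

lemma inverse_upper_triangular:
  fixes g h :: "nat \<Rightarrow> nat \<Rightarrow> 'a::field"
  assumes hg: "\<And>i j. i < d \<Longrightarrow> j < d \<Longrightarrow> (\<Sum>a<d. h i a * g a j) = (if i = j then 1 else 0)"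
    and g: "\<And>i j. j < i \<Longrightarrow> i < d \<Longrightarrow> g i j = 0"
  shows "j < i \<Longrightarrow> i < d \<Longrightarrow> h i j = 0"
proof (induction j arbitrary: i rule: less_induct)
  case (less j)
  have sum_eq: "(\<Sum>a<d. h k a * g a j) = h k j * g j j" if k: "j \<le> k" "k < d" for k
  proof -
    have "(\<Sum>a<d. h k a * g a j) = (\<Sum>a\<in>{j}. h k a * g a j)"
    proof (intro sum.mono_neutral_right ballI)
      fix a assume a: "a \<in> {..<d} - {j}"
      then consider "a < j" | "j < a" by fastforce
      then show "h k a * g a j = 0"
        by cases (use less.IH[of a k] g[of j a] k a in auto)
    qed (use k in auto)
    then show ?thesis by simp
  qed
  have "h j j * g j j = 1" using sum_eq[of j] hg[of j j] less.prems by auto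
  moreover have "h i j * g j j = 0" using sum_eq[of i] hg[of i j] less.prems by auto
  ultimately show ?case by auto
qed

definition gmat :: "nat \<Rightarrow> 'k::alg_closed_field mpoly mat" where
  "gmat d = mat d d (\<lambda>(i, j). if i \<le> j then mvar (i, j) else 0)"

lemma mat_prod_entry:
  fixes A B :: "'r::comm_ring_1 mat"
  assumes "A \<in> carrier_mat d d" "B \<in> carrier_mat d d" "A * B = c \<cdot>\<^sub>m 1\<^sub>m d" "i < d" "j < d"
  shows "(\<Sum>a<d. A $$ (i, a) * B $$ (a, j)) = (if i = j then c else 0)"
proof -
  have "(A * B) $$ (i, j) = (\<Sum>a<d. A $$ (i, a) * B $$ (a, j))"
    using assms(1,2,4,5) by (simp add: scalar_prod_def atLeast0LessThan)
  moreover have "(A * B) $$ (i, j) = (if i = j then c else 0)"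
    unfolding assms(3) using assms(4,5) by simp
  ultimately show ?thesis by simp
qed

text \<open>The inverse is the adjugate divided by the determinant \<delta>, so it specialises
  wherever \<delta> does not vanish, in particular at every invertible triangular matrix. By the
  last clause the whole group consists of specialisations of one matrix.\<close>

lemma generic_upper_triangular:
  "\<exists>g h :: nat \<Rightarrow> nat \<Rightarrow> 'k::alg_closed_field mpoly fract.
    (\<forall>i<d. \<forall>j<d. (\<Sum>a<d. g i a * h a j) = (if i = j then 1 else 0)) \<and>
    (\<forall>i<d. \<forall>j<d. (\<Sum>a<d. h i a * g a j) = (if i = j then 1 else 0)) \<and>
    (\<forall>i<d. \<forall>j<i. g i j = 0 \<and> h i j = 0) \<and>
    (\<forall>g0 h0. g0 \<in> carrier_mat d d \<and> h0 \<in> carrier_mat d d \<and> upper_tri d g0 \<and> g0 * h0 = 1\<^sub>m d \<and> h0 * g0 = 1\<^sub>m d \<longrightarrow>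
      (\<exists>P. \<forall>i<d. \<forall>j<d. spec P (g i j) (g0 $$ (i, j)) \<and> spec P (h i j) (h0 $$ (i, j))))"
proof -
  define R where "R = (gmat d :: 'k mpoly mat)"
  define B where "B = adj_mat R"
  define \<delta> where "\<delta> = det R"
  have R: "R \<in> carrier_mat d d" by (simp add: R_def gmat_def)
  note adj = adj_mat[OF R, folded B_def \<delta>_def]
  define g where "g i j = to_fr (R $$ (i, j))" for i j
  define h where "h i j = Fract (B $$ (i, j)) \<delta>" for i j
  have pt: "det (map_mat (\<lambda>p. mval p P) R) = mval \<delta> P \<and> map_mat (\<lambda>p. mval p P) R * map_mat (\<lambda>p. mval p P) B = mval \<delta> P \<cdot>\<^sub>m 1\<^sub>m d" for P
  proof -
    interpret comm_ring_hom "\<lambda>p::'k mpoly. mval p P" by (rule comm_ring_hom_mval)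
    have "map_mat (\<lambda>p. mval p P) R * map_mat (\<lambda>p. mval p P) B = map_mat (\<lambda>p. mval p P) (R * B)"
      by (rule mat_hom_mult[symmetric, OF R adj(1)])
    also have "\<dots> = mval \<delta> P \<cdot>\<^sub>m 1\<^sub>m d" unfolding adj(2) by (intro eq_matI) auto
    finally show ?thesis by (simp add: \<delta>_def)
  qed
  \<comment> \<open>\<delta> is a nonzero polynomial because it takes the value 1 at the identity
    matrix.\<close>
  have "map_mat (\<lambda>p. mval p (\<lambda>(i, j). if i = j then 1 else 0)) R = (1\<^sub>m d :: 'k mat)"
    by (intro eq_matI) (auto simp: R_def gmat_def)
  with pt[of "\<lambda>(i, j). if i = j then 1 else 0"] have \<delta>0: "\<delta> \<noteq> 0" by auto
  have h: "h i j = inverse (to_fr \<delta>) * to_fr (B $$ (i, j))" for i j by (simp add: h_def to_fr_def)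
  have inv: "inverse (to_fr \<delta>) * to_fr \<delta> = 1" using \<delta>0 by (simp add: to_fr_eq_0)
  have gh: "(\<Sum>a<d. g i a * h a j) = (if i = j then 1 else 0)" if "i < d" "j < d" for i j
  proof -
    have "(\<Sum>a<d. g i a * h a j) = inverse (to_fr \<delta>) * to_fr (\<Sum>a<d. R $$ (i, a) * B $$ (a, j))"
      by (simp add: g_def h to_fr_sum to_fr_simps sum_distrib_left mult_ac)
    then show ?thesis using mat_prod_entry[OF R adj(1,2) that] inv by (simp add: to_fr_simps)
  qed
  have hg: "(\<Sum>a<d. h i a * g a j) = (if i = j then 1 else 0)" if "i < d" "j < d" for i j
  proof -
    have "(\<Sum>a<d. h i a * g a j) = inverse (to_fr \<delta>) * to_fr (\<Sum>a<d. B $$ (i, a) * R $$ (a, j))"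
      by (simp add: g_def h to_fr_sum to_fr_simps sum_distrib_left mult_ac)
    then show ?thesis using mat_prod_entry[OF adj(1) R adj(3) that] inv by (simp add: to_fr_simps)
  qed
  have g0: "g i j = 0" if "j < i" "i < d" for i j using that by (simp add: g_def R_def gmat_def to_fr_simps)
  have h0: "h i j = 0" if "j < i" "i < d" for i j by (rule inverse_upper_triangular[OF hg g0 that])
  have "\<exists>P. \<forall>i<d. \<forall>j<d. spec P (g i j) (G $$ (i, j)) \<and> spec P (h i j) (H $$ (i, j))"
    if GH: "G \<in> carrier_mat d d" "H \<in> carrier_mat d d" "upper_tri d G" "G * H = 1\<^sub>m d" "H * G = 1\<^sub>m d" for G H
  proof -
    define P where "P = (\<lambda>(i, j). G $$ (i, j))"
    have RP: "map_mat (\<lambda>p. mval p P) R = G"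
      using GH(1,3) by (intro eq_matI) (auto simp: R_def gmat_def P_def upper_tri_def)
    define B' where "B' = map_mat (\<lambda>p. mval p P) B"
    have B': "B' \<in> carrier_mat d d" using adj(1) by (simp add: B'_def)
    have dG: "det G = mval \<delta> P" "G * B' = mval \<delta> P \<cdot>\<^sub>m 1\<^sub>m d" using pt[of P] by (auto simp: RP B'_def)
    have "det G * det H = 1" using GH by (metis det_mult det_one)
    then have nz: "mval \<delta> P \<noteq> 0" using dG by auto
    have "H * (G * B') = (H * G) * B'" by (rule assoc_mult_mat[symmetric]) (use GH B' in auto)
    then have "B' = H * (G * B')" using GH(5) B' by simp
    also have "\<dots> = mval \<delta> P \<cdot>\<^sub>m H" unfolding dG(2) using GH(2) by (simp add: mult_smult_distrib[OF GH(2) one_carrier_mat])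
    finally have BH: "B' = mval \<delta> P \<cdot>\<^sub>m H" .
    show ?thesis
    proof (intro exI[of _ P] allI impI conjI)
      fix i j assume ij: "i < d" "j < d"
      have "G $$ (i, j) = mval (R $$ (i, j)) P" using ij R by (simp flip: RP)
      then show "spec P (g i j) (G $$ (i, j))" using spec_to_fr by (simp add: g_def)
      have "mval (B $$ (i, j)) P = mval \<delta> P * H $$ (i, j)"
        using ij adj(1) GH arg_cong[OF BH, of "\<lambda>M. M $$ (i, j)"] by (simp add: B'_def)
      then show "spec P (h i j) (H $$ (i, j))" using spec_Fract[OF nz, of "B $$ (i, j)"] nz by (simp add: h_def)
    qed
  qed
  then show ?thesis using gh hg g0 h0 by (intro exI[of _ g] exI[of _ h]) auto
qed

text \<open>\<open>curve_selection\<close> is applied to the algebra generated by the entries of the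
  generic conjugate, at the point \<nu>, with the entries of the generic matrix and of its inverse
  as the functions whose poles are to be controlled. Clearing the poles with \<tau>, which is
  expanded as \<open>fps_X\<close>, gives two matrices of power series whose product is a power of
  \<open>fps_X\<close>.\<close>

theorem degeneration_along_curve:
  fixes scal :: "'k::alg_closed_field \<Rightarrow> 'a::ring_1 \<Rightarrow> 'a"
  assumes fd: "fin_dim_algebra scal" and \<mu>: "\<mu> \<in> tri_reps scal d" and \<nu>: "\<nu> \<in> zariski_closure d (U_orbit d \<mu>)"
  shows "\<exists>n (G :: nat \<Rightarrow> nat \<Rightarrow> 'k fps) G' N.
    (\<forall>i<d. \<forall>j<d. (\<Sum>a<d. G' i a * G a j) = (if i = j then fps_X ^ n else 0)) \<and>
    (\<forall>i<d. \<forall>j<d. (\<Sum>a<d. G i a * G' a j) = (if i = j then fps_X ^ n else 0)) \<and>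
    (\<forall>i<d. \<forall>j<i. G i j = 0 \<and> G' i j = 0) \<and>
    (\<forall>x. \<forall>i<d. \<forall>j<d. (\<Sum>b<d. (\<Sum>a<d. G' i a * fps_const (\<mu> x $$ (a, b))) * G b j) = fps_X ^ n * N x i j \<and>
      fps_nth (N x i j) 0 = \<nu> x $$ (i, j))"
proof -
  obtain g h :: "nat \<Rightarrow> nat \<Rightarrow> 'k mpoly fract" where
    gh: "\<And>i j. i < d \<Longrightarrow> j < d \<Longrightarrow> (\<Sum>a<d. g i a * h a j) = (if i = j then 1 else 0)" and
    hg: "\<And>i j. i < d \<Longrightarrow> j < d \<Longrightarrow> (\<Sum>a<d. h i a * g a j) = (if i = j then 1 else 0)" and
    tri: "\<And>i j. j < i \<Longrightarrow> i < d \<Longrightarrow> g i j = 0 \<and> h i j = 0" and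
    sp: "\<And>g0 h0. g0 \<in> carrier_mat d d \<Longrightarrow> h0 \<in> carrier_mat d d \<Longrightarrow> upper_tri d g0 \<Longrightarrow>
      g0 * h0 = 1\<^sub>m d \<Longrightarrow> h0 * g0 = 1\<^sub>m d \<Longrightarrow>
      \<exists>P. \<forall>i<d. \<forall>j<d. spec P (g i j) (g0 $$ (i, j)) \<and> spec P (h i j) (h0 $$ (i, j))"
    using generic_upper_triangular[of d] by (elim exE conjE) blast
  have rep: "is_rep scal d \<mu>" using \<mu> by (simp add: tri_reps_def)
  have \<mu>c: "\<mu> x \<in> carrier_mat d d" for x using rep by (simp add: is_rep_def)
  define E where "E x i j = (\<Sum>b<d. (\<Sum>a<d. g i a * fconst (\<mu> x $$ (a, b))) * h b j)" for x i j
  have "\<exists>P. \<forall>x i j. i < d \<longrightarrow> j < d \<longrightarrow> spec P (E x i j) (\<rho> x $$ (i, j))" if "\<rho> \<in> U_orbit d \<mu>" for \<rho>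
  proof -
    obtain g0 h0 where \<rho>: "\<rho> = (\<lambda>x. g0 * \<mu> x * h0)" and *: "g0 \<in> carrier_mat d d" "h0 \<in> carrier_mat d d"
      "upper_tri d g0" "g0 * h0 = 1\<^sub>m d" "h0 * g0 = 1\<^sub>m d" using \<open>\<rho> \<in> U_orbit d \<mu>\<close> by (auto simp: U_orbit_def)
    from sp[OF *] obtain P where P: "\<And>i j. i < d \<Longrightarrow> j < d \<Longrightarrow> spec P (g i j) (g0 $$ (i, j)) \<and> spec P (h i j) (h0 $$ (i, j))"
      by blast
    have c: "spec P (fconst c) c" for c using spec_to_fr[of P "mconst c"] by (simp add: fconst_def)
    have "spec P (E x i j) (\<rho> x $$ (i, j))" if "i < d" "j < d" for x i j
      unfolding E_def \<rho> index_triple_mult[OF *(1) \<mu>c *(2) that]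
      using P that by (intro spec_sum spec_add_mult(2) c) auto
    then show ?thesis by blast
  qed
  from polrel_hom[OF this \<nu>] obtain A \<phi> where A: "gen.khom A \<phi>" "A = {f. \<exists>p. polrel d E f p}"
    and \<phi>: "\<And>x i j. i < d \<Longrightarrow> j < d \<Longrightarrow> \<phi> (E x i j) = \<nu> x $$ (i, j)" by blast
  obtain Bs where Bs: "finite Bs" "module.span scal Bs = UNIV" and vs: "vector_space scal"
    using fd by (auto simp: fin_dim_algebra_def k_algebra_def)
  interpret vector_space scal by (rule vs)
  define Y where "Y = (\<lambda>(x, i, j). E x i j) ` (Bs \<times> {..<d} \<times> {..<d})"
  have Yfin: "finite Y" using Bs by (simp add: Y_def)
  have EA: "E x i j \<in> A" if "i < d" "j < d" for x i j using polrel.coord[OF that, of E x] by (auto simp: A(2))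
  define R where "R = gen (range fconst) Y"
  have R: "is_subring R" unfolding R_def by (rule is_subring_gen[OF gen.is_subring_K])
  note Rr = is_subringD[OF R]
  have E_add: "E (x + y) i j = E x i j + E y i j" for x y i j
  proof -
    have "\<mu> (x + y) $$ (a, b) = \<mu> x $$ (a, b) + \<mu> y $$ (a, b)" if "a < d" "b < d" for a b
      using rep that carrier_matD[OF \<mu>c[of y]] by (simp add: is_rep_def)
    then have "E (x + y) i j = (\<Sum>b<d. (\<Sum>a<d. g i a * (fconst (\<mu> x $$ (a, b)) + fconst (\<mu> y $$ (a, b)))) * h b j)"
      unfolding E_def by (intro sum.cong arg_cong2[where f = "(*)"] refl) (auto simp: gen.\<iota>_add)
    then show ?thesis unfolding E_def by (simp add: distrib_left distrib_right sum.distrib)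
  qed
  have E_scal: "E (scal c x) i j = fconst c * E x i j" for c x i j
  proof -
    have "\<mu> (scal c x) $$ (a, b) = c * \<mu> x $$ (a, b)" if "a < d" "b < d" for a b
      using rep that carrier_matD[OF \<mu>c[of x]] by (simp add: is_rep_def)
    then have "E (scal c x) i j = (\<Sum>b<d. (\<Sum>a<d. g i a * (fconst c * fconst (\<mu> x $$ (a, b)))) * h b j)"
      unfolding E_def by (intro sum.cong arg_cong2[where f = "(*)"] refl) (auto simp: gen.\<iota>_mult)
    then show ?thesis unfolding E_def by (simp add: sum_distrib_left sum_distrib_right mult_ac)
  qed
  have ER: "E x i j \<in> R" if "i < d" "j < d" for x i j
  proof -
    \<comment> \<open>The entries of \<open>E x\<close> are linear in \<open>x\<close>, so those
      belonging to a finite spanning set of the algebra generate all the others. This is where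
      finite dimension enters.\<close>
    have "subspace {x. E x i j \<in> R}"
    proof (rule subspaceI)
      show "0 \<in> {x. E x i j \<in> R}" using E_scal[of 0 0 i j] Rr(1) by (simp add: gen.\<iota>_0)
      show "x + y \<in> {x. E x i j \<in> R}" if "x \<in> {x. E x i j \<in> R}" "y \<in> {x. E x i j \<in> R}" for x y
        using that E_add Rr(3) by simp
      show "scal c x \<in> {x. E x i j \<in> R}" if "x \<in> {x. E x i j \<in> R}" for c x
        using that E_scal Rr(5) by (auto simp: R_def intro: gen.base gen.mult)
    qed
    moreover have "Bs \<subseteq> {x. E x i j \<in> R}" using that by (force simp: R_def Y_def intro: gen.gen)
    ultimately have "span Bs \<subseteq> {x. E x i j \<in> R}" by (rule span_minimal[rotated])
    then show ?thesis using Bs(2) by auto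
  qed
  have AR: "A = gen (range fconst) Y"
  proof
    have "f \<in> R" if "polrel d E f p" for f p
      using that by induction (auto intro: ER Rr, simp add: R_def gen.base)
    then show "A \<subseteq> gen (range fconst) Y" by (auto simp: A(2) R_def)
    show "gen (range fconst) Y \<subseteq> A"
      using gen.khomD(1,2)[OF A(1)] EA by (intro gen_least) (auto simp: Y_def)
  qed
  define B0 where "B0 = (\<lambda>(i, j). g i j) ` ({..<d} \<times> {..<d}) \<union> (\<lambda>(i, j). h i j) ` ({..<d} \<times> {..<d})"
  have B0fin: "finite B0" by (simp add: B0_def)
  obtain W \<tau> and \<theta> :: "'k mpoly fract \<Rightarrow> 'k fps" and n where W: "is_subring W" "A \<subseteq> W" "\<tau> \<in> W" "\<forall>f\<in>B0. \<tau> ^ n * f \<in> W"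
    and \<theta>: "\<forall>x\<in>W. \<forall>y\<in>W. \<theta> (x + y) = \<theta> x + \<theta> y \<and> \<theta> (x * y) = \<theta> x * \<theta> y" "\<forall>c. \<theta> (fconst c) = fps_const c" "\<theta> \<tau> = fps_X"
      "\<forall>x\<in>A. fps_nth (\<theta> x) 0 = \<phi> x"
    using gen.curve_selection[OF A(1) AR Yfin B0fin to_fr_mvar_notin[of "(0, 0)"]] by (elim exE conjE)
  note Wr = is_subringD[OF W(1)]
  have \<theta>_add: "\<theta> (x + y) = \<theta> x + \<theta> y" and \<theta>_mult: "\<theta> (x * y) = \<theta> x * \<theta> y" if "x \<in> W" "y \<in> W" for x y
    using \<theta>(1) that by auto
  have \<theta>0: "\<theta> 0 = 0" using \<theta>(2)[rule_format, of 0] by (simp add: gen.\<iota>_0)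
  have \<theta>1: "\<theta> 1 = 1" using \<theta>(2)[rule_format, of 1] by (simp add: gen.\<iota>_1)
  have \<theta>_sum: "\<theta> (sum f I) = (\<Sum>i\<in>I. \<theta> (f i))" if "\<And>i. i \<in> I \<Longrightarrow> f i \<in> W" for f and I :: "nat set"
    using that by (induction I rule: infinite_finite_induct) (auto simp: \<theta>0 \<theta>_add is_subring_sum[OF W(1)])
  have \<theta>\<tau>: "\<theta> (\<tau> ^ m) = fps_X ^ m" for m
    by (induction m) (auto simp: \<theta>1 \<theta>_mult W(3) Wr(7) \<theta>(3))
  have constW: "fconst c \<in> W" for c using gen.khomD(3)[OF A(1)] W(2) by blast
  \<comment> \<open>The roles are exchanged on purpose: points of the orbit have the form
    \<open>g * \<mu> x * h\<close>, while the lattice construction conjugates as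
    \<open>G^-1 \<mu> G\<close>, so \<open>G\<close> comes from the inverse \<open>h\<close>. Both
    matrices are scaled by \<open>\<tau> ^ n\<close>, whence the exponent \<open>n + n\<close> of
    their product.\<close>
  define G where "G i j = \<theta> (\<tau> ^ n * h i j)" for i j
  define G' where "G' i j = \<theta> (\<tau> ^ n * g i j)" for i j
  have gW: "\<tau> ^ n * g i j \<in> W" and hW: "\<tau> ^ n * h i j \<in> W" if "i < d" "j < d" for i j
    using W(4) that by (auto simp: B0_def)
  have prod: "(\<Sum>a<d. \<theta> (\<tau> ^ n * u i a) * \<theta> (\<tau> ^ n * v a j)) = (if i = j then fps_X ^ (n + n) else 0)"
    if uW: "\<And>i j. i < d \<Longrightarrow> j < d \<Longrightarrow> \<tau> ^ n * u i j \<in> W" and vW: "\<And>i j. i < d \<Longrightarrow> j < d \<Longrightarrow> \<tau> ^ n * v i j \<in> W" and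
      "(\<Sum>a<d. u i a * v a j) = (if i = j then 1 else 0)" "i < d" "j < d" for u v :: "nat \<Rightarrow> nat \<Rightarrow> 'k mpoly fract" and i j
  proof -
    have "(\<Sum>a<d. \<theta> (\<tau> ^ n * u i a) * \<theta> (\<tau> ^ n * v a j)) = \<theta> (\<Sum>a<d. (\<tau> ^ n * u i a) * (\<tau> ^ n * v a j))"
    proof (subst \<theta>_sum)
      show "(\<tau> ^ n * u i a) * (\<tau> ^ n * v a j) \<in> W" if "a \<in> {..<d}" for a
        by (rule Wr(5)) (use that \<open>i < d\<close> \<open>j < d\<close> in \<open>auto intro: uW vW\<close>)
    qed (use uW vW that(4,5) in \<open>auto simp: \<theta>_mult\<close>)
    also have "(\<Sum>a<d. (\<tau> ^ n * u i a) * (\<tau> ^ n * v a j)) = \<tau> ^ (n + n) * (\<Sum>a<d. u i a * v a j)"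
      by (simp add: sum_distrib_left power_add mult_ac)
    finally show ?thesis using that(3) by (auto simp: \<theta>\<tau> \<theta>0)
  qed
  have N: "(\<Sum>b<d. (\<Sum>a<d. G' i a * fps_const (\<mu> x $$ (a, b))) * G b j) = fps_X ^ (n + n) * \<theta> (E x i j) \<and>
      fps_nth (\<theta> (E x i j)) 0 = \<nu> x $$ (i, j)" if ij: "i < d" "j < d" for x i j
  proof -
    have inner: "(\<Sum>a<d. \<tau> ^ n * g i a * fconst (\<mu> x $$ (a, b))) \<in> W \<and>
       \<theta> (\<Sum>a<d. \<tau> ^ n * g i a * fconst (\<mu> x $$ (a, b))) = (\<Sum>a<d. G' i a * fps_const (\<mu> x $$ (a, b)))" for b
    proof -
      have t: "\<tau> ^ n * g i a * fconst (\<mu> x $$ (a, b)) \<in> W" if "a < d" for a using gW[OF ij(1) that] constW by (rule Wr(5))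
      then show ?thesis using is_subring_sum[OF W(1), of "{..<d}"]
        by (subst \<theta>_sum) (auto simp: G'_def \<theta>_mult gW ij constW \<theta>(2))
    qed
    have "(\<Sum>b<d. (\<Sum>a<d. G' i a * fps_const (\<mu> x $$ (a, b))) * G b j) =
      \<theta> (\<Sum>b<d. (\<Sum>a<d. \<tau> ^ n * g i a * fconst (\<mu> x $$ (a, b))) * (\<tau> ^ n * h b j))"
    proof (subst \<theta>_sum)
      show "(\<Sum>a<d. \<tau> ^ n * g i a * fconst (\<mu> x $$ (a, b))) * (\<tau> ^ n * h b j) \<in> W" if "b \<in> {..<d}" for b
        by (rule Wr(5)) (use that inner hW[OF _ ij(2)] in auto)
    qed (use inner hW[OF _ ij(2)] in \<open>auto simp: \<theta>_mult G_def\<close>)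
    also have "(\<Sum>b<d. (\<Sum>a<d. \<tau> ^ n * g i a * fconst (\<mu> x $$ (a, b))) * (\<tau> ^ n * h b j)) = \<tau> ^ (n + n) * E x i j"
      by (simp add: E_def sum_distrib_left sum_distrib_right power_add mult_ac)
    also have "\<theta> (\<tau> ^ (n + n) * E x i j) = fps_X ^ (n + n) * \<theta> (E x i j)"
      using EA[OF ij] W(2) Wr(7)[OF W(3)] by (subst \<theta>_mult) (auto simp: \<theta>\<tau>)
    finally show ?thesis using \<theta>(4) EA[OF ij] \<phi>[OF ij] by auto
  qed
  show ?thesis
  proof (rule exI[of _ "n + n"], rule exI[of _ G], rule exI[of _ G'], rule exI[of _ "\<lambda>x i j. \<theta> (E x i j)"],
      intro conjI allI impI)
    fix i j assume ij: "i < d" "j < d"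
    show "(\<Sum>a<d. G' i a * G a j) = (if i = j then fps_X ^ (n + n) else 0)"
      unfolding G_def G'_def by (rule prod[where u = g and v = h, OF gW hW gh[OF ij] ij])
    show "(\<Sum>a<d. G i a * G' a j) = (if i = j then fps_X ^ (n + n) else 0)"
      unfolding G_def G'_def by (rule prod[where u = h and v = g, OF hW gW hg[OF ij] ij])
  next
    fix i j assume "i < d" "j < i"
    then show "G i j = 0" "G' i j = 0" using tri by (auto simp: G_def G'_def \<theta>0)
  qed (use N in auto)
qed

section \<open>Block matrices and vectors\<close>

lemma vec_split: "v \<in> carrier_vec (m + l) \<Longrightarrow> \<exists>u\<in>carrier_vec m. \<exists>t\<in>carrier_vec l. v = u @\<^sub>v t"
  for v :: "'a vec"
  using vec_first_last_append[of v m l] by (metis vec_first_carrier vec_last_carrier)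

lemma append_inj:
  assumes "u \<in> carrier_vec m" "u' \<in> carrier_vec m" "u @\<^sub>v v = u' @\<^sub>v v'" shows "u = u' \<and> v = v'"
  using append_vec_eq[OF assms(1,2)] assms(3) by blast

lemma mult_minus_distrib_vec:
  fixes M :: "'a::comm_ring_1 mat"
  assumes "M \<in> carrier_mat m n" "u \<in> carrier_vec n" "v \<in> carrier_vec n"
  shows "M *\<^sub>v (u - v) = M *\<^sub>v u - M *\<^sub>v v"
  using assms by (intro eq_vecI) (auto simp: scalar_prod_def right_diff_distrib sum_subtractf)

lemma smult_mat_mult_vec:
  fixes A :: "'k::field mat"
  assumes "A \<in> carrier_mat m n" "u \<in> carrier_vec n"
  shows "(c \<cdot>\<^sub>m A) *\<^sub>v u = c \<cdot>\<^sub>v (A *\<^sub>v u)"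
  using assms by (intro eq_vecI) (auto simp: scalar_prod_def sum_distrib_left mult.assoc intro!: sum.cong)

lemma mat_mult_index:
  fixes A :: "'k::comm_ring_1 mat"
  assumes "A \<in> carrier_mat m k" "B \<in> carrier_mat k l" "i < m" "j < l"
  shows "(A * B) $$ (i, j) = (\<Sum>c<k. A $$ (i, c) * B $$ (c, j))"
  using assms by (simp add: scalar_prod_def atLeast0LessThan)

lemma mat_vec_index:
  fixes M :: "'k::comm_ring_1 mat"
  assumes "M \<in> carrier_mat k m" "u \<in> carrier_vec m" "i < k"
  shows "(M *\<^sub>v u) $ i = (\<Sum>j<m. M $$ (i, j) * u $ j)"
  using assms by (simp add: scalar_prod_def atLeast0LessThan)

lemma diag_block_mult_vec:
  assumes A: "A \<in> carrier_mat r1 c1" and B: "B \<in> carrier_mat r2 c2"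
    and u: "u \<in> carrier_vec c1" and v: "v \<in> carrier_vec c2"
  shows "diag_block r1 c1 A r2 c2 B *\<^sub>v (u @\<^sub>v v) = (A *\<^sub>v u) @\<^sub>v (B *\<^sub>v v)"
proof -
  have z: "0\<^sub>m r c *\<^sub>v w = 0\<^sub>v r" if "w \<in> carrier_vec c" for r c and w :: "'a vec"
    using that by (intro eq_vecI) auto
  have "diag_block r1 c1 A r2 c2 B *\<^sub>v (u @\<^sub>v v) =
      (A *\<^sub>v u + 0\<^sub>m r1 c2 *\<^sub>v v) @\<^sub>v (0\<^sub>m r2 c1 *\<^sub>v u + B *\<^sub>v v)"
    unfolding diag_block_def by (rule four_block_mat_mult_vec[OF A _ _ B u v]) auto
  also have "\<dots> = (A *\<^sub>v u) @\<^sub>v (B *\<^sub>v v)"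
    unfolding z[OF u] z[OF v] using mult_mat_vec_carrier[OF A u] mult_mat_vec_carrier[OF B v] by simp
  finally show ?thesis .
qed

lemma incl_carrier: "incl_mat l \<in> carrier_mat (l + 1) l"
  unfolding incl_mat_def by (rule mat_carrier)

lemma incl_mult_vec:
  assumes "t \<in> carrier_vec l" "i < l + 1"
  shows "(incl_mat l *\<^sub>v t) $ i = (if i < l then t $ i else 0)"
proof -
  have "(incl_mat l *\<^sub>v t) $ i = (\<Sum>j<l. (if i = j then 1 else 0) * t $ j)"
    using assms by (simp add: incl_mat_def scalar_prod_def atLeast0LessThan)
  also have "\<dots> = (\<Sum>j<l. if j = i then t $ i else 0)" by (intro sum.cong) auto
  finally show ?thesis by simp
qed

lemma diag_block_carrier:
  assumes "A \<in> carrier_mat r1 c1" "B \<in> carrier_mat r2 c2"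
  shows "diag_block r1 c1 A r2 c2 B \<in> carrier_mat (r1 + r2) (c1 + c2)"
  unfolding diag_block_def by (rule four_block_carrier_mat[OF assms])

lemma sum_lessThan_add: "(\<Sum>j<m + n. f j) = (\<Sum>j<m. f j) + (\<Sum>j<n. f (m + j))"
  for f :: "nat \<Rightarrow> 'a::comm_monoid_add"
  by (induction n) (auto simp: add.assoc)

lemma mult_append_vec:
  fixes M :: "'a::comm_ring_1 mat"
  assumes "M \<in> carrier_mat k (m + l)" "u \<in> carrier_vec m" "c \<in> carrier_vec l" "i < k"
  shows "(M *\<^sub>v (u @\<^sub>v c)) $ i = (\<Sum>j<m. M $$ (i, j) * u $ j) + (\<Sum>j<l. M $$ (i, m + j) * c $ j)"
proof -
  have "(M *\<^sub>v (u @\<^sub>v c)) $ i = (\<Sum>j<m + l. M $$ (i, j) * (u @\<^sub>v c) $ j)"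
    using assms by (simp add: scalar_prod_def atLeast0LessThan)
  also have "\<dots> = (\<Sum>j<m. M $$ (i, j) * u $ j) + (\<Sum>j<l. M $$ (i, m + j) * c $ j)"
    unfolding sum_lessThan_add using assms by (intro arg_cong2[where f = "(+)"] sum.cong) auto
  finally show ?thesis .
qed

lemma mat_eqI_append:
  fixes H1 H2 :: "'a::comm_ring_1 mat"
  assumes "H1 \<in> carrier_mat k (m + l)" "H2 \<in> carrier_mat k (m + l)"
    "\<And>u c. u \<in> carrier_vec m \<Longrightarrow> c \<in> carrier_vec l \<Longrightarrow> H1 *\<^sub>v (u @\<^sub>v c) = H2 *\<^sub>v (u @\<^sub>v c)"
  shows "H1 = H2"
proof (rule eq_matI)
  fix i j assume ij: "i < dim_row H2" "j < dim_col H2"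
  obtain u c where uc: "u \<in> carrier_vec m" "c \<in> carrier_vec l" "(unit_vec (m + l) j :: 'a vec) = u @\<^sub>v c"
    using vec_split[OF unit_vec_carrier, of m l j] by blast
  have "(H1 *\<^sub>v unit_vec (m + l) j) $ i = (H2 *\<^sub>v unit_vec (m + l) j) $ i"
    unfolding uc(3) assms(3)[OF uc(1,2)] ..
  then show "H1 $$ (i, j) = H2 $$ (i, j)" using ij assms(1,2) by simp
qed (use assms in auto)

lemma mat_eq_if_vec_eq:
  fixes H1 H2 :: "'k::field mat"
  assumes "H1 \<in> carrier_mat m n" "H2 \<in> carrier_mat m n" "\<And>u. u \<in> carrier_vec n \<Longrightarrow> H1 *\<^sub>v u = H2 *\<^sub>v u"
  shows "H1 = H2"
proof (rule eq_matI)
  fix i j assume ij: "i < dim_row H2" "j < dim_col H2"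
  then have "(H1 *\<^sub>v unit_vec n j) $ i = (H2 *\<^sub>v unit_vec n j) $ i" using assms(3) by simp
  then show "H1 $$ (i, j) = H2 $$ (i, j)" using ij assms(1,2) by simp
qed (use assms in auto)

section \<open>Exact sequences from a curve\<close>

lemma sum_fun_apply: "(sum f I) x = (\<Sum>i\<in>I. f i x)"
  by (induction I rule: infinite_finite_induct) (auto simp: plus_fun_def zero_fun_def)

lemma fps_const_sum: "fps_const (sum f I) = (\<Sum>i\<in>I. fps_const (f i))"
  by (induction I rule: infinite_finite_induct) (auto simp flip: fps_const_add)

definition fscale :: "'k::field \<Rightarrow> (nat \<Rightarrow> 'k fps) \<Rightarrow> nat \<Rightarrow> 'k fps" where
  "fscale c w = (\<lambda>i. fps_const c * w i)"

text \<open>For fixed \<open>B\<close> this is the coordinate map from \<open>k^r\<close> to vectors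
  of power series. The modules of the theorem live on coordinate spaces, so the subspaces below are
  accessed through such maps.\<close>

definition comb :: "nat \<Rightarrow> (nat \<Rightarrow> nat \<Rightarrow> 'k::field fps) \<Rightarrow> 'k vec \<Rightarrow> nat \<Rightarrow> 'k fps" where
  "comb r B u = (\<lambda>i. \<Sum>p<r. fps_const (u $ p) * B p i)"

lemma vector_space_fscale: "vector_space (fscale :: 'k::field \<Rightarrow> _)"
  by unfold_locales
    (auto simp: fscale_def fun_eq_iff algebra_simps fps_const_add[symmetric] fps_const_mult[symmetric]
      simp del: fps_const_add fps_const_mult)

text \<open>A maximal independent subset of \<open>S\<close> is finite because it lies in the span
  of \<open>T\<close>; its enumeration is the basis \<open>B\<close>.\<close>

lemma comb_coordinates:
  fixes S :: "(nat \<Rightarrow> 'k::field fps) set"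
  assumes S: "module.subspace fscale S" and T: "finite T" "S \<subseteq> module.span fscale T"
  shows "\<exists>r B. (\<forall>u\<in>carrier_vec r. comb r B u \<in> S) \<and> (\<forall>w\<in>S. \<exists>u\<in>carrier_vec r. comb r B u = w) \<and>
    (\<forall>u\<in>carrier_vec r. comb r B u = (\<lambda>_. 0) \<longrightarrow> u = 0\<^sub>v r)"
proof -
  interpret vector_space "fscale :: 'k \<Rightarrow> _" by (rule vector_space_fscale)
  obtain C where C: "C \<subseteq> S" "independent C" "S \<subseteq> span C" by (rule maximal_independent_subset)
  have finC: "finite C" using independent_span_bound[OF T(1) C(2)] C(1) T(2) by auto
  obtain B where B: "bij_betw B {..<card C} C"
    using ex_bij_betw_nat_finite[OF finC] by (auto simp: atLeast0LessThan)
  define r where "r = card C"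
  have comb_eq: "comb r B u = (\<Sum>p<r. fscale (u $ p) (B p))" for u
    by (rule ext) (simp add: comb_def fscale_def sum_fun_apply)
  have comb_C: "comb r B u = (\<Sum>v\<in>C. fscale (u $ (the_inv_into {..<r} B v)) v)" for u
  proof -
    let ?F = "\<lambda>v. fscale (u $ (the_inv_into {..<r} B v)) v"
    have "inj_on B {..<r}" using B by (simp add: r_def bij_betw_def)
    then have "comb r B u = (\<Sum>p<r. ?F (B p))"
      unfolding comb_eq by (intro sum.cong) (simp_all add: the_inv_into_f_f)
    also have "\<dots> = sum ?F C" using sum.reindex_bij_betw[OF B, of ?F] by (simp add: r_def)
    finally show ?thesis .
  qed
  show ?thesis
  proof (intro exI[of _ r] exI[of _ B] conjI ballI impI)
    fix u :: "'k vec" assume u: "u \<in> carrier_vec r"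
    show "comb r B u \<in> S" unfolding comb_C using C(1) by (intro subspace_sum[OF S] subspace_scale[OF S]) auto
    assume "comb r B u = (\<lambda>_. 0)"
    then have "(\<Sum>v\<in>C. fscale (u $ (the_inv_into {..<r} B v)) v) = 0" by (simp add: comb_C zero_fun_def)
    then have z: "u $ (the_inv_into {..<r} B v) = 0" if "v \<in> C" for v
      using independentD[OF C(2) finC order.refl, of "\<lambda>v. u $ (the_inv_into {..<r} B v)" v] that by blast
    show "u = 0\<^sub>v r"
    proof (rule eq_vecI)
      fix p assume p: "p < dim_vec (0\<^sub>v r :: 'k vec)"
      then have "B p \<in> C" "the_inv_into {..<r} B (B p) = p"
        using B the_inv_into_f_f[of B "{..<r}" p] by (auto simp: r_def bij_betw_def)
      then show "u $ p = 0\<^sub>v r $ p" using z[of "B p"] p by simp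
    qed (use u in auto)
  next
    fix w assume "w \<in> S"
    then have "w \<in> span C" using C by auto
    then obtain c where c: "w = (\<Sum>v\<in>C. fscale (c v) v)" unfolding span_finite[OF finC] by auto
    show "\<exists>u\<in>carrier_vec r. comb r B u = w"
    proof (intro bexI[of _ "vec r (\<lambda>p. c (B p))"])
      have "the_inv_into {..<r} B v < r" "B (the_inv_into {..<r} B v) = v" if "v \<in> C" for v
        using B that the_inv_into_into[of B "{..<r}" v] f_the_inv_into_f[of B "{..<r}" v]
        by (auto simp: r_def bij_betw_def)
      then show "comb r B (vec r (\<lambda>p. c (B p))) = w" unfolding comb_C c by (intro sum.cong) auto
    qed auto
  qed
qed

lemma comb_linear:
  assumes "u \<in> carrier_vec r" "v \<in> carrier_vec r"
  shows "comb r B (u + v) = (\<lambda>i. comb r B u i + comb r B v i)" "comb r B (c \<cdot>\<^sub>v u) = (\<lambda>i. fps_const c * comb r B u i)"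
    "comb r B (0\<^sub>v r) = (\<lambda>_. 0)"
proof -
  have "comb r B (u + v) i = comb r B u i + comb r B v i" for i
    unfolding comb_def sum.distrib[symmetric]
    by (intro sum.cong) (use assms in \<open>auto simp: fps_const_add[symmetric] distrib_right simp del: fps_const_add\<close>)
  then show "comb r B (u + v) = (\<lambda>i. comb r B u i + comb r B v i)" by blast
  have "comb r B (c \<cdot>\<^sub>v u) i = fps_const c * comb r B u i" for i
    unfolding comb_def sum_distrib_left
    by (intro sum.cong) (use assms in \<open>auto simp: fps_const_mult[symmetric] mult.assoc simp del: fps_const_mult\<close>)
  then show "comb r B (c \<cdot>\<^sub>v u) = (\<lambda>i. fps_const c * comb r B u i)" by blast
  show "comb r B (0\<^sub>v r) = (\<lambda>_. 0)" by (simp add: comb_def)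
qed

lemma comb_mult_mat_vec:
  fixes H :: "'k::field mat"
  assumes H: "H \<in> carrier_mat r' r" and u: "u \<in> carrier_vec r"
  shows "comb r' B' (H *\<^sub>v u) i = (\<Sum>p<r. fps_const (u $ p) * comb r' B' (col H p) i)"
proof -
  have "fps_const ((H *\<^sub>v u) $ q) = (\<Sum>p<r. fps_const (u $ p) * fps_const (H $$ (q, p)))" if "q < r'" for q
  proof -
    have "(H *\<^sub>v u) $ q = (\<Sum>p<r. u $ p * H $$ (q, p))"
      using that H u by (auto simp: scalar_prod_def atLeast0LessThan mult.commute intro!: sum.cong)
    then show ?thesis by (simp add: fps_const_sum)
  qed
  then have "comb r' B' (H *\<^sub>v u) i = (\<Sum>q<r'. \<Sum>p<r. fps_const (u $ p) * fps_const (H $$ (q, p)) * B' q i)"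
    unfolding comb_def by (intro sum.cong) (auto simp: sum_distrib_right)
  also have "\<dots> = (\<Sum>p<r. \<Sum>q<r'. fps_const (u $ p) * fps_const (H $$ (q, p)) * B' q i)" by (rule sum.swap)
  also have "\<dots> = (\<Sum>p<r. fps_const (u $ p) * comb r' B' (col H p) i)"
    unfolding comb_def sum_distrib_left using H by (intro sum.cong) (auto simp: mult.assoc)
  finally show ?thesis .
qed

text \<open>Linearity is expressed against \<open>comb\<close>, the form in which it is used: the
  columns of the matrix of \<open>f\<close> are then the coordinates of the vectors
  \<open>f (B p)\<close>.\<close>

definition klin :: "((nat \<Rightarrow> 'k::field fps) \<Rightarrow> nat \<Rightarrow> 'k fps) \<Rightarrow> bool" where
  "klin f \<longleftrightarrow> (\<forall>r B u. f (comb r B u) = comb r (\<lambda>p. f (B p)) u)"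

lemma matrix_of_klin:
  fixes f :: "(nat \<Rightarrow> 'k::field fps) \<Rightarrow> nat \<Rightarrow> 'k fps"
  assumes f: "klin f" and im: "\<And>u. u \<in> carrier_vec r \<Longrightarrow> \<exists>v\<in>carrier_vec r'. comb r' B' v = f (comb r B u)"
  shows "\<exists>H\<in>carrier_mat r' r. \<forall>u\<in>carrier_vec r. comb r' B' (H *\<^sub>v u) = f (comb r B u)"
proof -
  have "\<exists>v. p < r \<longrightarrow> v \<in> carrier_vec r' \<and> comb r' B' v = f (B p)" for p
  proof (cases "p < r")
    case True
    have "comb r B (unit_vec r p) i = B p i" for i
    proof -
      have "comb r B (unit_vec r p) i = (\<Sum>q<r. if q = p then B q i else 0)"
        unfolding comb_def by (intro sum.cong) (use True in \<open>auto simp: unit_vec_def\<close>)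
      then show ?thesis using True by simp
    qed
    then have "comb r B (unit_vec r p) = B p" by blast
    then show ?thesis using im[of "unit_vec r p"] by auto
  qed auto
  then have "\<forall>p. \<exists>v. p < r \<longrightarrow> v \<in> carrier_vec r' \<and> comb r' B' v = f (B p)" ..
  from choice[OF this] obtain v where v: "\<And>p. p < r \<Longrightarrow> v p \<in> carrier_vec r'" "\<And>p. p < r \<Longrightarrow> comb r' B' (v p) = f (B p)"
    by auto
  define H where "H = mat r' r (\<lambda>(i, j). v j $ i)"
  have H: "H \<in> carrier_mat r' r" by (simp add: H_def)
  have col: "col H p = v p" if "p < r" for p using v(1)[OF that] that by (intro eq_vecI) (auto simp: H_def)
  show ?thesis
  proof (intro bexI[OF _ H] ballI ext)
    fix u :: "'k vec" and i assume u: "u \<in> carrier_vec r"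
    have "comb r' B' (H *\<^sub>v u) i = (\<Sum>p<r. fps_const (u $ p) * f (B p) i)"
      unfolding comb_mult_mat_vec[OF H u] by (intro sum.cong) (auto simp: col v)
    also have "\<dots> = f (comb r B u) i" using f unfolding klin_def by (simp add: comb_def)
    finally show "comb r' B' (H *\<^sub>v u) i = f (comb r B u) i" .
  qed
qed

text \<open>\<open>G\<close> is a curve in the upper triangular group with inverse \<open>X ^ -n G'\<close>, and \<open>N\<close> is the conjugate of
  \<open>\<mu>\<close> along it.\<close>
locale zwara =
  fixes scal :: "'k::field \<Rightarrow> 'a::ring_1 \<Rightarrow> 'a" and d n :: nat and \<mu> \<nu> :: "'a \<Rightarrow> 'k mat"
    and G G' :: "nat \<Rightarrow> nat \<Rightarrow> 'k fps" and N :: "'a \<Rightarrow> nat \<Rightarrow> nat \<Rightarrow> 'k fps"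
  assumes \<mu>: "is_rep scal d \<mu>" "\<And>x. upper_tri d (\<mu> x)" and \<nu>: "is_rep scal d \<nu>" "\<And>x. upper_tri d (\<nu> x)"
    and G'G: "\<And>i j. i < d \<Longrightarrow> j < d \<Longrightarrow> (\<Sum>a<d. G' i a * G a j) = (if i = j then fps_X ^ n else 0)"
    and GG': "\<And>i j. i < d \<Longrightarrow> j < d \<Longrightarrow> (\<Sum>a<d. G i a * G' a j) = (if i = j then fps_X ^ n else 0)"
    and tri: "\<And>i j. i < d \<Longrightarrow> j < i \<Longrightarrow> G i j = 0" "\<And>i j. i < d \<Longrightarrow> j < i \<Longrightarrow> G' i j = 0"
    and N: "\<And>x i j. i < d \<Longrightarrow> j < d \<Longrightarrow>
      (\<Sum>b<d. (\<Sum>a<d. G' i a * fps_const (\<mu> x $$ (a, b))) * G b j) = fps_X ^ n * N x i j"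
    and N0: "\<And>x i j. i < d \<Longrightarrow> j < d \<Longrightarrow> fps_nth (N x i j) 0 = \<nu> x $$ (i, j)"
begin

text \<open>Multiplying the defining equation of \<open>N\<close> by \<open>G'\<close> from the
  right produces \<open>G G' = X^n\<close>, and cancelling this power gives
  \<open>G' \<mu> = N G'\<close>. Thus \<open>gp\<close> carries the action by \<mu> to one by
  \<open>N\<close>, which has no poles.\<close>

lemma intertwine:
  assumes "i < d" "b < d"
  shows "(\<Sum>a<d. G' i a * fps_const (\<mu> x $$ (a, b))) = (\<Sum>c<d. N x i c * G' c b)"
proof -
  let ?L = "\<lambda>b. \<Sum>a<d. G' i a * fps_const (\<mu> x $$ (a, b))"
  have "fps_X ^ n * ?L b = (\<Sum>b'<d. if b' = b then fps_X ^ n * ?L b else 0)" using assms(2) by simp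
  also have "\<dots> = (\<Sum>b'<d. ?L b' * (\<Sum>j<d. G b' j * G' j b))"
    using assms(2) by (intro sum.cong refl) (simp add: GG' mult.commute)
  also have "\<dots> = (\<Sum>b'<d. \<Sum>j<d. ?L b' * G b' j * G' j b)" by (simp only: sum_distrib_left mult.assoc)
  also have "\<dots> = (\<Sum>j<d. (\<Sum>b'<d. ?L b' * G b' j) * G' j b)"
    by (subst sum.swap) (simp only: sum_distrib_right)
  also have "\<dots> = (\<Sum>j<d. fps_X ^ n * (N x i j * G' j b))"
    using assms(1) by (intro sum.cong refl) (simp add: N mult.assoc)
  also have "\<dots> = fps_X ^ n * (\<Sum>c<d. N x i c * G' c b)" by (simp only: sum_distrib_left)
  finally show ?thesis by simp
qed

text \<open>Up to the factor \<open>X^n\<close> these are the coordinates of \<open>w\<close> with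
  respect to the columns of \<open>G\<close>, as \<open>G'\<close> is \<open>X^n\<close> times the
  inverse of \<open>G\<close>.\<close>

definition gp :: "(nat \<Rightarrow> 'k fps) \<Rightarrow> nat \<Rightarrow> 'k fps" where
  "gp w i = (\<Sum>j<d. G' i j * w j)"

definition act :: "'a \<Rightarrow> (nat \<Rightarrow> 'k fps) \<Rightarrow> nat \<Rightarrow> 'k fps" where
  "act x w = (\<lambda>i. if i < d then \<Sum>j<d. fps_const (\<mu> x $$ (i, j)) * w j else 0)"

text \<open>Truncated representatives of \<open>G k[[X]]^l / X^m k[[X]]^l\<close>, as \<open>w\<close> lies in \<open>G k[[X]]^d\<close> iff
  \<open>X^n\<close> divides \<open>gp w\<close>. The module \<open>X_l\<close> will be \<open>S n l\<close>, and \<open>S (n + 1) l\<close> is \<open>X_l\<close> plus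
  \<open>X^n k^l\<close>, that is, a copy of \<open>X_l \<oplus> M_l\<close>.\<close>
definition S :: "nat \<Rightarrow> nat \<Rightarrow> (nat \<Rightarrow> 'k fps) set" where
  "S m l = {w. (\<forall>i\<ge>l. w i = 0) \<and> (\<forall>i. \<forall>k\<ge>m. fps_nth (w i) k = 0) \<and> (\<forall>i<d. \<forall>k<n. fps_nth (gp w i) k = 0)}"

lemma gp_comb: "gp (comb r B u) i = (\<Sum>p<r. fps_const (u $ p) * gp (B p) i)"
  unfolding gp_def comb_def sum_distrib_left by (subst sum.swap) (simp add: mult_ac)

lemma gp_act: assumes "i < d" shows "gp (act x w) i = (\<Sum>c<d. N x i c * gp w c)"
proof -
  have "gp (act x w) i = (\<Sum>a<d. \<Sum>b<d. G' i a * fps_const (\<mu> x $$ (a, b)) * w b)"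
    unfolding gp_def act_def sum_distrib_left by (intro sum.cong) (auto simp: sum_distrib_left mult_ac)
  also have "\<dots> = (\<Sum>b<d. (\<Sum>a<d. G' i a * fps_const (\<mu> x $$ (a, b))) * w b)"
    by (subst sum.swap) (simp only: sum_distrib_right)
  also have "\<dots> = (\<Sum>b<d. (\<Sum>c<d. N x i c * G' c b) * w b)"
    using assms by (intro sum.cong refl) (simp add: intertwine)
  also have "\<dots> = (\<Sum>c<d. N x i c * gp w c)"
    unfolding gp_def sum_distrib_left sum_distrib_right by (subst sum.swap) (simp add: mult_ac)
  finally show ?thesis .
qed

lemma klin_act: "klin (act x)"
  unfolding klin_def
proof (intro allI ext)
  fix r B u i
  show "act x (comb r B u) i = comb r (\<lambda>p. act x (B p)) u i"
  proof (cases "i < d")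
    case True
    have "act x (comb r B u) i = (\<Sum>j<d. \<Sum>p<r. fps_const (\<mu> x $$ (i, j)) * (fps_const (u $ p) * B p j))"
      using True by (simp add: act_def comb_def sum_distrib_left)
    also have "\<dots> = (\<Sum>p<r. \<Sum>j<d. fps_const (\<mu> x $$ (i, j)) * (fps_const (u $ p) * B p j))" by (rule sum.swap)
    also have "\<dots> = comb r (\<lambda>p. act x (B p)) u i"
      using True unfolding comb_def act_def by (simp add: sum_distrib_left mult_ac)
    finally show ?thesis .
  qed (simp add: act_def comb_def)
qed

definition shift :: "(nat \<Rightarrow> 'k fps) \<Rightarrow> nat \<Rightarrow> 'k fps" where "shift w = (\<lambda>i. fps_X * w i)"

lemma klin_shift: "klin shift"
  unfolding klin_def shift_def comb_def by (auto simp: sum_distrib_left mult_ac)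

lemma klin_id: "klin (\<lambda>w. w)" by (simp add: klin_def)

text \<open>The support is preserved because \<mu> is triangular, and divisibility of
  \<open>gp\<close> by \<open>X^n\<close> because \<open>N\<close> has power series entries.\<close>

lemma act_S:
  assumes w: "w \<in> S m l" and "l \<le> d" shows "act x w \<in> S m l"
proof -
  have supp: "act x w i = 0" if "l \<le> i" for i
  proof (cases "i < d")
    case True
    have "fps_const (\<mu> x $$ (i, j)) * w j = 0" if j: "j < d" for j
    proof (cases "j < l")
      case jl: True
      then have "\<mu> x $$ (i, j) = 0" using \<mu>(2)[of x] True j \<open>l \<le> i\<close> unfolding upper_tri_def by auto
      then show ?thesis by simp
    next
      case False
      then show ?thesis using w by (auto simp: S_def)
    qed
    then have "(\<Sum>j<d. fps_const (\<mu> x $$ (i, j)) * w j) = 0" by (intro sum.neutral) auto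
    then show ?thesis by (simp add: act_def)
  qed (simp add: act_def)
  have deg: "fps_nth (act x w i) k = 0" if "m \<le> k" for i k
    using w that by (auto simp: act_def S_def fps_sum_nth)
  have "fps_nth (gp (act x w) i) k = 0" if "i < d" "k < n" for i k
    using w that by (simp add: gp_act fps_sum_nth fps_mult_nth S_def)
  with supp deg show ?thesis by (auto simp: S_def)
qed

text \<open>As \<open>gp w\<close> is divisible by \<open>X^n\<close>, the coefficient of
  \<open>X^n\<close> sees only the constant term of \<open>N\<close>, which is \<nu>. This makes the
  map \<open>b\<close> equivariant.\<close>

lemma gp_act_n:
  assumes w: "w \<in> S m l" and "i < d"
  shows "fps_nth (gp (act x w) i) n = (\<Sum>c<d. \<nu> x $$ (i, c) * fps_nth (gp w c) n)"
proof -
  have "fps_nth (N x i c * gp w c) n = \<nu> x $$ (i, c) * fps_nth (gp w c) n" if c: "c < d" for c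
  proof -
    have "fps_nth (N x i c * gp w c) n = (\<Sum>k=0..n. if k = 0 then \<nu> x $$ (i, c) * fps_nth (gp w c) n else 0)"
      unfolding fps_mult_nth
    proof (intro sum.cong refl)
      fix k assume "k \<in> {0..n}"
      show "fps_nth (N x i c) k * fps_nth (gp w c) (n - k) =
          (if k = 0 then \<nu> x $$ (i, c) * fps_nth (gp w c) n else 0)"
      proof (cases "k = 0")
        case False
        then have "n - k < n" using \<open>k \<in> {0..n}\<close> by auto
        then show ?thesis using False w c by (auto simp: S_def)
      qed (use N0[OF assms(2) c] in simp)
    qed
    then show ?thesis by simp
  qed
  then show ?thesis using assms(2) by (simp add: gp_act fps_sum_nth)
qed

lemma gp_supp:
  assumes w: "w \<in> S m l" and "l \<le> i" "i < d" shows "gp w i = 0"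
proof -
  have "G' i j * w j = 0" if "j < d" for j
    using w assms(2,3) tri(2)[of i j] by (cases "j < l") (auto simp: S_def)
  then show ?thesis unfolding gp_def by (intro sum.neutral) auto
qed

text \<open>The vectors \<open>X^n\<close> times a unit vector. Those with \<open>i < l\<close> span
  the complement of \<open>S n l\<close> in \<open>S (Suc n) l\<close> that carries the module
  \<open>M_l\<close>.\<close>

definition E :: "nat \<Rightarrow> nat \<Rightarrow> 'k fps" where "E i = (\<lambda>j. if j = i then fps_X ^ n else 0)"

definition plus_basis :: "nat \<Rightarrow> (nat \<Rightarrow> nat \<Rightarrow> 'k fps) \<Rightarrow> nat \<Rightarrow> nat \<Rightarrow> 'k fps" where
  "plus_basis r B = (\<lambda>p. if p < r then B p else E (p - r))"

lemma comb_E: "comb l E v i = (if i < l then fps_const (v $ i) * fps_X ^ n else 0)"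
proof -
  have "comb l E v i = (\<Sum>p<l. if p = i then fps_const (v $ i) * fps_X ^ n else 0)"
    unfolding comb_def E_def by (intro sum.cong) auto
  then show ?thesis by simp
qed

lemma comb_plus:
  assumes "u \<in> carrier_vec r" "v \<in> carrier_vec l"
  shows "comb (r + l) (plus_basis r B) (u @\<^sub>v v) i = comb r B u i + comb l E v i"
proof -
  have "comb (r + l) (plus_basis r B) (u @\<^sub>v v) i =
     (\<Sum>p<r. fps_const ((u @\<^sub>v v) $ p) * plus_basis r B p i) + (\<Sum>p<l. fps_const ((u @\<^sub>v v) $ (r + p)) * plus_basis r B (r + p) i)"
    unfolding comb_def
    by (induction l) (auto simp: add.assoc)
  also have "(\<Sum>p<r. fps_const ((u @\<^sub>v v) $ p) * plus_basis r B p i) = comb r B u i"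
    unfolding comb_def by (intro sum.cong) (use assms in \<open>auto simp: plus_basis_def\<close>)
  also have "(\<Sum>p<l. fps_const ((u @\<^sub>v v) $ (r + p)) * plus_basis r B (r + p) i) = comb l E v i"
    unfolding comb_def by (intro sum.cong) (use assms in \<open>auto simp: plus_basis_def\<close>)
  finally show ?thesis .
qed

lemma subspace_S: "module.subspace fscale (S m l)"
proof -
  interpret vector_space "fscale :: 'k \<Rightarrow> _" by (rule vector_space_fscale)
  have gp_add: "gp (u + v) i = gp u i + gp v i" for u v i
    by (simp add: gp_def distrib_left sum.distrib)
  have gp_scale: "gp (fscale c u) i = fps_const c * gp u i" for c u i
    by (simp add: gp_def fscale_def sum_distrib_left mult_ac)
  show ?thesis
    by (rule subspaceI) (auto simp: S_def gp_add gp_scale, auto simp: fscale_def gp_def)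
qed

lemma coordinates_S:
  "\<exists>r B. (\<forall>u\<in>carrier_vec r. comb r B u \<in> S m l) \<and> (\<forall>w\<in>S m l. \<exists>u\<in>carrier_vec r. comb r B u = w) \<and>
    (\<forall>u\<in>carrier_vec r. comb r B u = (\<lambda>_. 0) \<longrightarrow> u = 0\<^sub>v r)"
proof -
  interpret vector_space "fscale :: 'k \<Rightarrow> _" by (rule vector_space_fscale)
  define e where "e = (\<lambda>(i::nat, k) j. if j = i then (fps_X :: 'k fps) ^ k else 0)"
  define T where "T = e ` ({..<l} \<times> {..<m})"
  have "w \<in> span T" if w: "w \<in> S m l" for w
  proof -
    have "w = (\<Sum>i<l. \<Sum>k<m. fscale (fps_nth (w i) k) (e (i, k)))"
    proof
      fix j
      have "(\<Sum>i<l. \<Sum>k<m. fscale (fps_nth (w i) k) (e (i, k))) j =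
         (\<Sum>i<l. if i = j then \<Sum>k<m. fps_const (fps_nth (w i) k) * fps_X ^ k else 0)"
        unfolding sum_fun_apply by (intro sum.cong) (auto simp: fscale_def e_def)
      also have "\<dots> = (if j < l then \<Sum>k<m. fps_const (fps_nth (w j) k) * fps_X ^ k else 0)" by simp
      also have "\<dots> = w j"
      proof (cases "j < l")
        case True
        have "fps_nth (\<Sum>k<m. fps_const (fps_nth (w j) k) * fps_X ^ k) q = fps_nth (w j) q" for q
        proof -
          have "fps_nth (\<Sum>k<m. fps_const (fps_nth (w j) k) * fps_X ^ k) q = (\<Sum>k<m. if k = q then fps_nth (w j) k else 0)"
            unfolding fps_sum_nth by (intro sum.cong) (auto simp: fps_X_power_nth)
          then show ?thesis using w by (auto simp: S_def)
        qed
        then show ?thesis using True by (simp add: fps_eq_iff)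
      qed (use w in \<open>auto simp: S_def\<close>)
      finally show "w j = (\<Sum>i<l. \<Sum>k<m. fscale (fps_nth (w i) k) (e (i, k))) j" by simp
    qed
    also have "\<dots> \<in> span T" by (intro span_sum span_scale span_base) (auto simp: T_def)
    finally show ?thesis .
  qed
  then show ?thesis by (intro comb_coordinates[OF subspace_S, of T]) (auto simp: T_def)
qed

lemma shift_S: "w \<in> S n l \<Longrightarrow> shift w \<in> S (Suc n) l"
proof -
  assume w: "w \<in> S n l"
  have gps: "gp (shift w) i = fps_X * gp w i" for i by (simp add: gp_def shift_def sum_distrib_left mult_ac)
  show ?thesis using w unfolding S_def mem_Collect_eq gps
    by (auto simp: shift_def)
qed

lemma E_S:
  assumes "l \<le> d" shows "comb l E v \<in> S (Suc n) l"
proof -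
  have "gp (comb l E v) i = fps_X ^ n * (\<Sum>j<d. G' i j * (if j < l then fps_const (v $ j) else 0))" for i
    unfolding gp_def comb_E sum_distrib_left by (intro sum.cong) (auto simp: mult_ac)
  then show ?thesis by (auto simp: S_def comb_E fps_X_power_mult_nth fps_X_power_nth)
qed

lemma S_Suc: "w \<in> S n l \<Longrightarrow> w \<in> S (Suc n) l" by (auto simp: S_def)

lemma S_l_mono: "w \<in> S m l \<Longrightarrow> l \<le> l' \<Longrightarrow> w \<in> S m l'" by (auto simp: S_def)

text \<open>The coefficients of \<open>X^n\<close> split off: what remains after subtracting them
  has degree below \<open>n\<close> and still lies in the lattice, because \<open>X^n k^l\<close>
  does.\<close>

lemma coordinates_S_plus:
  assumes "l \<le> d" and B: "\<And>u. u \<in> carrier_vec r \<Longrightarrow> comb r B u \<in> S n l"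
    "\<And>w. w \<in> S n l \<Longrightarrow> \<exists>u\<in>carrier_vec r. comb r B u = w"
    "\<And>u. u \<in> carrier_vec r \<Longrightarrow> comb r B u = (\<lambda>_. 0) \<Longrightarrow> u = 0\<^sub>v r"
  shows "v \<in> carrier_vec (r + l) \<Longrightarrow> comb (r + l) (plus_basis r B) v \<in> S (Suc n) l"
    "w \<in> S (Suc n) l \<Longrightarrow> \<exists>v\<in>carrier_vec (r + l). comb (r + l) (plus_basis r B) v = w"
    "v \<in> carrier_vec (r + l) \<Longrightarrow> comb (r + l) (plus_basis r B) v = (\<lambda>_. 0) \<Longrightarrow> v = 0\<^sub>v (r + l)"
proof -
  interpret vector_space "fscale :: 'k \<Rightarrow> _" by (rule vector_space_fscale)
  have sum_S: "(\<lambda>i. a i + b i) \<in> S m l" if "a \<in> S m l" "b \<in> S m l" for a b m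
    using subspace_add[OF subspace_S that] by (simp add: plus_fun_def)
  show "comb (r + l) (plus_basis r B) v \<in> S (Suc n) l" if "v \<in> carrier_vec (r + l)" for v
  proof -
    obtain u t where v: "u \<in> carrier_vec r" "t \<in> carrier_vec l" "v = u @\<^sub>v t" using vec_split[OF \<open>v \<in> carrier_vec (r + l)\<close>] by auto
    have "comb (r + l) (plus_basis r B) v = (\<lambda>i. comb r B u i + comb l E t i)"
      unfolding v(3) using comb_plus[OF v(1,2)] by blast
    then show ?thesis using sum_S[OF S_Suc[OF B(1)[OF v(1)]] E_S[OF assms(1)]] by simp
  qed
  show "\<exists>v\<in>carrier_vec (r + l). comb (r + l) (plus_basis r B) v = w" if w: "w \<in> S (Suc n) l" for w
  proof -
    define t where "t = vec l (\<lambda>i. fps_nth (w i) n)"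
    define q where "q = (\<lambda>i. w i - comb l E t i)"
    have gq: "gp q i = gp w i - gp (comb l E t) i" for i
      by (simp add: gp_def q_def right_diff_distrib sum_subtractf)
    have "q \<in> S n l" unfolding S_def mem_Collect_eq
    proof (intro conjI allI impI)
      show "q i = 0" if "l \<le> i" for i using w that by (auto simp: q_def comb_E S_def)
      show "fps_nth (q i) k = 0" if "n \<le> k" for i k
        using w that by (cases "k = n"; cases "i < l") (auto simp: q_def comb_E S_def t_def fps_X_power_nth)
      show "fps_nth (gp q i) k = 0" if "i < d" "k < n" for i k
        using w E_S[OF assms(1), of t] that by (auto simp: gq S_def)
    qed
    then obtain u where u: "u \<in> carrier_vec r" "comb r B u = q" using B(2) by blast
    have t: "t \<in> carrier_vec l" by (simp add: t_def)
    show ?thesis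
      by (intro bexI[of _ "u @\<^sub>v t"] ext) (use u t in \<open>auto simp: comb_plus q_def\<close>)
  qed
  show "v = 0\<^sub>v (r + l)" if v: "v \<in> carrier_vec (r + l)" "comb (r + l) (plus_basis r B) v = (\<lambda>_. 0)" for v
  proof -
    obtain u t where ut: "u \<in> carrier_vec r" "t \<in> carrier_vec l" "v = u @\<^sub>v t" using vec_split[OF v(1)] by auto
    have 0: "comb r B u i + comb l E t i = 0" for i
      using v(2) comb_plus[OF ut(1,2), of B i] by (simp add: ut(3))
    have t0: "t $ i = 0" if "i < l" for i
    proof -
      have "fps_nth (comb r B u i) n = 0" using B(1)[OF ut(1)] by (auto simp: S_def)
      then show ?thesis using arg_cong[OF 0[of i], of "\<lambda>f. fps_nth f n"] that by (simp add: comb_E)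
    qed
    then have t: "t = 0\<^sub>v l" using ut(2) by (intro eq_vecI) auto
    then have "comb l E t i = 0" for i by (simp add: comb_E)
    then have "comb r B u = (\<lambda>_. 0)" using 0 by (intro ext) simp
    then have "u = 0\<^sub>v r" using B(3) ut(1) by auto
    then show ?thesis using ut(3) t by (intro eq_vecI) auto
  qed
qed

end

lemma comb_inj:
  fixes u v :: "'k::field vec"
  assumes ker: "\<And>u. u \<in> carrier_vec r \<Longrightarrow> comb r B u = (\<lambda>_. 0) \<Longrightarrow> u = 0\<^sub>v r"
    and "u \<in> carrier_vec r" "v \<in> carrier_vec r" "comb r B u = comb r B v"
  shows "u = v"
proof -
  have mv: "(-1) \<cdot>\<^sub>v v \<in> carrier_vec r" using assms by auto
  have "comb r B (u + (-1) \<cdot>\<^sub>v v) = (\<lambda>_. 0)"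
    unfolding comb_linear(1)[OF assms(2) mv] comb_linear(2)[OF assms(3,3)] assms(4)
    by (simp add: fun_eq_iff flip: fps_const_neg)
  then have 0: "u + (-1) \<cdot>\<^sub>v v = 0\<^sub>v r" using ker mv assms(2) by auto
  show ?thesis
  proof (rule eq_vecI)
    fix i assume "i < dim_vec v"
    then show "u $ i = v $ i" using arg_cong[OF 0, of "\<lambda>w. w $ i"] assms(2,3) by simp
  qed (use assms in auto)
qed

section \<open>Module structure and exactness\<close>

context zwara
begin

lemma act_one: assumes "w \<in> S m l" "l \<le> d" shows "act 1 w = w"
proof
  fix i show "act 1 w i = w i"
  proof (cases "i < d")
    case True
    have "(\<Sum>j<d. fps_const (\<mu> 1 $$ (i, j)) * w j) = (\<Sum>j<d. if j = i then w i else 0)"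
      using \<mu>(1) True by (intro sum.cong) (auto simp: is_rep_def)
    then show ?thesis using True by (simp add: act_def)
  qed (use assms in \<open>auto simp: act_def S_def\<close>)
qed

lemma \<mu>_carrier: "\<mu> x \<in> carrier_mat d d" using \<mu>(1) by (simp add: is_rep_def)

lemma act_add: "act (x + y) w = (\<lambda>i. act x w i + act y w i)"
proof
  fix i
  have "fps_const (\<mu> (x + y) $$ (i, j)) = fps_const (\<mu> x $$ (i, j)) + fps_const (\<mu> y $$ (i, j))" if "i < d" "j < d" for j
    using \<mu>(1) that carrier_matD[OF \<mu>_carrier[of y]] by (simp add: is_rep_def)
  then show "act (x + y) w i = act x w i + act y w i"
    by (simp add: act_def sum.distrib[symmetric] distrib_right[symmetric])
qed

lemma act_scal: "act (scal c x) w = (\<lambda>i. fps_const c * act x w i)"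
proof
  fix i
  have "fps_const (\<mu> (scal c x) $$ (i, j)) = fps_const c * fps_const (\<mu> x $$ (i, j))" if "i < d" "j < d" for j
    using \<mu>(1) that carrier_matD[OF \<mu>_carrier[of x]] by (simp add: is_rep_def)
  then show "act (scal c x) w i = fps_const c * act x w i"
    by (simp add: act_def sum_distrib_left mult.assoc del: fps_const_mult)
qed

lemma act_mult: "act (x * y) w = act x (act y w)"
proof
  fix i
  show "act (x * y) w i = act x (act y w) i"
  proof (cases "i < d")
    case True
    have "fps_const (\<mu> (x * y) $$ (i, j)) = (\<Sum>a<d. fps_const (\<mu> x $$ (i, a)) * fps_const (\<mu> y $$ (a, j)))" if "j < d" for j
    proof -
      have "\<mu> (x * y) $$ (i, j) = (\<Sum>a<d. \<mu> x $$ (i, a) * \<mu> y $$ (a, j))"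
        using \<mu>(1) that True carrier_matD[OF \<mu>_carrier[of x]] carrier_matD[OF \<mu>_carrier[of y]]
        by (simp add: is_rep_def scalar_prod_def atLeast0LessThan)
      then show ?thesis by (simp add: fps_const_sum)
    qed
    then have "act (x * y) w i = (\<Sum>j<d. \<Sum>a<d. fps_const (\<mu> x $$ (i, a)) * fps_const (\<mu> y $$ (a, j)) * w j)"
      using True by (simp add: act_def sum_distrib_right del: fps_const_mult)
    also have "\<dots> = (\<Sum>a<d. \<Sum>j<d. fps_const (\<mu> x $$ (i, a)) * fps_const (\<mu> y $$ (a, j)) * w j)" by (rule sum.swap)
    also have "\<dots> = act x (act y w) i" using True by (simp add: act_def sum_distrib_left mult.assoc del: fps_const_mult)
    finally show ?thesis .
  qed (simp add: act_def)
qed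

lemma gp_shift: "gp (shift w) i = fps_X * gp w i"
  by (simp add: gp_def shift_def sum_distrib_left mult_ac)

lemma gp_cutoff:
  assumes "k \<le> n" shows "fps_nth (gp (\<lambda>i. fps_cutoff (Suc n) (w i)) i) k = fps_nth (gp w i) k"
  unfolding gp_def fps_sum_nth fps_mult_nth using assms by (intro sum.cong refl) auto

text \<open>The preimage of \<open>y\<close> is \<open>G y\<close>, since
  \<open>G' G y = X^n y\<close>. Cutting it off above degree \<open>n\<close> does not change the
  coefficients of \<open>gp\<close> up to \<open>n\<close>, which are the only ones that
  matter.\<close>

lemma gp_surj:
  assumes "l \<le> d" shows "\<exists>w\<in>S (Suc n) l. \<forall>i<l. fps_nth (gp w i) n = y $ i"
proof -
  define y' where "y' i = (if i < l then fps_const (y $ i) else 0)" for i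
  define w0 where "w0 i = (if i < d then \<Sum>j<d. G i j * y' j else 0)" for i
  define w where "w = (\<lambda>i. fps_cutoff (Suc n) (w0 i))"
  have gp0: "gp w0 i = fps_X ^ n * y' i" if "i < d" for i
  proof -
    have "gp w0 i = (\<Sum>j<d. \<Sum>c<d. G' i j * G j c * y' c)"
      unfolding gp_def w0_def by (intro sum.cong) (auto simp: sum_distrib_left mult.assoc)
    also have "\<dots> = (\<Sum>c<d. (\<Sum>j<d. G' i j * G j c) * y' c)" by (subst sum.swap) (simp only: sum_distrib_right)
    also have "\<dots> = (\<Sum>c<d. if c = i then fps_X ^ n * y' i else 0)" using that by (intro sum.cong) (auto simp: G'G)
    finally show ?thesis using that by simp
  qed
  have gpw: "fps_nth (gp w i) k = (if k = n then fps_nth (y' i) 0 else 0)" if "i < d" "k \<le> n" for i k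
    using gp_cutoff[OF that(2), of w0 i] that by (simp add: w_def gp0 fps_X_power_mult_nth)
  have supp: "w0 i = 0" if "l \<le> i" for i
  proof -
    have "G i j * y' j = 0" if "j < d" "i < d" for j
      using tri(1)[OF that(2), of j] \<open>l \<le> i\<close> by (cases "j < l") (auto simp: y'_def)
    then show ?thesis by (auto simp: w0_def intro!: sum.neutral)
  qed
  have "w \<in> S (Suc n) l"
    unfolding S_def mem_Collect_eq
  proof (intro conjI allI impI)
    show "w i = 0" if "l \<le> i" for i using supp[OF that] by (simp add: w_def)
    show "fps_nth (w i) k = 0" if "Suc n \<le> k" for i k using that by (simp add: w_def)
    show "fps_nth (gp w i) k = 0" if "i < d" "k < n" for i k using gpw that by simp
  qed
  moreover have "fps_nth (gp w i) n = y $ i" if "i < l" for i using gpw[of i n] that assms by (simp add: y'_def)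
  ultimately show ?thesis by blast
qed

text \<open>If \<open>X^(n+1)\<close> divides \<open>G' w\<close>, it divides
  \<open>G G' w = X^n w\<close>, so \<open>w\<close> is divisible by \<open>X\<close>, and the
  quotient is in the lattice again. This gives exactness in the middle.\<close>

lemma gp_kernel:
  assumes "l \<le> d" and w: "w \<in> S (Suc n) l" and 0: "\<And>i. i < l \<Longrightarrow> fps_nth (gp w i) n = 0"
  shows "\<exists>q\<in>S n l. w = shift q"
proof -
  have gp0: "fps_nth (gp w i) k = 0" if "i < d" "k \<le> n" for i k
    using w 0[of i] gp_supp[OF w _ that(1)] that by (cases "i < l"; cases "k = n") (auto simp: S_def)
  have w0: "fps_nth (w i) 0 = 0" for i
  proof (cases "i < d")
    case True
    have "(\<Sum>a<d. G i a * gp w a) = (\<Sum>a<d. \<Sum>j<d. G i a * G' a j * w j)"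
      unfolding gp_def by (simp add: sum_distrib_left mult.assoc)
    also have "\<dots> = (\<Sum>j<d. (\<Sum>a<d. G i a * G' a j) * w j)" by (subst sum.swap) (simp only: sum_distrib_right)
    also have "\<dots> = (\<Sum>j<d. if j = i then fps_X ^ n * w i else 0)" using True by (intro sum.cong) (auto simp: GG')
    finally have "fps_X ^ n * w i = (\<Sum>a<d. G i a * gp w a)" using True by simp
    then have "fps_nth (fps_X ^ n * w i) n = fps_nth (\<Sum>a<d. G i a * gp w a) n" by simp
    also have "\<dots> = 0" unfolding fps_sum_nth fps_mult_nth using gp0 by (intro sum.neutral ballI) auto
    finally show ?thesis by (simp add: fps_X_power_mult_nth)
  qed (use w assms(1) in \<open>auto simp: S_def\<close>)
  define q where "q = (\<lambda>i. fps_shift 1 (w i))"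
  have wq: "w = shift q"
  proof
    fix i show "w i = shift q i" unfolding shift_def q_def fps_eq_iff
    proof
      fix k show "fps_nth (w i) k = fps_nth (fps_X * fps_shift 1 (w i)) k" using w0[of i] by (cases k) auto
    qed
  qed
  have "q \<in> S n l" unfolding S_def mem_Collect_eq
  proof (intro conjI allI impI)
    show "q i = 0" if "l \<le> i" for i using w that by (auto simp: q_def S_def)
    show "fps_nth (q i) k = 0" if "n \<le> k" for i k using w that by (auto simp: q_def S_def)
    show "fps_nth (gp q i) k = 0" if "i < d" "k < n" for i k
      using gp0[OF that(1), of "Suc k"] that(2) by (simp add: wq gp_shift)
  qed
  then show ?thesis using wq by blast
qed

text \<open>Under the coordinate maps, \<open>h\<close> is the inclusion for growing
  \<open>l\<close>, \<open>a\<close> is multiplication by \<open>X\<close>, and \<open>b\<close>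
  takes the coefficient of \<open>X^n\<close> in \<open>gp\<close>. Identities between matrices are
  pushed forward along the injective maps \<open>?K\<close> and \<open>?K'\<close>, or read off from
  \<open>gp\<close>, and become identities between operations on power series.\<close>

theorem exact_sequence:
  "\<exists>(dX :: nat \<Rightarrow> nat) (X :: nat \<Rightarrow> 'a \<Rightarrow> 'k mat) (h :: nat \<Rightarrow> 'k mat) (a :: nat \<Rightarrow> 'k mat) (b :: nat \<Rightarrow> 'k mat).
       (\<forall>l\<in>{1..d}. is_rep scal (dX l) (X l)) \<and>
       (\<forall>l\<in>{1..<d}. is_hom (dX l) (X l) (dX (l + 1)) (X (l + 1)) (h l)) \<and>
       (\<forall>l\<in>{1..d}. is_hom (dX l) (X l) (dX l + l) (dsum_rep (dX l) (X l) l (sub_rep l \<mu>)) (a l) \<and>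
                    is_hom (dX l + l) (dsum_rep (dX l) (X l) l (sub_rep l \<mu>)) l (sub_rep l \<nu>) (b l) \<and>
                    short_exact (dX l) (dX l + l) l (a l) (b l)) \<and>
       (\<forall>l\<in>{1..<d}.
          diag_block (dX (l + 1)) (dX l) (h l) (l + 1) l (incl_mat l) * a l = a (l + 1) * h l \<and>
          incl_mat l * b l = b (l + 1) * diag_block (dX (l + 1)) (dX l) (h l) (l + 1) l (incl_mat l))"
proof -
  have "\<forall>l. \<exists>rB. (\<forall>u\<in>carrier_vec (fst rB). comb (fst rB) (snd rB) u \<in> S n l) \<and>
     (\<forall>w\<in>S n l. \<exists>u\<in>carrier_vec (fst rB). comb (fst rB) (snd rB) u = w) \<and>
     (\<forall>u\<in>carrier_vec (fst rB). comb (fst rB) (snd rB) u = (\<lambda>_. 0) \<longrightarrow> u = 0\<^sub>v (fst rB))"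
    using coordinates_S[of n] by simp
  from choice[OF this] obtain rB where rB: "\<And>l. (\<forall>u\<in>carrier_vec (fst (rB l)). comb (fst (rB l)) (snd (rB l)) u \<in> S n l) \<and>
     (\<forall>w\<in>S n l. \<exists>u\<in>carrier_vec (fst (rB l)). comb (fst (rB l)) (snd (rB l)) u = w) \<and>
     (\<forall>u\<in>carrier_vec (fst (rB l)). comb (fst (rB l)) (snd (rB l)) u = (\<lambda>_. 0) \<longrightarrow> u = 0\<^sub>v (fst (rB l)))" by blast
  define r where "r l = fst (rB l)" for l
  define B where "B l = snd (rB l)" for l
  define P where "P l = plus_basis (r l) (B l)" for l
  let ?K = "\<lambda>l. comb (r l) (B l)" and ?K' = "\<lambda>l. comb (r l + l) (P l)"
  have K: "\<And>u. u \<in> carrier_vec (r l) \<Longrightarrow> ?K l u \<in> S n l"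
    "\<And>w. w \<in> S n l \<Longrightarrow> \<exists>u\<in>carrier_vec (r l). ?K l u = w"
    "\<And>u. u \<in> carrier_vec (r l) \<Longrightarrow> ?K l u = (\<lambda>_. 0) \<Longrightarrow> u = 0\<^sub>v (r l)" for l
    using rB[of l] by (auto simp: r_def B_def)
  have K': "\<And>v. v \<in> carrier_vec (r l + l) \<Longrightarrow> ?K' l v \<in> S (Suc n) l"
    "\<And>w. w \<in> S (Suc n) l \<Longrightarrow> \<exists>v\<in>carrier_vec (r l + l). ?K' l v = w"
    "\<And>v. v \<in> carrier_vec (r l + l) \<Longrightarrow> ?K' l v = (\<lambda>_. 0) \<Longrightarrow> v = 0\<^sub>v (r l + l)" if "l \<le> d" for l
    using coordinates_S_plus[OF that K] unfolding P_def by blast+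
  have Kinj: "u = v" if "u \<in> carrier_vec (r l)" "v \<in> carrier_vec (r l)" "?K l u = ?K l v" for u v l
    by (rule comb_inj[OF K(3) that])
  have K'inj: "u = v" if "l \<le> d" "u \<in> carrier_vec (r l + l)" "v \<in> carrier_vec (r l + l)" "?K' l u = ?K' l v" for u v l
    by (rule comb_inj[OF K'(3)[OF that(1)] that(2-4)])
  have K'app: "?K' l (u @\<^sub>v t) = (\<lambda>i. ?K l u i + comb l E t i)" if "u \<in> carrier_vec (r l)" "t \<in> carrier_vec l" for l u t
    using comb_plus[OF that] by (auto simp: P_def)
  define X where "X l x = (SOME H. H \<in> carrier_mat (r l) (r l) \<and> (\<forall>u\<in>carrier_vec (r l). ?K l (H *\<^sub>v u) = act x (?K l u)))" for l x
  have X: "X l x \<in> carrier_mat (r l) (r l)" "\<And>u. u \<in> carrier_vec (r l) \<Longrightarrow> ?K l (X l x *\<^sub>v u) = act x (?K l u)" if "l \<le> d" for l x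
  proof -
    have "\<exists>v\<in>carrier_vec (r l). ?K l v = act x (?K l u)" if "u \<in> carrier_vec (r l)" for u
      using K(2)[OF act_S[OF K(1)[OF that] \<open>l \<le> d\<close>]] .
    from matrix_of_klin[OF klin_act this]
    have "\<exists>H. H \<in> carrier_mat (r l) (r l) \<and> (\<forall>u\<in>carrier_vec (r l). ?K l (H *\<^sub>v u) = act x (?K l u))" by blast
    from someI_ex[OF this, folded X_def]
    show "X l x \<in> carrier_mat (r l) (r l)" "\<And>u. u \<in> carrier_vec (r l) \<Longrightarrow> ?K l (X l x *\<^sub>v u) = act x (?K l u)" by auto
  qed
  define h where "h l = (SOME H. H \<in> carrier_mat (r (l + 1)) (r l) \<and> (\<forall>u\<in>carrier_vec (r l). ?K (l + 1) (H *\<^sub>v u) = ?K l u))" for l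
  have h: "h l \<in> carrier_mat (r (l + 1)) (r l)" "\<And>u. u \<in> carrier_vec (r l) \<Longrightarrow> ?K (l + 1) (h l *\<^sub>v u) = ?K l u" for l
  proof -
    have "\<exists>v\<in>carrier_vec (r (l + 1)). ?K (l + 1) v = ?K l u" if "u \<in> carrier_vec (r l)" for u
      by (rule K(2)[OF S_l_mono[OF K(1)[OF that]]]) simp
    from matrix_of_klin[OF klin_id this]
    have "\<exists>H. H \<in> carrier_mat (r (l + 1)) (r l) \<and> (\<forall>u\<in>carrier_vec (r l). ?K (l + 1) (H *\<^sub>v u) = ?K l u)" by blast
    from someI_ex[OF this, folded h_def]
    show "h l \<in> carrier_mat (r (l + 1)) (r l)" "\<And>u. u \<in> carrier_vec (r l) \<Longrightarrow> ?K (l + 1) (h l *\<^sub>v u) = ?K l u" by auto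
  qed
  define a where "a l = (SOME H. H \<in> carrier_mat (r l + l) (r l) \<and> (\<forall>u\<in>carrier_vec (r l). ?K' l (H *\<^sub>v u) = shift (?K l u)))" for l
  have a: "a l \<in> carrier_mat (r l + l) (r l)" "\<And>u. u \<in> carrier_vec (r l) \<Longrightarrow> ?K' l (a l *\<^sub>v u) = shift (?K l u)" if "l \<le> d" for l
  proof -
    have "\<exists>v\<in>carrier_vec (r l + l). ?K' l v = shift (?K l u)" if "u \<in> carrier_vec (r l)" for u
      by (rule K'(2)[OF \<open>l \<le> d\<close> shift_S[OF K(1)[OF that]]])
    from matrix_of_klin[OF klin_shift this]
    have "\<exists>H. H \<in> carrier_mat (r l + l) (r l) \<and> (\<forall>u\<in>carrier_vec (r l). ?K' l (H *\<^sub>v u) = shift (?K l u))" by blast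
    from someI_ex[OF this, folded a_def]
    show "a l \<in> carrier_mat (r l + l) (r l)" "\<And>u. u \<in> carrier_vec (r l) \<Longrightarrow> ?K' l (a l *\<^sub>v u) = shift (?K l u)" by auto
  qed
  define b where "b l = mat l (r l + l) (\<lambda>(i, p). fps_nth (gp (P l p) i) n)" for l
  have b: "b l \<in> carrier_mat l (r l + l)" for l by (simp add: b_def)
  have bv: "(b l *\<^sub>v v) $ i = fps_nth (gp (?K' l v) i) n" if "v \<in> carrier_vec (r l + l)" "i < l" for l v i
    using that by (auto simp: b_def scalar_prod_def gp_comb fps_sum_nth atLeast0LessThan mult.commute intro!: sum.cong)
  have sub: "sub_rep l \<rho> x \<in> carrier_mat l l" for l and \<rho> :: "'a \<Rightarrow> 'k mat" and x by (simp add: sub_rep_def)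
  have ds: "dsum_rep (r l) (X l) l (sub_rep l \<mu>) x \<in> carrier_mat (r l + l) (r l + l)" if "l \<le> d" for l x
    unfolding dsum_rep_def using X(1)[OF that] sub by (intro four_block_carrier_mat) auto
  have Kds: "?K' l (dsum_rep (r l) (X l) l (sub_rep l \<mu>) x *\<^sub>v v) = act x (?K' l v)"
    if l: "l \<le> d" and v: "v \<in> carrier_vec (r l + l)" for l x v
  proof -
    obtain u t where ut: "u \<in> carrier_vec (r l)" "t \<in> carrier_vec l" "v = u @\<^sub>v t" using vec_split[OF v] by auto
    \<comment> \<open>On the summand \<open>X^n k^l\<close> the action has constant coefficients and
      is that of \<open>M_l\<close>; triangularity keeps the entries from \<open>l\<close> on
      zero.\<close>
    have actE: "act x (comb l E t) = comb l E (sub_rep l \<mu> x *\<^sub>v t)"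
    proof
      fix i
      show "act x (comb l E t) i = comb l E (sub_rep l \<mu> x *\<^sub>v t) i"
      proof (cases "i < l")
        case True
        have "(\<Sum>j<d. fps_const (\<mu> x $$ (i, j)) * comb l E t j) = (\<Sum>j<l. fps_const (\<mu> x $$ (i, j)) * (fps_const (t $ j) * fps_X ^ n))"
          using l by (intro sum.mono_neutral_cong_right) (auto simp: comb_E)
        also have "\<dots> = fps_const (\<Sum>j<l. \<mu> x $$ (i, j) * t $ j) * fps_X ^ n"
          by (simp add: fps_const_sum sum_distrib_right mult.assoc[symmetric])
        also have "(\<Sum>j<l. \<mu> x $$ (i, j) * t $ j) = (sub_rep l \<mu> x *\<^sub>v t) $ i"
          using True ut(2) by (simp add: sub_rep_def scalar_prod_def atLeast0LessThan)
        finally show ?thesis using True l by (simp add: act_def comb_E)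
      next
        case False
        have "act x (comb l E t) \<in> S (Suc n) l" by (rule act_S[OF E_S[OF l] l])
        then show ?thesis using False by (auto simp: S_def comb_E)
      qed
    qed
    have "dsum_rep (r l) (X l) l (sub_rep l \<mu>) x *\<^sub>v v = (X l x *\<^sub>v u) @\<^sub>v (sub_rep l \<mu> x *\<^sub>v t)"
      unfolding dsum_rep_def ut(3) by (rule mult_mat_vec_split[OF X(1)[OF l] sub ut(1,2)])
    also have "?K' l \<dots> = (\<lambda>i. act x (?K l u) i + act x (comb l E t) i)"
      by (subst K'app) (simp_all add: actE X(2)[OF l ut(1)] mult_mat_vec_carrier[OF X(1)[OF l] ut(1)]
        mult_mat_vec_carrier[OF sub ut(2)])
    also have "\<dots> = act x (?K' l v)" unfolding ut(3) K'app[OF ut(1,2)]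
      by (auto simp: act_def sum.distrib distrib_left)
    finally show ?thesis .
  qed
  let ?D = "\<lambda>l. diag_block (r (l + 1)) (r l) (h l) (l + 1) l (incl_mat l)"
  have D: "?D l \<in> carrier_mat (r (l + 1) + (l + 1)) (r l + l)" for l
    by (rule diag_block_carrier[OF h(1) incl_carrier])
  \<comment> \<open>Under \<open>?K'\<close> the block matrix becomes the inclusion of
    \<open>S (Suc n) l\<close> into \<open>S (Suc n) (l + 1)\<close>, which is the reason why both
    squares commute.\<close>
  have KD: "?K' (l + 1) (?D l *\<^sub>v v) = ?K' l v" if v: "v \<in> carrier_vec (r l + l)" for l v
  proof -
    obtain u t where ut: "u \<in> carrier_vec (r l)" "t \<in> carrier_vec l" "v = u @\<^sub>v t" using vec_split[OF v] by auto
    have hu: "h l *\<^sub>v u \<in> carrier_vec (r (l + 1))" using h(1)[of l] ut(1) by auto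
    have it: "incl_mat l *\<^sub>v t \<in> carrier_vec (l + 1)" by (rule mult_mat_vec_carrier[OF incl_carrier ut(2)])
    have Dv: "?D l *\<^sub>v v = (h l *\<^sub>v u) @\<^sub>v (incl_mat l *\<^sub>v t)"
      unfolding ut(3) by (rule diag_block_mult_vec[OF h(1) incl_carrier ut(1,2)])
    have "?K' (l + 1) (?D l *\<^sub>v v) = (\<lambda>i. ?K l u i + comb (l + 1) E (incl_mat l *\<^sub>v t) i)"
      unfolding Dv K'app[OF hu it] h(2)[OF ut(1)] ..
    moreover have "comb (l + 1) E (incl_mat l *\<^sub>v t) = comb l E t"
    proof
      fix i
      show "comb (l + 1) E (incl_mat l *\<^sub>v t) i = comb l E t i"
      proof (cases "i < l + 1")
        case True
        show ?thesis unfolding comb_E incl_mult_vec[OF ut(2) True] if_P[OF True]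
          by (cases "i < l") (simp_all only: if_True if_False fps_const_0_eq_0 mult_zero_left)
      next
        case False
        then have "\<not> i < l" by simp
        then show ?thesis unfolding comb_E if_not_P[OF False] by (simp only: if_False)
      qed
    qed
    ultimately show ?thesis unfolding ut(3) K'app[OF ut(1,2)] by (simp only:)
  qed
  have reps: "is_rep scal (r l) (X l)" if l: "l \<le> d" for l
    unfolding is_rep_def
  proof (intro conjI allI)
    note Xc = X(1)[OF l] and XK = X(2)[OF l]
    have XuC: "X l x *\<^sub>v u \<in> carrier_vec (r l)" if "u \<in> carrier_vec (r l)" for x u using Xc[of x] that by auto
    show "X l x \<in> carrier_mat (r l) (r l)" for x by (rule Xc)
    show "X l 1 = 1\<^sub>m (r l)"
    proof (rule mat_eq_if_vec_eq[OF Xc])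
      fix u :: "'k vec" assume u: "u \<in> carrier_vec (r l)"
      show "X l 1 *\<^sub>v u = 1\<^sub>m (r l) *\<^sub>v u"
        using u XuC[OF u] by (intro Kinj) (auto simp: XK act_one[OF K(1)[OF u] l])
    qed auto
    fix x y c
    show "X l (x + y) = X l x + X l y"
    proof (rule mat_eq_if_vec_eq[OF Xc])
      fix u :: "'k vec" assume u: "u \<in> carrier_vec (r l)"
      have "(X l x + X l y) *\<^sub>v u = X l x *\<^sub>v u + X l y *\<^sub>v u" by (rule add_mult_distrib_mat_vec[OF Xc Xc u])
      then show "X l (x + y) *\<^sub>v u = (X l x + X l y) *\<^sub>v u"
        using u XuC[OF u] by (intro Kinj) (auto simp: XK act_add comb_linear)
    qed (use Xc in auto)
    show "X l (x * y) = X l x * X l y"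
    proof (rule mat_eq_if_vec_eq[OF Xc])
      fix u :: "'k vec" assume u: "u \<in> carrier_vec (r l)"
      have "(X l x * X l y) *\<^sub>v u = X l x *\<^sub>v (X l y *\<^sub>v u)" by (rule assoc_mult_mat_vec[OF Xc Xc u])
      then show "X l (x * y) *\<^sub>v u = (X l x * X l y) *\<^sub>v u"
        using u XuC by (intro Kinj) (auto simp: XK act_mult)
    qed (rule Xc mult_carrier_mat[OF Xc Xc])+
    show "X l (scal c x) = c \<cdot>\<^sub>m X l x"
    proof (rule mat_eq_if_vec_eq[OF Xc])
      fix u :: "'k vec" assume u: "u \<in> carrier_vec (r l)"
      have "(c \<cdot>\<^sub>m X l x) *\<^sub>v u = c \<cdot>\<^sub>v (X l x *\<^sub>v u)"
        using Xc[of x] u by (intro eq_vecI) (auto simp: scalar_prod_def sum_distrib_left mult.assoc)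
      then show "X l (scal c x) *\<^sub>v u = (c \<cdot>\<^sub>m X l x) *\<^sub>v u"
        using u XuC[OF u] by (intro Kinj) (auto simp: XK act_scal comb_linear(2)[of _ "r l" "0\<^sub>v (r l)"])
    qed (use Xc in auto)
  qed
  have hom_h: "is_hom (r l) (X l) (r (l + 1)) (X (l + 1)) (h l)" if l: "l + 1 \<le> d" for l
    unfolding is_hom_def
  proof (intro conjI allI)
    show "h l \<in> carrier_mat (r (l + 1)) (r l)" by (rule h)
    fix x
    have l': "l \<le> d" using l by simp
    show "h l * X l x = X (l + 1) x * h l"
    proof (rule mat_eq_if_vec_eq)
      show "h l * X l x \<in> carrier_mat (r (l + 1)) (r l)" "X (l + 1) x * h l \<in> carrier_mat (r (l + 1)) (r l)"
        by (rule mult_carrier_mat[OF h(1) X(1)[OF l']] mult_carrier_mat[OF X(1)[OF l] h(1)])+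
      fix u :: "'k vec" assume u: "u \<in> carrier_vec (r l)"
      have Xu: "X l x *\<^sub>v u \<in> carrier_vec (r l)" and hu: "h l *\<^sub>v u \<in> carrier_vec (r (l + 1))"
        using X(1)[OF l', of x] h(1)[of l] u by auto
      have "?K (l + 1) (h l *\<^sub>v (X l x *\<^sub>v u)) = ?K (l + 1) (X (l + 1) x *\<^sub>v (h l *\<^sub>v u))"
        unfolding h(2)[OF Xu] X(2)[OF l' u] X(2)[OF l hu] h(2)[OF u] ..
      then have "h l *\<^sub>v (X l x *\<^sub>v u) = X (l + 1) x *\<^sub>v (h l *\<^sub>v u)"
        using Xu hu h(1)[of l] X(1)[OF l, of x] by (intro Kinj) auto
      then show "(h l * X l x) *\<^sub>v u = (X (l + 1) x * h l) *\<^sub>v u"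
        unfolding assoc_mult_mat_vec[OF h(1) X(1)[OF l'] u] assoc_mult_mat_vec[OF X(1)[OF l] h(1) u] .
    qed
  qed
  have hom_a: "is_hom (r l) (X l) (r l + l) (dsum_rep (r l) (X l) l (sub_rep l \<mu>)) (a l)" if l: "l \<le> d" for l
    unfolding is_hom_def
  proof (intro conjI allI)
    show "a l \<in> carrier_mat (r l + l) (r l)" by (rule a[OF l])
    fix x
    let ?d = "dsum_rep (r l) (X l) l (sub_rep l \<mu>) x"
    show "a l * X l x = ?d * a l"
    proof (rule mat_eq_if_vec_eq)
      show "a l * X l x \<in> carrier_mat (r l + l) (r l)" "?d * a l \<in> carrier_mat (r l + l) (r l)"
        by (rule mult_carrier_mat[OF a(1)[OF l] X(1)[OF l]] mult_carrier_mat[OF ds[OF l] a(1)[OF l]])+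
      fix u :: "'k vec" assume u: "u \<in> carrier_vec (r l)"
      have Xu: "X l x *\<^sub>v u \<in> carrier_vec (r l)" and au: "a l *\<^sub>v u \<in> carrier_vec (r l + l)"
        using X(1)[OF l, of x] a(1)[OF l] u by auto
      have "?K' l (a l *\<^sub>v (X l x *\<^sub>v u)) = ?K' l (?d *\<^sub>v (a l *\<^sub>v u))"
        unfolding a(2)[OF l Xu] X(2)[OF l u] Kds[OF l au] a(2)[OF l u]
        by (auto simp: shift_def act_def sum_distrib_left mult_ac)
      then have "a l *\<^sub>v (X l x *\<^sub>v u) = ?d *\<^sub>v (a l *\<^sub>v u)"
        using Xu au a(1)[OF l] ds[OF l, of x] by (intro K'inj[OF l]) auto
      then show "(a l * X l x) *\<^sub>v u = (?d * a l) *\<^sub>v u"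
        unfolding assoc_mult_mat_vec[OF a(1)[OF l] X(1)[OF l] u] assoc_mult_mat_vec[OF ds[OF l] a(1)[OF l] u] .
    qed
  qed
  have hom_b: "is_hom (r l + l) (dsum_rep (r l) (X l) l (sub_rep l \<mu>)) l (sub_rep l \<nu>) (b l)" if l: "l \<le> d" for l
    unfolding is_hom_def
  proof (intro conjI allI)
    show "b l \<in> carrier_mat l (r l + l)" by (rule b)
    fix x
    let ?d = "dsum_rep (r l) (X l) l (sub_rep l \<mu>) x"
    show "b l * ?d = sub_rep l \<nu> x * b l"
    proof (rule mat_eq_if_vec_eq)
      show "b l * ?d \<in> carrier_mat l (r l + l)" "sub_rep l \<nu> x * b l \<in> carrier_mat l (r l + l)"
        by (rule mult_carrier_mat[OF b ds[OF l]] mult_carrier_mat[OF sub b])+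
      fix v :: "'k vec" assume v: "v \<in> carrier_vec (r l + l)"
      have dv: "?d *\<^sub>v v \<in> carrier_vec (r l + l)" using ds[OF l, of x] v by auto
      have bvc: "b l *\<^sub>v v \<in> carrier_vec l" using b[of l] v by auto
      have "b l *\<^sub>v (?d *\<^sub>v v) = sub_rep l \<nu> x *\<^sub>v (b l *\<^sub>v v)"
      proof (rule eq_vecI)
        fix i assume "i < dim_vec (sub_rep l \<nu> x *\<^sub>v (b l *\<^sub>v v))"
        then have i: "i < l" using sub[of l \<nu> x] by auto
        have "(b l *\<^sub>v (?d *\<^sub>v v)) $ i = (\<Sum>c<d. \<nu> x $$ (i, c) * fps_nth (gp (?K' l v) c) n)"
          unfolding bv[OF dv i] Kds[OF l v] using i l by (intro gp_act_n[OF K'(1)[OF l v]]) auto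
        also have "\<dots> = (\<Sum>c<l. \<nu> x $$ (i, c) * (b l *\<^sub>v v) $ c)"
          using l gp_supp[OF K'(1)[OF l v]] by (intro sum.mono_neutral_cong_right) (auto simp: bv[OF v])
        also have "\<dots> = (sub_rep l \<nu> x *\<^sub>v (b l *\<^sub>v v)) $ i"
          unfolding mat_vec_index[OF sub bvc i] using i by (intro sum.cong) (auto simp: sub_rep_def)
        finally show "(b l *\<^sub>v (?d *\<^sub>v v)) $ i = (sub_rep l \<nu> x *\<^sub>v (b l *\<^sub>v v)) $ i" .
      qed (use b[of l] sub[of l \<nu> x] in auto)
      then show "(b l * ?d) *\<^sub>v v = (sub_rep l \<nu> x * b l) *\<^sub>v v"
        unfolding assoc_mult_mat_vec[OF b ds[OF l] v] assoc_mult_mat_vec[OF sub b v] .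
    qed
  qed
  have exact: "short_exact (r l) (r l + l) l (a l) (b l)" if l: "l \<le> d" for l
    unfolding short_exact_def
  proof (intro conjI ballI impI)
    show "a l \<in> carrier_mat (r l + l) (r l)" "b l \<in> carrier_mat l (r l + l)" using a(1)[OF l] b by auto
  next
    fix u :: "'k vec" assume u: "u \<in> carrier_vec (r l)" "a l *\<^sub>v u = 0\<^sub>v (r l + l)"
    have z: "comb m C (0\<^sub>v m) = (\<lambda>_. 0 :: 'k fps)" for m C by (simp add: comb_def)
    have "shift (?K l u) = (\<lambda>_. 0)" using a(2)[OF l u(1)] by (simp add: u(2) z)
    then have "?K l u = (\<lambda>_. 0)" by (auto simp: shift_def fun_eq_iff)
    then show "u = 0\<^sub>v (r l)" by (rule K(3)[OF u(1)])
  next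
    fix y :: "'k vec" assume y: "y \<in> carrier_vec l"
    obtain w where w: "w \<in> S (Suc n) l" "\<forall>i<l. fps_nth (gp w i) n = y $ i" using gp_surj[OF l] by blast
    obtain v where v: "v \<in> carrier_vec (r l + l)" "?K' l v = w" using K'(2)[OF l w(1)] by auto
    have "b l *\<^sub>v v = y" using y b[of l] bv[OF v(1)] w(2) by (intro eq_vecI) (auto simp: v(2))
    then show "\<exists>v\<in>carrier_vec (r l + l). b l *\<^sub>v v = y" using v by auto
  next
    fix v :: "'k vec" assume v: "v \<in> carrier_vec (r l + l)"
    show "b l *\<^sub>v v = 0\<^sub>v l \<longleftrightarrow> (\<exists>u\<in>carrier_vec (r l). v = a l *\<^sub>v u)"
    proof
      assume b0: "b l *\<^sub>v v = 0\<^sub>v l"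
      have "fps_nth (gp (?K' l v) i) n = 0" if "i < l" for i using bv[OF v that] that by (simp add: b0)
      from gp_kernel[OF l K'(1)[OF l v] this] obtain q where q: "q \<in> S n l" "?K' l v = shift q" by auto
      obtain u where u: "u \<in> carrier_vec (r l)" "?K l u = q" using K(2)[OF q(1)] by auto
      have "?K' l v = ?K' l (a l *\<^sub>v u)" unfolding a(2)[OF l u(1)] u(2) q(2) ..
      then have "v = a l *\<^sub>v u" using v a(1)[OF l] u by (intro K'inj[OF l]) auto
      then show "\<exists>u\<in>carrier_vec (r l). v = a l *\<^sub>v u" using u by auto
    next
      assume "\<exists>u\<in>carrier_vec (r l). v = a l *\<^sub>v u"
      then obtain u where u: "u \<in> carrier_vec (r l)" "v = a l *\<^sub>v u" by auto
      have "(b l *\<^sub>v v) $ i = 0" if i: "i < l" for i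
      proof -
        have "(b l *\<^sub>v v) $ i = fps_nth (fps_X * gp (?K l u) i) n"
          by (subst bv[OF v i]) (simp only: u(2) a(2)[OF l u(1)] gp_shift)
        also have "\<dots> = 0" using K(1)[OF u(1)] i l by (auto simp: S_def)
        finally show ?thesis .
      qed
      then show "b l *\<^sub>v v = 0\<^sub>v l" using b[of l] by (intro eq_vecI) auto
    qed
  qed
  have sq_a: "?D l * a l = a (l + 1) * h l" if l: "l + 1 \<le> d" for l
  proof (rule mat_eq_if_vec_eq)
    have l': "l \<le> d" using l by simp
    show "?D l * a l \<in> carrier_mat (r (l + 1) + (l + 1)) (r l)" "a (l + 1) * h l \<in> carrier_mat (r (l + 1) + (l + 1)) (r l)"
      by (rule mult_carrier_mat[OF D a(1)[OF l']] mult_carrier_mat[OF a(1)[OF l] h(1)])+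
    fix u :: "'k vec" assume u: "u \<in> carrier_vec (r l)"
    have au: "a l *\<^sub>v u \<in> carrier_vec (r l + l)" and hu: "h l *\<^sub>v u \<in> carrier_vec (r (l + 1))"
      using a(1)[OF l'] h(1)[of l] u by auto
    have "?K' (l + 1) (?D l *\<^sub>v (a l *\<^sub>v u)) = ?K' (l + 1) (a (l + 1) *\<^sub>v (h l *\<^sub>v u))"
      unfolding KD[OF au] a(2)[OF l' u] a(2)[OF l hu] h(2)[OF u] ..
    then have "?D l *\<^sub>v (a l *\<^sub>v u) = a (l + 1) *\<^sub>v (h l *\<^sub>v u)"
      using au hu D[of l] a(1)[OF l] by (intro K'inj[OF l]) auto
    then show "(?D l * a l) *\<^sub>v u = (a (l + 1) * h l) *\<^sub>v u"
      unfolding assoc_mult_mat_vec[OF D a(1)[OF l'] u] assoc_mult_mat_vec[OF a(1)[OF l] h(1) u] .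
  qed
  have sq_b: "incl_mat l * b l = b (l + 1) * ?D l" if l: "l + 1 \<le> d" for l
  proof (rule mat_eq_if_vec_eq)
    have l': "l \<le> d" using l by simp
    show "incl_mat l * b l \<in> carrier_mat (l + 1) (r l + l)" "b (l + 1) * ?D l \<in> carrier_mat (l + 1) (r l + l)"
      by (rule mult_carrier_mat[OF incl_carrier b] mult_carrier_mat[OF b D])+
    fix v :: "'k vec" assume v: "v \<in> carrier_vec (r l + l)"
    have bvc: "b l *\<^sub>v v \<in> carrier_vec l" and Dv: "?D l *\<^sub>v v \<in> carrier_vec (r (l + 1) + (l + 1))"
      using b[of l] D[of l] v by auto
    have "incl_mat l *\<^sub>v (b l *\<^sub>v v) = b (l + 1) *\<^sub>v (?D l *\<^sub>v v)"
    proof (rule eq_vecI)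
      fix i assume "i < dim_vec (b (l + 1) *\<^sub>v (?D l *\<^sub>v v))"
      then have i: "i < l + 1" using b[of "l + 1"] by auto
      \<comment> \<open>The additional coordinate of the target has to vanish, and does so because
        \<open>G'\<close> is triangular.\<close>
      have "gp (?K' l v) l = 0" using gp_supp[OF K'(1)[OF l' v], of l] l by auto
      then show "(incl_mat l *\<^sub>v (b l *\<^sub>v v)) $ i = (b (l + 1) *\<^sub>v (?D l *\<^sub>v v)) $ i"
        unfolding incl_mult_vec[OF bvc i] bv[OF Dv i] KD[OF v] using bv[OF v] i by (cases "i = l") (simp_all del: index_mult_mat_vec)
    qed (use incl_carrier[of l] b[of "l + 1"] in auto)
    then show "(incl_mat l * b l) *\<^sub>v v = (b (l + 1) * ?D l) *\<^sub>v v"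
      unfolding assoc_mult_mat_vec[OF incl_carrier b v] assoc_mult_mat_vec[OF b D v] .
  qed
  show ?thesis
    using reps hom_h hom_a hom_b exact sq_a sq_b
    by (intro exI[of _ r] exI[of _ X] exI[of _ h] conjI exI[of _ a] exI[of _ b] ballI) auto
qed

end

section \<open>A curve from exact sequences\<close>

lemma inverse_of_det_nonzero:
  fixes A :: "'k::field mat"
  assumes A: "A \<in> carrier_mat n n" and "det A \<noteq> 0"
  shows "\<exists>B\<in>carrier_mat n n. A * B = 1\<^sub>m n \<and> B * A = 1\<^sub>m n"
proof -
  note adj = adj_mat[OF A]
  let ?B = "inverse (det A) \<cdot>\<^sub>m adj_mat A"
  have "A * ?B = inverse (det A) \<cdot>\<^sub>m (A * adj_mat A)" by (rule mult_smult_distrib[OF A adj(1)])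
  moreover have "?B * A = inverse (det A) \<cdot>\<^sub>m (adj_mat A * A)" by (rule mult_smult_assoc_mat[OF adj(1) A])
  moreover have "inverse (det A) \<cdot>\<^sub>m (det A \<cdot>\<^sub>m 1\<^sub>m n) = 1\<^sub>m n" using assms(2) by (intro eq_matI) auto
  ultimately show ?thesis using adj by (intro bexI[of _ ?B]) auto
qed

text \<open>The exceptional \<open>t\<close> are the negatives of the eigenvalues of
  \<open>A\<close>, which are roots of its characteristic polynomial.\<close>

lemma finite_singular_shifts:
  fixes A :: "'k::field mat"
  assumes A: "A \<in> carrier_mat n n"
  shows "finite {t. det (A + t \<cdot>\<^sub>m 1\<^sub>m n) = 0}"
proof -
  have "char_poly A \<noteq> 0" using degree_monic_char_poly[OF A] by auto
  then have "finite {k. poly (char_poly A) k = 0}" by (rule poly_roots_finite)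
  then have "finite (uminus ` {k. poly (char_poly A) k = 0})" by (rule finite_imageI)
  moreover have "{t. det (A + t \<cdot>\<^sub>m 1\<^sub>m n) = 0} \<subseteq> uminus ` {k. poly (char_poly A) k = 0}"
  proof
    fix t assume "t \<in> {t. det (A + t \<cdot>\<^sub>m 1\<^sub>m n) = 0}"
    then have "det (char_matrix A (- t)) = 0" using A by (simp add: char_matrix_def)
    then have "poly (char_poly A) (- t) = 0" using eigenvalue_det[OF A] eigenvalue_root_char_poly[OF A] by blast
    then show "t \<in> uminus ` {k. poly (char_poly A) k = 0}" by (intro image_eqI[of _ _ "- t"]) auto
  qed
  ultimately show ?thesis by (rule finite_subset[rotated])
qed

lemma poly_fun_along_curve:
  fixes \<delta> :: "'k::field poly"
  assumes c: "\<And>x i j. i < d \<Longrightarrow> j < d \<Longrightarrow> \<exists>R. \<forall>t. poly \<delta> t \<noteq> 0 \<longrightarrow> poly \<delta> t * (c t x $$ (i, j)) = poly R t"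
    and "p \<in> poly_fun d"
  shows "\<exists>m R. \<forall>t. poly \<delta> t \<noteq> 0 \<longrightarrow> poly \<delta> t ^ m * p (c t) = poly R t"
  using assms(2)
proof induction
  case (const a)
  then show ?case by (intro exI[of _ 0] exI[of _ "[:a:]"]) auto
next
  case (coord i j x)
  from c[OF coord, of x] obtain R where "\<forall>t. poly \<delta> t \<noteq> 0 \<longrightarrow> poly \<delta> t * (c t x $$ (i, j)) = poly R t" ..
  then show ?case by (intro exI[of _ 1] exI[of _ R]) auto
next
  case (add p q)
  then obtain m R m' R' where *: "\<forall>t. poly \<delta> t \<noteq> 0 \<longrightarrow> poly \<delta> t ^ m * p (c t) = poly R t"
    "\<forall>t. poly \<delta> t \<noteq> 0 \<longrightarrow> poly \<delta> t ^ m' * q (c t) = poly R' t" by auto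
  show ?case
  proof (intro exI[of _ "m + m'"] exI[of _ "\<delta> ^ m' * R + \<delta> ^ m * R'"] allI impI)
    fix t assume "poly \<delta> t \<noteq> 0"
    then have "poly R t = poly \<delta> t ^ m * p (c t)" "poly R' t = poly \<delta> t ^ m' * q (c t)" using * by auto
    then show "poly \<delta> t ^ (m + m') * (p (c t) + q (c t)) = poly (\<delta> ^ m' * R + \<delta> ^ m * R') t"
      by (simp add: power_add algebra_simps)
  qed
next
  case (mult p q)
  then obtain m R m' R' where *: "\<forall>t. poly \<delta> t \<noteq> 0 \<longrightarrow> poly \<delta> t ^ m * p (c t) = poly R t"
    "\<forall>t. poly \<delta> t \<noteq> 0 \<longrightarrow> poly \<delta> t ^ m' * q (c t) = poly R' t" by auto
  show ?case
  proof (intro exI[of _ "m + m'"] exI[of _ "R * R'"] allI impI)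
    fix t assume "poly \<delta> t \<noteq> 0"
    then have "poly R t = poly \<delta> t ^ m * p (c t)" "poly R' t = poly \<delta> t ^ m' * q (c t)" using * by auto
    then show "poly \<delta> t ^ (m + m') * (p (c t) * q (c t)) = poly (R * R') t"
      by (simp add: power_add algebra_simps)
  qed
qed

text \<open>Up to a power of \<delta> a polynomial function along the curve is a polynomial in
  \<open>t\<close>. If it vanishes on the orbit, this polynomial has infinitely many roots and is
  zero, so the function also vanishes at \<open>t = 0\<close>, where \<delta> is invertible.\<close>

lemma closure_of_curve:
  fixes \<delta> :: "'k::alg_closed_field poly"
  assumes c: "\<And>x i j. i < d \<Longrightarrow> j < d \<Longrightarrow> \<exists>R. \<forall>t. poly \<delta> t \<noteq> 0 \<longrightarrow> poly \<delta> t * (c t x $$ (i, j)) = poly R t"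
    and \<delta>0: "poly \<delta> 0 \<noteq> 0" and fin: "finite Z" and orb: "\<And>t. t \<notin> Z \<Longrightarrow> c t \<in> Orb"
  shows "c 0 \<in> zariski_closure d Orb"
  unfolding zariski_closure_def
proof (intro CollectI ballI impI)
  fix p :: "('a \<Rightarrow> 'k mat) \<Rightarrow> 'k" assume p: "p \<in> poly_fun d" "\<forall>\<rho>\<in>Orb. p \<rho> = 0"
  obtain m R where R: "\<And>t. poly \<delta> t \<noteq> 0 \<Longrightarrow> poly \<delta> t ^ m * p (c t) = poly R t"
    using poly_fun_along_curve[of d \<delta> c, OF c p(1)] by blast
  have "\<delta> \<noteq> 0" using \<delta>0 by auto
  then have fin': "finite (Z \<union> {t. poly \<delta> t = 0})" using fin poly_roots_finite by auto
  have "R = 0"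
  proof (rule ccontr)
    assume "R \<noteq> 0"
    then have "finite {t. poly R t = 0}" by (rule poly_roots_finite)
    moreover have "UNIV \<subseteq> {t. poly R t = 0} \<union> (Z \<union> {t. poly \<delta> t = 0})"
    proof
      fix t
      show "t \<in> {t. poly R t = 0} \<union> (Z \<union> {t. poly \<delta> t = 0})"
      proof (cases "t \<in> Z \<union> {t. poly \<delta> t = 0}")
        case False
        then have "p (c t) = 0" using p(2) orb by auto
        then show ?thesis using R[of t] False by simp
      qed auto
    qed
    ultimately have "finite (UNIV :: 'k set)" using fin' finite_subset by blast
    then show False using infinite_alg_closed_field by blast
  qed
  then show "p (c 0) = 0" using R[OF \<delta>0] \<delta>0 by simp
qed

locale exact_flag =
  fixes scal :: "'k::alg_closed_field \<Rightarrow> 'a::ring_1 \<Rightarrow> 'a"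
    and d :: nat and \<mu> \<nu> :: "'a \<Rightarrow> 'k mat"
    and dX :: "nat \<Rightarrow> nat" and X :: "nat \<Rightarrow> 'a \<Rightarrow> 'k mat" and h a b :: "nat \<Rightarrow> 'k mat"
  assumes d1: "1 \<le> d" and \<mu>: "\<mu> \<in> tri_reps scal d" and \<nu>: "\<nu> \<in> tri_reps scal d"
    and X: "\<And>l. l \<in> {1..d} \<Longrightarrow> is_rep scal (dX l) (X l)"
    and h: "\<And>l. l \<in> {1..<d} \<Longrightarrow> is_hom (dX l) (X l) (dX (l + 1)) (X (l + 1)) (h l)"
    and a: "\<And>l. l \<in> {1..d} \<Longrightarrow> is_hom (dX l) (X l) (dX l + l) (dsum_rep (dX l) (X l) l (sub_rep l \<mu>)) (a l)"
    and b: "\<And>l. l \<in> {1..d} \<Longrightarrow> is_hom (dX l + l) (dsum_rep (dX l) (X l) l (sub_rep l \<mu>)) l (sub_rep l \<nu>) (b l)"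
    and ex: "\<And>l. l \<in> {1..d} \<Longrightarrow> short_exact (dX l) (dX l + l) l (a l) (b l)"
    and sqa: "\<And>l. l \<in> {1..<d} \<Longrightarrow> diag_block (dX (l + 1)) (dX l) (h l) (l + 1) l (incl_mat l) * a l = a (l + 1) * h l"
    and sqb: "\<And>l. l \<in> {1..<d} \<Longrightarrow> incl_mat l * b l = b (l + 1) * diag_block (dX (l + 1)) (dX l) (h l) (l + 1) l (incl_mat l)"
begin

definition aX :: "nat \<Rightarrow> 'k mat" where "aX l = mat (dX l) (dX l) (\<lambda>(i, j). a l $$ (i, j))"
definition aM :: "nat \<Rightarrow> 'k mat" where "aM l = mat l (dX l) (\<lambda>(i, j). a l $$ (dX l + i, j))"

abbreviation "D l \<equiv> diag_block (dX (l + 1)) (dX l) (h l) (l + 1) l (incl_mat l)"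
abbreviation "\<rho> l \<equiv> dsum_rep (dX l) (X l) l (sub_rep l \<mu>)"

lemma carriers:
  assumes "l \<in> {1..d}"
  shows "a l \<in> carrier_mat (dX l + l) (dX l)" "b l \<in> carrier_mat l (dX l + l)" "X l x \<in> carrier_mat (dX l) (dX l)"
    "\<rho> l x \<in> carrier_mat (dX l + l) (dX l + l)"
proof -
  show "a l \<in> carrier_mat (dX l + l) (dX l)" "b l \<in> carrier_mat l (dX l + l)" "X l x \<in> carrier_mat (dX l) (dX l)"
    using a[OF assms] b[OF assms] X[OF assms] by (auto simp: is_hom_def is_rep_def)
  then show "\<rho> l x \<in> carrier_mat (dX l + l) (dX l + l)"
    unfolding dsum_rep_def sub_rep_def by (intro four_block_carrier_mat) auto
qed

lemma aXM [simp]: "aX l \<in> carrier_mat (dX l) (dX l)" "aM l \<in> carrier_mat l (dX l)"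
  by (simp_all add: aX_def aM_def)

lemma sub_rep_carrier [simp]: "sub_rep l \<kappa> x \<in> carrier_mat l l" by (simp add: sub_rep_def)

lemma a_vec:
  assumes l: "l \<in> {1..d}" and u: "u \<in> carrier_vec (dX l)"
  shows "a l *\<^sub>v u = (aX l *\<^sub>v u) @\<^sub>v (aM l *\<^sub>v u)"
proof (rule eq_vecI)
  fix i assume "i < dim_vec ((aX l *\<^sub>v u) @\<^sub>v (aM l *\<^sub>v u))"
  then have i: "i < dX l + l" by (simp add: aX_def aM_def)
  show "(a l *\<^sub>v u) $ i = ((aX l *\<^sub>v u) @\<^sub>v (aM l *\<^sub>v u)) $ i"
    using i carriers(1)[OF l] u by (auto simp: aX_def aM_def scalar_prod_def intro!: sum.cong)
qed (use carriers(1)[OF l] in \<open>auto simp: aX_def aM_def\<close>)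

lemma \<rho>_vec:
  assumes l: "l \<in> {1..d}" and u: "u \<in> carrier_vec (dX l)" "m \<in> carrier_vec l"
  shows "\<rho> l x *\<^sub>v (u @\<^sub>v m) = (X l x *\<^sub>v u) @\<^sub>v (sub_rep l \<mu> x *\<^sub>v m)"
  unfolding dsum_rep_def by (rule mult_mat_vec_split[OF carriers(3)[OF l] sub_rep_carrier u])

text \<open>Equivariance of \<open>a\<close>, split by components: \<open>aX\<close> is an
  endomorphism of \<open>X_l\<close> and \<open>aM\<close> a homomorphism to \<open>M_l\<close>.
  Hence adding a scalar to \<open>aX\<close> keeps the embedding equivariant.\<close>

lemma a_components:
  assumes l: "l \<in> {1..d}" and u: "u \<in> carrier_vec (dX l)"
  shows "aX l *\<^sub>v (X l x *\<^sub>v u) = X l x *\<^sub>v (aX l *\<^sub>v u)" "aM l *\<^sub>v (X l x *\<^sub>v u) = sub_rep l \<mu> x *\<^sub>v (aM l *\<^sub>v u)"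
proof -
  note c = carriers(1,2)[OF l] carriers(3,4)[OF l, of x]
  have Xu: "X l x *\<^sub>v u \<in> carrier_vec (dX l)" using c(3) u by auto
  have "a l * X l x = \<rho> l x * a l" using a[OF l] by (simp add: is_hom_def)
  then have "a l *\<^sub>v (X l x *\<^sub>v u) = \<rho> l x *\<^sub>v (a l *\<^sub>v u)"
    using assoc_mult_mat_vec[OF c(1) c(3) u] assoc_mult_mat_vec[OF c(4) c(1) u] by simp
  then have eq: "(aX l *\<^sub>v (X l x *\<^sub>v u)) @\<^sub>v (aM l *\<^sub>v (X l x *\<^sub>v u)) =
      (X l x *\<^sub>v (aX l *\<^sub>v u)) @\<^sub>v (sub_rep l \<mu> x *\<^sub>v (aM l *\<^sub>v u))"
    unfolding a_vec[OF l u] a_vec[OF l Xu]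
    by (subst (asm) \<rho>_vec[OF l mult_mat_vec_carrier[OF aXM(1) u] mult_mat_vec_carrier[OF aXM(2) u]])
  from append_inj[OF _ _ eq] show "aX l *\<^sub>v (X l x *\<^sub>v u) = X l x *\<^sub>v (aX l *\<^sub>v u)"
    "aM l *\<^sub>v (X l x *\<^sub>v u) = sub_rep l \<mu> x *\<^sub>v (aM l *\<^sub>v u)"
    using mult_mat_vec_carrier[OF aXM(1) Xu] mult_mat_vec_carrier[OF c(3) mult_mat_vec_carrier[OF aXM(1) u]] by auto
qed

lemma h_carrier: "l \<in> {1..<d} \<Longrightarrow> h l \<in> carrier_mat (dX (l + 1)) (dX l)"
  using h by (auto simp: is_hom_def)

lemmas D_vec = diag_block_mult_vec[OF h_carrier incl_carrier]

lemma D_carrier: "l \<in> {1..<d} \<Longrightarrow> D l \<in> carrier_mat (dX (l + 1) + (l + 1)) (dX l + l)"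
  by (rule diag_block_carrier[OF h_carrier incl_carrier])

lemma h_components:
  assumes l: "l \<in> {1..<d}" and u: "u \<in> carrier_vec (dX l)"
  shows "h l *\<^sub>v (aX l *\<^sub>v u) = aX (l + 1) *\<^sub>v (h l *\<^sub>v u)" "incl_mat l *\<^sub>v (aM l *\<^sub>v u) = aM (l + 1) *\<^sub>v (h l *\<^sub>v u)"
proof -
  have l': "l \<in> {1..d}" "l + 1 \<in> {1..d}" using l by auto
  have hu: "h l *\<^sub>v u \<in> carrier_vec (dX (l + 1))" using h_carrier[OF l] u by auto
  have "D l *\<^sub>v (a l *\<^sub>v u) = a (l + 1) *\<^sub>v (h l *\<^sub>v u)"
    using sqa[OF l] assoc_mult_mat_vec[OF D_carrier[OF l] carriers(1)[OF l'(1)] u]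
      assoc_mult_mat_vec[OF carriers(1)[OF l'(2)] h_carrier[OF l] u] by simp
  then have eq: "(h l *\<^sub>v (aX l *\<^sub>v u)) @\<^sub>v (incl_mat l *\<^sub>v (aM l *\<^sub>v u)) =
      (aX (l + 1) *\<^sub>v (h l *\<^sub>v u)) @\<^sub>v (aM (l + 1) *\<^sub>v (h l *\<^sub>v u))"
    unfolding a_vec[OF l'(1) u] a_vec[OF l'(2) hu]
    by (subst (asm) D_vec[OF l mult_mat_vec_carrier[OF aXM(1) u] mult_mat_vec_carrier[OF aXM(2) u]])
  from append_inj[OF _ _ eq] show "h l *\<^sub>v (aX l *\<^sub>v u) = aX (l + 1) *\<^sub>v (h l *\<^sub>v u)"
    "incl_mat l *\<^sub>v (aM l *\<^sub>v u) = aM (l + 1) *\<^sub>v (h l *\<^sub>v u)"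
    using mult_mat_vec_carrier[OF aXM(1) hu] mult_mat_vec_carrier[OF h_carrier[OF l] mult_mat_vec_carrier[OF aXM(1) u]] by auto
qed

section \<open>Perturbing the first component of the embedding by a scalar\<close>

definition A :: "nat \<Rightarrow> 'k \<Rightarrow> 'k mat" where "A l t = aX l + t \<cdot>\<^sub>m 1\<^sub>m (dX l)"
definition R :: "nat \<Rightarrow> 'k \<Rightarrow> 'k mat" where
  "R l t = (SOME B. B \<in> carrier_mat (dX l) (dX l) \<and> A l t * B = 1\<^sub>m (dX l) \<and> B * A l t = 1\<^sub>m (dX l))"

text \<open>Outside this set \<open>aX l + t\<close> is invertible at all levels simultaneously, so
  the cokernels are identified with the \<open>M_l\<close> for the same \<open>t\<close>.\<close>

definition Z :: "'k set" where "Z = {t. \<exists>l\<in>{1..d}. det (A l t) = 0}"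

lemma finite_Z: "finite Z"
proof -
  have "Z = (\<Union>l\<in>{1..d}. {t. det (A l t) = 0})" by (auto simp: Z_def)
  then show ?thesis using finite_singular_shifts[OF aXM(1)] by (auto simp: A_def)
qed

lemma A_carrier [simp]: "A l t \<in> carrier_mat (dX l) (dX l)" by (simp add: A_def)

lemma A_vec:
  assumes u: "u \<in> carrier_vec (dX l)" shows "A l t *\<^sub>v u = aX l *\<^sub>v u + t \<cdot>\<^sub>v u"
proof -
  have "(t \<cdot>\<^sub>m 1\<^sub>m (dX l)) *\<^sub>v u = t \<cdot>\<^sub>v (1\<^sub>m (dX l) *\<^sub>v u)"
    by (rule smult_mat_mult_vec[OF one_carrier_mat u])
  then show ?thesis unfolding A_def
    using u add_mult_distrib_mat_vec[OF aXM(1) _ u, of "t \<cdot>\<^sub>m 1\<^sub>m (dX l)"] by simp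
qed

lemma R_inverse:
  assumes "t \<notin> Z" "l \<in> {1..d}"
  shows "R l t \<in> carrier_mat (dX l) (dX l)" "u \<in> carrier_vec (dX l) \<Longrightarrow> A l t *\<^sub>v (R l t *\<^sub>v u) = u"
    "u \<in> carrier_vec (dX l) \<Longrightarrow> R l t *\<^sub>v (A l t *\<^sub>v u) = u"
proof -
  have "det (A l t) \<noteq> 0" using assms by (auto simp: Z_def)
  then have "\<exists>B. B \<in> carrier_mat (dX l) (dX l) \<and> A l t * B = 1\<^sub>m (dX l) \<and> B * A l t = 1\<^sub>m (dX l)"
    using inverse_of_det_nonzero[OF A_carrier] by blast
  from someI_ex[OF this, folded R_def]
  have *: "R l t \<in> carrier_mat (dX l) (dX l)" "A l t * R l t = 1\<^sub>m (dX l)" "R l t * A l t = 1\<^sub>m (dX l)" by auto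
  show "R l t \<in> carrier_mat (dX l) (dX l)" by (rule *)
  show "A l t *\<^sub>v (R l t *\<^sub>v u) = u" if "u \<in> carrier_vec (dX l)" for u
    unfolding assoc_mult_mat_vec[OF A_carrier *(1) that, symmetric] *(2) using that by simp
  show "R l t *\<^sub>v (A l t *\<^sub>v u) = u" if "u \<in> carrier_vec (dX l)" for u
    unfolding assoc_mult_mat_vec[OF *(1) A_carrier that, symmetric] *(3) using that by simp
qed

text \<open>For all but finitely many \<open>t\<close> this is the cokernel of \<open>a + t (1, 0)\<close>.\<close>
definition q :: "nat \<Rightarrow> 'k \<Rightarrow> 'k vec \<Rightarrow> 'k vec \<Rightarrow> 'k vec" where
  "q l t u m = m - aM l *\<^sub>v (R l t *\<^sub>v u)"

lemma R_intertwine: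
  assumes t: "t \<notin> Z" and l: "l \<in> {1..d}" and u: "u \<in> carrier_vec (dX l)"
  shows "R l t *\<^sub>v (X l x *\<^sub>v u) = X l x *\<^sub>v (R l t *\<^sub>v u)"
proof -
  define w where "w = R l t *\<^sub>v u"
  have w: "w \<in> carrier_vec (dX l)" using R_inverse(1)[OF t l] u by (simp add: w_def)
  have u': "u = A l t *\<^sub>v w" unfolding w_def using R_inverse(2)[OF t l u] by simp
  note Xc = carriers(3)[OF l, of x]
  have Xw: "X l x *\<^sub>v w \<in> carrier_vec (dX l)" using Xc w by auto
  have "X l x *\<^sub>v u = X l x *\<^sub>v (aX l *\<^sub>v w) + X l x *\<^sub>v (t \<cdot>\<^sub>v w)"
    unfolding u' A_vec[OF w]
    by (rule mult_add_distrib_mat_vec[OF Xc mult_mat_vec_carrier[OF aXM(1) w]]) (use w in auto)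
  also have "\<dots> = A l t *\<^sub>v (X l x *\<^sub>v w)"
    unfolding A_vec[OF Xw] a_components(1)[OF l w] mult_mat_vec[OF Xc w] ..
  finally show ?thesis using R_inverse(3)[OF t l Xw] by (simp add: w_def)
qed

lemma R_h:
  assumes t: "t \<notin> Z" and l: "l \<in> {1..<d}" and u: "u \<in> carrier_vec (dX l)"
  shows "R (l + 1) t *\<^sub>v (h l *\<^sub>v u) = h l *\<^sub>v (R l t *\<^sub>v u)"
proof -
  have l': "l \<in> {1..d}" "l + 1 \<in> {1..d}" using l by auto
  define w where "w = R l t *\<^sub>v u"
  have w: "w \<in> carrier_vec (dX l)" using R_inverse(1)[OF t l'(1)] u by (simp add: w_def)
  have u': "u = A l t *\<^sub>v w" unfolding w_def using R_inverse(2)[OF t l'(1) u] by simp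
  note hc = h_carrier[OF l]
  have hw: "h l *\<^sub>v w \<in> carrier_vec (dX (l + 1))" using hc w by auto
  have "h l *\<^sub>v u = h l *\<^sub>v (aX l *\<^sub>v w) + h l *\<^sub>v (t \<cdot>\<^sub>v w)"
    unfolding u' A_vec[OF w]
    by (rule mult_add_distrib_mat_vec[OF hc mult_mat_vec_carrier[OF aXM(1) w]]) (use w in auto)
  also have "\<dots> = A (l + 1) t *\<^sub>v (h l *\<^sub>v w)"
    unfolding A_vec[OF hw] h_components(1)[OF l w] mult_mat_vec[OF hc w] ..
  finally show ?thesis using R_inverse(3)[OF t l'(2) hw] by (simp add: w_def)
qed

lemma q_hom:
  assumes t: "t \<notin> Z" and l: "l \<in> {1..d}" and u: "u \<in> carrier_vec (dX l)" "m \<in> carrier_vec l"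
  shows "q l t (X l x *\<^sub>v u) (sub_rep l \<mu> x *\<^sub>v m) = sub_rep l \<mu> x *\<^sub>v q l t u m"
proof -
  have Ru: "R l t *\<^sub>v u \<in> carrier_vec (dX l)" using R_inverse(1)[OF t l] u by auto
  show ?thesis unfolding q_def R_intertwine[OF t l u(1)] a_components(2)[OF l Ru]
    by (rule mult_minus_distrib_vec[symmetric, OF sub_rep_carrier u(2)]) (use mult_mat_vec_carrier[OF aXM(2) Ru] in auto)
qed

text \<open>The identifications of the cokernels with the \<open>M_l\<close> commute with the flag
  maps, because \<open>h\<close> intertwines the inverses \<open>R\<close>. This transports
  triangularity up to level \<open>d\<close>.\<close>

lemma q_D:
  assumes t: "t \<notin> Z" and l: "l \<in> {1..<d}" and u: "u \<in> carrier_vec (dX l)" "m \<in> carrier_vec l"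
  shows "q (l + 1) t (h l *\<^sub>v u) (incl_mat l *\<^sub>v m) = incl_mat l *\<^sub>v q l t u m"
proof -
  have l': "l \<in> {1..d}" using l by auto
  have Ru: "R l t *\<^sub>v u \<in> carrier_vec (dX l)" using R_inverse(1)[OF t l'] u by auto
  show ?thesis unfolding q_def R_h[OF t l u(1)] h_components(2)[OF l Ru, symmetric]
    by (rule mult_minus_distrib_vec[symmetric, OF incl_carrier u(2)]) (use mult_mat_vec_carrier[OF aXM(2) Ru] in auto)
qed

lemma q_kernel:
  assumes t: "t \<notin> Z" and l: "l \<in> {1..d}" and u: "u \<in> carrier_vec (dX l)"
  shows "q l t (aX l *\<^sub>v u + t \<cdot>\<^sub>v u) (aM l *\<^sub>v u) = 0\<^sub>v l"
  unfolding q_def A_vec[OF u, symmetric] R_inverse(3)[OF t l u] using mult_mat_vec_carrier[OF aXM(2) u] by simp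

text \<open>The lift is chosen at level \<open>j + 1\<close>, where the unit vector with index
  \<open>j\<close> first occurs, and pushed up along the flag. At that level its image under
  \<open>q\<close> has only the coordinates up to \<open>j\<close>, and the inclusions add
  zeros.\<close>

lemma adapted_lift:
  assumes j: "j < d"
  shows "\<exists>u\<in>carrier_vec (dX d). \<exists>m\<in>carrier_vec d. b d *\<^sub>v (u @\<^sub>v m) = unit_vec d j \<and>
    (\<forall>t i. t \<notin> Z \<longrightarrow> j < i \<longrightarrow> i < d \<longrightarrow> q d t u m $ i = 0)"
proof -
  have "\<exists>u\<in>carrier_vec (dX l). \<exists>m\<in>carrier_vec l. b l *\<^sub>v (u @\<^sub>v m) = unit_vec l j \<and>
    (\<forall>t i. t \<notin> Z \<longrightarrow> j < i \<longrightarrow> i < l \<longrightarrow> q l t u m $ i = 0)" if "j + 1 \<le> l" "l \<le> d" for l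
    using that
  proof (induction l rule: dec_induct)
    case base
    then have l: "j + 1 \<in> {1..d}" by auto
    have "\<exists>v\<in>carrier_vec (dX (j + 1) + (j + 1)). b (j + 1) *\<^sub>v v = unit_vec (j + 1) j"
      using ex[OF l] unfolding short_exact_def by auto
    then obtain v where v: "v \<in> carrier_vec (dX (j + 1) + (j + 1))" "b (j + 1) *\<^sub>v v = unit_vec (j + 1) j" by auto
    from vec_split[OF v(1)] v(2) show ?case by fastforce
  next
    case (step l)
    then obtain u m where um: "u \<in> carrier_vec (dX l)" "m \<in> carrier_vec l" "b l *\<^sub>v (u @\<^sub>v m) = unit_vec l j"
      "\<And>t i. t \<notin> Z \<Longrightarrow> j < i \<Longrightarrow> i < l \<Longrightarrow> q l t u m $ i = 0" by auto
    have l: "l \<in> {1..<d}" "l \<in> {1..d}" "l + 1 \<in> {1..d}" using step by auto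
    have hu: "h l *\<^sub>v u \<in> carrier_vec (dX (l + 1))" using h_carrier[OF l(1)] um by auto
    have im: "incl_mat l *\<^sub>v m \<in> carrier_vec (l + 1)" by (rule mult_mat_vec_carrier[OF incl_carrier um(2)])
    have umc: "u @\<^sub>v m \<in> carrier_vec (dX l + l)" using um by auto
    have "b (l + 1) *\<^sub>v ((h l *\<^sub>v u) @\<^sub>v (incl_mat l *\<^sub>v m)) = (b (l + 1) * D l) *\<^sub>v (u @\<^sub>v m)"
      using assoc_mult_mat_vec[OF carriers(2)[OF l(3)] D_carrier[OF l(1)] umc] D_vec[OF l(1) um(1,2)] by simp
    also have "\<dots> = incl_mat l *\<^sub>v unit_vec l j"
      unfolding sqb[OF l(1), symmetric] um(3)[symmetric]
      by (rule assoc_mult_mat_vec[OF incl_carrier carriers(2)[OF l(2)] umc])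
    also have "\<dots> = unit_vec (l + 1) j"
      proof (rule eq_vecI)
      fix i assume "i < dim_vec (unit_vec (l + 1) j :: 'k vec)"
      then have i: "i < l + 1" by simp
      show "(incl_mat l *\<^sub>v unit_vec l j) $ i = (unit_vec (l + 1) j :: 'k vec) $ i"
        unfolding incl_mult_vec[OF unit_vec_carrier i] using i step(1) by auto
    qed (simp add: incl_mat_def)
    finally have 1: "b (l + 1) *\<^sub>v ((h l *\<^sub>v u) @\<^sub>v (incl_mat l *\<^sub>v m)) = unit_vec (l + 1) j" .
    have 2: "q (l + 1) t (h l *\<^sub>v u) (incl_mat l *\<^sub>v m) $ i = 0" if "t \<notin> Z" "j < i" "i < l + 1" for t i
    proof -
      have Ru: "R l t *\<^sub>v u \<in> carrier_vec (dX l)" using R_inverse(1)[OF that(1) l(2)] um(1) by auto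
      have "q l t u m \<in> carrier_vec l" unfolding q_def using um(2) mult_mat_vec_carrier[OF aXM(2) Ru] by auto
      from incl_mult_vec[OF this that(3)] show ?thesis
        unfolding q_D[OF that(1) l(1) um(1,2)] using um(4)[OF that(1,2)] by (simp del: index_mult_mat_vec)
    qed
    show ?case using 1 2 hu im by auto
  qed
  from this[of d] j show ?thesis by auto
qed

theorem \<nu>_in_closure: "\<nu> \<in> zariski_closure d (U_orbit d \<mu>)"
proof -
  have ld: "d \<in> {1..d}" using d1 by auto
  define n where "n = dX d"
  have "\<rho> d x \<in> carrier_mat (n + d) (n + d)" for x
    unfolding n_def by (rule carriers(4)[OF ld])
  note c = carriers(1-3)[OF ld, folded n_def] this
  have "\<forall>j. \<exists>um. j < d \<longrightarrow> fst um \<in> carrier_vec n \<and> snd um \<in> carrier_vec d \<and> b d *\<^sub>v (fst um @\<^sub>v snd um) = unit_vec d j \<and>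
    (\<forall>t i. t \<notin> Z \<longrightarrow> j < i \<longrightarrow> i < d \<longrightarrow> q d t (fst um) (snd um) $ i = 0)"
    using adapted_lift unfolding n_def by (auto simp: Bex_def)
  from choice[OF this] obtain um where um: "\<And>j. j < d \<Longrightarrow> fst (um j) \<in> carrier_vec n \<and> snd (um j) \<in> carrier_vec d \<and>
    b d *\<^sub>v (fst (um j) @\<^sub>v snd (um j)) = unit_vec d j \<and>
    (\<forall>t i. t \<notin> Z \<longrightarrow> j < i \<longrightarrow> i < d \<longrightarrow> q d t (fst (um j)) (snd (um j)) $ i = 0)" by blast
  define U where "U j = fst (um j)" for j
  define M where "M j = snd (um j)" for j
  have U: "U j \<in> carrier_vec n" and M: "M j \<in> carrier_vec d" and bUM: "b d *\<^sub>v (U j @\<^sub>v M j) = unit_vec d j"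
    and qUM: "\<And>t i. t \<notin> Z \<Longrightarrow> j < i \<Longrightarrow> i < d \<Longrightarrow> q d t (U j) (M j) $ i = 0" if "j < d" for j
    using um[OF that] by (auto simp: U_def M_def)
  define V where "V = mat (n + d) d (\<lambda>(i, j). (U j @\<^sub>v M j) $ i)"
  have V: "V \<in> carrier_mat (n + d) d" by (simp add: V_def)
  have colV: "col V j = U j @\<^sub>v M j" if "j < d" for j
    using U[OF that] M[OF that] that by (intro eq_vecI) (auto simp: V_def)
  have bV: "b d * V = 1\<^sub>m d"
  proof (rule eq_matI)
    fix i j assume ij: "i < dim_row (1\<^sub>m d :: 'k mat)" "j < dim_col (1\<^sub>m d :: 'k mat)"
    then have "(b d * V) $$ (i, j) = (b d *\<^sub>v col V j) $ i" using c(2) V by auto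
    also have "\<dots> = 1\<^sub>m d $$ (i, j)" using ij colV bUM by (auto simp: unit_vec_def)
    finally show "(b d * V) $$ (i, j) = 1\<^sub>m d $$ (i, j)" .
  qed (use c(2) V in auto)
  \<comment> \<open>The columns of \<open>a + t (1, 0)\<close> at level \<open>d\<close>, followed
    by those of \<open>V\<close>. If it is invertible, the columns of \<open>V\<close> represent a
    basis of the cokernel.\<close>
  define W where "W t = mat (n + d) (n + d) (\<lambda>(i, j). if j < n then a d $$ (i, j) + (if i = j then t else 0) else V $$ (i, j - n))" for t
  define Zm where "Zm = mat d (n + d) (\<lambda>(i, j). if j = n + i then 1 else 0 :: 'k)"
  have W: "W t \<in> carrier_mat (n + d) (n + d)" for t by (simp add: W_def)
  have Zm: "Zm \<in> carrier_mat d (n + d)" by (simp add: Zm_def)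
  have Z_vec: "Zm *\<^sub>v (u @\<^sub>v v) = v" if "u \<in> carrier_vec n" "v \<in> carrier_vec d" for u v
  proof (rule eq_vecI)
    fix i assume "i < dim_vec v"
    then have i: "i < d" using that by auto
    have "(\<Sum>j<n. Zm $$ (i, j) * u $ j) = 0" using i by (intro sum.neutral) (auto simp: Zm_def)
    moreover have "(\<Sum>j<d. Zm $$ (i, n + j) * v $ j) = (\<Sum>j<d. if j = i then v $ i else 0)"
      using i by (intro sum.cong) (auto simp: Zm_def)
    ultimately show "(Zm *\<^sub>v (u @\<^sub>v v)) $ i = v $ i" using mult_append_vec[OF Zm that i] i by simp
  qed (use that Zm in auto)
  have W_vec: "W t *\<^sub>v (u @\<^sub>v v) = ((aX d *\<^sub>v u + t \<cdot>\<^sub>v u) @\<^sub>v (aM d *\<^sub>v u)) + V *\<^sub>v v"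
    if u: "u \<in> carrier_vec n" and v: "v \<in> carrier_vec d" for t u v
  proof (rule eq_vecI)
    have u': "u \<in> carrier_vec (dX d)" using u by (simp add: n_def)
    have ac: "aX d \<in> carrier_mat n n" "aM d \<in> carrier_mat d n" by (simp_all add: n_def)
    have au: "aX d *\<^sub>v u \<in> carrier_vec n" "aM d *\<^sub>v u \<in> carrier_vec d" "t \<cdot>\<^sub>v u \<in> carrier_vec n"
      using mult_mat_vec_carrier[OF ac(1) u] mult_mat_vec_carrier[OF ac(2) u] u by auto
    fix i assume "i < dim_vec (((aX d *\<^sub>v u + t \<cdot>\<^sub>v u) @\<^sub>v (aM d *\<^sub>v u)) + V *\<^sub>v v)"
    then have i: "i < n + d" using V by auto
    have gen: "(x @\<^sub>v z) $ i + (if i < n then y $ i else 0) + w $ i = (((x + y) @\<^sub>v z) + w) $ i"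
      if "x \<in> carrier_vec n" "y \<in> carrier_vec n" "z \<in> carrier_vec d" "w \<in> carrier_vec (n + d)" "i < n + d"
      for x y z w :: "'k vec" and i
      using that by (cases "i < n") auto
    have "(\<Sum>j<n. W t $$ (i, j) * u $ j) = (\<Sum>j<n. a d $$ (i, j) * u $ j) + (\<Sum>j<n. if j = i then t * u $ i else 0)"
      unfolding sum.distrib[symmetric] using i by (intro sum.cong) (auto simp: W_def algebra_simps)
    also have "(\<Sum>j<n. a d $$ (i, j) * u $ j) = (a d *\<^sub>v u) $ i" by (rule mat_vec_index[symmetric, OF c(1) u i])
    also have "(\<Sum>j<n. if j = i then t * u $ i else 0) = (if i < n then t * u $ i else 0)" by simp
    finally have 1: "(\<Sum>j<n. W t $$ (i, j) * u $ j) = (a d *\<^sub>v u) $ i + (if i < n then t * u $ i else 0)" .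
    have "(\<Sum>j<d. W t $$ (i, n + j) * v $ j) = (\<Sum>j<d. V $$ (i, j) * v $ j)" using i by (intro sum.cong) (auto simp: W_def)
    also have "\<dots> = (V *\<^sub>v v) $ i" by (rule mat_vec_index[symmetric, OF V v i])
    finally have 2: "(\<Sum>j<d. W t $$ (i, n + j) * v $ j) = (V *\<^sub>v v) $ i" .
    show "(W t *\<^sub>v (u @\<^sub>v v)) $ i = (((aX d *\<^sub>v u + t \<cdot>\<^sub>v u) @\<^sub>v (aM d *\<^sub>v u)) + V *\<^sub>v v) $ i"
      unfolding mult_append_vec[OF W u v i] 1 2 a_vec[OF ld u']
      using gen[OF au(1,3,2) mult_mat_vec_carrier[OF V v] i] carrier_vecD[OF u]
      by (cases "i < n") (simp_all del: index_mult_mat_vec)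
  qed (use W V in \<open>auto simp: aX_def aM_def n_def\<close>)
  have bW: "b d *\<^sub>v (W 0 *\<^sub>v (u @\<^sub>v v)) = v" if u: "u \<in> carrier_vec n" and v: "v \<in> carrier_vec d" for u v
  proof -
    have u': "u \<in> carrier_vec (dX d)" using u by (simp add: n_def)
    have au: "a d *\<^sub>v u \<in> carrier_vec (n + d)" by (rule mult_mat_vec_carrier[OF c(1) u])
    have Vv: "V *\<^sub>v v \<in> carrier_vec (n + d)" by (rule mult_mat_vec_carrier[OF V v])
    have "aX d *\<^sub>v u \<in> carrier_vec n" using mult_mat_vec_carrier[OF aXM(1) u'] by (simp add: n_def)
    then have "aX d *\<^sub>v u + 0 \<cdot>\<^sub>v u = aX d *\<^sub>v u" using carrier_vecD[of _ n] u
      by (intro eq_vecI) (simp_all del: index_mult_mat_vec dim_mult_mat_vec)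
    then have "W 0 *\<^sub>v (u @\<^sub>v v) = a d *\<^sub>v u + V *\<^sub>v v" unfolding W_vec[OF u v] a_vec[OF ld u'] by simp
    then have "b d *\<^sub>v (W 0 *\<^sub>v (u @\<^sub>v v)) = b d *\<^sub>v (a d *\<^sub>v u) + b d *\<^sub>v (V *\<^sub>v v)"
      using mult_add_distrib_mat_vec[OF c(2) au Vv] by simp
    also have "b d *\<^sub>v (a d *\<^sub>v u) = 0\<^sub>v d" using ex[OF ld] u au unfolding short_exact_def n_def by auto
    also have "b d *\<^sub>v (V *\<^sub>v v) = v" using assoc_mult_mat_vec[OF c(2) V v] bV v by simp
    finally show ?thesis using v by simp
  qed
  \<comment> \<open>At \<open>t = 0\<close> a kernel vector with parts \<open>u\<close> and
    \<open>v\<close> has \<open>v = 0\<close>, because \<open>b d\<close> kills the image of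
    \<open>a d\<close> and is a left inverse of \<open>V\<close>; then \<open>u = 0\<close>, because
    \<open>a d\<close> is injective.\<close>
  have W0: "det (W 0) \<noteq> 0"
  proof
    assume "det (W 0) = 0"
    then obtain w where w: "w \<in> carrier_vec (n + d)" "w \<noteq> 0\<^sub>v (n + d)" "W 0 *\<^sub>v w = 0\<^sub>v (n + d)"
      using det_0_iff_vec_prod_zero_field[OF W] by blast
    obtain u v where uv: "u \<in> carrier_vec n" "v \<in> carrier_vec d" "w = u @\<^sub>v v" using vec_split[OF w(1)] by auto
    have u': "u \<in> carrier_vec (dX d)" using uv by (simp add: n_def)
    have "b d *\<^sub>v 0\<^sub>v (n + d) = 0\<^sub>v d" using c(2) by (intro eq_vecI) auto
    then have v0: "v = 0\<^sub>v d" using bW[OF uv(1,2)] w(3) uv(3) by simp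
    have "V *\<^sub>v 0\<^sub>v d = 0\<^sub>v (n + d)" using V by (intro eq_vecI) auto
    moreover have "aX d *\<^sub>v u + 0 \<cdot>\<^sub>v u = aX d *\<^sub>v u"
      using carrier_vecD[OF mult_mat_vec_carrier[OF aXM(1) u']] carrier_vecD[OF u']
      by (intro eq_vecI) (simp_all del: index_mult_mat_vec dim_mult_mat_vec)
    ultimately have "a d *\<^sub>v u + 0\<^sub>v (n + d) = 0\<^sub>v (n + d)"
      using W_vec[OF uv(1,2), of 0] w(3) uv(3) v0 a_vec[OF ld u'] by simp
    then have "a d *\<^sub>v u = 0\<^sub>v (n + d)" using mult_mat_vec_carrier[OF c(1) uv(1)] by simp
    then have "u = 0\<^sub>v n" using ex[OF ld] uv(1) unfolding short_exact_def n_def by auto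
    then show False using w(2) uv(3) v0 by (auto intro!: eq_vecI)
  qed
  \<comment> \<open>The same matrix over \<open>k[t]\<close>. Its adjugate inverts
    \<open>W t\<close> with denominator \<delta>, so the entries along the curve are rational in
    \<open>t\<close>.\<close>
  define Wp where "Wp = mat (n + d) (n + d) (\<lambda>(i, j). if j < n then [:a d $$ (i, j), if i = j then 1 else 0:] else [:V $$ (i, j - n):])"
  have Wp: "Wp \<in> carrier_mat (n + d) (n + d)" by (simp add: Wp_def)
  define \<delta> where "\<delta> = det Wp"
  define Aj where "Aj = adj_mat Wp"
  note adj = adj_mat[OF Wp, folded Aj_def \<delta>_def]
  have ev: "poly \<delta> t = det (W t) \<and> map_mat (\<lambda>p. poly p t) Aj * W t = poly \<delta> t \<cdot>\<^sub>m 1\<^sub>m (n + d)" for t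
  proof -
    have hom: "semiring_hom (\<lambda>p :: 'k poly. poly p t)" "comm_ring_hom (\<lambda>p :: 'k poly. poly p t)"
      by (unfold_locales; auto)+
    have Wt: "map_mat (\<lambda>p. poly p t) Wp = W t" by (intro eq_matI) (auto simp: Wp_def W_def)
    have "map_mat (\<lambda>p. poly p t) Aj * map_mat (\<lambda>p. poly p t) Wp = map_mat (\<lambda>p. poly p t) (Aj * Wp)"
      by (rule semiring_hom.mat_hom_mult[OF hom(1) adj(1) Wp, symmetric])
    also have "\<dots> = poly \<delta> t \<cdot>\<^sub>m 1\<^sub>m (n + d)" unfolding adj(3) by (intro eq_matI) auto
    finally show ?thesis using comm_ring_hom.hom_det[OF hom(2), of Wp] by (simp add: Wt \<delta>_def)
  qed
  \<comment> \<open>For nonzero \<delta> these are the last \<open>d\<close> rows of the inverse of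
    \<open>W t\<close>: the projection to the cokernel, in the coordinates given by
    \<open>V\<close>.\<close>
  define P where "P t = mat d (n + d) (\<lambda>(i, m). inverse (poly \<delta> t) * poly (Aj $$ (n + i, m)) t)" for t
  have P: "P t \<in> carrier_mat d (n + d)" for t by (simp add: P_def)
  have PW: "P t * W t = Zm" if "poly \<delta> t \<noteq> 0" for t
  proof (rule eq_matI)
    fix i j assume "i < dim_row Zm" "j < dim_col Zm"
    then have ij: "i < d" "j < n + d" using Zm by auto
    have "(P t * W t) $$ (i, j) = inverse (poly \<delta> t) * (\<Sum>m<n + d. poly (Aj $$ (n + i, m)) t * W t $$ (m, j))"
      using ij W[of t] P[of t] by (simp add: scalar_prod_def atLeast0LessThan P_def sum_distrib_left mult.assoc)
    also have "(\<Sum>m<n + d. poly (Aj $$ (n + i, m)) t * W t $$ (m, j)) = (map_mat (\<lambda>p. poly p t) Aj * W t) $$ (n + i, j)"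
      using ij W[of t] adj(1) by (simp add: scalar_prod_def atLeast0LessThan)
    also have "inverse (poly \<delta> t) * \<dots> = Zm $$ (i, j)" using ev[of t] ij that by (auto simp: Zm_def)
    finally show "(P t * W t) $$ (i, j) = Zm $$ (i, j)" .
  qed (use P W Zm in auto)
  have cancel: "S = T" if st: "S \<in> carrier_mat d (n + d)" "T \<in> carrier_mat d (n + d)" "S * W t = T * W t" "poly \<delta> t \<noteq> 0" for S T t
  proof -
    obtain B where B: "B \<in> carrier_mat (n + d) (n + d)" "W t * B = 1\<^sub>m (n + d)"
      using inverse_of_det_nonzero[OF W] ev st(4) by metis
    have "S * (W t * B) = S * W t * B" by (rule assoc_mult_mat[symmetric, OF st(1) W B(1)])
    also have "\<dots> = T * (W t * B)" unfolding st(3) by (rule assoc_mult_mat[OF st(2) W B(1)])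
    finally have "S * (W t * B) = T * (W t * B)" .
    then show ?thesis using B(2) st(1,2) by simp
  qed
  \<comment> \<open>The action on the cokernel in the basis given by \<open>V\<close>. It is
    meaningful wherever \<delta> is nonzero, in particular at 0, where the projection is
    \<open>b d\<close>.\<close>
  define cv where "cv t x = P t * \<rho> d x * V" for t x
  have sub\<kappa>: "sub_rep d \<kappa> x = \<kappa> x" if "\<kappa> \<in> tri_reps scal d" for \<kappa> x
  proof -
    have "\<kappa> x \<in> carrier_mat d d" using that by (simp add: tri_reps_def is_rep_def)
    then show ?thesis by (intro eq_matI) (auto simp: sub_rep_def)
  qed
  have \<delta>0: "poly \<delta> 0 \<noteq> 0" using ev W0 by simp
  have P0: "P 0 = b d"
  proof (rule cancel[OF P c(2) _ \<delta>0])
    have "b d * W 0 = Zm"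
    proof (rule mat_eqI_append)
      show "b d * W 0 \<in> carrier_mat d (n + d)" "Zm \<in> carrier_mat d (n + d)" using c(2) W[of 0] Zm by auto
      fix u v :: "'k vec" assume uv: "u \<in> carrier_vec n" "v \<in> carrier_vec d"
      then have "u @\<^sub>v v \<in> carrier_vec (n + d)" by auto
      from assoc_mult_mat_vec[OF c(2) W this]
      show "(b d * W 0) *\<^sub>v (u @\<^sub>v v) = Zm *\<^sub>v (u @\<^sub>v v)" using bW[OF uv] Z_vec[OF uv] by simp
    qed
    then show "P 0 * W 0 = b d * W 0" using PW[OF \<delta>0] by simp
  qed
  have cv0: "cv 0 = \<nu>"
  proof
    fix x
    have \<nu>c: "\<nu> x \<in> carrier_mat d d" using \<nu> by (simp add: tri_reps_def is_rep_def)
    have "b d * \<rho> d x = \<nu> x * b d" using b[OF ld] sub\<kappa>[OF \<nu>, of x] by (simp add: is_hom_def)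
    then have "cv 0 x = \<nu> x * b d * V" by (simp add: cv_def P0)
    also have "\<dots> = \<nu> x * (b d * V)" by (rule assoc_mult_mat[OF \<nu>c c(2) V])
    finally show "cv 0 x = \<nu> x" using bV \<nu>c by simp
  qed
  have poly_cv: "\<exists>R. \<forall>t. poly \<delta> t \<noteq> 0 \<longrightarrow> poly \<delta> t * (cv t x $$ (i, j)) = poly R t" if ij: "i < d" "j < d" for x i j
  proof (intro exI allI impI)
    fix t assume t: "poly \<delta> t \<noteq> 0"
    have "cv t x $$ (i, j) = (\<Sum>k<n + d. (P t * \<rho> d x) $$ (i, k) * V $$ (k, j))"
      unfolding cv_def by (rule mat_mult_index[OF mult_carrier_mat[OF P c(4)] V ij])
    also have "\<dots> = (\<Sum>k<n + d. (\<Sum>m<n + d. P t $$ (i, m) * \<rho> d x $$ (m, k)) * V $$ (k, j))"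
      using ij(1) by (intro sum.cong refl) (simp only: lessThan_iff mat_mult_index[OF P c(4)])
    also have "\<dots> = inverse (poly \<delta> t) * (\<Sum>k<n + d. (\<Sum>m<n + d. poly (Aj $$ (n + i, m)) t * \<rho> d x $$ (m, k)) * V $$ (k, j))"
      using ij by (simp add: P_def sum_distrib_left sum_distrib_right mult_ac)
    finally show "poly \<delta> t * (cv t x $$ (i, j)) =
      poly (\<Sum>k<n + d. (\<Sum>m<n + d. Aj $$ (n + i, m) * [:\<rho> d x $$ (m, k):]) * [:V $$ (k, j):]) t"
      using t by (simp add: poly_sum mult.commute)
  qed
  have orbit: "cv t \<in> U_orbit d \<mu>" if t: "t \<notin> Z \<union> {t. poly \<delta> t = 0}" for t
  proof -
    have tZ: "t \<notin> Z" and t\<delta>: "poly \<delta> t \<noteq> 0" using t by auto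
    note Rc = R_inverse(1)[OF tZ ld, folded n_def]
    have aMc: "aM d \<in> carrier_mat d n" "aX d \<in> carrier_mat n n" by (simp_all add: n_def)
    \<comment> \<open>The matrix of \<open>q\<close>: a second projection to the cokernel, available
      only outside \<open>Z\<close>, which therefore equals \<open>P t\<close> up to the base change
      \<open>Gt\<close>.\<close>
    define Qm where "Qm = mat d (n + d) (\<lambda>(i, j). if j < n then - (aM d * R d t) $$ (i, j) else if j = n + i then 1 else 0)"
    have Qm: "Qm \<in> carrier_mat d (n + d)" by (simp add: Qm_def)
    have qc: "q d t u m \<in> carrier_vec d" if "u \<in> carrier_vec n" "m \<in> carrier_vec d" for u m
      unfolding q_def using that(2) mult_mat_vec_carrier[OF aMc(1) mult_mat_vec_carrier[OF Rc that(1)]] by auto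
    have Q_vec: "Qm *\<^sub>v (u @\<^sub>v m) = q d t u m" if u: "u \<in> carrier_vec n" and m: "m \<in> carrier_vec d" for u m
    proof (rule eq_vecI)
      fix i assume "i < dim_vec (q d t u m)"
      then have i: "i < d" using qc[OF u m] by auto
      have "(\<Sum>j<n. Qm $$ (i, j) * u $ j) = - (\<Sum>j<n. (aM d * R d t) $$ (i, j) * u $ j)"
        unfolding sum_negf[symmetric] using i by (intro sum.cong) (auto simp: Qm_def)
      also have "(\<Sum>j<n. (aM d * R d t) $$ (i, j) * u $ j) = (aM d *\<^sub>v (R d t *\<^sub>v u)) $ i"
        using mat_vec_index[OF mult_carrier_mat[OF aMc(1) Rc] u i] assoc_mult_mat_vec[OF aMc(1) Rc u] by simp
      finally have 1: "(\<Sum>j<n. Qm $$ (i, j) * u $ j) = - (aM d *\<^sub>v (R d t *\<^sub>v u)) $ i" .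
      have "(\<Sum>j<d. Qm $$ (i, n + j) * m $ j) = (\<Sum>j<d. if j = i then m $ i else 0)"
        using i by (intro sum.cong) (auto simp: Qm_def)
      then have 2: "(\<Sum>j<d. Qm $$ (i, n + j) * m $ j) = m $ i" using i by simp
      have aRu: "aM d *\<^sub>v (R d t *\<^sub>v u) \<in> carrier_vec d"
        by (rule mult_mat_vec_carrier[OF aMc(1) mult_mat_vec_carrier[OF Rc u]])
      show "(Qm *\<^sub>v (u @\<^sub>v m)) $ i = q d t u m $ i"
        unfolding mult_append_vec[OF Qm u m i] 1 2 q_def using i m carrier_vecD[OF aRu]
        by (simp del: index_mult_mat_vec dim_mult_mat_vec)
    qed (use Qm qc[OF u m] in auto)
    define Gt where "Gt = Qm * V"
    have Gt: "Gt \<in> carrier_mat d d" unfolding Gt_def using Qm V by auto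
    have Gt_index: "Gt $$ (i, j) = q d t (U j) (M j) $ i" if "i < d" "j < d" for i j
    proof -
      have "Gt $$ (i, j) = (Qm *\<^sub>v col V j) $ i" unfolding Gt_def using that Qm V by auto
      then show ?thesis using colV[OF that(2)] Q_vec[OF U[OF that(2)] M[OF that(2)]] by simp
    qed
    have QW: "Qm * W t = Gt * Zm"
    proof (rule mat_eqI_append)
      show "Qm * W t \<in> carrier_mat d (n + d)" "Gt * Zm \<in> carrier_mat d (n + d)" using Qm W[of t] Gt Zm by auto
      fix u v :: "'k vec" assume uv: "u \<in> carrier_vec n" "v \<in> carrier_vec d"
      then have uvc: "u @\<^sub>v v \<in> carrier_vec (n + d)" by auto
      have u': "u \<in> carrier_vec (dX d)" using uv by (simp add: n_def)
      have s: "aX d *\<^sub>v u + t \<cdot>\<^sub>v u \<in> carrier_vec n" "aM d *\<^sub>v u \<in> carrier_vec d"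
        using mult_mat_vec_carrier[OF aMc(2) uv(1)] mult_mat_vec_carrier[OF aMc(1) uv(1)] uv(1) by auto
      then have s': "(aX d *\<^sub>v u + t \<cdot>\<^sub>v u) @\<^sub>v (aM d *\<^sub>v u) \<in> carrier_vec (n + d)" by auto
      have Vv: "V *\<^sub>v v \<in> carrier_vec (n + d)" by (rule mult_mat_vec_carrier[OF V uv(2)])
      have "(Qm * W t) *\<^sub>v (u @\<^sub>v v) = Qm *\<^sub>v (W t *\<^sub>v (u @\<^sub>v v))" by (rule assoc_mult_mat_vec[OF Qm W uvc])
      also have "\<dots> = Qm *\<^sub>v ((aX d *\<^sub>v u + t \<cdot>\<^sub>v u) @\<^sub>v (aM d *\<^sub>v u)) + Qm *\<^sub>v (V *\<^sub>v v)"
        unfolding W_vec[OF uv] by (rule mult_add_distrib_mat_vec[OF Qm s' Vv])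
      also have "Qm *\<^sub>v ((aX d *\<^sub>v u + t \<cdot>\<^sub>v u) @\<^sub>v (aM d *\<^sub>v u)) = 0\<^sub>v d"
        unfolding Q_vec[OF s] by (rule q_kernel[OF tZ ld u'])
      also have "Qm *\<^sub>v (V *\<^sub>v v) = Gt *\<^sub>v v" unfolding Gt_def by (rule assoc_mult_mat_vec[symmetric, OF Qm V uv(2)])
      also have "0\<^sub>v d + Gt *\<^sub>v v = Gt *\<^sub>v (Zm *\<^sub>v (u @\<^sub>v v))"
        unfolding Z_vec[OF uv] using mult_mat_vec_carrier[OF Gt uv(2)] by simp
      also have "\<dots> = (Gt * Zm) *\<^sub>v (u @\<^sub>v v)" by (rule assoc_mult_mat_vec[symmetric, OF Gt Zm uvc])
      finally show "(Qm * W t) *\<^sub>v (u @\<^sub>v v) = (Gt * Zm) *\<^sub>v (u @\<^sub>v v)" .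
    qed
    have QGP: "Qm = Gt * P t"
    proof (rule cancel[OF Qm _ _ t\<delta>])
      show "Gt * P t \<in> carrier_mat d (n + d)" using Gt P[of t] by auto
      show "Qm * W t = Gt * P t * W t" unfolding QW assoc_mult_mat[OF Gt P W] PW[OF t\<delta>] ..
    qed
    \<comment> \<open>On the summand \<open>M_d\<close> the map \<open>q\<close> is the identity, so
      \<open>Em\<close> is a right inverse of \<open>Qm\<close>. This exhibits the inverse of
      \<open>Gt\<close> directly.\<close>
    define Em where "Em = mat (n + d) d (\<lambda>(i, j). if i = n + j then 1 else 0 :: 'k)"
    have Em: "Em \<in> carrier_mat (n + d) d" by (simp add: Em_def)
    have QE: "Qm * Em = 1\<^sub>m d"
    proof (rule eq_matI)
      fix i j assume "i < dim_row (1\<^sub>m d :: 'k mat)" "j < dim_col (1\<^sub>m d :: 'k mat)"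
      then have ij: "i < d" "j < d" by auto
      have "(Qm * Em) $$ (i, j) = (\<Sum>k<n + d. Qm $$ (i, k) * Em $$ (k, j))"
        using ij Qm Em by (simp add: scalar_prod_def atLeast0LessThan)
      also have "\<dots> = (\<Sum>k<n + d. if k = n + j then Qm $$ (i, n + j) else 0)"
        using ij by (intro sum.cong) (auto simp: Em_def)
      also have "\<dots> = 1\<^sub>m d $$ (i, j)" using ij by (auto simp: Qm_def)
      finally show "(Qm * Em) $$ (i, j) = 1\<^sub>m d $$ (i, j)" .
    qed (use Qm Em in auto)
    define kt where "kt = P t * Em"
    have kt: "kt \<in> carrier_mat d d" unfolding kt_def using P[of t] Em by auto
    have Gk: "Gt * kt = 1\<^sub>m d" unfolding kt_def assoc_mult_mat[symmetric, OF Gt P Em] QGP[symmetric] by (rule QE)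
    have kG: "kt * Gt = 1\<^sub>m d" by (rule mat_mult_left_right_inverse[OF Gt kt Gk])
    have sum1: "(\<Sum>k<d. kt $$ (i, k) * Gt $$ (k, j)) = (if i = j then 1 else 0)" if "i < d" "j < d" for i j
    proof -
      have "(\<Sum>k<d. kt $$ (i, k) * Gt $$ (k, j)) = (kt * Gt) $$ (i, j)"
        using that kt Gt by (simp add: scalar_prod_def atLeast0LessThan)
      then show ?thesis using that by (simp add: kG)
    qed
    \<comment> \<open>Here the adapted lifts pay off: under \<open>q\<close> the column of
      \<open>V\<close> with index \<open>j\<close> has no coordinates beyond
      \<open>j\<close>.\<close>
    have Gtri: "Gt $$ (i, j) = 0" if "j < i" "i < d" for i j
      using Gt_index[of i j] qUM[of j t i] tZ that by simp
    have "kt $$ (i, j) = 0" if "j < i" "i < d" for i j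
      by (rule inverse_upper_triangular[where g = "\<lambda>i j. Gt $$ (i, j)" and h = "\<lambda>i j. kt $$ (i, j)", OF sum1 Gtri that])
    then have utk: "upper_tri d kt" by (auto simp: upper_tri_def)
    have "cv t x = kt * \<mu> x * Gt" for x
    proof -
      note \<rho>c = c(4)[of x]
      have \<mu>c: "\<mu> x \<in> carrier_mat d d" using \<mu> by (simp add: tri_reps_def is_rep_def)
      have Q\<rho>: "Qm * \<rho> d x = \<mu> x * Qm"
      proof (rule mat_eqI_append)
        show "Qm * \<rho> d x \<in> carrier_mat d (n + d)" "\<mu> x * Qm \<in> carrier_mat d (n + d)" using Qm \<rho>c \<mu>c by auto
        fix u v :: "'k vec" assume uv: "u \<in> carrier_vec n" "v \<in> carrier_vec d"
        then have uvc: "u @\<^sub>v v \<in> carrier_vec (n + d)" by auto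
        have u': "u \<in> carrier_vec (dX d)" using uv by (simp add: n_def)
        have Xu: "X d x *\<^sub>v u \<in> carrier_vec n" by (rule mult_mat_vec_carrier[OF c(3) uv(1)])
        have mv: "\<mu> x *\<^sub>v v \<in> carrier_vec d" by (rule mult_mat_vec_carrier[OF \<mu>c uv(2)])
        show "(Qm * \<rho> d x) *\<^sub>v (u @\<^sub>v v) = (\<mu> x * Qm) *\<^sub>v (u @\<^sub>v v)"
          unfolding assoc_mult_mat_vec[OF Qm \<rho>c uvc] assoc_mult_mat_vec[OF \<mu>c Qm uvc] \<rho>_vec[OF ld u' uv(2)]
            sub\<kappa>[OF \<mu>] Q_vec[OF Xu mv] Q_vec[OF uv]
          using q_hom[OF tZ ld u' uv(2), of x] by (simp add: sub\<kappa>[OF \<mu>])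
      qed
      have PR: "P t * \<rho> d x \<in> carrier_mat d (n + d)" using P[of t] \<rho>c by auto
      have PRV: "P t * \<rho> d x * V \<in> carrier_mat d d" using PR V by auto
      have "kt * \<mu> x * Gt = kt * (\<mu> x * Gt)" by (rule assoc_mult_mat[OF kt \<mu>c Gt])
      also have "\<mu> x * Gt = \<mu> x * Qm * V" unfolding Gt_def by (rule assoc_mult_mat[symmetric, OF \<mu>c Qm V])
      also have "\<dots> = Qm * \<rho> d x * V" unfolding Q\<rho> ..
      also have "\<dots> = Gt * P t * \<rho> d x * V" unfolding QGP ..
      also have "\<dots> = Gt * (P t * \<rho> d x * V)"
        unfolding assoc_mult_mat[OF Gt P \<rho>c] by (rule assoc_mult_mat[OF Gt PR V])
      also have "kt * \<dots> = kt * Gt * (P t * \<rho> d x * V)" by (rule assoc_mult_mat[symmetric, OF kt Gt PRV])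
      also have "\<dots> = cv t x" unfolding kG cv_def by (rule left_mult_one_mat[OF PRV])
      finally show ?thesis ..
    qed
    then show ?thesis unfolding U_orbit_def
      by (intro CollectI exI[of _ kt] exI[of _ Gt] conjI kt Gt utk kG Gk) auto
  qed
  have "finite (Z \<union> {t. poly \<delta> t = 0})"
    using finite_Z poly_roots_finite[of \<delta>] \<delta>0 by (cases "\<delta> = 0") auto
  from closure_of_curve[of d \<delta> cv, OF poly_cv \<delta>0 this orbit] show ?thesis unfolding cv0 .
qed

end

theorem theorem1p6:
  fixes scal :: "'k::alg_closed_field \<Rightarrow> 'a::ring_1 \<Rightarrow> 'a"
    and d :: nat and \<mu> \<nu> :: "'a \<Rightarrow> 'k mat"
  assumes "basic_algebra scal"
    and "d \<ge> 1"
    and "\<mu> \<in> tri_reps scal d" and "\<nu> \<in> tri_reps scal d"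
  shows "\<nu> \<in> zariski_closure d (U_orbit d \<mu>) \<longleftrightarrow>
    (\<exists>(dX :: nat \<Rightarrow> nat) (X :: nat \<Rightarrow> 'a \<Rightarrow> 'k mat) (h :: nat \<Rightarrow> 'k mat) (a :: nat \<Rightarrow> 'k mat) (b :: nat \<Rightarrow> 'k mat).
       (\<forall>l\<in>{1..d}. is_rep scal (dX l) (X l)) \<and>
       (\<forall>l\<in>{1..<d}. is_hom (dX l) (X l) (dX (l + 1)) (X (l + 1)) (h l)) \<and>
       (\<forall>l\<in>{1..d}. is_hom (dX l) (X l) (dX l + l) (dsum_rep (dX l) (X l) l (sub_rep l \<mu>)) (a l) \<and>
                    is_hom (dX l + l) (dsum_rep (dX l) (X l) l (sub_rep l \<mu>)) l (sub_rep l \<nu>) (b l) \<and>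
                    short_exact (dX l) (dX l + l) l (a l) (b l)) \<and>
       (\<forall>l\<in>{1..<d}.
          diag_block (dX (l + 1)) (dX l) (h l) (l + 1) l (incl_mat l) * a l = a (l + 1) * h l \<and>
          incl_mat l * b l = b (l + 1) * diag_block (dX (l + 1)) (dX l) (h l) (l + 1) l (incl_mat l)))"
    (is "_ \<longleftrightarrow> ?R")
proof
  have \<mu>: "is_rep scal d \<mu>" "\<And>x. upper_tri d (\<mu> x)" and \<nu>: "is_rep scal d \<nu>" "\<And>x. upper_tri d (\<nu> x)"
    using assms(3,4) by (auto simp: tri_reps_def)
  have fd: "fin_dim_algebra scal" using assms(1) by (simp add: basic_algebra_def)
  {
    assume "\<nu> \<in> zariski_closure d (U_orbit d \<mu>)"
    from degeneration_along_curve[OF fd assms(3) this] obtain n and G G' :: "nat \<Rightarrow> nat \<Rightarrow> 'k fps" and N where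
      G: "\<forall>i<d. \<forall>j<d. (\<Sum>a<d. G' i a * G a j) = (if i = j then fps_X ^ n else 0)"
      "\<forall>i<d. \<forall>j<d. (\<Sum>a<d. G i a * G' a j) = (if i = j then fps_X ^ n else 0)"
      "\<forall>i<d. \<forall>j<i. G i j = 0 \<and> G' i j = 0"
      "\<forall>x. \<forall>i<d. \<forall>j<d. (\<Sum>b<d. (\<Sum>a<d. G' i a * fps_const (\<mu> x $$ (a, b))) * G b j) = fps_X ^ n * N x i j \<and>
        fps_nth (N x i j) 0 = \<nu> x $$ (i, j)"
      by (elim exE conjE)
    interpret zwara scal d n \<mu> \<nu> G G' N
      by unfold_locales (use \<mu> \<nu> G in auto)
    show ?R by (rule exact_sequence)
  }
  assume ?R
  then obtain dX X h a b where ex: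
    "\<forall>l\<in>{1..d}. is_rep scal (dX l) (X l)"
    "\<forall>l\<in>{1..<d}. is_hom (dX l) (X l) (dX (l + 1)) (X (l + 1)) (h l)"
    "\<forall>l\<in>{1..d}. is_hom (dX l) (X l) (dX l + l) (dsum_rep (dX l) (X l) l (sub_rep l \<mu>)) (a l) \<and>
      is_hom (dX l + l) (dsum_rep (dX l) (X l) l (sub_rep l \<mu>)) l (sub_rep l \<nu>) (b l) \<and>
      short_exact (dX l) (dX l + l) l (a l) (b l)"
    "\<forall>l\<in>{1..<d}. diag_block (dX (l + 1)) (dX l) (h l) (l + 1) l (incl_mat l) * a l = a (l + 1) * h l \<and>
      incl_mat l * b l = b (l + 1) * diag_block (dX (l + 1)) (dX l) (h l) (l + 1) l (incl_mat l)"
    by (elim exE conjE)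
  interpret exact_flag scal d \<mu> \<nu> dX X h a b
    by unfold_locales (use assms ex in blast)+
  show "\<nu> \<in> zariski_closure d (U_orbit d \<mu>)" by (rule \<nu>_in_closure)
qed

end
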